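(* Let $\ell\in\mathbb{Z}_{>0}$, $J\subset\mathbb{Z}/\ell\mathbb{Z}$, and let $\mathbf{c}\in\mathbb{C}^{\mathbb{Z}/\ell\mathbb{Z}}$ be $J$-standard with $\mathbf{c}(\delta)=\sum_i\mathbf{c}_i\ne0$. Let $\alpha=\mathrm{Res}_\ell(\nu)+n\delta$ with $n\ge0$ and $\nu\in\mathcal{C}_\ell\cap\mathcal{C}_J$. Then the symplectic leaves of $\mathcal{X}_{\mathbf{c}}(\alpha)$ are parameterized by a subset of $\mathcal{C}_\ell\cap\mathcal{C}_J$, namely the image of the set $\coprod_{n'=0}^n\mathcal{P}_\nu(n'\ell+|\nu|)$ under the map $\mathrm{Core}_\ell\circ\mathrm{Core}_J$; the leaf $\mathfrak{L}^\alpha_{\alpha'}$ with $\alpha'=\mathrm{Res}_\ell(\nu')+r'\delta$ ($\nu'\in\mathcal{C}_\ell$, $r'\in\mathbb{Z}$) corresponds to $\nu'$.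
   Context: Partitions. $\mathcal{P}$ is the set of partitions, identified with Young diagrams; $|\lambda|$ is the number of boxes. The $\ell$-residue of the box in row $r$, column $s$ is $s-r\bmod\ell$. $\mathrm{Res}_\ell(\lambda)\in\mathbb{Z}^{\mathbb{Z}/\ell\mathbb{Z}}$ counts boxes of each residue. A box is removable if deleting it leaves a Young diagram; $\mu\le\lambda$ means $\mu$ is obtained from $\lambda$ by successively deleting removable boxes. $\lambda$ is an $\ell$-core if there is no $\mu\le\lambda$ such that $\lambda\setminus\mu$ consists of $\ell$ boxes with $\ell$ distinct residues; $\mathcal{C}_\ell$ is the set of $\ell$-cores. $\mathrm{Core}_\ell(\lambda)$ is the $\ell$-core obtained from $\lambda$ by repeatedly removing $\ell$ boxes with distinct residues in this way (independent of choices). $\mathcal{P}_\nu(N)$ is the set of partitions of $N$ with $\ell$-core $\nu$. For $J\subset\mathbb{Z}/\ell\mathbb{Z}$, $\lambda$ is a $J$-core if it has no removable box with residue in $J$; $\mathcal{C}_J$ is the set of $J$-cores; $\mathrm{Core}_J(\lambda)$ is obtained from $\lambda$ by successively removing removable boxes with residue in $J$ until none remain. $\delta=\sum_{i}e_i=(1,\dots,1)$. Every element of $\mathbb{Z}^{\mathbb{Z}/\ell\mathbb{Z}}$ is uniquely of the form $\mathrm{Res}_\ell(\nu)+n\delta$, $\nu\in\mathcal{C}_\ell$, $n\in\mathbb{Z}$. $J$-standard. For $\ell\ge2$, the affine Weyl group $W^{\mathrm{aff}}$ of type $\widetilde{\mathsf{A}}_{\ell-1}$, generated by $s_i$, $i\in\mathbb{Z}/\ell\mathbb{Z}$,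 acts on $\mathbb{C}^{\mathbb{Z}/\ell\mathbb{Z}}$ by $(s_i^*\mathbf{c})_j=\mathbf{c}_j-(e_i,e_j)\mathbf{c}_i$ with $(e_i,e_j)=2\cdot1_{i,j}-1_{j,i+1}-1_{j,i-1}$; for $\ell=1$, $W^{\mathrm{aff}}=1$. $\mathbf{c}$ is $J$-standard if its stabilizer in $W^{\mathrm{aff}}$ is the parabolic subgroup $W_J=\langle s_i:i\in J\rangle$; then $J=\{i:\mathbf{c}_i=0\}$. Quiver variety. For $\alpha\in\mathbb{Z}_{\ge0}^{\mathbb{Z}/\ell\mathbb{Z}}$, consider tuples $(X,Y,x,y)$ with $X_i\in\mathrm{Hom}(\mathbb{C}^{\alpha_{i+1}},\mathbb{C}^{\alpha_i})$, $Y_i\in\mathrm{Hom}(\mathbb{C}^{\alpha_i},\mathbb{C}^{\alpha_{i+1}})$, $x\in\mathrm{Hom}(\mathbb{C},\mathbb{C}^{\alpha_0})$, $y\in\mathrm{Hom}(\mathbb{C}^{\alpha_0},\mathbb{C})$ satisfying $X_iY_i-Y_{i-1}X_{i-1}+1_{i,0}xy=\mathbf{c}_i\mathrm{Id}$ for all $i$; $\mathcal{X}_{\mathbf{c}}(\alpha)$ is the quotient of this set by $\prod_iGL(\alpha_i)$ (reduced affine GIT quotient). Its points are classes $[M]$ of semisimple representations of the double of the cyclic quiver framed by one extra vertex $\infty$ (with space $\mathbb{C}$) attached to $0$. Each such $M$ is uniquely $M_0\oplus M_1$ with $M_0$ simple, containing the $\infty$-component, and $M_1$ a representation of the unframed double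 cyclic quiver. $\mathfrak{L}^\alpha_{\alpha'}$ is the set of $[M]\in\mathcal{X}_{\mathbf{c}}(\alpha)$ for which $M_0$ has dimension vector $\alpha'$ on $\mathbb{Z}/\ell\mathbb{Z}$; the non-empty $\mathfrak{L}^\alpha_{\alpha'}$ are exactly the symplectic leaves of $\mathcal{X}_{\mathbf{c}}(\alpha)$. *)

theory Defs
  imports "HOL-Algebra.Group_Action" "HOL-Algebra.Generated_Groups"
    "Jordan_Normal_Form.VS_Connect"
begin

text \<open>Throughout, $\mathbb{Z}/l\mathbb{Z}$ is represented by \<open>{..<l}\<close> with arithmetic mod \<open>l\<close>;
  vectors indexed by it are functions on \<open>nat\<close> whose values outside \<open>{..<l}\<close> are irrelevant.\<close>

section \<open>Partitions and cores\<close>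

text \<open>Partitions are Young diagrams: finite down-closed sets of boxes (row, column).
  Rows and columns are counted from 0, which does not change residues.\<close>

type_synonym diagram = "(nat \<times> nat) set"

definition partitions :: "diagram set" where
  "partitions = {\<mu>. finite \<mu> \<and> (\<forall>(r, s) \<in> \<mu>. \<forall>r' \<le> r. \<forall>s' \<le> s. (r', s') \<in> \<mu>)}"

definition residue :: "nat \<Rightarrow> nat \<times> nat \<Rightarrow> nat" where
  "residue l b = nat ((int (snd b) - int (fst b)) mod int l)"

definition Res :: "nat \<Rightarrow> diagram \<Rightarrow> nat \<Rightarrow> nat" where
  "Res l \<mu> i = card {b \<in> \<mu>. residue l b = i}"

definition removable :: "diagram \<Rightarrow> nat \<times> nat \<Rightarrow> bool" where
  "removable \<mu> b \<longleftrightarrow> b \<in> \<mu> \<and> \<mu> - {b} \<in> partitions"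

definition remove_box :: "diagram \<Rightarrow> diagram \<Rightarrow> bool" where
  "remove_box \<mu> \<kappa> \<longleftrightarrow> (\<exists>b. removable \<mu> b \<and> \<kappa> = \<mu> - {b})"

definition diagram_le :: "diagram \<Rightarrow> diagram \<Rightarrow> bool" where
  "diagram_le \<kappa> \<mu> \<longleftrightarrow> remove_box\<^sup>*\<^sup>* \<mu> \<kappa>"

definition ell_step :: "nat \<Rightarrow> diagram \<Rightarrow> diagram \<Rightarrow> bool" where
  "ell_step l \<mu> \<kappa> \<longleftrightarrow>
     diagram_le \<kappa> \<mu> \<and> card (\<mu> - \<kappa>) = l \<and> inj_on (residue l) (\<mu> - \<kappa>)"

definition ell_cores :: "nat \<Rightarrow> diagram set" where
  "ell_cores l = {\<mu> \<in> partitions. \<nexists>\<kappa>. ell_step l \<mu> \<kappa>}"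

definition Core_ell :: "nat \<Rightarrow> diagram \<Rightarrow> diagram" where
  "Core_ell l \<mu> = (THE \<kappa>. (ell_step l)\<^sup>*\<^sup>* \<mu> \<kappa> \<and> \<kappa> \<in> ell_cores l)"

definition partitions_with_core :: "nat \<Rightarrow> diagram \<Rightarrow> nat \<Rightarrow> diagram set" where
  "partitions_with_core l \<nu> N = {\<mu> \<in> partitions. card \<mu> = N \<and> Core_ell l \<mu> = \<nu>}"

definition J_step :: "nat \<Rightarrow> nat set \<Rightarrow> diagram \<Rightarrow> diagram \<Rightarrow> bool" where
  "J_step l J \<mu> \<kappa> \<longleftrightarrow> (\<exists>b. removable \<mu> b \<and> residue l b \<in> J \<and> \<kappa> = \<mu> - {b})"

definition J_cores :: "nat \<Rightarrow> nat set \<Rightarrow> diagram set" where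
  "J_cores l J = {\<mu> \<in> partitions. \<nexists>b. removable \<mu> b \<and> residue l b \<in> J}"

definition Core_J :: "nat \<Rightarrow> nat set \<Rightarrow> diagram \<Rightarrow> diagram" where
  "Core_J l J \<mu> = (THE \<kappa>. (J_step l J)\<^sup>*\<^sup>* \<mu> \<kappa> \<and> \<kappa> \<in> J_cores l J)"

section \<open>The affine Weyl group and standard parameters\<close>

definition succ_mod :: "nat \<Rightarrow> nat \<Rightarrow> nat" where
  "succ_mod l i = (i + 1) mod l"

definition pred_mod :: "nat \<Rightarrow> nat \<Rightarrow> nat" where
  "pred_mod l i = (i + l - 1) mod l"

definition cartan :: "nat \<Rightarrow> nat \<Rightarrow> nat \<Rightarrow> int" where
  "cartan l i j = 2 * of_bool (i = j) - of_bool (j = succ_mod l i) - of_bool (j = pred_mod l i)"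

text \<open>For \<open>l = 1\<close> the form vanishes, so \<open>weyl_refl 1 0\<close> is the identity and the group below is trivial,
  as it should be. For \<open>l \<ge> 2\<close> the reflection representation is faithful, so the affine Weyl group
  and its parabolic subgroups are realised as groups of permutations of the parameter space.\<close>

definition weyl_refl :: "nat \<Rightarrow> nat \<Rightarrow> (nat \<Rightarrow> complex) \<Rightarrow> (nat \<Rightarrow> complex)" where
  "weyl_refl l i c = (\<lambda>j. if j < l then c j - of_int (cartan l i j) * c i else c j)"

definition W_parabolic :: "nat \<Rightarrow> nat set \<Rightarrow> ((nat \<Rightarrow> complex) \<Rightarrow> (nat \<Rightarrow> complex)) set" where
  "W_parabolic l J = generate (BijGroup UNIV) (weyl_refl l ` J)"

definition W_aff :: "nat \<Rightarrow> ((nat \<Rightarrow> complex) \<Rightarrow> (nat \<Rightarrow> complex)) monoid" where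
  "W_aff l = (BijGroup UNIV)\<lparr>carrier := W_parabolic l {..<l}\<rparr>"

definition J_standard :: "nat \<Rightarrow> nat set \<Rightarrow> (nat \<Rightarrow> complex) \<Rightarrow> bool" where
  "J_standard l J c \<longleftrightarrow> stabilizer (W_aff l) (\<lambda>w. w) c = W_parabolic l J"

section \<open>Representations of the framed double cyclic quiver\<close>

text \<open>The vertex \<open>Some i\<close> is the vertex \<open>i\<close> of the cycle and \<open>None\<close> is the framing vertex at infinity.
  A representation with dimension vector \<open>d\<close> has \<open>X i : i + 1 \<rightarrow> i\<close>, \<open>Y i : i \<rightarrow> i + 1\<close>,
  \<open>x : \<infinity> \<rightarrow> 0\<close> and \<open>y : 0 \<rightarrow> \<infinity>\<close>.\<close>

type_synonym dimvec = "nat option \<Rightarrow> nat"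

definition verts :: "nat \<Rightarrow> nat option set" where
  "verts l = insert None (Some ` {..<l})"

definition framed :: "nat \<Rightarrow> (nat \<Rightarrow> nat) \<Rightarrow> dimvec" where
  "framed k \<alpha> = case_option k \<alpha>"

record quiver_rep =
  qX :: "nat \<Rightarrow> complex mat"
  qY :: "nat \<Rightarrow> complex mat"
  qx :: "complex mat"
  qy :: "complex mat"

definition rep_space :: "nat \<Rightarrow> dimvec \<Rightarrow> quiver_rep set" where
  "rep_space l d = {M.
     qX M \<in> (\<Pi>\<^sub>E i\<in>{..<l}. carrier_mat (d (Some i)) (d (Some (succ_mod l i)))) \<and>
     qY M \<in> (\<Pi>\<^sub>E i\<in>{..<l}. carrier_mat (d (Some (succ_mod l i))) (d (Some i))) \<and>
     qx M \<in> carrier_mat (d (Some 0)) (d None) \<and>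
     qy M \<in> carrier_mat (d None) (d (Some 0))}"

definition GL :: "nat \<Rightarrow> (nat \<Rightarrow> nat) \<Rightarrow> (nat \<Rightarrow> complex mat) set" where
  "GL l \<alpha> = (\<Pi>\<^sub>E i\<in>{..<l}. {g \<in> carrier_mat (\<alpha> i) (\<alpha> i). invertible_mat g})"

text \<open>\<open>N = g \<cdot> M\<close>, with the inverses of the \<open>g i\<close> cleared; the group acts trivially at infinity.\<close>

definition transforms :: "nat \<Rightarrow> (nat \<Rightarrow> complex mat) \<Rightarrow> quiver_rep \<Rightarrow> quiver_rep \<Rightarrow> bool" where
  "transforms l g M N \<longleftrightarrow>
     (\<forall>i<l. qX N i * g (succ_mod l i) = g i * qX M i \<and>
            qY N i * g i = g (succ_mod l i) * qY M i) \<and>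
     qx N = g 0 * qx M \<and> qy N * g 0 = qy M"

definition isomorphic_reps :: "nat \<Rightarrow> (nat \<Rightarrow> nat) \<Rightarrow> quiver_rep \<Rightarrow> quiver_rep \<Rightarrow> bool" where
  "isomorphic_reps l \<alpha> M N \<longleftrightarrow> (\<exists>g\<in>GL l \<alpha>. transforms l g M N)"

definition subrep :: "nat \<Rightarrow> dimvec \<Rightarrow> quiver_rep \<Rightarrow> (nat option \<Rightarrow> complex vec set) \<Rightarrow> bool" where
  "subrep l d M U \<longleftrightarrow>
     (\<forall>v\<in>verts l. VectorSpace.subspace class_ring (U v) (module_vec TYPE(complex) (d v))) \<and>
     (\<forall>i<l. (\<forall>u\<in>U (Some (succ_mod l i)). qX M i *\<^sub>v u \<in> U (Some i)) \<and>
            (\<forall>u\<in>U (Some i). qY M i *\<^sub>v u \<in> U (Some (succ_mod l i)))) \<and>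
     (\<forall>u\<in>U None. qx M *\<^sub>v u \<in> U (Some 0)) \<and>
     (\<forall>u\<in>U (Some 0). qy M *\<^sub>v u \<in> U None)"

definition simple_rep :: "nat \<Rightarrow> dimvec \<Rightarrow> quiver_rep \<Rightarrow> bool" where
  "simple_rep l d M \<longleftrightarrow>
     (\<exists>v\<in>verts l. d v \<noteq> 0) \<and>
     (\<forall>U. subrep l d M U \<longrightarrow>
        (\<forall>v\<in>verts l. U v = {0\<^sub>v (d v)}) \<or> (\<forall>v\<in>verts l. U v = carrier_vec (d v)))"

definition semisimple_rep :: "nat \<Rightarrow> dimvec \<Rightarrow> quiver_rep \<Rightarrow> bool" where
  "semisimple_rep l d M \<longleftrightarrow>
     (\<forall>U. subrep l d M U \<longrightarrow>
        (\<exists>U'. subrep l d M U' \<and>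
           (\<forall>v\<in>verts l. U v \<inter> U' v = {0\<^sub>v (d v)} \<and>
                         {u + u' | u u'. u \<in> U v \<and> u' \<in> U' v} = carrier_vec (d v))))"

definition direct_sum_rep :: "nat \<Rightarrow> quiver_rep \<Rightarrow> quiver_rep \<Rightarrow> quiver_rep" where
  "direct_sum_rep l M N =
     \<lparr>qX = (\<lambda>i\<in>{..<l}. diag_block_mat [qX M i, qX N i]),
      qY = (\<lambda>i\<in>{..<l}. diag_block_mat [qY M i, qY N i]),
      qx = diag_block_mat [qx M, qx N],
      qy = diag_block_mat [qy M, qy N]\<rparr>"

section \<open>The quiver variety and its leaves\<close>

definition moment_fiber :: "nat \<Rightarrow> (nat \<Rightarrow> complex) \<Rightarrow> (nat \<Rightarrow> nat) \<Rightarrow> quiver_rep set" where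
  "moment_fiber l c \<alpha> = {M \<in> rep_space l (framed 1 \<alpha>).
     \<forall>i<l. qX M i * qY M i - qY M (pred_mod l i) * qX M (pred_mod l i)
             + (if i = 0 then qx M * qy M else 0\<^sub>m (\<alpha> i) (\<alpha> i))
           = c i \<cdot>\<^sub>m 1\<^sub>m (\<alpha> i)}"

inductive_set poly_funs :: "nat \<Rightarrow> (nat \<Rightarrow> nat) \<Rightarrow> (quiver_rep \<Rightarrow> complex) set"
  for l :: nat and \<alpha> :: "nat \<Rightarrow> nat" where
  const: "(\<lambda>M. k) \<in> poly_funs l \<alpha>"
| coord_X: "i < l \<Longrightarrow> a < \<alpha> i \<Longrightarrow> b < \<alpha> (succ_mod l i) \<Longrightarrow> (\<lambda>M. qX M i $$ (a, b)) \<in> poly_funs l \<alpha>"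
| coord_Y: "i < l \<Longrightarrow> a < \<alpha> (succ_mod l i) \<Longrightarrow> b < \<alpha> i \<Longrightarrow> (\<lambda>M. qY M i $$ (a, b)) \<in> poly_funs l \<alpha>"
| coord_x: "a < \<alpha> 0 \<Longrightarrow> (\<lambda>M. qx M $$ (a, 0)) \<in> poly_funs l \<alpha>"
| coord_y: "b < \<alpha> 0 \<Longrightarrow> (\<lambda>M. qy M $$ (0, b)) \<in> poly_funs l \<alpha>"
| add: "f \<in> poly_funs l \<alpha> \<Longrightarrow> g \<in> poly_funs l \<alpha> \<Longrightarrow> (\<lambda>M. f M + g M) \<in> poly_funs l \<alpha>"
| mult: "f \<in> poly_funs l \<alpha> \<Longrightarrow> g \<in> poly_funs l \<alpha> \<Longrightarrow> (\<lambda>M. f M * g M) \<in> poly_funs l \<alpha>"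

definition invariant_funs ::
    "nat \<Rightarrow> (nat \<Rightarrow> complex) \<Rightarrow> (nat \<Rightarrow> nat) \<Rightarrow> (quiver_rep \<Rightarrow> complex) set" where
  "invariant_funs l c \<alpha> = {f \<in> poly_funs l \<alpha>.
     \<forall>M\<in>moment_fiber l c \<alpha>. \<forall>N\<in>moment_fiber l c \<alpha>. isomorphic_reps l \<alpha> M N \<longrightarrow> f M = f N}"

text \<open>The closed points of the reduced affine GIT quotient: two points of the moment fiber are
  identified if and only if no invariant regular function separates them.\<close>

definition git_rel :: "nat \<Rightarrow> (nat \<Rightarrow> complex) \<Rightarrow> (nat \<Rightarrow> nat) \<Rightarrow> quiver_rep rel" where
  "git_rel l c \<alpha> = {(M, N). M \<in> moment_fiber l c \<alpha> \<and> N \<in> moment_fiber l c \<alpha> \<and>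
     (\<forall>f\<in>invariant_funs l c \<alpha>. f M = f N)}"

definition quiver_variety ::
    "nat \<Rightarrow> (nat \<Rightarrow> complex) \<Rightarrow> (nat \<Rightarrow> nat) \<Rightarrow> quiver_rep set set" where
  "quiver_variety l c \<alpha> = moment_fiber l c \<alpha> // git_rel l c \<alpha>"

text \<open>In \<open>M \<cong> M0 \<oplus> M1\<close> the summand \<open>M0\<close> contains the whole (one-dimensional) space at infinity and
  \<open>M1\<close> has zero space there, i.e. it is a representation of the unframed double cyclic quiver.\<close>

definition leaf ::
    "nat \<Rightarrow> (nat \<Rightarrow> complex) \<Rightarrow> (nat \<Rightarrow> nat) \<Rightarrow> (nat \<Rightarrow> nat) \<Rightarrow> quiver_rep set set" where
  "leaf l c \<alpha> \<alpha>' = {p \<in> quiver_variety l c \<alpha>.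
     \<exists>M\<in>p. semisimple_rep l (framed 1 \<alpha>) M \<and>
       (\<exists>\<alpha>''. (\<forall>i<l. \<alpha> i = \<alpha>' i + \<alpha>'' i) \<and>
         (\<exists>M0\<in>rep_space l (framed 1 \<alpha>'). \<exists>M1\<in>rep_space l (framed 0 \<alpha>'').
            simple_rep l (framed 1 \<alpha>') M0 \<and>
            isomorphic_reps l \<alpha> (direct_sum_rep l M0 M1) M))}"

definition symplectic_leaves ::
    "nat \<Rightarrow> (nat \<Rightarrow> complex) \<Rightarrow> (nat \<Rightarrow> nat) \<Rightarrow> quiver_rep set set set" where
  "symplectic_leaves l c \<alpha> = {leaf l c \<alpha> \<alpha>' | \<alpha>'. leaf l c \<alpha> \<alpha>' \<noteq> {}}"

end

theory Submission
  imports Defs "Jordan_Normal_Form.Spectral_Radius"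
begin

text \<open>The leaf of \<open>\<alpha>'\<close> is non-empty iff there is a simple framed representation \<open>M0\<close> of dimension
  \<open>\<alpha>'\<close> and \<open>\<alpha> - \<alpha>'\<close> is the dimension of an unframed one. An unframed representation is supported on
  vertices that lie in a window of the cycle over which \<open>c\<close> sums to zero; for \<open>J\<close>-standard \<open>c\<close> such
  windows lie in \<open>J\<close>, since otherwise the reflection in the corresponding root fixes \<open>c\<close> without
  belonging to \<open>W\<^sub>J\<close>.

  Reflection functors at vertices with \<open>c i \<noteq> 0\<close> act on dimension vectors of simple representations
  as the affine Weyl group does on residues of cores. They reduce both the necessary condition
  (\<open>\<alpha>' = Res \<nu>' + r \<delta>\<close>, with \<open>\<nu>'\<close> a \<open>J\<close>-core) and the existence of \<open>M0\<close> to \<open>\<nu>' = {}\<close>, where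
  Calogero--Moser matrices provide a simple representation of dimension \<open>r \<delta>\<close>.

  On the side of partitions, everything is read off the boundary: the edge of \<open>\<mu>\<close> at the content
  \<open>k\<close> is 1 or 0, a removable box is an edge 0 followed by an edge 1, and an \<open>l\<close>-core is a diagram
  whose edges are weakly decreasing along every residue class. Given a \<open>J\<close>-core \<open>\<nu>'\<close> below \<open>\<alpha>\<close>, adding boxes
  with residue in \<open>J\<close> as long as possible produces the partition that is mapped to \<open>\<nu>'\<close>.

  Finally \<open>\<alpha>'\<close> is determined by a point of the leaf, because the traces of closed paths through the framing are
  invariant functions and determine the dimension of \<open>M0\<close>.\<close>


section \<open>Partitions by diagonals\<close>

text \<open>The existence of \<open>M0\<close> is proved by an induction that reflects
  \<open>c\<close> together with the core. The stabilizer of a reflected parameter is a conjugate of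
  the given one and in general no longer standard parabolic, so the induction carries a condition on
  windows instead: \<open>potential l c p = potential l c q\<close> with \<open>p < q\<close>
  implies \<open>edge \<nu> q \<le> edge \<nu> p\<close>. A simple reflection composes the potential
  (up to a constant) and the edge sequence with the same affine transposition
  \<open>sig l i\<close>, so the condition survives as long as \<open>c i \<noteq> 0\<close>. For
  the given parameter it holds because windows with equal potential at both ends lie in
  \<open>J\<close>, where the edges of a \<open>J\<close>-core decrease. Non-emptiness of a leaf
  asks for one point only, and the zero representation can serve as \<open>M1\<close>: \<alpha> -
  \<alpha>' is supported in \<open>J\<close>, where \<open>c\<close> vanishes. Since
  \<open>c\<close> has non-zero sum, \<open>J\<close> is a proper subset of the cycle and hence of
  finite type. Positivity of the Cartan form then yields the addable boxes that lead from \<nu>' up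
  to a partition with core \<nu>.\<close>

definition content :: "nat \<times> nat \<Rightarrow> int" where
  "content b = int (snd b) - int (fst b)"

definition diag_count :: "diagram \<Rightarrow> int \<Rightarrow> int" where
  "diag_count \<mu> k = int (card {b \<in> \<mu>. content b = k})"

text \<open>For the diagonal lengths of a partition this is the boundary word, or Maya diagram. The
  correction for \<open>k < 0\<close> reflects that diagonals grow towards the main one: the empty
  diagram has edge 1 at the negative positions and 0 at the others.\<close>

definition edge_of :: "(int \<Rightarrow> int) \<Rightarrow> int \<Rightarrow> int" where
  "edge_of d k = d k - d (k + 1) + of_bool (k < 0)"

abbreviation edge :: "diagram \<Rightarrow> int \<Rightarrow> int" where
  "edge \<mu> \<equiv> edge_of (diag_count \<mu>)"

lemma partitions_finite: "\<mu> \<in> partitions \<Longrightarrow> finite \<mu>"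
  by (auto simp: partitions_def)

lemma partitions_down:
  "\<mu> \<in> partitions \<Longrightarrow> (r, s) \<in> \<mu> \<Longrightarrow> r' \<le> r \<Longrightarrow> s' \<le> s \<Longrightarrow> (r', s') \<in> \<mu>"
  by (simp add: partitions_def Ball_def split_paired_all split_def)

lemma partitionsI:
  assumes "finite \<mu>" "\<And>r s r' s'. (r, s) \<in> \<mu> \<Longrightarrow> r' \<le> r \<Longrightarrow> s' \<le> s \<Longrightarrow> (r', s') \<in> \<mu>"
  shows "\<mu> \<in> partitions"
  unfolding partitions_def mem_Collect_eq
proof (intro conjI ballI)
  fix b assume "b \<in> \<mu>"
  then show "case b of (r, s) \<Rightarrow> \<forall>r'\<le>r. \<forall>s'\<le>s. (r', s') \<in> \<mu>"
    by (cases b) (simp, intro allI impI, rule assms(2))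
qed (rule assms(1))

lemma empty_partition: "{} \<in> partitions"
  by (simp add: partitions_def)

lemma down_closed_eq_lessThan:
  fixes T :: "nat set"
  assumes "finite T" and "\<And>t t'. t \<in> T \<Longrightarrow> t' \<le> t \<Longrightarrow> t' \<in> T"
  shows "T = {..<card T}"
proof -
  have "T = {..<Suc (Max T)}" if "T \<noteq> {}"
  proof (intro equalityI subsetI)
    fix t assume "t \<in> T"
    then show "t \<in> {..<Suc (Max T)}" using Max_ge[OF assms(1)] by (simp add: less_Suc_eq_le)
  next
    fix t assume "t \<in> {..<Suc (Max T)}"
    then show "t \<in> T" using assms(2)[OF Max_in[OF assms(1) that], of t] by simp
  qed
  then show ?thesis
    by (cases "T = {}") (simp, metis card_lessThan)
qed

text \<open>By down-closure the boxes of one diagonal, numbered by \<open>min r s\<close>, form an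
  initial segment, so a number occurs exactly if it is below the length of the diagonal.\<close>

lemma mem_iff_diag_count:
  assumes "\<mu> \<in> partitions"
  shows "(r, s) \<in> \<mu> \<longleftrightarrow> int (min r s) < diag_count \<mu> (int s - int r)"
proof -
  define k where "k = int s - int r"
  define T where "T = (\<lambda>b. min (fst b) (snd b)) ` {b \<in> \<mu>. content b = k}"
  have inj: "inj_on (\<lambda>b. min (fst b) (snd b)) {b \<in> \<mu>. content b = k}"
    by (auto simp: inj_on_def content_def min_def split: if_splits)
  have *: "t \<in> T \<longleftrightarrow> (t + nat (- k), t + nat k) \<in> \<mu>" for t
  proof
    assume "t \<in> T"
    then obtain r s where rs: "(r, s) \<in> \<mu>" "int s - int r = k" "t = min r s"
      by (auto simp: T_def content_def)
    have "t + nat (- k) = r" "t + nat k = s" unfolding rs(3) rs(2)[symmetric] by auto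
    with rs(1) show "(t + nat (- k), t + nat k) \<in> \<mu>" by simp
  next
    assume "(t + nat (- k), t + nat k) \<in> \<mu>"
    then show "t \<in> T"
      unfolding T_def by (intro image_eqI[of _ _ "(t + nat (- k), t + nat k)"]) (auto simp: content_def)
  qed
  have T_eq: "T = {..<card T}"
  proof (rule down_closed_eq_lessThan)
    show "finite T" using partitions_finite[OF assms] by (simp add: T_def)
    show "t' \<in> T" if "t \<in> T" "t' \<le> t" for t t'
      using that partitions_down[OF assms] by (auto simp: *)
  qed
  have card: "card T = card {b \<in> \<mu>. content b = k}"
    unfolding T_def by (rule card_image[OF inj])
  have "t \<in> T \<longleftrightarrow> t < card T" for t
    by (subst T_eq) simp
  then have "t \<in> T \<longleftrightarrow> int t < diag_count \<mu> k" for t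
    unfolding diag_count_def card by simp
  moreover have "(r, s) \<in> \<mu> \<longleftrightarrow> min r s \<in> T"
  proof -
    have "(min r s + nat (- k), min r s + nat k) = (r, s)" by (auto simp: k_def)
    then show ?thesis using *[of "min r s"] by simp
  qed
  ultimately show ?thesis by (simp add: k_def)
qed

lemma diag_count_nonneg: "0 \<le> diag_count \<mu> k"
  by (simp add: diag_count_def)

lemma partition_eqI:
  assumes "\<mu> \<in> partitions" "\<kappa> \<in> partitions" "\<And>k. diag_count \<mu> k = diag_count \<kappa> k"
  shows "\<mu> = \<kappa>"
proof (rule Set.set_eqI)
  fix b
  show "b \<in> \<mu> \<longleftrightarrow> b \<in> \<kappa>"
    using assms(3) by (cases b) (simp add: mem_iff_diag_count[OF assms(1)] mem_iff_diag_count[OF assms(2)])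
qed

lemma partition_subset_iff:
  assumes "\<mu> \<in> partitions" "\<kappa> \<in> partitions"
  shows "\<kappa> \<subseteq> \<mu> \<longleftrightarrow> (\<forall>k. diag_count \<kappa> k \<le> diag_count \<mu> k)"
proof
  assume "\<kappa> \<subseteq> \<mu>"
  then show "\<forall>k. diag_count \<kappa> k \<le> diag_count \<mu> k"
    using partitions_finite[OF assms(1)] by (auto simp: diag_count_def intro!: card_mono)
next
  assume *: "\<forall>k. diag_count \<kappa> k \<le> diag_count \<mu> k"
  show "\<kappa> \<subseteq> \<mu>"
  proof
    fix b assume "b \<in> \<kappa>"
    then show "b \<in> \<mu>"
      using * by (cases b) (auto simp only: mem_iff_diag_count[OF assms(1)] mem_iff_diag_count[OF assms(2)]
        intro: less_le_trans)
  qed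
qed

text \<open>Moving a box one step left or up leads to a neighbouring diagonal and lowers its number
  by at most one. Adjacent lengths therefore differ by at most one, in the direction dictated by the
  sign of \<open>k\<close>.\<close>

lemma edge_01:
  assumes "\<mu> \<in> partitions"
  shows "edge \<mu> k = 0 \<or> edge \<mu> k = 1"
proof -
  note mem = mem_iff_diag_count[OF assms] and down = partitions_down[OF assms]
  let ?d = "diag_count \<mu>"
  have nn: "0 \<le> ?d j" for j by (rule diag_count_nonneg)
  show ?thesis
  proof (cases "k \<ge> 0")
    case True
    define m where "m = nat k"
    have k: "k = int m" using True by (simp add: m_def)
    have row: "int t < ?d (int j) \<longleftrightarrow> (t, t + j) \<in> \<mu>" for t j :: nat
      using mem[of t "t + j"] by simp
    have "?d (k + 1) \<le> ?d k"
    proof (rule ccontr)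
      assume *: "\<not> ?thesis"
      define t where "t = nat (?d k)"
      have "int t < ?d (int (Suc m))" "\<not> int t < ?d (int m)"
        using * nn[of k] by (auto simp: t_def k add.commute)
      then show False using down[of t "t + Suc m" t "t + m"] by (simp add: row del: of_nat_Suc)
    qed
    moreover have "?d k \<le> ?d (k + 1) + 1"
    proof (rule ccontr)
      assume *: "\<not> ?thesis"
      define t where "t = nat (?d (k + 1))"
      have "int (Suc t) < ?d (int m)" "\<not> int t < ?d (int (Suc m))"
        using * nn[of "k + 1"] by (auto simp: t_def k add.commute)
      then show False using down[of "Suc t" "Suc t + m" t "t + Suc m"]
        by (simp add: row del: of_nat_Suc)
    qed
    ultimately show ?thesis using True by (auto simp: edge_of_def)
  next
    case False
    define m where "m = nat (- k - 1)"
    have k: "k = - int (Suc m)" "k + 1 = - int m" using False by (auto simp: m_def)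
    have row: "int t < ?d (- int j) \<longleftrightarrow> (t + j, t) \<in> \<mu>" for t j :: nat
      using mem[of "t + j" t] by simp
    have "?d k \<le> ?d (k + 1)"
    proof (rule ccontr)
      assume *: "\<not> ?thesis"
      define t where "t = nat (?d (k + 1))"
      have "int t < ?d (- int (Suc m))" "\<not> int t < ?d (- int m)"
        using * nn[of "k + 1"] unfolding t_def k(2)[symmetric] k(1)[symmetric] by auto
      then show False using down[of "t + Suc m" t "t + m" t] by (simp only: row) auto
    qed
    moreover have "?d (k + 1) \<le> ?d k + 1"
    proof (rule ccontr)
      assume *: "\<not> ?thesis"
      define t where "t = nat (?d k)"
      have "int (Suc t) < ?d (- int m)" "\<not> int t < ?d (- int (Suc m))"
        using * nn[of k] unfolding t_def k(2)[symmetric] k(1)[symmetric] by auto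
      then show False using down[of "Suc t + m" "Suc t" "t + Suc m" t]
        by (simp only: row) auto
    qed
    ultimately show ?thesis using False by (auto simp: edge_of_def)
  qed
qed

lemma diag_count_support:
  assumes "\<mu> \<in> partitions"
  shows "\<exists>N > 0. \<forall>k. N \<le> \<bar>k\<bar> \<longrightarrow> diag_count \<mu> k = 0"
proof -
  have "finite (content ` \<mu>)" using partitions_finite[OF assms] by simp
  then obtain N where N: "\<forall>k \<in> content ` \<mu>. \<bar>k\<bar> \<le> N"
    using finite_imageI[of "content ` \<mu>" abs] Max_ge[of "abs ` content ` \<mu>"] by (metis imageI)
  have "diag_count \<mu> k = 0" if "max 0 N + 1 \<le> \<bar>k\<bar>" for k
  proof -
    have "{b \<in> \<mu>. content b = k} = {}" using N that by fastforce
    then show ?thesis unfolding diag_count_def by (simp only: card.empty of_nat_0)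
  qed
  then show ?thesis by (intro exI[of _ "max 0 N + 1"]) auto
qed

definition diagram_of :: "(int \<Rightarrow> int) \<Rightarrow> diagram" where
  "diagram_of d = {(r, s). int (min r s) < d (int s - int r)}"

text \<open>Converse to \<open>edge_01\<close> and \<open>diag_count_support\<close>: every 0/1
  boundary word with the right tails comes from a partition. New partitions are built below by
  prescribing their diagonal lengths.\<close>

lemma diagram_of_partition:
  assumes supp: "\<And>k. N \<le> \<bar>k\<bar> \<Longrightarrow> d k = 0"
    and e01: "\<And>k. edge_of d k = 0 \<or> edge_of d k = 1"
  shows "diagram_of d \<in> partitions" and "diag_count (diagram_of d) = d"
proof -
  have up: "d (k + 1) \<le> d k \<and> d k \<le> d (k + 1) + 1" if "k \<ge> 0" for k
    using e01[of k] that by (auto simp: edge_of_def)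
  have dn: "d k \<le> d (k + 1) \<and> d (k + 1) \<le> d k + 1" if "k < 0" for k
    using e01[of k] that by (auto simp: edge_of_def)
  have row: "(r, s) \<in> diagram_of d" if "(Suc r, s) \<in> diagram_of d" for r s
  proof (cases "int s - int (Suc r) \<ge> 0")
    case True
    with that up[OF True] show ?thesis by (auto simp: diagram_of_def min_def)
  next
    case False
    with that dn[of "int s - int (Suc r)"] show ?thesis by (auto simp: diagram_of_def min_def)
  qed
  have col: "(r, s) \<in> diagram_of d" if "(r, Suc s) \<in> diagram_of d" for r s
  proof (cases "int s - int r \<ge> 0")
    case True
    with that up[OF True] show ?thesis by (auto simp: diagram_of_def min_def add.commute algebra_simps)
  next
    case False
    with that dn[of "int s - int r"] show ?thesis
      by (auto simp: diagram_of_def min_def algebra_simps split: if_splits)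
  qed
  have row': "(r + m, s) \<in> diagram_of d \<Longrightarrow> (r, s) \<in> diagram_of d" for r m s
    by (induction m) (auto intro: row)
  have col': "(r, s + m) \<in> diagram_of d \<Longrightarrow> (r, s) \<in> diagram_of d" for r m s
    by (induction m) (auto intro: col)
  have down: "(r', s') \<in> diagram_of d" if "(r, s) \<in> diagram_of d" "r' \<le> r" "s' \<le> s" for r s r' s'
    using that row'[of r' "r - r'" s] col'[of r' s' "s - s'"] by auto
  have bound: "int r < N \<and> int s < N" if "(r, s) \<in> diagram_of d" for r s
  proof -
    have "(r, 0) \<in> diagram_of d" "(0, s) \<in> diagram_of d" using down[OF that] by auto
    then show ?thesis using supp[of "- int r"] supp[of "int s"]
      by (auto simp: diagram_of_def not_le intro: ccontr)
  qed
  have "diagram_of d \<subseteq> {..<nat N} \<times> {..<nat N}" using bound by force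
  then have fin: "finite (diagram_of d)" using finite_subset by blast
  then show part: "diagram_of d \<in> partitions" using down by (intro partitionsI)
  \<comment> \<open>A diagonal of \<open>diagram_of d\<close> has length \<open>max 0 (d k)\<close>,
    so the sign has to be excluded. It follows by walking outwards, along which \<open>d\<close>
    decreases, to where \<open>d\<close> is zero.\<close>
  have "0 \<le> d k" for k
  proof (cases "k \<ge> 0")
    case True
    have "d (k + int m) \<le> d k" for m
    proof (induction m)
      case (Suc m)
      then show ?case using up[of "k + int m"] True by (simp add: algebra_simps)
    qed simp
    from this[of "nat N"] supp[of "k + int (nat N)"] True show ?thesis by auto
  next
    case False
    have "d (k - int m) \<le> d k" for m
    proof (induction m)
      case (Suc m)
      then show ?case using dn[of "k - int m - 1"] False by (simp add: algebra_simps)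
    qed simp
    from this[of "nat N"] supp[of "k - int (nat N)"] False show ?thesis by auto
  qed
  moreover have "diag_count (diagram_of d) k = max 0 (d k)" for k
  proof -
    let ?f = "\<lambda>t. (t + nat (- k), t + nat k)"
    have "{b \<in> diagram_of d. content b = k} = ?f ` {..<nat (d k)}"
    proof (intro equalityI subsetI)
      fix b assume b: "b \<in> {b \<in> diagram_of d. content b = k}"
      obtain r s where rs: "b = (r, s)" by force
      with b have "b = ?f (min r s)" "int (min r s) < d k"
        by (auto simp: content_def diagram_of_def)
      then show "b \<in> ?f ` {..<nat (d k)}" by (intro image_eqI[of _ _ "min r s"]) auto
    qed (auto simp: diagram_of_def content_def)
    moreover have "inj ?f" by (auto simp: inj_def)
    ultimately show ?thesis by (simp add: diag_count_def card_image[OF inj_on_subset])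
  qed
  ultimately show "diag_count (diagram_of d) = d" by (auto simp: max_def fun_eq_iff)
qed

section \<open>Residue classes of contents and neighbours in the cycle\<close>

definition cls :: "nat \<Rightarrow> int \<Rightarrow> nat" where
  "cls l k = nat (k mod int l)"

lemma residue_eq_cls: "residue l b = cls l (content b)"
  by (simp add: residue_def cls_def content_def)

lemma cls_less: "l > 0 \<Longrightarrow> cls l k < l"
  by (simp add: cls_def nat_less_iff)

lemma cls_0: "cls l 0 = 0"
  by (simp add: cls_def)

lemma cls_of_nat: "i < l \<Longrightarrow> cls l (int i) = i"
  by (simp add: cls_def)

lemma int_cls: "l > 0 \<Longrightarrow> int (cls l k) = k mod int l"
  by (simp add: cls_def)

lemma cls_eq_iff: "l > 0 \<Longrightarrow> cls l k = cls l k' \<longleftrightarrow> int l dvd k - k'"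
  by (metis int_cls mod_eq_dvd_iff of_nat_eq_iff)

lemma cls_inj_window:
  assumes "l > 0" "cls l k = cls l k'" "\<bar>k - k'\<bar> < int l"
  shows "k = k'"
proof (rule ccontr)
  assume "k \<noteq> k'"
  then have "int l \<le> \<bar>k - k'\<bar>"
    using assms by (intro zdvd_imp_le) (auto simp: cls_eq_iff)
  then show False using assms by simp
qed

lemma cls_succ: "l > 0 \<Longrightarrow> cls l (k + 1) = succ_mod l (cls l k)"
  by (rule of_nat_eq_iff[where ?'a = int, THEN iffD1])
    (simp add: int_cls succ_mod_def of_nat_mod mod_add_left_eq mod_add_right_eq add.commute)

lemma cls_pred: "l > 0 \<Longrightarrow> cls l (k - 1) = pred_mod l (cls l k)"
proof (rule of_nat_eq_iff[where ?'a = int, THEN iffD1])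
  assume l: "l > 0"
  have "int (pred_mod l (cls l k)) = (int (cls l k) + int l - 1) mod int l"
    using l by (simp add: pred_mod_def of_nat_mod of_nat_diff)
  also have "\<dots> = (int (cls l k) - 1) mod int l"
    by (metis add_diff_eq diff_add_eq mod_add_self2)
  also have "\<dots> = (k - 1) mod int l"
    using l by (simp add: int_cls mod_diff_left_eq)
  finally show "int (cls l (k - 1)) = int (pred_mod l (cls l k))" using l by (simp add: int_cls)
qed

lemma succ_mod_less: "l > 0 \<Longrightarrow> succ_mod l i < l"
  by (simp add: succ_mod_def)

lemma pred_mod_less: "l > 0 \<Longrightarrow> pred_mod l i < l"
  by (simp add: pred_mod_def)

lemma succ_pred_mod: "i < l \<Longrightarrow> succ_mod l (pred_mod l i) = i"
  using cls_succ[of l "int i - 1"] cls_pred[of l "int i"] by (simp add: cls_of_nat)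

lemma pred_succ_mod: "i < l \<Longrightarrow> pred_mod l (succ_mod l i) = i"
  using cls_pred[of l "int i + 1"] cls_succ[of l "int i"] by (simp add: cls_of_nat)

lemma succ_mod_neq: "2 \<le> l \<Longrightarrow> i < l \<Longrightarrow> succ_mod l i \<noteq> i"
  by (cases "Suc i = l") (auto simp: succ_mod_def)

lemma pred_mod_neq: "2 \<le> l \<Longrightarrow> i < l \<Longrightarrow> pred_mod l i \<noteq> i"
  by (metis succ_mod_neq succ_pred_mod)

lemma cls_succ_eq_iff: "i < l \<Longrightarrow> cls l (k + 1) = i \<longleftrightarrow> cls l k = pred_mod l i"
  by (metis cls_less cls_succ gr_zeroI not_less_zero pred_succ_mod succ_pred_mod)

lemma cls_pred_eq_iff: "i < l \<Longrightarrow> cls l (k - 1) = i \<longleftrightarrow> cls l k = succ_mod l i"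
  by (metis cls_less cls_pred gr_zeroI not_less_zero pred_succ_mod succ_pred_mod)

lemma cyclic_induct:
  assumes "i0 < l" "P i0" and step: "\<And>i. i < l \<Longrightarrow> P i \<Longrightarrow> P (succ_mod l i)" and "i < l"
  shows "P i"
proof -
  have "P ((i0 + m) mod l)" for m
  proof (induction m)
    case 0
    then show ?case using assms by simp
  next
    case (Suc m)
    have "succ_mod l ((i0 + m) mod l) = (i0 + Suc m) mod l"
      by (simp add: succ_mod_def mod_Suc_eq)
    with step[OF _ Suc] \<open>i < l\<close> show ?case by simp
  qed
  from this[of "i + l - i0"] show ?thesis using assms by simp
qed

section \<open>Residue counts and their pairing with simple roots\<close>

lemma Res_eq_sum:
  assumes "\<mu> \<in> partitions" "finite K" "\<And>k. k \<notin> K \<Longrightarrow> diag_count \<mu> k = 0"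
  shows "int (Res l \<mu> i) = (\<Sum>k\<in>K. if cls l k = i then diag_count \<mu> k else 0)"
proof -
  let ?B = "\<lambda>k. {b \<in> \<mu>. content b = k}"
  have fin: "finite \<mu>" by (rule partitions_finite[OF assms(1)])
  have "content b \<in> K" if "b \<in> \<mu>" for b
  proof (rule ccontr)
    assume "content b \<notin> K"
    then have "card (?B (content b)) = 0" using assms(3) by (simp add: diag_count_def)
    then have "?B (content b) = {}" using fin by simp
    with that show False by blast
  qed
  then have "{b \<in> \<mu>. residue l b = i} = (\<Union>k\<in>{k \<in> K. cls l k = i}. ?B k)"
    by (auto simp: residue_eq_cls)
  then have "Res l \<mu> i = (\<Sum>k\<in>{k \<in> K. cls l k = i}. card (?B k))"
    unfolding Res_def using fin assms(2) by (simp only:) (subst card_UN_disjoint, auto)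
  then have "int (Res l \<mu> i) = (\<Sum>k\<in>{k \<in> K. cls l k = i}. diag_count \<mu> k)"
    by (simp add: diag_count_def)
  also have "\<dots> = (\<Sum>k\<in>K. if cls l k = i then diag_count \<mu> k else 0)"
    using assms(2) by (simp add: sum.inter_filter)
  finally show ?thesis .
qed

text \<open>Framing vector minus the affine Cartan matrix applied to \<open>a\<close>. The simple
  reflection at \<open>i\<close> acts on dimension vectors by adding \<open>defect l a i\<close> to
  \<open>a i\<close>. Multiples of \<delta> do not change it.\<close>

definition defect :: "nat \<Rightarrow> (nat \<Rightarrow> int) \<Rightarrow> nat \<Rightarrow> int" where
  "defect l a i = of_bool (i = 0) - (2 * a i - a (pred_mod l i) - a (succ_mod l i))"

lemma edge_diff:
  "edge_of d (k - 1) - edge_of d k = of_bool (k = 0) - 2 * d k + d (k - 1) + d (k + 1)"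
  by (auto simp: edge_of_def)

lemma sum_shift_int:
  fixes f :: "int \<Rightarrow> int"
  shows "(\<Sum>k\<in>{a..b}. f (k - c)) = (\<Sum>k\<in>{a - c..b - c}. f k)"
  by (subst image_minus_const_atLeastAtMost'[symmetric], subst sum.reindex) (auto simp: inj_on_def)

text \<open>The summand is 1 at an addable box and -1 at a removable one, so the defect counts
  addable minus removable boxes of residue \<open>i\<close>. It is a second difference of diagonal
  lengths, and summed over a residue class the shifted lengths become the counts at the neighbouring
  residues.\<close>

lemma defect_Res_eq_sum:
  assumes "\<mu> \<in> partitions" "i < l" "N > 0" and supp: "\<And>k. N \<le> \<bar>k\<bar> \<Longrightarrow> diag_count \<mu> k = 0"
  shows "defect l (\<lambda>j. int (Res l \<mu> j)) i =
    (\<Sum>k\<in>{-N..N}. if cls l k = i then edge \<mu> (k - 1) - edge \<mu> k else 0)"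
proof -
  let ?d = "diag_count \<mu>" and ?K = "{-N..N}"
  have l: "l > 0" using assms(2) by simp
  have R: "int (Res l \<mu> j) = (\<Sum>k\<in>?K. if cls l k = j then ?d k else 0)" for j
    by (rule Res_eq_sum) (use assms in auto)
  have m: "(\<Sum>k\<in>?K. if cls l k = i then ?d (k - 1) else 0) = int (Res l \<mu> (pred_mod l i))"
  proof -
    have "(\<Sum>k\<in>?K. if cls l k = i then ?d (k - 1) else 0) =
      (\<Sum>k\<in>{-N - 1..N - 1}. if cls l k = pred_mod l i then ?d k else 0)"
      using sum_shift_int[where f = "\<lambda>k. if cls l (k + 1) = i then ?d k else 0" and c = 1 and a = "-N" and b = N]
      by (simp add: cls_succ_eq_iff[OF assms(2)] cong: if_cong)
    also have "\<dots> = int (Res l \<mu> (pred_mod l i))"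
      by (rule Res_eq_sum[symmetric]) (use assms in auto)
    finally show ?thesis .
  qed
  have p: "(\<Sum>k\<in>?K. if cls l k = i then ?d (k + 1) else 0) = int (Res l \<mu> (succ_mod l i))"
  proof -
    have "(\<Sum>k\<in>?K. if cls l k = i then ?d (k + 1) else 0) =
      (\<Sum>k\<in>{-N + 1..N + 1}. if cls l k = succ_mod l i then ?d k else 0)"
      using sum_shift_int[where f = "\<lambda>k. if cls l (k - 1) = i then ?d k else 0" and c = "-1" and a = "-N" and b = N]
      by (simp add: cls_pred_eq_iff[OF assms(2)] cong: if_cong)
    also have "\<dots> = int (Res l \<mu> (succ_mod l i))"
      by (rule Res_eq_sum[symmetric]) (use assms in auto)
    finally show ?thesis .
  qed
  have z: "(\<Sum>k\<in>?K. if cls l k = i then of_bool (k = 0) else (0::int)) = of_bool (i = 0)"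
  proof -
    have "(\<Sum>k\<in>?K. if cls l k = i then of_bool (k = 0) else (0::int)) =
      (\<Sum>k\<in>?K. if k = 0 then of_bool (i = 0) else 0)"
      by (rule sum.cong) (auto simp: cls_0)
    then show ?thesis using assms(3) by simp
  qed
  have "(\<Sum>k\<in>?K. if cls l k = i then edge \<mu> (k - 1) - edge \<mu> k else 0) =
    (\<Sum>k\<in>?K. (if cls l k = i then of_bool (k = 0) else 0) - 2 * (if cls l k = i then ?d k else 0)
      + (if cls l k = i then ?d (k - 1) else 0) + (if cls l k = i then ?d (k + 1) else 0))"
    by (rule sum.cong) (auto simp: edge_diff)
  also have "\<dots> = defect l (\<lambda>j. int (Res l \<mu> j)) i"
    by (simp only: sum.distrib sum_subtractf sum_distrib_left[symmetric] m p z R[symmetric])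
      (simp add: defect_def)
  finally show ?thesis by simp
qed

section \<open>Boxes and strips on the boundary word\<close>

lemma diag_count_Diff:
  assumes "finite \<mu>" "\<kappa> \<subseteq> \<mu>"
  shows "diag_count (\<mu> - \<kappa>) k = diag_count \<mu> k - diag_count \<kappa> k"
proof -
  have "{b \<in> \<mu> - \<kappa>. content b = k} = {b \<in> \<mu>. content b = k} - {b \<in> \<kappa>. content b = k}" by auto
  moreover have "card ({b \<in> \<mu>. content b = k} - {b \<in> \<kappa>. content b = k})
      = card {b \<in> \<mu>. content b = k} - card {b \<in> \<kappa>. content b = k}"
    by (rule card_Diff_subset) (use assms in \<open>auto intro: finite_subset\<close>)
  moreover have "card {b \<in> \<kappa>. content b = k} \<le> card {b \<in> \<mu>. content b = k}"
    by (rule card_mono) (use assms in auto)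
  ultimately show ?thesis by (simp add: diag_count_def)
qed

lemma diag_count_singleton: "diag_count {b} k = of_bool (k = content b)"
proof -
  have "{b' \<in> {b}. content b' = k} = (if k = content b then {b} else {})" by auto
  then show ?thesis by (simp add: diag_count_def)
qed

text \<open>Deleting the box lowers the edge at its content by one and raises the edge before it by
  one. As both words take only the values 0 and 1, the old values are forced.\<close>

lemma removable_edges:
  assumes "\<mu> \<in> partitions" "removable \<mu> b"
  shows "edge \<mu> (content b - 1) = 0" "edge \<mu> (content b) = 1"
proof -
  have b: "b \<in> \<mu>" "\<mu> - {b} \<in> partitions" using assms by (auto simp: removable_def)
  have "diag_count (\<mu> - {b}) k = diag_count \<mu> k - of_bool (k = content b)" for k
    using diag_count_Diff[of \<mu> "{b}" k] b partitions_finite[OF assms(1)]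
    by (simp add: diag_count_singleton)
  then have "edge (\<mu> - {b}) (content b) = edge \<mu> (content b) - 1"
    "edge (\<mu> - {b}) (content b - 1) = edge \<mu> (content b - 1) + 1"
    by (auto simp: edge_of_def)
  then show "edge \<mu> (content b - 1) = 0" "edge \<mu> (content b) = 1"
    using edge_01[OF assms(1), of "content b"] edge_01[OF assms(1), of "content b - 1"]
      edge_01[OF b(2), of "content b"] edge_01[OF b(2), of "content b - 1"] by auto
qed

lemma removable_of_diag_count:
  assumes "\<mu> \<in> partitions" "\<kappa> \<in> partitions"
    and d: "\<And>j. diag_count \<kappa> j = diag_count \<mu> j - of_bool (j = k)"
  obtains b where "removable \<mu> b" "content b = k" "\<kappa> = \<mu> - {b}"
proof -
  have sub: "\<kappa> \<subseteq> \<mu>" using assms by (simp add: partition_subset_iff)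
  have fin: "finite \<mu>" using assms(1) by (rule partitions_finite)
  have D: "diag_count (\<mu> - \<kappa>) j = of_bool (j = k)" for j
    using diag_count_Diff[OF fin sub] d by simp
  have "card {b \<in> \<mu> - \<kappa>. content b = k} = 1"
    using D[of k] by (simp add: diag_count_def)
  then obtain b where b: "{b \<in> \<mu> - \<kappa>. content b = k} = {b}" by (rule card_1_singletonE)
  have "content b' = k" if "b' \<in> \<mu> - \<kappa>" for b'
  proof (rule ccontr)
    assume "content b' \<noteq> k"
    then have "card {b \<in> \<mu> - \<kappa>. content b = content b'} = 0"
      using D[of "content b'"] by (simp add: diag_count_def)
    then have "{b \<in> \<mu> - \<kappa>. content b = content b'} = {}" using fin by simp
    with that show False by blast
  qed
  then have "\<mu> - \<kappa> = {b}" using b by auto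
  then have "\<kappa> = \<mu> - {b}" "b \<in> \<mu>" "content b = k" using sub b by auto
  then show thesis using that assms(2) by (auto simp: removable_def)
qed

text \<open>Exchanging the edges at \<open>a - 1\<close> and \<open>b\<close> shortens every
  diagonal from \<open>a\<close> to \<open>b\<close> by one; this is the removal of a rim
  hook.\<close>

lemma remove_strip:
  assumes "\<mu> \<in> partitions" "a \<le> b" "edge \<mu> (a - 1) = 0" "edge \<mu> b = 1"
  obtains \<kappa> where "\<kappa> \<in> partitions"
    "\<And>k. diag_count \<kappa> k = diag_count \<mu> k - of_bool (a \<le> k \<and> k \<le> b)"
proof -
  define d where "d = (\<lambda>k. diag_count \<mu> k - of_bool (a \<le> k \<and> k \<le> b))"
  obtain N where N: "\<And>k. N \<le> \<bar>k\<bar> \<Longrightarrow> diag_count \<mu> k = 0" using diag_count_support[OF assms(1)] by auto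
  have e: "edge_of d k = edge \<mu> k + of_bool (k = a - 1) - of_bool (k = b)" for k
    using assms(2) by (auto simp: edge_of_def d_def)
  have "edge_of d k = 0 \<or> edge_of d k = 1" for k
    using edge_01[OF assms(1), of k] assms(2-4) by (auto simp: e)
  moreover have "d k = 0" if "max N (max (\<bar>a\<bar> + 1) (\<bar>b\<bar> + 1)) \<le> \<bar>k\<bar>" for k
    using that N by (auto simp: d_def)
  ultimately have "diagram_of d \<in> partitions" "diag_count (diagram_of d) = d"
    using diagram_of_partition by blast+
  then show thesis using that[of "diagram_of d"] by (simp add: d_def)
qed

lemma ex_removable:
  assumes "\<mu> \<in> partitions" "edge \<mu> (k - 1) = 0" "edge \<mu> k = 1"
  obtains b where "removable \<mu> b" "content b = k"
proof -
  obtain \<kappa> where \<kappa>: "\<kappa> \<in> partitions"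
    and d: "\<And>j. diag_count \<kappa> j = diag_count \<mu> j - of_bool (k \<le> j \<and> j \<le> k)"
    using remove_strip[OF assms(1) order_refl assms(2,3)] by blast
  have "diag_count \<kappa> j = diag_count \<mu> j - of_bool (j = k)" for j
    unfolding d by (cases "j = k") auto
  from removable_of_diag_count[OF assms(1) \<kappa> this] show thesis using that by metis
qed

lemma ex_addable:
  assumes "\<mu> \<in> partitions" "edge \<mu> (k - 1) = 1" "edge \<mu> k = 0"
  obtains \<kappa> b where "\<kappa> \<in> partitions" "removable \<kappa> b" "content b = k" "\<mu> = \<kappa> - {b}"
proof -
  define d where "d = (\<lambda>j. diag_count \<mu> j + of_bool (j = k))"
  obtain N where N: "\<And>k. N \<le> \<bar>k\<bar> \<Longrightarrow> diag_count \<mu> k = 0" using diag_count_support[OF assms(1)] by auto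
  have e: "edge_of d j = edge \<mu> j + of_bool (j = k) - of_bool (j = k - 1)" for j
    by (auto simp: edge_of_def d_def)
  have "edge_of d j = 0 \<or> edge_of d j = 1" for j
    using edge_01[OF assms(1), of j] assms(2,3) by (auto simp: e)
  moreover have "d j = 0" if "max N (\<bar>k\<bar> + 1) \<le> \<bar>j\<bar>" for j
    using that N by (auto simp: d_def)
  ultimately have D: "diagram_of d \<in> partitions" "diag_count (diagram_of d) = d"
    using diagram_of_partition by blast+
  have "diag_count \<mu> j = diag_count (diagram_of d) j - of_bool (j = k)" for j
    unfolding D(2) by (simp add: d_def)
  from removable_of_diag_count[OF D(1) assms(1) this] show thesis using that D(1) by metis
qed

lemma J_cores_iff:
  "\<mu> \<in> J_cores l J \<longleftrightarrow>
    \<mu> \<in> partitions \<and> (\<forall>k. cls l k \<in> J \<longrightarrow> \<not> (edge \<mu> (k - 1) = 0 \<and> edge \<mu> k = 1))"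
proof (cases "\<mu> \<in> partitions")
  case True
  have "(\<exists>b. removable \<mu> b \<and> content b = k) \<longleftrightarrow> edge \<mu> (k - 1) = 0 \<and> edge \<mu> k = 1" for k
    using removable_edges[OF True] ex_removable[OF True, of k] by metis
  then show ?thesis using True by (simp add: J_cores_def residue_eq_cls) metis
qed (simp add: J_cores_def)

lemma diagram_le_iff:
  assumes "\<mu> \<in> partitions"
  shows "diagram_le \<kappa> \<mu> \<longleftrightarrow> \<kappa> \<in> partitions \<and> \<kappa> \<subseteq> \<mu>"
proof
  assume "diagram_le \<kappa> \<mu>"
  then have "remove_box\<^sup>*\<^sup>* \<mu> \<kappa>" by (simp add: diagram_le_def)
  then show "\<kappa> \<in> partitions \<and> \<kappa> \<subseteq> \<mu>"
    by induction (use assms in \<open>auto simp: remove_box_def removable_def\<close>)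
next
  assume "\<kappa> \<in> partitions \<and> \<kappa> \<subseteq> \<mu>"
  then have \<kappa>: "\<kappa> \<in> partitions" and "\<kappa> \<subseteq> \<mu>" by auto
  then show "diagram_le \<kappa> \<mu>" using assms
  proof (induction "card (\<mu> - \<kappa>)" arbitrary: \<mu> rule: less_induct)
    case (less \<mu>)
    have fin: "finite \<mu>" using less.prems by (auto intro: partitions_finite)
    show ?case
    proof (cases "\<mu> = \<kappa>")
      case False
      have ne: "\<mu> - \<kappa> \<noteq> {}" "finite (\<mu> - \<kappa>)" using False less.prems fin by auto
      \<comment> \<open>A box of \<open>\<mu> - \<kappa>\<close> with largest row plus column is
        removable: a box of \<mu> further right or below would also lie outside \<kappa> and have a
        larger sum.\<close>
      let ?M = "Max ((\<lambda>b. fst b + snd b) ` (\<mu> - \<kappa>))"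
      have "?M \<in> (\<lambda>b. fst b + snd b) ` (\<mu> - \<kappa>)" using ne by (intro Max_in) auto
      then obtain b where b: "?M = fst b + snd b" "b \<in> \<mu> - \<kappa>" by (rule imageE)
      have mx: "fst b' + snd b' \<le> fst b + snd b" if "b' \<in> \<mu> - \<kappa>" for b'
        unfolding b(1)[symmetric] using ne(2) that by (intro Max_ge finite_imageI imageI)
      have down: "(r', s') \<in> \<mu> - {b}" if rs: "(r, s) \<in> \<mu> - {b}" "r' \<le> r" "s' \<le> s" for r s r' s'
      proof -
        have in\<mu>: "(r', s') \<in> \<mu>"
          using rs partitions_down[OF \<open>\<mu> \<in> partitions\<close>, of r s r' s'] by auto
        have "(r', s') \<noteq> b"
        proof
          assume eq: "(r', s') = b"
          have "(r, s) \<notin> \<kappa>" using partitions_down[OF \<kappa>, of r s r' s'] rs b(2) eq by auto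
          then have "r + s \<le> r' + s'" using mx[of "(r, s)"] rs eq by auto
          with rs eq show False by auto
        qed
        with in\<mu> show ?thesis by simp
      qed
      have "finite (\<mu> - {b})" using fin by simp
      then have part: "\<mu> - {b} \<in> partitions" by (rule partitionsI[OF _ down])
      have "card (\<mu> - {b} - \<kappa>) < card (\<mu> - \<kappa>)"
        using b(2) fin by (intro psubset_card_mono) auto
      from less.hyps[OF this \<kappa> _ part] have "remove_box\<^sup>*\<^sup>* (\<mu> - {b}) \<kappa>"
        using less.prems b(2) by (auto simp: diagram_le_def)
      moreover have "remove_box \<mu> (\<mu> - {b})"
        unfolding remove_box_def removable_def using part b(2) by blast
      ultimately show ?thesis unfolding diagram_le_def by (rule converse_rtranclp_into_rtranclp[rotated])
    qed (simp add: diagram_le_def)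
  qed
qed

section \<open>Cores\<close>

definition flush :: "nat \<Rightarrow> diagram \<Rightarrow> bool" where
  "flush l \<mu> \<longleftrightarrow> (\<forall>k. edge \<mu> k = 1 \<longrightarrow> edge \<mu> (k - int l) = 1)"

lemma flush_antimono:
  assumes "\<mu> \<in> partitions" "flush l \<mu>" "l > 0" "cls l k = cls l k'" "k \<le> k'"
  shows "edge \<mu> k' \<le> edge \<mu> k"
proof -
  have *: "edge \<mu> (k' - int m * int l) = 1" if "edge \<mu> k' = 1" for m
  proof (induction m)
    case (Suc m)
    then have "edge \<mu> (k' - int m * int l - int l) = 1" using assms(2) by (simp add: flush_def)
    then show ?case by (simp add: algebra_simps)
  qed (simp add: that)
  have "int l dvd k' - k" using assms(3,4) cls_eq_iff by metis
  then obtain q where "k' - k = int l * q" by (rule dvdE)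
  moreover from this assms(5) have "0 \<le> int l * q" by simp
  then have "0 \<le> q" using assms(3) by (simp add: zero_le_mult_iff)
  ultimately have "k = k' - int (nat q) * int l" by (simp add: algebra_simps)
  then show ?thesis using *[of "nat q"] edge_01[OF assms(1), of k'] edge_01[OF assms(1), of k] by auto
qed

lemma ell_step_facts:
  assumes "\<mu> \<in> partitions" "ell_step l \<mu> \<kappa>" "l > 0"
  shows "\<kappa> \<in> partitions" "\<kappa> \<subseteq> \<mu>" "card \<mu> = card \<kappa> + l"
    and "i < l \<Longrightarrow> card {b \<in> \<mu> - \<kappa>. residue l b = i} = 1"
    and "i < l \<Longrightarrow> Res l \<mu> i = Res l \<kappa> i + 1"
proof -
  have fin: "finite \<mu>" by (rule partitions_finite[OF assms(1)])
  show \<kappa>: "\<kappa> \<in> partitions" "\<kappa> \<subseteq> \<mu>"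
    using assms(2) diagram_le_iff[OF assms(1)] by (auto simp: ell_step_def)
  have c: "card (\<mu> - \<kappa>) = l" and inj: "inj_on (residue l) (\<mu> - \<kappa>)"
    using assms(2) by (auto simp: ell_step_def)
  have "card \<kappa> \<le> card \<mu>" using fin \<kappa>(2) by (rule card_mono)
  then show "card \<mu> = card \<kappa> + l"
    using c card_Diff_subset[OF finite_subset[OF \<kappa>(2) fin] \<kappa>(2)] by simp
  assume i: "i < l"
  have "residue l ` (\<mu> - \<kappa>) = {..<l}"
  proof (rule card_subset_eq)
    show "residue l ` (\<mu> - \<kappa>) \<subseteq> {..<l}" using assms(3) by (auto simp: residue_eq_cls cls_less)
    show "card (residue l ` (\<mu> - \<kappa>)) = card {..<l}" using card_image[OF inj] c by simp
  qed simp
  with i have "i \<in> residue l ` (\<mu> - \<kappa>)" by simp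
  then obtain b where b: "b \<in> \<mu> - \<kappa>" "residue l b = i" by blast
  have eq: "{b \<in> \<mu> - \<kappa>. residue l b = i} = {b}"
    using b inj unfolding inj_on_def by blast
  then show *: "card {b \<in> \<mu> - \<kappa>. residue l b = i} = 1" by simp
  have "{b \<in> \<mu>. residue l b = i} = {b \<in> \<kappa>. residue l b = i} \<union> {b \<in> \<mu> - \<kappa>. residue l b = i}"
    using \<kappa>(2) by blast
  moreover have "card \<dots> = card {b \<in> \<kappa>. residue l b = i} + card {b \<in> \<mu> - \<kappa>. residue l b = i}"
    by (rule card_Un_disjoint) (use fin \<kappa>(2) in \<open>auto intro: finite_subset\<close>)
  ultimately show "Res l \<mu> i = Res l \<kappa> i + 1" by (simp only: Res_def *)
qed

text \<open>An edge 1 at \<open>k\<close> with an edge 0 at \<open>k - l\<close> bounds a rim hook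
  with contents \<open>k - l + 1\<close> to \<open>k\<close>. These are \<open>l\<close> consecutive
  contents, so the residues are distinct and the hook is an \<open>ell_step\<close>.\<close>

lemma ell_core_flush:
  assumes "\<mu> \<in> ell_cores l" "l > 0"
  shows "flush l \<mu>"
proof (rule ccontr)
  assume "\<not> flush l \<mu>"
  have \<mu>: "\<mu> \<in> partitions" using assms by (simp add: ell_cores_def)
  obtain k where k: "edge \<mu> k = 1" "edge \<mu> (k - int l) \<noteq> 1"
    using \<open>\<not> flush l \<mu>\<close> by (auto simp: flush_def)
  define a where "a = k - int l + 1"
  have a: "a \<le> k" "edge \<mu> (a - 1) = 0"
    using k assms(2) edge_01[OF \<mu>, of "k - int l"] by (auto simp: a_def)
  obtain \<kappa> where \<kappa>: "\<kappa> \<in> partitions"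
    and d: "\<And>j. diag_count \<kappa> j = diag_count \<mu> j - of_bool (a \<le> j \<and> j \<le> k)"
    using remove_strip[OF \<mu> a k(1)] by blast
  have fin: "finite \<mu>" by (rule partitions_finite[OF \<mu>])
  have sub: "\<kappa> \<subseteq> \<mu>" using \<mu> \<kappa> d by (simp add: partition_subset_iff)
  have D: "card {b \<in> \<mu> - \<kappa>. content b = j} = of_bool (a \<le> j \<and> j \<le> k)" for j
  proof -
    have "diag_count (\<mu> - \<kappa>) j = of_bool (a \<le> j \<and> j \<le> k)" by (simp add: diag_count_Diff[OF fin sub] d)
    then show ?thesis unfolding diag_count_def by (cases "a \<le> j \<and> j \<le> k") simp_all
  qed
  have inj: "inj_on content (\<mu> - \<kappa>)"
  proof (rule inj_onI)
    fix b b' assume b: "b \<in> \<mu> - \<kappa>" "b' \<in> \<mu> - \<kappa>" "content b = content b'"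
    let ?S = "{b'' \<in> \<mu> - \<kappa>. content b'' = content b}"
    have bS: "b \<in> ?S" "b' \<in> ?S" using b(1,2) b(3)[symmetric] by blast+
    have "finite ?S" using fin by simp
    then have "card ?S \<noteq> 0" using bS(1) card_0_eq by blast
    moreover have "card ?S = 0 \<or> card ?S = 1" unfolding D by simp
    ultimately have "card ?S = 1" by linarith
    then obtain x where x: "?S = {x}" by (rule card_1_singletonE)
    then have "b = x" "b' = x" using bS unfolding x by simp_all
    then show "b = b'" by simp
  qed
  have img: "content ` (\<mu> - \<kappa>) = {a..k}"
  proof (intro equalityI subsetI)
    fix j assume "j \<in> content ` (\<mu> - \<kappa>)"
    then have "{b \<in> \<mu> - \<kappa>. content b = j} \<noteq> {}" by auto
    moreover have "finite {b \<in> \<mu> - \<kappa>. content b = j}" using fin by simp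
    ultimately have "card {b \<in> \<mu> - \<kappa>. content b = j} \<noteq> 0" using card_0_eq by blast
    then show "j \<in> {a..k}" unfolding D by (simp split: if_splits)
  next
    fix j assume "j \<in> {a..k}"
    then have "card {b \<in> \<mu> - \<kappa>. content b = j} = 1" unfolding D by simp
    then obtain b where b: "{b \<in> \<mu> - \<kappa>. content b = j} = {b}" by (rule card_1_singletonE)
    have "b \<in> {b \<in> \<mu> - \<kappa>. content b = j}" unfolding b by simp
    then show "j \<in> content ` (\<mu> - \<kappa>)" by blast
  qed
  have "card (\<mu> - \<kappa>) = l"
    using card_image[OF inj] img by (simp add: a_def)
  moreover have "inj_on (residue l) (\<mu> - \<kappa>)"
  proof (rule inj_onI)
    fix b b' assume b: "b \<in> \<mu> - \<kappa>" "b' \<in> \<mu> - \<kappa>" "residue l b = residue l b'"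
    have "content b \<in> {a..k}" "content b' \<in> {a..k}" using b img by blast+
    then have "\<bar>content b - content b'\<bar> < int l" by (auto simp: a_def)
    then have "content b = content b'"
      using b(3) assms(2) cls_inj_window by (simp add: residue_eq_cls)
    then show "b = b'" using inj b by (auto dest: inj_onD)
  qed
  ultimately have "ell_step l \<mu> \<kappa>"
    using \<kappa> sub by (simp add: ell_step_def diagram_le_iff[OF \<mu>])
  then show False using assms by (auto simp: ell_cores_def)
qed

text \<open>Removing one box of each residue from a flush diagram is impossible: if \<open>k i\<close> is the content of
  the removed box of residue \<open>i\<close>, flushness forces \<open>k (i + 1) > k i\<close> around the whole cycle.\<close>

lemma flush_ell_core:
  assumes "\<mu> \<in> partitions" "flush l \<mu>" "l > 0"
  shows "\<mu> \<in> ell_cores l"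
proof (rule ccontr)
  assume "\<mu> \<notin> ell_cores l"
  then obtain \<kappa> where step: "ell_step l \<mu> \<kappa>" using assms by (auto simp: ell_cores_def)
  note facts = ell_step_facts[OF assms(1) step assms(3)]
  have fin: "finite \<mu>" by (rule partitions_finite[OF assms(1)])
  have "\<exists>b. {b \<in> \<mu> - \<kappa>. residue l b = i} = {b}" if "i < l" for i
    using facts(4)[OF that] by (metis card_1_singletonE)
  then obtain \<beta> where \<beta>: "\<And>i. i < l \<Longrightarrow> {b \<in> \<mu> - \<kappa>. residue l b = i} = {\<beta> i}" by metis
  define f where "f = diag_count (\<mu> - \<kappa>)"
  define K where "K = (\<lambda>i. content (\<beta> i))"
  have f: "f k = of_bool (k = K (cls l k))" for k
  proof -
    have i: "cls l k < l" using assms(3) by (rule cls_less)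
    have "{b \<in> \<mu> - \<kappa>. content b = k} = {b \<in> {b \<in> \<mu> - \<kappa>. residue l b = cls l k}. content b = k}"
      by (auto simp: residue_eq_cls)
    also have "\<dots> = (if k = K (cls l k) then {\<beta> (cls l k)} else {})"
      unfolding \<beta>[OF i] K_def by auto
    finally show ?thesis unfolding f_def diag_count_def by simp
  qed
  have cK: "cls l (K i) = i" if "i < l" for i
  proof -
    have "\<beta> i \<in> {b \<in> \<mu> - \<kappa>. residue l b = i}" unfolding \<beta>[OF that] by simp
    then show ?thesis by (simp add: K_def residue_eq_cls)
  qed
  have e: "edge \<kappa> k = edge \<mu> k - f k + f (k + 1)" for k
    using diag_count_Diff[OF fin facts(2)] by (simp add: edge_of_def f_def)
  \<comment> \<open>Unless the two boxes have adjacent contents, the removal changes the edge at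
    \<open>K i\<close> from 1 to 0 and the edge at \<open>K (succ_mod l i) - 1\<close> from 0 to 1.
    Both positions have class \<open>i\<close>, so flushness puts the first before the
    second.\<close>
  have less: "K i < K (succ_mod l i)" if i: "i < l" for i
  proof (cases "K (succ_mod l i) = K i + 1")
    case False
    let ?k = "K i" and ?a = "K (succ_mod l i) - 1"
    have "cls l (?k + 1) = succ_mod l i" using assms(3) cK[OF i] by (simp add: cls_succ)
    then have "f (?k + 1) = 0" "f ?k = 1" using False cK[OF i] by (auto simp: f)
    then have 1: "edge \<mu> ?k = 1" using e[of ?k] edge_01[OF assms(1), of ?k] edge_01[OF facts(1), of ?k] by auto
    have ca: "cls l ?a = i"
      using assms(3) i cK[of "succ_mod l i"] by (simp add: cls_pred succ_mod_less pred_succ_mod)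
    have "f (?a + 1) = 1" using cK[of "succ_mod l i"] assms(3) by (simp add: f succ_mod_less)
    moreover have "f ?a = 0" using False by (auto simp: f ca)
    ultimately have 2: "edge \<mu> ?a = 0" using e[of ?a] edge_01[OF assms(1), of ?a] edge_01[OF facts(1), of ?a] by auto
    show ?thesis
    proof (rule ccontr)
      assume "\<not> ?thesis"
      then have "edge \<mu> ?k \<le> edge \<mu> ?a"
        using flush_antimono[OF assms, of ?a ?k] cK[OF i] ca by simp
      with 1 2 show False by simp
    qed
  qed simp
  let ?M = "Max (K ` {..<l})"
  have "?M \<in> K ` {..<l}" using assms(3) by (intro Max_in) auto
  then obtain i where i: "i < l" "?M = K i" by auto
  have "K (succ_mod l i) \<le> ?M" using assms(3) by (intro Max_ge) (auto simp: succ_mod_less)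
  with less[OF i(1)] i(2) show False by linarith
qed

lemma ell_cores_iff: "l > 0 \<Longrightarrow> \<mu> \<in> ell_cores l \<longleftrightarrow> \<mu> \<in> partitions \<and> flush l \<mu>"
  using ell_core_flush[of \<mu> l] flush_ell_core[of \<mu> l] unfolding ell_cores_def by blast

text \<open>On each runner the difference of the two edge sequences has constant sign and sum zero.\<close>

lemma ell_core_unique:
  assumes "l > 0" "\<mu> \<in> ell_cores l" "\<kappa> \<in> ell_cores l"
    and "\<And>i. i < l \<Longrightarrow> int (Res l \<mu> i) = int (Res l \<kappa> i) + m"
  shows "\<mu> = \<kappa>"
proof -
  have \<mu>: "\<mu> \<in> partitions" "flush l \<mu>" and \<kappa>: "\<kappa> \<in> partitions" "flush l \<kappa>"
    using assms by (auto simp: ell_cores_iff)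
  obtain N1 where N1: "N1 > 0" "\<And>k. N1 \<le> \<bar>k\<bar> \<Longrightarrow> diag_count \<mu> k = 0"
    using diag_count_support[OF \<mu>(1)] by auto
  obtain N2 where N2: "N2 > 0" "\<And>k. N2 \<le> \<bar>k\<bar> \<Longrightarrow> diag_count \<kappa> k = 0"
    using diag_count_support[OF \<kappa>(1)] by auto
  define N where "N = max N1 N2"
  have N: "diag_count \<mu> k = 0" "diag_count \<kappa> k = 0" if "N \<le> \<bar>k\<bar>" for k
    using that N1 N2 by (auto simp: N_def)
  define f where "f = (\<lambda>k. edge \<mu> k - edge \<kappa> k)"
  define g where "g = (\<lambda>k. diag_count \<mu> k - diag_count \<kappa> k)"
  let ?K = "{-N - 1..N + 1}"
  have fg: "f k = g k - g (k + 1)" for k by (simp add: f_def g_def edge_of_def)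
  have G: "(\<Sum>k\<in>{a..b}. if cls l k = i then g k else 0) = m"
    if "i < l" "a \<le> - N" "N \<le> b" for i a b
  proof -
    have "(\<Sum>k\<in>{a..b}. if cls l k = i then diag_count \<mu> k else 0) = int (Res l \<mu> i)"
      using that N by (intro Res_eq_sum[symmetric] \<mu>) auto
    moreover have "(\<Sum>k\<in>{a..b}. if cls l k = i then diag_count \<kappa> k else 0) = int (Res l \<kappa> i)"
      using that N by (intro Res_eq_sum[symmetric] \<kappa>) auto
    moreover have "(\<Sum>k\<in>{a..b}. if cls l k = i then g k else 0) =
      (\<Sum>k\<in>{a..b}. if cls l k = i then diag_count \<mu> k else 0) -
      (\<Sum>k\<in>{a..b}. if cls l k = i then diag_count \<kappa> k else 0)"
      unfolding sum_subtractf[symmetric] by (rule sum.cong) (auto simp: g_def)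
    ultimately show ?thesis using assms(4)[OF that(1)] by simp
  qed
  \<comment> \<open>The differences \<open>g\<close> of diagonal lengths sum to \<open>m\<close>
    over every class, and \<open>f\<close> compares \<open>g\<close> at a position of class
    \<open>i\<close> with \<open>g\<close> at the next class, so \<open>m\<close> cancels. The
    summation range exceeds \<open>N\<close> by one to absorb that shift.\<close>
  have S: "(\<Sum>k\<in>?K. if cls l k = i then f k else 0) = 0" if i: "i < l" for i
  proof -
    have "(\<Sum>k\<in>?K. if cls l k = i then f k else 0) =
      (\<Sum>k\<in>?K. if cls l k = i then g k else 0) - (\<Sum>k\<in>?K. if cls l k = i then g (k + 1) else 0)"
      unfolding sum_subtractf[symmetric] by (rule sum.cong) (auto simp: fg)
    also have "(\<Sum>k\<in>?K. if cls l k = i then g (k + 1) else 0) =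
      (\<Sum>k\<in>{-N..2 + N}. if cls l k = succ_mod l i then g k else 0)"
      using sum_shift_int[where f = "\<lambda>k. if cls l (k - 1) = i then g k else 0" and c = "-1"
          and a = "-N - 1" and b = "N + 1"]
      by (simp add: cls_pred_eq_iff[OF i] cong: if_cong)
    finally show ?thesis using G[OF i, of "-N - 1" "N + 1"] G[OF succ_mod_less[OF assms(1), of i], of "-N" "2 + N"] by simp
  qed
  have f0: "f k = 0" if k: "k \<in> ?K" for k
  proof -
    let ?i = "cls l k"
    let ?h = "\<lambda>j. if cls l j = ?i then f j else 0"
    note e = edge_01[OF \<mu>(1)] edge_01[OF \<kappa>(1)]
    have i: "?i < l" using assms(1) by (rule cls_less)
    have sgn: "(\<forall>j\<in>?K. 0 \<le> ?h j) \<or> (\<forall>j\<in>?K. 0 \<le> - ?h j)"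
    proof (rule ccontr)
      assume "\<not> ?thesis"
      then obtain j j' where j: "cls l j = ?i" "cls l j' = ?i" "f j < 0" "f j' > 0"
        by (auto split: if_splits)
      have "edge \<mu> j = 0" "edge \<kappa> j = 1" "edge \<mu> j' = 1" "edge \<kappa> j' = 0"
        using j e[of j] e[of j'] by (auto simp: f_def)
      moreover have "edge \<mu> j' \<le> edge \<mu> j \<or> edge \<kappa> j \<le> edge \<kappa> j'"
        using flush_antimono[OF \<mu> assms(1), of j j'] flush_antimono[OF \<kappa> assms(1), of j' j] j(1,2)
        by (cases "j \<le> j'") auto
      ultimately show False by auto
    qed
    then have "?h k = 0"
    proof
      assume "\<forall>j\<in>?K. 0 \<le> ?h j"
      then have "\<forall>j\<in>?K. ?h j = 0"
        using sum_nonneg_eq_0_iff[of ?K ?h] S[OF i] by simp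
      then show ?thesis using k by blast
    next
      assume "\<forall>j\<in>?K. 0 \<le> - ?h j"
      moreover have "(\<Sum>j\<in>?K. - ?h j) = 0" unfolding sum_negf S[OF i] by simp
      ultimately have "\<forall>j\<in>?K. - ?h j = 0"
        using sum_nonneg_eq_0_iff[of ?K "\<lambda>j. - ?h j"] by simp
      then show ?thesis using k by force
    qed
    then show ?thesis by simp
  qed
  \<comment> \<open>Since \<open>f\<close> vanishes, \<open>g\<close> is constant up to
    \<open>N\<close>, where it is zero.\<close>
  have "g k = 0" for k
  proof (cases "\<bar>k\<bar> < N")
    case True
    have "g (k + int j) = g k" if "k + int j \<le> N" for j
      using that
    proof (induction j)
      case (Suc j)
      then have "f (k + int j) = 0" using True by (intro f0) auto
      then show ?case using Suc fg[of "k + int j"] by (simp add: algebra_simps)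
    qed simp
    moreover have "k + int (nat (N - k)) = N" using True by simp
    ultimately have "g N = g k" by (metis order_refl)
    then show ?thesis using True N[of N] by (simp add: g_def)
  qed (use N in \<open>auto simp: g_def\<close>)
  then show ?thesis using \<mu> \<kappa> by (intro partition_eqI) (auto simp: g_def)
qed

text \<open>The affine transposition exchanging \<open>k - 1\<close> and \<open>k\<close> for all \<open>k\<close> of class \<open>i\<close>.\<close>

definition sig :: "nat \<Rightarrow> nat \<Rightarrow> int \<Rightarrow> int" where
  "sig l i k = (if cls l k = i then k - 1 else if cls l (k + 1) = i then k + 1 else k)"

lemma sig_cases:
  assumes "2 \<le> l" "i < l"
  obtains "cls l k = i" "cls l (k + 1) \<noteq> i" "cls l (k - 1) \<noteq> i" "sig l i k = k - 1"
  | "cls l k \<noteq> i" "cls l (k + 1) = i" "cls l (k + 2) \<noteq> i" "sig l i k = k + 1"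
  | "cls l k \<noteq> i" "cls l (k + 1) \<noteq> i" "sig l i k = k"
proof -
  have n: "cls l (j + 1) \<noteq> cls l j" for j
    using assms succ_mod_neq[of l "cls l j"] by (simp add: cls_succ cls_less)
  consider "cls l k = i" | "cls l k \<noteq> i" "cls l (k + 1) = i" | "cls l k \<noteq> i" "cls l (k + 1) \<noteq> i"
    by blast
  then show thesis
  proof cases
    case 1
    then show ?thesis using n[of k] n[of "k - 1"] by (intro that(1)) (simp_all add: sig_def)
  next
    case 2
    then show ?thesis using n[of "k + 1"] by (intro that(2)) (simp_all add: sig_def add.assoc)
  next
    case 3
    then show ?thesis by (intro that(3)) (simp_all add: sig_def)
  qed
qed

lemma sig_sig: "2 \<le> l \<Longrightarrow> i < l \<Longrightarrow> sig l i (sig l i k) = k"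
  by (rule sig_cases[of l i k]) (auto simp: sig_def)

lemma sig_shift:
  assumes "l > 0"
  shows "sig l i (k + int l * m) = sig l i k + int l * m"
proof -
  have "cls l (j + int l * m) = cls l j" for j by (simp add: cls_def)
  from this[of k] this[of "k + 1"] show ?thesis by (simp add: sig_def algebra_simps)
qed

text \<open>All addable boxes of residue \<open>i\<close> are added and all removable ones removed
  at once. The term added to the diagonal length in \<open>d\<close> is 1, -1 or 0 accordingly, and
  these terms sum to the defect.\<close>

lemma reflect_partition:
  assumes "\<mu> \<in> partitions" "2 \<le> l" "i < l"
  obtains \<kappa> where "\<kappa> \<in> partitions" "\<And>k. edge \<kappa> k = edge \<mu> (sig l i k)"
    and "\<And>j. int (Res l \<kappa> j) = int (Res l \<mu> j) + of_bool (j = i) * defect l (\<lambda>j. int (Res l \<mu> j)) i"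
proof -
  define d where "d = (\<lambda>k. diag_count \<mu> k + (if cls l k = i then edge \<mu> (k - 1) - edge \<mu> k else 0))"
  obtain N where N: "N > 0" "\<And>k. N \<le> \<bar>k\<bar> \<Longrightarrow> diag_count \<mu> k = 0"
    using diag_count_support[OF assms(1)] by auto
  have e: "edge_of d k = edge \<mu> (sig l i k)" for k
    by (rule sig_cases[OF assms(2,3), of k]) (auto simp: edge_of_def d_def)
  have supp: "d k = 0" if "N + 1 \<le> \<bar>k\<bar>" for k
    using that N by (auto simp: d_def edge_diff)
  have "edge_of d k = 0 \<or> edge_of d k = 1" for k
    unfolding e by (rule edge_01[OF assms(1)])
  from diagram_of_partition[OF supp this]
  have D: "diagram_of d \<in> partitions" "diag_count (diagram_of d) = d" by auto
  have R: "int (Res l (diagram_of d) j) =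
    int (Res l \<mu> j) + of_bool (j = i) * defect l (\<lambda>j. int (Res l \<mu> j)) i" for j
  proof -
    let ?K = "{- (N + 1)..N + 1}"
    have "int (Res l (diagram_of d) j) = (\<Sum>k\<in>?K. if cls l k = j then d k else 0)"
    proof (rule Res_eq_sum[OF D(1), unfolded D(2)])
      show "d k = 0" if "k \<notin> ?K" for k using that by (intro supp) auto
    qed simp
    also have "\<dots> = (\<Sum>k\<in>?K. if cls l k = j then diag_count \<mu> k else 0) +
      of_bool (j = i) * (\<Sum>k\<in>?K. if cls l k = i then edge \<mu> (k - 1) - edge \<mu> k else 0)"
      unfolding sum_distrib_left sum.distrib[symmetric] by (rule sum.cong) (auto simp: d_def)
    also have "(\<Sum>k\<in>?K. if cls l k = j then diag_count \<mu> k else 0) = int (Res l \<mu> j)"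
    proof (rule Res_eq_sum[symmetric, OF assms(1)])
      show "diag_count \<mu> k = 0" if "k \<notin> ?K" for k using that by (intro N(2)) auto
    qed simp
    also have "(\<Sum>k\<in>?K. if cls l k = i then edge \<mu> (k - 1) - edge \<mu> k else 0) =
      defect l (\<lambda>j. int (Res l \<mu> j)) i"
    proof (rule defect_Res_eq_sum[symmetric, OF assms(1,3)])
      show "diag_count \<mu> k = 0" if "N + 1 \<le> \<bar>k\<bar>" for k using that by (intro N(2)) auto
    qed (use N(1) in simp)
    finally show ?thesis .
  qed
  show thesis by (rule that[OF D(1) _ R]) (simp add: D(2) e)
qed

text \<open>\<open>sig l i\<close> commutes with the translation by \<open>l\<close>, so flushness
  is inherited.\<close>

lemma reflect_ell_core:
  assumes "\<mu> \<in> ell_cores l" "2 \<le> l" "i < l"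
  obtains \<kappa> where "\<kappa> \<in> ell_cores l" "\<And>k. edge \<kappa> k = edge \<mu> (sig l i k)"
    and "\<And>j. int (Res l \<kappa> j) = int (Res l \<mu> j) + of_bool (j = i) * defect l (\<lambda>j. int (Res l \<mu> j)) i"
proof -
  have l: "l > 0" using assms by simp
  have \<mu>: "\<mu> \<in> partitions" "flush l \<mu>" using assms l by (auto simp: ell_cores_iff)
  obtain \<kappa> where \<kappa>: "\<kappa> \<in> partitions" "\<And>k. edge \<kappa> k = edge \<mu> (sig l i k)"
    "\<And>j. int (Res l \<kappa> j) = int (Res l \<mu> j) + of_bool (j = i) * defect l (\<lambda>j. int (Res l \<mu> j)) i"
    by (rule reflect_partition[OF \<mu>(1) assms(2,3)]) (rule that)
  have "sig l i (k - int l) = sig l i k - int l" for k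
    using sig_shift[OF l, of i k "-1"] by simp
  then have "flush l \<kappa>" using \<mu>(2) by (simp add: flush_def \<kappa>(2))
  then have "\<kappa> \<in> ell_cores l" using \<kappa>(1) l by (simp add: ell_cores_iff)
  then show thesis by (rule that[OF _ \<kappa>(2,3)])
qed

text \<open>In an \<open>l\<close>-core one removable box of residue \<open>i\<close> excludes
  addable ones: flushness spreads the edge 1 to all earlier positions of its class and the edge 0 to
  all later positions of the preceding class. No summand of the defect is then positive, and one is
  -1.\<close>

lemma core_defect_removable:
  assumes "\<mu> \<in> ell_cores l" "i < l" "cls l k = i" "edge \<mu> (k - 1) = 0" "edge \<mu> k = 1"
  shows "defect l (\<lambda>j. int (Res l \<mu> j)) i < 0"
proof -
  have l: "l > 0" using assms by simp
  have \<mu>: "\<mu> \<in> partitions" "flush l \<mu>" using assms l by (auto simp: ell_cores_iff)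
  note e = edge_01[OF \<mu>(1)]
  obtain N where N: "N > 0" "\<And>k. N \<le> \<bar>k\<bar> \<Longrightarrow> diag_count \<mu> k = 0"
    using diag_count_support[OF \<mu>(1)] by auto
  define N' where "N' = max N (\<bar>k\<bar>)"
  have "edge \<mu> (j - 1) \<le> edge \<mu> j" if j: "cls l j = i" for j
  proof (cases "j \<le> k")
    case True
    then have "edge \<mu> k \<le> edge \<mu> j" using \<mu> l assms(3) j by (intro flush_antimono) auto
    then show ?thesis using assms e[of "j - 1"] e[of j] by auto
  next
    case False
    have "cls l (k - 1) = cls l (j - 1)" using l assms(3) j by (simp add: cls_pred)
    with False have "edge \<mu> (j - 1) \<le> edge \<mu> (k - 1)" using \<mu> l by (intro flush_antimono) auto
    then show ?thesis using assms e[of "j - 1"] e[of j] by auto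
  qed
  then have "(\<Sum>j\<in>{-N'..N'}. if cls l j = i then edge \<mu> (j - 1) - edge \<mu> j else 0) < (\<Sum>j\<in>{-N'..N'}. 0)"
    using assms by (intro sum_strict_mono_ex1) (auto simp: N'_def intro!: bexI[of _ k])
  moreover have "defect l (\<lambda>j. int (Res l \<mu> j)) i =
    (\<Sum>j\<in>{-N'..N'}. if cls l j = i then edge \<mu> (j - 1) - edge \<mu> j else 0)"
    using \<mu> assms N by (intro defect_Res_eq_sum) (auto simp: N'_def)
  ultimately show ?thesis by simp
qed

lemma J_core_defect:
  assumes "\<mu> \<in> J_cores l J" "i < l" "i \<in> J"
  shows "0 \<le> defect l (\<lambda>j. int (Res l \<mu> j)) i"
proof -
  have \<mu>: "\<mu> \<in> partitions" using assms by (simp add: J_cores_iff)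
  note e = edge_01[OF \<mu>]
  obtain N where N: "N > 0" "\<And>k. N \<le> \<bar>k\<bar> \<Longrightarrow> diag_count \<mu> k = 0"
    using diag_count_support[OF \<mu>(1)] by auto
  have "0 \<le> edge \<mu> (k - 1) - edge \<mu> k" if "cls l k = i" for k
    using that assms e[of k] e[of "k - 1"] by (auto simp: J_cores_iff)
  then have "0 \<le> (\<Sum>j\<in>{-N..N}. if cls l j = i then edge \<mu> (j - 1) - edge \<mu> j else 0)"
    by (intro sum_nonneg) auto
  then show ?thesis using defect_Res_eq_sum[OF \<mu> assms(2) N(1)] N by simp
qed

text \<open>With \<open>J_core_defect\<close> this turns the \<open>J\<close>-core property of an
  \<open>l\<close>-core into inequalities on its residue counts, the form in which simple
  representations supply it.\<close>

lemma ell_core_J_core: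
  assumes "\<mu> \<in> ell_cores l" "J \<subseteq> {..<l}" "\<And>i. i \<in> J \<Longrightarrow> 0 \<le> defect l (\<lambda>j. int (Res l \<mu> j)) i"
  shows "\<mu> \<in> J_cores l J"
proof -
  have "\<mu> \<in> partitions" using assms by (simp add: ell_cores_def)
  moreover have "\<not> (edge \<mu> (k - 1) = 0 \<and> edge \<mu> k = 1)" if k: "cls l k \<in> J" for k
  proof
    assume "edge \<mu> (k - 1) = 0 \<and> edge \<mu> k = 1"
    then have "defect l (\<lambda>j. int (Res l \<mu> j)) (cls l k) < 0"
      using k assms(2) by (intro core_defect_removable[OF assms(1)]) auto
    with assms(3)[OF k] show False by simp
  qed
  ultimately show ?thesis by (simp add: J_cores_iff)
qed

lemma defect_cong:
  assumes "i < l" "\<And>j. j < l \<Longrightarrow> a j = b j + m"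
  shows "defect l a i = defect l b i"
  using assms pred_mod_less[of l i] succ_mod_less[of l i] by (simp add: defect_def)

section \<open>The core of a partition with respect to \<open>l\<close>\<close>

lemma ell_steps_facts:
  assumes "(ell_step l)\<^sup>*\<^sup>* \<mu> \<kappa>" "\<mu> \<in> partitions" "l > 0"
  shows "\<kappa> \<in> partitions \<and> (\<exists>m. card \<mu> = card \<kappa> + m * l \<and> (\<forall>i<l. Res l \<mu> i = Res l \<kappa> i + m))"
  using assms(1)
proof induction
  case base
  show ?case using assms(2) by (auto intro!: exI[of _ 0])
next
  case (step \<kappa> \<kappa>')
  then obtain m where m: "card \<mu> = card \<kappa> + m * l" "\<forall>i<l. Res l \<mu> i = Res l \<kappa> i + m"
    and \<kappa>: "\<kappa> \<in> partitions" by auto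
  note facts = ell_step_facts[OF \<kappa> step(2) assms(3)]
  have "card \<mu> = card \<kappa>' + Suc m * l" using m(1) facts(3) by simp
  moreover have "\<forall>i<l. Res l \<mu> i = Res l \<kappa>' i + Suc m" using m(2) facts(5) by simp
  ultimately show ?case using facts(1) by blast
qed

lemma ex_ell_core:
  assumes "\<mu> \<in> partitions" "l > 0"
  shows "\<exists>\<kappa>. (ell_step l)\<^sup>*\<^sup>* \<mu> \<kappa> \<and> \<kappa> \<in> ell_cores l"
  using assms(1)
proof (induction "card \<mu>" arbitrary: \<mu> rule: less_induct)
  case (less \<mu>)
  show ?case
  proof (cases "\<mu> \<in> ell_cores l")
    case False
    then obtain \<kappa> where \<kappa>: "ell_step l \<mu> \<kappa>" using less.prems by (auto simp: ell_cores_def)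
    note facts = ell_step_facts[OF less.prems \<kappa> assms(2)]
    have "card \<kappa> < card \<mu>" using facts(3) assms(2) by simp
    from less.hyps[OF this facts(1)] obtain \<rho> where "(ell_step l)\<^sup>*\<^sup>* \<kappa> \<rho>" "\<rho> \<in> ell_cores l" by blast
    then show ?thesis using \<kappa> by (blast intro: converse_rtranclp_into_rtranclp)
  qed auto
qed

text \<open>Each \<open>ell_step\<close> lowers all residue counts by one, so every end point has
  the residue vector of \<kappa> up to a multiple of \<delta>, and \<open>ell_core_unique\<close>
  identifies it with \<kappa>.\<close>

lemma Core_ell_unique:
  assumes "\<mu> \<in> partitions" "l > 0" "\<kappa> \<in> ell_cores l"
    and "\<And>i. i < l \<Longrightarrow> int (Res l \<mu> i) = int (Res l \<kappa> i) + m"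
  shows "Core_ell l \<mu> = \<kappa>"
proof -
  have *: "\<rho> = \<kappa>" if \<rho>: "(ell_step l)\<^sup>*\<^sup>* \<mu> \<rho>" "\<rho> \<in> ell_cores l" for \<rho>
  proof -
    obtain m' where m': "\<forall>i<l. Res l \<mu> i = Res l \<rho> i + m'" using ell_steps_facts[OF \<rho>(1) assms(1,2)] by blast
    show ?thesis
    proof (rule ell_core_unique[OF assms(2) \<rho>(2) assms(3)])
      fix i assume "i < l"
      then show "int (Res l \<rho> i) = int (Res l \<kappa> i) + (m - int m')"
        using m' assms(4)[of i] by simp
    qed
  qed
  obtain \<rho> where \<rho>: "(ell_step l)\<^sup>*\<^sup>* \<mu> \<rho>" "\<rho> \<in> ell_cores l" using ex_ell_core[OF assms(1,2)] by blast
  show ?thesis unfolding Core_ell_def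
    by (rule the_equality) (use \<rho> *[OF \<rho>] * in blast)+
qed

lemma Core_ell_facts:
  assumes "\<mu> \<in> partitions" "l > 0"
  obtains m where "Core_ell l \<mu> \<in> ell_cores l" "card \<mu> = card (Core_ell l \<mu>) + m * l"
    "\<And>i. i < l \<Longrightarrow> Res l \<mu> i = Res l (Core_ell l \<mu>) i + m"
proof -
  obtain \<rho> where \<rho>: "(ell_step l)\<^sup>*\<^sup>* \<mu> \<rho>" "\<rho> \<in> ell_cores l" using ex_ell_core[OF assms] by blast
  obtain m where m: "card \<mu> = card \<rho> + m * l" "\<forall>i<l. Res l \<mu> i = Res l \<rho> i + m"
    using ell_steps_facts[OF \<rho>(1) assms] by blast
  have "Core_ell l \<mu> = \<rho>"
    by (rule Core_ell_unique[OF assms \<rho>(2), where m = "int m"]) (use m(2) in simp)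
  then show thesis using that[of m] m \<rho>(2) by simp
qed

lemma Core_ell_core: "\<kappa> \<in> ell_cores l \<Longrightarrow> l > 0 \<Longrightarrow> Core_ell l \<kappa> = \<kappa>"
  by (rule Core_ell_unique[where m = 0]) (auto simp: ell_cores_def)

section \<open>The core of a partition with respect to \<open>J\<close>\<close>

lemma J_step_facts:
  assumes "\<mu> \<in> partitions" "J_step l J \<mu> \<kappa>"
  shows "\<kappa> \<in> partitions" "card \<mu> = card \<kappa> + 1"
    and "Res l \<kappa> i \<le> Res l \<mu> i" "i \<notin> J \<Longrightarrow> Res l \<kappa> i = Res l \<mu> i"
proof -
  obtain b where b: "removable \<mu> b" "residue l b \<in> J" "\<kappa> = \<mu> - {b}"
    using assms(2) by (auto simp: J_step_def)
  have fin: "finite \<mu>" by (rule partitions_finite[OF assms(1)])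
  show "\<kappa> \<in> partitions" using b by (simp add: removable_def)
  show "card \<mu> = card \<kappa> + 1"
    using b fin card_Suc_Diff1[of \<mu> b] by (simp add: removable_def)
  show "Res l \<kappa> i \<le> Res l \<mu> i"
    unfolding Res_def b(3) by (rule card_mono) (use fin in auto)
  assume "i \<notin> J"
  then have "{b' \<in> \<mu> - {b}. residue l b' = i} = {b' \<in> \<mu>. residue l b' = i}" using b(2) by blast
  then show "Res l \<kappa> i = Res l \<mu> i" by (simp only: Res_def b(3))
qed

lemma J_steps_facts:
  assumes "(J_step l J)\<^sup>*\<^sup>* \<mu> \<kappa>" "\<mu> \<in> partitions"
  shows "\<kappa> \<in> partitions \<and> (\<forall>i. Res l \<kappa> i \<le> Res l \<mu> i \<and> (i \<notin> J \<longrightarrow> Res l \<kappa> i = Res l \<mu> i))"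
  using assms(1)
proof induction
  case (step \<kappa> \<kappa>')
  then have \<kappa>: "\<kappa> \<in> partitions" by blast
  show ?case
    using step.IH J_step_facts[OF \<kappa> step(2)] by (metis order_trans)
qed (use assms(2) in simp)

text \<open>A box removable from \<open>\<kappa>\<close> that lies in a smaller partition is removable there as well.\<close>

lemma J_core_subset:
  assumes "(J_step l J)\<^sup>*\<^sup>* \<mu> \<kappa>" "\<mu> \<in> partitions" "\<rho> \<in> J_cores l J" "\<rho> \<subseteq> \<mu>"
  shows "\<rho> \<subseteq> \<kappa>"
  using assms(1)
proof induction
  case (step \<kappa> \<kappa>')
  obtain b where b: "removable \<kappa> b" "residue l b \<in> J" "\<kappa>' = \<kappa> - {b}"
    using step(2) by (auto simp: J_step_def)
  have \<rho>: "\<rho> \<in> partitions" using assms(3) by (simp add: J_cores_def)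
  have part: "\<kappa> - {b} \<in> partitions" using b by (simp add: removable_def)
  have "b \<notin> \<rho>"
  proof
    assume "b \<in> \<rho>"
    have "\<rho> - {b} = \<rho> \<inter> (\<kappa> - {b})" using step.IH by blast
    moreover have "\<rho> \<inter> (\<kappa> - {b}) \<in> partitions"
    proof (rule partitionsI)
      show "finite (\<rho> \<inter> (\<kappa> - {b}))" using partitions_finite[OF \<rho>] by simp
      show "(r', s') \<in> \<rho> \<inter> (\<kappa> - {b})" if "(r, s) \<in> \<rho> \<inter> (\<kappa> - {b})" "r' \<le> r" "s' \<le> s" for r s r' s'
        using partitions_down[OF \<rho>, of r s r' s'] partitions_down[OF part, of r s r' s'] that by blast
    qed
    ultimately have "removable \<rho> b" using \<open>b \<in> \<rho>\<close> by (simp add: removable_def)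
    then show False using assms(3) b(2) unfolding J_cores_def by blast
  qed
  then show ?case using step.IH b(3) by blast
qed (rule assms(4))

lemma J_steps_subset: "(J_step l J)\<^sup>*\<^sup>* \<mu> \<kappa> \<Longrightarrow> \<kappa> \<subseteq> \<mu>"
  by (induction rule: rtranclp_induct) (auto simp: J_step_def)

text \<open>Of two \<open>J\<close>-cores reached from \<mu>, each lies in \<mu> and hence in the
  other by \<open>J_core_subset\<close>.\<close>

lemma Core_J_eqI:
  assumes "\<mu> \<in> partitions" "(J_step l J)\<^sup>*\<^sup>* \<mu> \<kappa>" "\<kappa> \<in> J_cores l J"
  shows "Core_J l J \<mu> = \<kappa>"
  unfolding Core_J_def
proof (rule the_equality)
  fix \<rho> assume "(J_step l J)\<^sup>*\<^sup>* \<mu> \<rho> \<and> \<rho> \<in> J_cores l J"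
  then show "\<rho> = \<kappa>"
    using J_core_subset[OF _ assms(1)] assms J_steps_subset[of l J \<mu>] by (intro equalityI) blast+
qed (use assms in simp)

lemma Core_J_facts:
  assumes "\<mu> \<in> partitions"
  shows "(J_step l J)\<^sup>*\<^sup>* \<mu> (Core_J l J \<mu>)" "Core_J l J \<mu> \<in> J_cores l J"
proof -
  have "\<exists>\<kappa>. (J_step l J)\<^sup>*\<^sup>* \<mu> \<kappa> \<and> \<kappa> \<in> J_cores l J"
    using assms
  proof (induction "card \<mu>" arbitrary: \<mu> rule: less_induct)
    case (less \<mu>)
    show ?case
    proof (cases "\<mu> \<in> J_cores l J")
      case False
      then obtain \<kappa> where \<kappa>: "J_step l J \<mu> \<kappa>"
        using less.prems unfolding J_cores_def J_step_def by blast
      note facts = J_step_facts[OF less.prems \<kappa>]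
      have "card \<kappa> < card \<mu>" using facts(2) by simp
      from less.hyps[OF this facts(1)] show ?thesis
        using \<kappa> by (blast intro: converse_rtranclp_into_rtranclp)
    qed auto
  qed
  then obtain \<kappa> where "(J_step l J)\<^sup>*\<^sup>* \<mu> \<kappa>" "\<kappa> \<in> J_cores l J" by blast
  then show "(J_step l J)\<^sup>*\<^sup>* \<mu> (Core_J l J \<mu>)" "Core_J l J \<mu> \<in> J_cores l J"
    using Core_J_eqI[OF assms] by metis+
qed

section \<open>Partitions with prescribed residue counts\<close>

lemma card_eq_sum_Res:
  assumes "\<mu> \<in> partitions" "l > 0"
  shows "card \<mu> = (\<Sum>i<l. Res l \<mu> i)"
proof -
  have fin: "finite \<mu>" by (rule partitions_finite[OF assms(1)])
  have "\<mu> = (\<Union>i\<in>{..<l}. {b \<in> \<mu>. residue l b = i})"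
    using assms(2) by (auto simp: residue_eq_cls cls_less)
  then have "card \<mu> = card (\<Union>i\<in>{..<l}. {b \<in> \<mu>. residue l b = i})" by simp
  also have "\<dots> = (\<Sum>i<l. card {b \<in> \<mu>. residue l b = i})"
    by (rule card_UN_disjoint) (use fin in auto)
  finally show ?thesis by (simp add: Res_def)
qed

text \<open>A positive vector supported on a proper subset of the cycle pairs positively with the simple
  root at a place where it is maximal but its successor is not.\<close>

lemma ex_positive_pairing:
  fixes g :: "nat \<Rightarrow> int"
  assumes "\<And>i. i < l \<Longrightarrow> 0 \<le> g i" "i0 < l" "g i0 = 0" "i1 < l" "g i1 \<noteq> 0"
  obtains i where "i < l" "0 < g i" "g (pred_mod l i) + g (succ_mod l i) < 2 * g i"
proof -
  define m where "m = Max (g ` {..<l})"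
  have le: "g i \<le> m" if "i < l" for i unfolding m_def using that by (intro Max_ge) auto
  have "m \<in> g ` {..<l}" unfolding m_def using assms(2) by (intro Max_in) auto
  then obtain im where im: "im < l" "g im = m" by (metis imageE lessThan_iff)
  have pos: "0 < m" using le[OF assms(4)] assms(1)[OF assms(4)] assms(5) by simp
  have "\<exists>i<l. g i = m \<and> g (succ_mod l i) \<noteq> m"
  proof (rule ccontr)
    assume neg: "\<not> (\<exists>i<l. g i = m \<and> g (succ_mod l i) \<noteq> m)"
    have "g i0 = m"
      by (rule cyclic_induct[where P = "\<lambda>i. g i = m", OF im _ assms(2)]) (use neg in blast)
    with assms(3) pos show False by simp
  qed
  then obtain i where i: "i < l" "g i = m" "g (succ_mod l i) \<noteq> m" by blast
  have "g (pred_mod l i) \<le> m" "g (succ_mod l i) \<le> m"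
    using i(1) by (auto intro!: le pred_mod_less succ_mod_less)
  then show thesis using i pos by (intro that[of i]) auto
qed

lemma defect_pos_addable:
  assumes "\<mu> \<in> partitions" "i < l" "0 < defect l (\<lambda>j. int (Res l \<mu> j)) i"
  obtains k where "cls l k = i" "edge \<mu> (k - 1) = 1" "edge \<mu> k = 0"
proof -
  obtain N where N: "N > 0" "\<And>k. N \<le> \<bar>k\<bar> \<Longrightarrow> diag_count \<mu> k = 0"
    using diag_count_support[OF assms(1)] by auto
  have "0 < (\<Sum>k\<in>{-N..N}. if cls l k = i then edge \<mu> (k - 1) - edge \<mu> k else 0)"
    using defect_Res_eq_sum[OF assms(1,2) N] assms(3) by simp
  then obtain k where "0 < (if cls l k = i then edge \<mu> (k - 1) - edge \<mu> k else 0)"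
    by (meson not_le sum_nonpos)
  then have "cls l k = i" "0 < edge \<mu> (k - 1) - edge \<mu> k" by (auto split: if_splits)
  then show thesis
    using edge_01[OF assms(1), of k] edge_01[OF assms(1), of "k - 1"] by (intro that[of k]) auto
qed

lemma Res_remove:
  assumes "removable \<mu> b" "finite \<mu>"
  shows "Res l \<mu> i = Res l (\<mu> - {b}) i + of_bool (i = residue l b)"
proof -
  have b: "b \<in> \<mu>" using assms by (simp add: removable_def)
  show ?thesis
  proof (cases "i = residue l b")
    case True
    have "{b' \<in> \<mu>. residue l b' = i} = insert b {b' \<in> \<mu> - {b}. residue l b' = i}" using b True by blast
    moreover have "card \<dots> = Suc (card {b' \<in> \<mu> - {b}. residue l b' = i})"
      using assms(2) by (subst card_insert_disjoint) auto
    ultimately show ?thesis using True by (simp only: Res_def) simp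
  next
    case False
    then have "{b' \<in> \<mu>. residue l b' = i} = {b' \<in> \<mu> - {b}. residue l b' = i}" by blast
    then show ?thesis using False by (simp only: Res_def) simp
  qed
qed

text \<open>The missing amount \<open>g\<close> is non-negative and vanishes off the proper subset
  \<open>J\<close>, so it pairs positively with some simple root in its support. There the defect of
  \<kappa> exceeds that of \<open>a\<close>, which forces an addable box of that residue; adding it
  decreases \<open>g\<close>.\<close>

lemma add_J_boxes:
  assumes "\<kappa> \<in> partitions" "J \<subseteq> {..<l}" "J \<noteq> {..<l}"
    and "\<And>i. i < l \<Longrightarrow> int (Res l \<kappa> i) \<le> a i"
    and "\<And>i. i < l \<Longrightarrow> i \<notin> J \<Longrightarrow> int (Res l \<kappa> i) = a i"
    and "\<And>i. i \<in> J \<Longrightarrow> 0 \<le> defect l a i"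
  shows "\<exists>\<mu>\<in>partitions. (J_step l J)\<^sup>*\<^sup>* \<mu> \<kappa> \<and> (\<forall>i<l. int (Res l \<mu> i) = a i)"
  using assms(1,4,5)
proof (induction "nat (\<Sum>i<l. a i - int (Res l \<kappa> i))" arbitrary: \<kappa> rule: less_induct)
  case (less \<kappa>)
  define g where "g = (\<lambda>i. a i - int (Res l \<kappa> i))"
  have g: "0 \<le> g i" if "i < l" for i using less.prems(2)[OF that] by (simp add: g_def)
  show ?case
  proof (cases "\<forall>i<l. g i = 0")
    case True
    then show ?thesis using less.prems(1) by (intro bexI[of _ \<kappa>]) (auto simp: g_def)
  next
    case False
    then obtain i1 where i1: "i1 < l" "g i1 \<noteq> 0" by blast
    obtain i0 where i0: "i0 < l" "i0 \<notin> J" using assms(2,3) by blast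
    have "g i0 = 0" using less.prems(3)[OF i0] by (simp add: g_def)
    then obtain i where i: "i < l" "0 < g i" "g (pred_mod l i) + g (succ_mod l i) < 2 * g i"
      using ex_positive_pairing[of l g, OF g i0(1) _ i1] by blast
    have iJ: "i \<in> J"
    proof (rule ccontr)
      assume "i \<notin> J"
      then show False using less.prems(3)[OF i(1)] i(2) by (simp add: g_def)
    qed
    have "defect l (\<lambda>j. int (Res l \<kappa> j)) i = defect l a i + (2 * g i - g (pred_mod l i) - g (succ_mod l i))"
      by (simp add: defect_def g_def)
    then have "0 < defect l (\<lambda>j. int (Res l \<kappa> j)) i" using assms(6)[OF iJ] i(3) by simp
    then obtain k where k: "cls l k = i" "edge \<kappa> (k - 1) = 1" "edge \<kappa> k = 0"
      using defect_pos_addable[OF less.prems(1) i(1)] by blast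
    obtain \<rho> b where \<rho>: "\<rho> \<in> partitions" "removable \<rho> b" "content b = k" "\<kappa> = \<rho> - {b}"
      using ex_addable[OF less.prems(1) k(2,3)] by blast
    have R: "Res l \<rho> j = Res l \<kappa> j + of_bool (j = i)" for j
      using Res_remove[OF \<rho>(2) partitions_finite[OF \<rho>(1)], of l j] \<rho>(3,4) k(1) by (simp add: residue_eq_cls)
    have "(\<Sum>j<l. a j - int (Res l \<rho> j)) < (\<Sum>j<l. a j - int (Res l \<kappa> j))"
      by (rule sum_strict_mono_ex1) (use i(1) in \<open>auto simp: R intro!: bexI[of _ i]\<close>)
    moreover have "0 \<le> (\<Sum>j<l. a j - int (Res l \<rho> j))"
      using g i(2) by (intro sum_nonneg) (auto simp: R g_def)
    ultimately have dec: "nat (\<Sum>j<l. a j - int (Res l \<rho> j)) < nat (\<Sum>j<l. a j - int (Res l \<kappa> j))" by simp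
    obtain \<mu> where \<mu>: "\<mu> \<in> partitions" "(J_step l J)\<^sup>*\<^sup>* \<mu> \<rho>" "\<forall>j<l. int (Res l \<mu> j) = a j"
    proof -
      have 1: "int (Res l \<rho> j) \<le> a j" if "j < l" for j
        using g[OF that] i(2) by (cases "j = i") (auto simp: R g_def)
      have 2: "int (Res l \<rho> j) = a j" if "j < l" "j \<notin> J" for j
        using less.prems(3)[OF that] that iJ by (auto simp: R)
      show thesis using less.hyps[OF dec \<rho>(1) 1 2] that by blast
    qed
    moreover have "J_step l J \<rho> \<kappa>"
      unfolding J_step_def using \<rho> k(1) iJ by (intro exI[of _ b]) (simp add: residue_eq_cls)
    ultimately show ?thesis by (blast intro: rtranclp.rtrancl_into_rtrancl)
  qed
qed

text \<open>Passing to the \<open>l\<close>-core changes the residue vector by a multiple of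
  \<delta>, which the defect does not see.\<close>

lemma Core_ell_J_core:
  assumes "\<mu> \<in> J_cores l J" "J \<subseteq> {..<l}" "l > 0"
  shows "Core_ell l \<mu> \<in> ell_cores l \<inter> J_cores l J"
proof -
  have \<mu>: "\<mu> \<in> partitions" using assms by (simp add: J_cores_def)
  obtain m where m: "Core_ell l \<mu> \<in> ell_cores l" "\<And>i. i < l \<Longrightarrow> Res l \<mu> i = Res l (Core_ell l \<mu>) i + m"
    using Core_ell_facts[OF \<mu> assms(3)] by metis
  have "Core_ell l \<mu> \<in> J_cores l J"
  proof (rule ell_core_J_core[OF m(1) assms(2)])
    fix i assume i: "i \<in> J"
    then have "i < l" using assms(2) by blast
    moreover from this have "defect l (\<lambda>j. int (Res l \<mu> j)) i = defect l (\<lambda>j. int (Res l (Core_ell l \<mu>) j)) i"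
      by (rule defect_cong[where m = "int m"]) (simp add: m(2))
    ultimately show "0 \<le> defect l (\<lambda>j. int (Res l (Core_ell l \<mu>) j)) i"
      using J_core_defect[OF assms(1) _ i] by simp
  qed
  with m(1) show ?thesis by simp
qed

lemma ex_removable_edge:
  assumes "\<mu> \<in> partitions" "\<mu> \<noteq> {}"
  obtains k where "edge \<mu> (k - 1) = 0" "edge \<mu> k = 1"
proof -
  have "diagram_le {} \<mu>" by (simp add: diagram_le_iff[OF assms(1)] empty_partition)
  then have "remove_box\<^sup>*\<^sup>* \<mu> {}" by (simp add: diagram_le_def)
  then obtain \<kappa> where "remove_box \<mu> \<kappa>" using assms(2) by (metis converse_rtranclpE)
  then obtain b where "removable \<mu> b" unfolding remove_box_def by blast
  then show thesis by (intro that[OF removable_edges[OF assms(1)]])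
qed

section \<open>Subspaces and complements of matrices\<close>

lemma subspace_vec_iff:
  "VectorSpace.subspace class_ring U (module_vec TYPE('a :: field) n) \<longleftrightarrow>
    U \<subseteq> carrier_vec n \<and> 0\<^sub>v n \<in> U \<and> (\<forall>u\<in>U. \<forall>v\<in>U. u + v \<in> U) \<and> (\<forall>a. \<forall>u\<in>U. a \<cdot>\<^sub>v u \<in> U)"
proof -
  have "vectorspace (class_ring :: 'a ring) (module_vec TYPE('a) n)" by (rule vec_vs)
  moreover have "Module.module (class_ring :: 'a ring) (module_vec TYPE('a) n)" by (rule vec_module)
  ultimately show ?thesis
    unfolding VectorSpace.subspace_def LinearCombinations.submodule_def
    by (auto simp: module_vec_simps class_ring_simps)
qed

text \<open>Padding with zero rows gives a square matrix whose last row vanishes; its transpose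
  kills the last unit vector, so its determinant is zero.\<close>

lemma ex_kernel_vec:
  fixes A :: "'a :: field mat"
  assumes A: "A \<in> carrier_mat N m" and "N < m"
  obtains v where "v \<in> carrier_vec m" "v \<noteq> 0\<^sub>v m" "A *\<^sub>v v = 0\<^sub>v N"
proof -
  define A' where "A' = mat m m (\<lambda>(i, j). if i < N then A $$ (i, j) else 0)"
  have A': "A' \<in> carrier_mat m m" by (simp add: A'_def)
  let ?u = "unit_vec m (m - 1) :: 'a vec"
  have "A'\<^sup>T *\<^sub>v ?u = 0\<^sub>v m"
    using assms(2) by (intro eq_vecI) (auto simp: A'_def scalar_prod_def unit_vec_def intro!: sum.neutral)
  moreover have "?u \<noteq> 0\<^sub>v m"
  proof
    assume "?u = 0\<^sub>v m"
    then have "?u $ (m - 1) = 0\<^sub>v m $ (m - 1)" by simp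
    then show False using assms(2) by simp
  qed
  ultimately have "det A'\<^sup>T = 0"
    using det_0_iff_vec_prod_zero_field[of "A'\<^sup>T" m] A' by (metis transpose_carrier_mat unit_vec_carrier)
  then have "det A' = 0" using det_transpose[OF A'] by simp
  then obtain v where v: "v \<in> carrier_vec m" "v \<noteq> 0\<^sub>v m" "A' *\<^sub>v v = 0\<^sub>v m"
    using det_0_iff_vec_prod_zero_field[OF A'] by blast
  have "A *\<^sub>v v = 0\<^sub>v N"
  proof (intro eq_vecI)
    fix i assume i: "i < dim_vec (0\<^sub>v N)"
    have "(A *\<^sub>v v) $ i = (A' *\<^sub>v v) $ i"
      using i A v(1) assms(2) by (auto simp: A'_def scalar_prod_def intro!: sum.cong)
    then show "(A *\<^sub>v v) $ i = 0\<^sub>v N $ i" using i v(3) assms(2) by simp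
  qed (use A in simp)
  with v that show thesis by blast
qed

section \<open>Block matrices\<close>

definition hcat :: "'a mat \<Rightarrow> 'a mat \<Rightarrow> 'a mat" where
  "hcat A B = mat (dim_row A) (dim_col A + dim_col B)
    (\<lambda>(i, j). if j < dim_col A then A $$ (i, j) else B $$ (i, j - dim_col A))"

definition vcat :: "'a mat \<Rightarrow> 'a mat \<Rightarrow> 'a mat" where
  "vcat A B = mat (dim_row A + dim_row B) (dim_col A)
    (\<lambda>(i, j). if i < dim_row A then A $$ (i, j) else B $$ (i - dim_row A, j))"

lemma hcat_carrier [simp, intro]:
  "A \<in> carrier_mat n p \<Longrightarrow> B \<in> carrier_mat n q \<Longrightarrow> hcat A B \<in> carrier_mat n (p + q)"
  by (auto simp: hcat_def)

lemma vcat_carrier [simp, intro]: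
  "A \<in> carrier_mat p n \<Longrightarrow> B \<in> carrier_mat q n \<Longrightarrow> vcat A B \<in> carrier_mat (p + q) n"
  by (auto simp: vcat_def)

lemma sum_split_add:
  fixes f :: "nat \<Rightarrow> 'a :: comm_monoid_add"
  shows "(\<Sum>k\<in>{0..<p + q}. f k) = (\<Sum>k\<in>{0..<p}. f k) + (\<Sum>k\<in>{0..<q}. f (p + k))"
proof -
  have "(\<Sum>k\<in>{0..<p + q}. f k) = (\<Sum>k\<in>{0..<p}. f k) + (\<Sum>k\<in>{p..<p + q}. f k)"
    by (rule sum.atLeastLessThan_concat[symmetric]) auto
  also have "(\<Sum>k\<in>{p..<p + q}. f k) = (\<Sum>k\<in>{0..<q}. f (p + k))"
    using sum.shift_bounds_nat_ivl[of f 0 p q] by (simp add: add.commute)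
  finally show ?thesis .
qed

lemma hcat_mult_vcat:
  fixes A :: "'a :: semiring_0 mat"
  assumes "A \<in> carrier_mat n p" "B \<in> carrier_mat n q" "C \<in> carrier_mat p m" "D \<in> carrier_mat q m"
  shows "hcat A B * vcat C D = A * C + B * D"
proof (rule eq_matI)
  fix i j assume "i < dim_row (A * C + B * D)" "j < dim_col (A * C + B * D)"
  then have ij: "i < n" "j < m" using assms by auto
  have "(hcat A B * vcat C D) $$ (i, j) = (\<Sum>k\<in>{0..<p + q}. hcat A B $$ (i, k) * vcat C D $$ (k, j))"
    using assms ij by (simp add: hcat_def vcat_def scalar_prod_def)
  also have "\<dots> = (\<Sum>k\<in>{0..<p}. A $$ (i, k) * C $$ (k, j)) + (\<Sum>k\<in>{0..<q}. B $$ (i, k) * D $$ (k, j))"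
    unfolding sum_split_add using assms ij by (auto simp: hcat_def vcat_def intro!: arg_cong2[where f = "(+)"] sum.cong)
  also have "\<dots> = (A * C + B * D) $$ (i, j)"
    using assms ij by (simp add: scalar_prod_def)
  finally show "(hcat A B * vcat C D) $$ (i, j) = (A * C + B * D) $$ (i, j)" .
qed (use assms in \<open>auto simp: hcat_def vcat_def\<close>)

lemma vcat_mult:
  assumes "A \<in> carrier_mat p n" "B \<in> carrier_mat q n" "C \<in> carrier_mat n m"
  shows "vcat A B * C = vcat (A * C) (B * C)"
  using assms by (intro eq_matI) (auto simp: vcat_def scalar_prod_def)

lemma mult_hcat:
  assumes "C \<in> carrier_mat m n" "A \<in> carrier_mat n p" "B \<in> carrier_mat n q"
  shows "C * hcat A B = hcat (C * A) (C * B)"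
  using assms by (intro eq_matI) (auto simp: hcat_def scalar_prod_def)

lemma vcat_mult_hcat:
  assumes "A \<in> carrier_mat p n" "B \<in> carrier_mat q n" "C \<in> carrier_mat n r" "D \<in> carrier_mat n s"
  shows "vcat A B * hcat C D = four_block_mat (A * C) (A * D) (B * C) (B * D)"
  using assms by (intro eq_matI) (auto simp: hcat_def vcat_def scalar_prod_def)

lemma vcat_split:
  assumes "P \<in> carrier_mat (p + q) m"
  obtains P1 P2 where "P1 \<in> carrier_mat p m" "P2 \<in> carrier_mat q m" "P = vcat P1 P2"
proof
  show "P = vcat (mat p m (\<lambda>(i, j). P $$ (i, j))) (mat q m (\<lambda>(i, j). P $$ (p + i, j)))"
    using assms by (intro eq_matI) (auto simp: vcat_def)
qed auto

lemma hcat_split: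
  assumes "P \<in> carrier_mat m (p + q)"
  obtains P1 P2 where "P1 \<in> carrier_mat m p" "P2 \<in> carrier_mat m q" "P = hcat P1 P2"
proof
  show "P = hcat (mat m p (\<lambda>(i, j). P $$ (i, j))) (mat m q (\<lambda>(i, j). P $$ (i, p + j)))"
    using assms by (intro eq_matI) (auto simp: hcat_def)
qed auto

lemma four_block_inject:
  assumes eq: "four_block_mat A B C D = four_block_mat A' B' C' D'"
    and "A \<in> carrier_mat p r" "B \<in> carrier_mat p s" "C \<in> carrier_mat q r" "D \<in> carrier_mat q s"
    and "A' \<in> carrier_mat p r" "B' \<in> carrier_mat p s" "C' \<in> carrier_mat q r" "D' \<in> carrier_mat q s"
  shows "A = A'" "B = B'" "C = C'" "D = D'"
proof -
  have *: "four_block_mat A B C D $$ (i, j) = four_block_mat A' B' C' D' $$ (i, j)" for i j using eq by simp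
  show "A = A'"
  proof (rule eq_matI)
    fix i j assume "i < dim_row A'" "j < dim_col A'"
    then show "A $$ (i, j) = A' $$ (i, j)" using *[of i j] assms(2-) by auto
  qed (use assms in auto)
  show "B = B'"
  proof (rule eq_matI)
    fix i j assume "i < dim_row B'" "j < dim_col B'"
    then show "B $$ (i, j) = B' $$ (i, j)" using *[of i "r + j"] assms(2-) by auto
  qed (use assms in auto)
  show "C = C'"
  proof (rule eq_matI)
    fix i j assume "i < dim_row C'" "j < dim_col C'"
    then show "C $$ (i, j) = C' $$ (i, j)" using *[of "p + i" j] assms(2-) by auto
  qed (use assms in auto)
  show "D = D'"
  proof (rule eq_matI)
    fix i j assume "i < dim_row D'" "j < dim_col D'"
    then show "D $$ (i, j) = D' $$ (i, j)" using *[of "p + i" "r + j"] assms(2-) by auto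
  qed (use assms in auto)
qed

lemma vcat_eq_zero:
  assumes "vcat A B = 0\<^sub>m (p + q) n" "A \<in> carrier_mat p n" "B \<in> carrier_mat q n"
  shows "A = 0\<^sub>m p n" "B = 0\<^sub>m q n"
proof -
  have *: "vcat A B $$ (i, j) = 0" if "i < p + q" "j < n" for i j using that by (simp add: assms(1))
  show "A = 0\<^sub>m p n"
  proof (rule eq_matI)
    fix i j assume "i < dim_row (0\<^sub>m p n)" "j < dim_col (0\<^sub>m p n)"
    then show "A $$ (i, j) = 0\<^sub>m p n $$ (i, j)" using *[of i j] assms(2,3) by (auto simp: vcat_def)
  qed (use assms in auto)
  show "B = 0\<^sub>m q n"
  proof (rule eq_matI)
    fix i j assume "i < dim_row (0\<^sub>m q n)" "j < dim_col (0\<^sub>m q n)"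
    then show "B $$ (i, j) = 0\<^sub>m q n $$ (i, j)" using *[of "p + i" j] assms(2,3) by (auto simp: vcat_def)
  qed (use assms in auto)
qed

lemma hcat_eq_zero:
  assumes "hcat A B = 0\<^sub>m n (p + q)" "A \<in> carrier_mat n p" "B \<in> carrier_mat n q"
  shows "A = 0\<^sub>m n p" "B = 0\<^sub>m n q"
proof -
  have *: "hcat A B $$ (i, j) = 0" if "i < n" "j < p + q" for i j using that by (simp add: assms(1))
  show "A = 0\<^sub>m n p"
  proof (rule eq_matI)
    fix i j assume "i < dim_row (0\<^sub>m n p)" "j < dim_col (0\<^sub>m n p)"
    then show "A $$ (i, j) = 0\<^sub>m n p $$ (i, j)" using *[of i j] assms(2,3) by (auto simp: hcat_def)
  qed (use assms in auto)
  show "B = 0\<^sub>m n q"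
  proof (rule eq_matI)
    fix i j assume "i < dim_row (0\<^sub>m n q)" "j < dim_col (0\<^sub>m n q)"
    then show "B $$ (i, j) = 0\<^sub>m n q $$ (i, j)" using *[of i "p + j"] assms(2,3) by (auto simp: hcat_def)
  qed (use assms in auto)
qed

lemma vcat_zero: "vcat (0\<^sub>m p n) (0\<^sub>m q n) = 0\<^sub>m (p + q) n"
  by (rule eq_matI) (auto simp: vcat_def)

lemma hcat_zero: "hcat (0\<^sub>m n p) (0\<^sub>m n q) = 0\<^sub>m n (p + q)"
  by (rule eq_matI) (auto simp: hcat_def)

lemma one_sided_inverse_le:
  fixes A :: "'a :: field mat"
  assumes "A \<in> carrier_mat n N" "B \<in> carrier_mat N n" "A * B = 1\<^sub>m n"
  shows "n \<le> N"
proof (rule ccontr)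
  assume "\<not> ?thesis"
  then have less: "N < n" by simp
  obtain v where v: "v \<in> carrier_vec n" "v \<noteq> 0\<^sub>v n" "B *\<^sub>v v = 0\<^sub>v N"
    by (rule ex_kernel_vec[OF assms(2) less])
  have "v = (A * B) *\<^sub>v v" using v assms(3) by simp
  also have "\<dots> = A *\<^sub>v (B *\<^sub>v v)" using assms v by (intro assoc_mult_mat_vec)
  also have "\<dots> = 0\<^sub>v n" using assms(1) v(3) by auto
  finally show False using v(2) by simp
qed

text \<open>Split the identity of \<open>K\<^sup>N\<close> along the idempotent \<open>B * A\<close>.\<close>

lemma complete_one_sided_inverse:
  fixes A :: "'a :: field mat"
  assumes "A \<in> carrier_mat n N" "B \<in> carrier_mat N n" "A * B = 1\<^sub>m n"
  shows "\<exists>m P Q. n + m = N \<and> P \<in> carrier_mat N m \<and> Q \<in> carrier_mat m N \<and>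
    A * P = 0\<^sub>m n m \<and> Q * B = 0\<^sub>m m n \<and> Q * P = 1\<^sub>m m \<and> B * A + P * Q = 1\<^sub>m N"
  using assms
proof (induction "N - n" arbitrary: n A B)
  case 0
  have nN: "n = N" using one_sided_inverse_le[OF 0(2-4)] 0(1) by simp
  have "B * A = 1\<^sub>m N" using 0(2-4) mat_mult_left_right_inverse unfolding nN by blast
  moreover have "0\<^sub>m N 0 * 0\<^sub>m 0 N = (0\<^sub>m N N :: 'a mat)" by (intro eq_matI) (auto simp: scalar_prod_def)
  ultimately show ?case using 0 nN
    by (intro exI[of _ 0] exI[of _ "0\<^sub>m N 0"] exI[of _ "0\<^sub>m 0 N"])
      (auto intro!: eq_matI simp: scalar_prod_def)
next
  case (Suc x)
  note A = Suc(3) and B = Suc(4) and AB = Suc(5)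
  have less: "n < N" using Suc(2) by simp
  obtain v where v: "v \<in> carrier_vec N" "v \<noteq> 0\<^sub>v N" "A *\<^sub>v v = 0\<^sub>v n"
    by (rule ex_kernel_vec[OF A less])
  obtain j where j: "j < N" "v $ j \<noteq> 0"
  proof (rule ccontr)
    assume "\<not> thesis"
    then have "v = 0\<^sub>v N" using that v(1) by (intro eq_vecI) auto
    with v(2) show False by simp
  qed
  define V where "V = mat N 1 (\<lambda>(i, _). v $ i)"
  define u0 where "u0 = mat 1 N (\<lambda>(_, k). if k = j then inverse (v $ j) else 0)"
  have V: "V \<in> carrier_mat N 1" and u0: "u0 \<in> carrier_mat 1 N" by (auto simp: V_def u0_def)
  have u0BA: "u0 * (B * A) \<in> carrier_mat 1 N" using u0 A B by auto
  \<comment> \<open>\<open>u0\<close> is a functional with value 1 on the kernel vector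
    \<open>V\<close>. The correction makes \<open>u\<close> vanish on the columns of
    \<open>B\<close> and does not change the value on \<open>V\<close>, because
    \<open>A * V = 0\<close>.\<close>
  define u where "u = u0 - u0 * (B * A)"
  have u: "u \<in> carrier_mat 1 N" unfolding u_def using u0BA by (rule minus_carrier_mat)
  have AV: "A * V = 0\<^sub>m n 1"
  proof (rule eq_matI)
    fix i k assume ik: "i < dim_row (0\<^sub>m n 1)" "k < dim_col (0\<^sub>m n 1)"
    have "(A * V) $$ (i, k) = (A *\<^sub>v v) $ i"
      using ik A v(1) by (auto simp: V_def scalar_prod_def intro!: sum.cong)
    then show "(A * V) $$ (i, k) = 0\<^sub>m n 1 $$ (i, k)" using ik v(3) by simp
  qed (use A V in auto)
  have u0V: "u0 * V = 1\<^sub>m 1"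
  proof (rule eq_matI)
    fix i k assume ik: "i < dim_row (1\<^sub>m 1 :: 'a mat)" "k < dim_col (1\<^sub>m 1 :: 'a mat)"
    have "(u0 * V) $$ (i, k) = (\<Sum>t\<in>{0..<N}. (if t = j then inverse (v $ j) else 0) * v $ t)"
      using ik by (simp add: u0_def V_def scalar_prod_def)
    also have "\<dots> = (\<Sum>t\<in>{0..<N}. if t = j then 1 else 0)"
      using j(2) by (intro sum.cong) auto
    also have "\<dots> = 1" using j(1) by simp
    finally show "(u0 * V) $$ (i, k) = 1\<^sub>m 1 $$ (i, k)" using ik by simp
  qed (auto simp: u0_def V_def)
  have BAB: "B * A * B = B" using assoc_mult_mat[OF B A B] AB B by simp
  have uB: "u * B = 0\<^sub>m 1 n"
  proof -
    have "u * B = u0 * B - u0 * (B * A) * B"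
      unfolding u_def by (rule minus_mult_distrib_mat[OF u0 u0BA B])
    also have "u0 * (B * A) * B = u0 * B" using assoc_mult_mat[OF u0 _ B, of "B * A"] A B BAB by simp
    finally show ?thesis using u0 B by auto
  qed
  have uV: "u * V = 1\<^sub>m 1"
  proof -
    have "u * V = u0 * V - u0 * (B * A) * V"
      unfolding u_def by (rule minus_mult_distrib_mat[OF u0 u0BA V])
    also have "u0 * (B * A) * V = u0 * (B * (A * V))"
      using assoc_mult_mat[OF u0 _ V, of "B * A"] assoc_mult_mat[OF B A V] A B by simp
    also have "\<dots> = 0\<^sub>m 1 1" using AV B u0 by simp
    finally show ?thesis using u0V by auto
  qed
  \<comment> \<open>Adjoining \<open>u\<close> as a row of \<open>A\<close> and \<open>V\<close> as
    a column of \<open>B\<close> gives a one-sided inverse pair of larger rank. The complement of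
    the original pair is the complement of the new one together with \<open>V\<close> and
    \<open>u\<close>.\<close>
  have A': "vcat A u \<in> carrier_mat (n + 1) N" and B': "hcat B V \<in> carrier_mat N (n + 1)"
    by (rule vcat_carrier[OF A u], rule hcat_carrier[OF B V])
  have "vcat A u * hcat B V = 1\<^sub>m (n + 1)"
    unfolding vcat_mult_hcat[OF A u B V] AB AV uB uV by (rule four_block_one_mat)
  moreover have "x = N - (n + 1)" using Suc(2) by simp
  ultimately have "\<exists>m P Q. n + 1 + m = N \<and> P \<in> carrier_mat N m \<and> Q \<in> carrier_mat m N \<and>
    vcat A u * P = 0\<^sub>m (n + 1) m \<and> Q * hcat B V = 0\<^sub>m m (n + 1) \<and> Q * P = 1\<^sub>m m \<and>
    hcat B V * vcat A u + P * Q = 1\<^sub>m N"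
    using Suc(1)[OF _ A' B'] by blast
  then obtain m P Q where IH: "n + 1 + m = N" "P \<in> carrier_mat N m"
    "Q \<in> carrier_mat m N" "vcat A u * P = 0\<^sub>m (n + 1) m" "Q * hcat B V = 0\<^sub>m m (n + 1)"
    "Q * P = 1\<^sub>m m" "hcat B V * vcat A u + P * Q = 1\<^sub>m N" by blast
  note P = IH(2) and Q = IH(3)
  have AP: "A * P = 0\<^sub>m n m" "u * P = 0\<^sub>m 1 m"
    using vcat_eq_zero[of "A * P" "u * P" n 1 m] IH(4) vcat_mult[OF A u P] A u P by auto
  have QB: "Q * B = 0\<^sub>m m n" "Q * V = 0\<^sub>m m 1"
    using hcat_eq_zero[of "Q * B" "Q * V" m n 1] IH(5) mult_hcat[OF Q B V] B V Q by auto
  have "B * A + V * u + P * Q = 1\<^sub>m N" using IH(7) hcat_mult_vcat[OF B V A u] by simp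
  then have one: "B * A + hcat V P * vcat u Q = 1\<^sub>m N"
    unfolding hcat_mult_vcat[OF V P u Q] using A B u V P Q by (subst assoc_add_mat[symmetric]) auto
  have "vcat u Q * hcat V P = 1\<^sub>m (1 + m)"
    unfolding vcat_mult_hcat[OF u Q V P] uV AP QB IH(6) by (rule four_block_one_mat)
  moreover have "A * hcat V P = 0\<^sub>m n (1 + m)" unfolding mult_hcat[OF A V P] AV AP by (rule hcat_zero)
  moreover have "vcat u Q * B = 0\<^sub>m (1 + m) n" unfolding vcat_mult[OF u Q B] uB QB by (rule vcat_zero)
  moreover have "hcat V P \<in> carrier_mat N (1 + m)" "vcat u Q \<in> carrier_mat (1 + m) N"
    by (rule hcat_carrier[OF V P], rule vcat_carrier[OF u Q])
  moreover have "n + (1 + m) = N" using IH(1) by simp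
  ultimately show ?case using one by blast
qed

text \<open>After division by \<open>c\<close> the pair is a one-sided inverse pair, and
  \<open>P\<close>, \<open>Q\<close> complete it to a decomposition of the identity. Rescaling
  \<open>Q\<close> by \<open>- c\<close> makes the composite on the new space the scalar
  \<open>- c\<close>, the reflected parameter, and turns \<open>P * Q\<close> into
  \<open>B * A - c\<close>.\<close>

lemma dual_blocks:
  fixes A1 :: "'a :: field mat"
  assumes A: "A1 \<in> carrier_mat n p" "A2 \<in> carrier_mat n q"
    and B: "B1 \<in> carrier_mat p n" "B2 \<in> carrier_mat q n"
    and AB: "A1 * B1 + A2 * B2 = c \<cdot>\<^sub>m 1\<^sub>m n" and c: "c \<noteq> 0"
  obtains m P1 P2 Q1 Q2 where "n + m = p + q"
    "P1 \<in> carrier_mat p m" "P2 \<in> carrier_mat q m" "Q1 \<in> carrier_mat m p" "Q2 \<in> carrier_mat m q"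
    "Q1 * P1 + Q2 * P2 = (- c) \<cdot>\<^sub>m 1\<^sub>m m"
    "P1 * Q1 = B1 * A1 - c \<cdot>\<^sub>m 1\<^sub>m p" "P1 * Q2 = B1 * A2"
    "P2 * Q1 = B2 * A1" "P2 * Q2 = B2 * A2 - c \<cdot>\<^sub>m 1\<^sub>m q"
proof -
  define A where "A = hcat (inverse c \<cdot>\<^sub>m A1) (inverse c \<cdot>\<^sub>m A2)"
  define B where "B = vcat B1 B2"
  have A': "A \<in> carrier_mat n (p + q)" and B': "B \<in> carrier_mat (p + q) n"
    unfolding A_def B_def
    by (rule hcat_carrier[OF smult_carrier_mat[OF A(1)] smult_carrier_mat[OF A(2)]],
      rule vcat_carrier[OF B])
  have "A * B = inverse c \<cdot>\<^sub>m (A1 * B1) + inverse c \<cdot>\<^sub>m (A2 * B2)"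
    unfolding A_def B_def hcat_mult_vcat[OF smult_carrier_mat[OF A(1)] smult_carrier_mat[OF A(2)] B]
      mult_smult_assoc_mat[OF A(1) B(1)] mult_smult_assoc_mat[OF A(2) B(2)] ..
  also have "\<dots> = inverse c \<cdot>\<^sub>m (A1 * B1 + A2 * B2)"
    using A B by (intro add_smult_distrib_left_mat[symmetric]) auto
  finally have "A * B = 1\<^sub>m n" unfolding AB using c by (auto intro!: eq_matI)
  from complete_one_sided_inverse[OF A' B' this] obtain m P Q where PQ: "n + m = p + q"
    "P \<in> carrier_mat (p + q) m" "Q \<in> carrier_mat m (p + q)" "Q * P = 1\<^sub>m m" "B * A + P * Q = 1\<^sub>m (p + q)"
    by blast
  obtain P1 P2 where P: "P1 \<in> carrier_mat p m" "P2 \<in> carrier_mat q m" "P = vcat P1 P2"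
    using vcat_split[OF PQ(2)] .
  obtain Q1 Q2 where Q: "Q1 \<in> carrier_mat m p" "Q2 \<in> carrier_mat m q" "Q = hcat Q1 Q2"
    using hcat_split[OF PQ(3)] .
  have QP: "Q1 * P1 + Q2 * P2 = 1\<^sub>m m"
    using PQ(4) unfolding P(3) Q(3) hcat_mult_vcat[OF Q(1,2) P(1,2)] .
  have BA: "B * A = four_block_mat (inverse c \<cdot>\<^sub>m (B1 * A1)) (inverse c \<cdot>\<^sub>m (B1 * A2))
    (inverse c \<cdot>\<^sub>m (B2 * A1)) (inverse c \<cdot>\<^sub>m (B2 * A2))"
    unfolding A_def B_def vcat_mult_hcat[OF B smult_carrier_mat[OF A(1)] smult_carrier_mat[OF A(2)]]
      mult_smult_distrib[OF B(1) A(1)] mult_smult_distrib[OF B(1) A(2)]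
      mult_smult_distrib[OF B(2) A(1)] mult_smult_distrib[OF B(2) A(2)] ..
  have "P * Q = four_block_mat (P1 * Q1) (P1 * Q2) (P2 * Q1) (P2 * Q2)"
    unfolding P(3) Q(3) by (rule vcat_mult_hcat[OF P(1,2) Q(1,2)])
  moreover have "four_block_mat (inverse c \<cdot>\<^sub>m (B1 * A1)) (inverse c \<cdot>\<^sub>m (B1 * A2))
      (inverse c \<cdot>\<^sub>m (B2 * A1)) (inverse c \<cdot>\<^sub>m (B2 * A2)) +
      four_block_mat (P1 * Q1) (P1 * Q2) (P2 * Q1) (P2 * Q2) =
    four_block_mat (inverse c \<cdot>\<^sub>m (B1 * A1) + P1 * Q1) (inverse c \<cdot>\<^sub>m (B1 * A2) + P1 * Q2)
      (inverse c \<cdot>\<^sub>m (B2 * A1) + P2 * Q1) (inverse c \<cdot>\<^sub>m (B2 * A2) + P2 * Q2)"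
    by (rule add_four_block_mat[of _ p p _ q _ q]) (use assms P(1,2) Q(1,2) in auto)
  ultimately have "four_block_mat (inverse c \<cdot>\<^sub>m (B1 * A1) + P1 * Q1) (inverse c \<cdot>\<^sub>m (B1 * A2) + P1 * Q2)
      (inverse c \<cdot>\<^sub>m (B2 * A1) + P2 * Q1) (inverse c \<cdot>\<^sub>m (B2 * A2) + P2 * Q2)
    = four_block_mat (1\<^sub>m p) (0\<^sub>m p q) (0\<^sub>m q p) (1\<^sub>m q)"
    using PQ(5) unfolding BA by simp
  from four_block_inject[OF this, of p p q q]
  have eqs: "inverse c \<cdot>\<^sub>m (B1 * A1) + P1 * Q1 = 1\<^sub>m p" "inverse c \<cdot>\<^sub>m (B1 * A2) + P1 * Q2 = 0\<^sub>m p q"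
    "inverse c \<cdot>\<^sub>m (B2 * A1) + P2 * Q1 = 0\<^sub>m q p" "inverse c \<cdot>\<^sub>m (B2 * A2) + P2 * Q2 = 1\<^sub>m q"
    using assms P(1,2) Q(1,2) by auto
  \<comment> \<open>Multiplying a block of the decomposed identity by \<open>c\<close> gives the
    entry of \<open>P * Q\<close> for the rescaled \<open>Q\<close>; the diagonal blocks have
    \<open>E = 1\<close>, the others \<open>E = 0\<close>.\<close>
  have solve: "Y * ((- c) \<cdot>\<^sub>m Z) = X - c \<cdot>\<^sub>m E"
    if "inverse c \<cdot>\<^sub>m X + Y * Z = E" "X \<in> carrier_mat r s" "Y \<in> carrier_mat r t" "Z \<in> carrier_mat t s" "E \<in> carrier_mat r s"
    for X Y Z E :: "'a mat" and r s t
  proof (rule eq_matI)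
    fix i k assume "i < dim_row (X - c \<cdot>\<^sub>m E)" "k < dim_col (X - c \<cdot>\<^sub>m E)"
    then have ik: "i < r" "k < s" using that by auto
    have "E $$ (i, k) = inverse c * X $$ (i, k) + (Y * Z) $$ (i, k)"
      unfolding that(1)[symmetric] using ik that by auto
    then have "c * E $$ (i, k) = X $$ (i, k) + c * (Y * Z) $$ (i, k)" using c by (simp add: field_simps)
    moreover have "(Y * ((- c) \<cdot>\<^sub>m Z)) $$ (i, k) = - c * (Y * Z) $$ (i, k)"
      using mult_smult_distrib[OF that(3,4), of "- c"] ik that by simp
    ultimately show "(Y * ((- c) \<cdot>\<^sub>m Z)) $$ (i, k) = (X - c \<cdot>\<^sub>m E) $$ (i, k)" using ik that by simp
  qed (use that in auto)
  have z: "X - c \<cdot>\<^sub>m 0\<^sub>m r s = X" if "X \<in> carrier_mat r s" for X :: "'a mat" and r s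
    using that by (intro eq_matI) auto
  show thesis
  proof (rule that[OF PQ(1) P(1,2)])
    show "(- c) \<cdot>\<^sub>m Q1 \<in> carrier_mat m p" "(- c) \<cdot>\<^sub>m Q2 \<in> carrier_mat m q" using Q by auto
    show "(- c) \<cdot>\<^sub>m Q1 * P1 + (- c) \<cdot>\<^sub>m Q2 * P2 = (- c) \<cdot>\<^sub>m 1\<^sub>m m"
      unfolding QP[symmetric] mult_smult_assoc_mat[OF Q(1) P(1)] mult_smult_assoc_mat[OF Q(2) P(2)]
      using P Q by (intro add_smult_distrib_left_mat[symmetric]) auto
    show "P1 * ((- c) \<cdot>\<^sub>m Q1) = B1 * A1 - c \<cdot>\<^sub>m 1\<^sub>m p" by (rule solve[OF eqs(1)]) (use assms P Q in auto)
    show "P2 * ((- c) \<cdot>\<^sub>m Q2) = B2 * A2 - c \<cdot>\<^sub>m 1\<^sub>m q" by (rule solve[OF eqs(4)]) (use assms P Q in auto)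
    have "P1 * ((- c) \<cdot>\<^sub>m Q2) = B1 * A2 - c \<cdot>\<^sub>m 0\<^sub>m p q" by (rule solve[OF eqs(2)]) (use assms P Q in auto)
    then show "P1 * ((- c) \<cdot>\<^sub>m Q2) = B1 * A2" using z[of "B1 * A2" p q] A B by simp
    have "P2 * ((- c) \<cdot>\<^sub>m Q1) = B2 * A1 - c \<cdot>\<^sub>m 0\<^sub>m q p" by (rule solve[OF eqs(3)]) (use assms P Q in auto)
    then show "P2 * ((- c) \<cdot>\<^sub>m Q1) = B2 * A1" using z[of "B2 * A1" q p] A B by simp
  qed
qed

section \<open>Representations\<close>

lemma hcat_inject:
  assumes "hcat A B = hcat A' B'" "A \<in> carrier_mat n p" "B \<in> carrier_mat n q"
    "A' \<in> carrier_mat n p" "B' \<in> carrier_mat n q"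
  shows "A = A'" "B = B'"
proof -
  have *: "hcat A B $$ (i, j) = hcat A' B' $$ (i, j)" for i j using assms(1) by simp
  show "A = A'"
  proof (rule eq_matI)
    fix i j assume "i < dim_row A'" "j < dim_col A'"
    then show "A $$ (i, j) = A' $$ (i, j)" using *[of i j] assms(2-) by (auto simp: hcat_def)
  qed (use assms in auto)
  show "B = B'"
  proof (rule eq_matI)
    fix i j assume "i < dim_row B'" "j < dim_col B'"
    then show "B $$ (i, j) = B' $$ (i, j)" using *[of i "p + j"] assms(2-) by (auto simp: hcat_def)
  qed (use assms in auto)
qed

lemma vcat_inject:
  assumes "vcat A B = vcat A' B'" "A \<in> carrier_mat p n" "B \<in> carrier_mat q n"
    "A' \<in> carrier_mat p n" "B' \<in> carrier_mat q n"
  shows "A = A'" "B = B'"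
proof -
  have *: "vcat A B $$ (i, j) = vcat A' B' $$ (i, j)" for i j using assms(1) by simp
  show "A = A'"
  proof (rule eq_matI)
    fix i j assume "i < dim_row A'" "j < dim_col A'"
    then show "A $$ (i, j) = A' $$ (i, j)" using *[of i j] assms(2-) by (auto simp: vcat_def)
  qed (use assms in auto)
  show "B = B'"
  proof (rule eq_matI)
    fix i j assume "i < dim_row B'" "j < dim_col B'"
    then show "B $$ (i, j) = B' $$ (i, j)" using *[of "p + i" j] assms(2-) by (auto simp: vcat_def)
  qed (use assms in auto)
qed

text \<open>The three blocks are the two neighbours of a vertex in the cycle and the framing. The
  last two are merged into one block for \<open>dual_blocks\<close> and split again.\<close>

lemma dual_blocks3:
  fixes A1 :: "'a :: field mat"
  assumes A: "A1 \<in> carrier_mat n p1" "A2 \<in> carrier_mat n p2" "A3 \<in> carrier_mat n p3"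
    and B: "B1 \<in> carrier_mat p1 n" "B2 \<in> carrier_mat p2 n" "B3 \<in> carrier_mat p3 n"
    and AB: "A1 * B1 + A2 * B2 + A3 * B3 = c \<cdot>\<^sub>m 1\<^sub>m n" and c: "c \<noteq> 0"
  obtains m P1 P2 P3 Q1 Q2 Q3 where "n + m = p1 + p2 + p3"
    "P1 \<in> carrier_mat p1 m" "P2 \<in> carrier_mat p2 m" "P3 \<in> carrier_mat p3 m"
    "Q1 \<in> carrier_mat m p1" "Q2 \<in> carrier_mat m p2" "Q3 \<in> carrier_mat m p3"
    "Q1 * P1 + Q2 * P2 + Q3 * P3 = (- c) \<cdot>\<^sub>m 1\<^sub>m m"
    "P1 * Q1 = B1 * A1 - c \<cdot>\<^sub>m 1\<^sub>m p1" "P1 * Q2 = B1 * A2" "P1 * Q3 = B1 * A3"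
    "P2 * Q1 = B2 * A1" "P2 * Q2 = B2 * A2 - c \<cdot>\<^sub>m 1\<^sub>m p2" "P2 * Q3 = B2 * A3"
    "P3 * Q1 = B3 * A1" "P3 * Q2 = B3 * A2" "P3 * Q3 = B3 * A3 - c \<cdot>\<^sub>m 1\<^sub>m p3"
proof -
  have A': "hcat A2 A3 \<in> carrier_mat n (p2 + p3)" and B': "vcat B2 B3 \<in> carrier_mat (p2 + p3) n"
    using A B by auto
  have prods: "A1 * B1 \<in> carrier_mat n n" "A2 * B2 \<in> carrier_mat n n" "A3 * B3 \<in> carrier_mat n n"
    using A B by auto
  have AB': "A1 * B1 + hcat A2 A3 * vcat B2 B3 = c \<cdot>\<^sub>m 1\<^sub>m n"
    unfolding hcat_mult_vcat[OF A(2,3) B(2,3)] AB[symmetric] using assoc_add_mat[OF prods] by simp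
  obtain m P1 P' Q1 Q' where D: "n + m = p1 + (p2 + p3)"
    "P1 \<in> carrier_mat p1 m" "P' \<in> carrier_mat (p2 + p3) m" "Q1 \<in> carrier_mat m p1" "Q' \<in> carrier_mat m (p2 + p3)"
    "Q1 * P1 + Q' * P' = (- c) \<cdot>\<^sub>m 1\<^sub>m m"
    "P1 * Q1 = B1 * A1 - c \<cdot>\<^sub>m 1\<^sub>m p1" "P1 * Q' = B1 * hcat A2 A3"
    "P' * Q1 = vcat B2 B3 * A1" "P' * Q' = vcat B2 B3 * hcat A2 A3 - c \<cdot>\<^sub>m 1\<^sub>m (p2 + p3)"
    by (rule dual_blocks[OF A(1) A' B(1) B' AB' c])
  obtain P2 P3 where P: "P2 \<in> carrier_mat p2 m" "P3 \<in> carrier_mat p3 m" "P' = vcat P2 P3"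
    using vcat_split[OF D(3)] .
  obtain Q2 Q3 where Q: "Q2 \<in> carrier_mat m p2" "Q3 \<in> carrier_mat m p3" "Q' = hcat Q2 Q3"
    using hcat_split[OF D(5)] .
  have "Q1 * P1 + (Q2 * P2 + Q3 * P3) = (- c) \<cdot>\<^sub>m 1\<^sub>m m"
    using D(6) unfolding P(3) Q(3) hcat_mult_vcat[OF Q(1,2) P(1,2)] .
  moreover have "Q1 * P1 \<in> carrier_mat m m" "Q2 * P2 \<in> carrier_mat m m" "Q3 * P3 \<in> carrier_mat m m"
    using P Q D by auto
  ultimately have QP: "Q1 * P1 + Q2 * P2 + Q3 * P3 = (- c) \<cdot>\<^sub>m 1\<^sub>m m"
    by (simp add: assoc_add_mat)
  have "hcat (P1 * Q2) (P1 * Q3) = hcat (B1 * A2) (B1 * A3)"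
    using D(8) unfolding Q(3) mult_hcat[OF D(2) Q(1,2)] mult_hcat[OF B(1) A(2,3)] .
  from hcat_inject[OF this, of p1 p2 p3] have e1: "P1 * Q2 = B1 * A2" "P1 * Q3 = B1 * A3"
    using A B D P Q by auto
  have "vcat (P2 * Q1) (P3 * Q1) = vcat (B2 * A1) (B3 * A1)"
    using D(9) unfolding P(3) vcat_mult[OF P(1,2) D(4)] vcat_mult[OF B(2,3) A(1)] .
  from vcat_inject[OF this, of p2 p1 p3] have e2: "P2 * Q1 = B2 * A1" "P3 * Q1 = B3 * A1"
    using A B D P Q by auto
  have "four_block_mat (B2 * A2) (B2 * A3) (B3 * A2) (B3 * A3) - c \<cdot>\<^sub>m 1\<^sub>m (p2 + p3)
    = four_block_mat (B2 * A2 - c \<cdot>\<^sub>m 1\<^sub>m p2) (B2 * A3) (B3 * A2) (B3 * A3 - c \<cdot>\<^sub>m 1\<^sub>m p3)"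
    using A B by (intro eq_matI) auto
  then have "four_block_mat (P2 * Q2) (P2 * Q3) (P3 * Q2) (P3 * Q3)
    = four_block_mat (B2 * A2 - c \<cdot>\<^sub>m 1\<^sub>m p2) (B2 * A3) (B3 * A2) (B3 * A3 - c \<cdot>\<^sub>m 1\<^sub>m p3)"
    using D(10) unfolding P(3) Q(3) vcat_mult_hcat[OF P(1,2) Q(1,2)] vcat_mult_hcat[OF B(2,3) A(2,3)] by simp
  moreover have "B2 * A2 - c \<cdot>\<^sub>m 1\<^sub>m p2 \<in> carrier_mat p2 p2" "B3 * A3 - c \<cdot>\<^sub>m 1\<^sub>m p3 \<in> carrier_mat p3 p3"
    by (intro minus_carrier_mat; simp)+
  ultimately
  have e3: "P2 * Q2 = B2 * A2 - c \<cdot>\<^sub>m 1\<^sub>m p2" "P2 * Q3 = B2 * A3"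
    "P3 * Q2 = B3 * A2" "P3 * Q3 = B3 * A3 - c \<cdot>\<^sub>m 1\<^sub>m p3"
    using four_block_inject[of "P2 * Q2" "P2 * Q3" "P3 * Q2" "P3 * Q3" _ _ _ _ p2 p2 p3 p3] A B P Q by auto
  show thesis
    by (rule that[OF _ D(2) P(1,2) D(4) Q(1,2) QP D(7) e1 e2(1) e3(1,2) e2(2) e3(3,4)]) (use D(1) in simp)
qed

lemma vcat_mult_vec:
  assumes "A \<in> carrier_mat p n" "B \<in> carrier_mat q n" "v \<in> carrier_vec n"
  shows "vcat A B *\<^sub>v v = (A *\<^sub>v v) @\<^sub>v (B *\<^sub>v v)"
  using assms by (intro eq_vecI) (auto simp: vcat_def scalar_prod_def)

lemma hcat_mult_vec:
  assumes "A \<in> carrier_mat n p" "B \<in> carrier_mat n q" "u \<in> carrier_vec p" "w \<in> carrier_vec q"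
  shows "hcat A B *\<^sub>v (u @\<^sub>v w) = A *\<^sub>v u + B *\<^sub>v w"
proof (rule eq_vecI)
  fix i assume i: "i < dim_vec (A *\<^sub>v u + B *\<^sub>v w)"
  then show "(hcat A B *\<^sub>v (u @\<^sub>v w)) $ i = (A *\<^sub>v u + B *\<^sub>v w) $ i"
    using assms by (simp add: hcat_def scalar_prod_def sum_split_add)
qed (use assms in \<open>auto simp: hcat_def\<close>)

text \<open>With \<open>R\<close> a right inverse of \<open>A\<close>, the columns of \<open>B\<close> and \<open>R\<close> are jointly independent.\<close>

lemma exact_dim_le:
  fixes A :: "'a :: field mat"
  assumes A: "A \<in> carrier_mat n N" and B: "B \<in> carrier_mat N n" and AB: "A * B = 0\<^sub>m n n"
    and inj: "\<And>v. v \<in> carrier_vec n \<Longrightarrow> B *\<^sub>v v = 0\<^sub>v N \<Longrightarrow> v = 0\<^sub>v n"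
    and surj: "\<And>w. w \<in> carrier_vec n \<Longrightarrow> \<exists>u\<in>carrier_vec N. A *\<^sub>v u = w"
  shows "2 * n \<le> N"
proof (rule ccontr)
  assume "\<not> ?thesis"
  then have less: "N < n + n" by simp
  have "\<exists>u\<in>carrier_vec N. A *\<^sub>v u = unit_vec n j" for j by (rule surj) simp
  then obtain u where u: "\<And>j. u j \<in> carrier_vec N" "\<And>j. A *\<^sub>v u j = unit_vec n j" by metis
  define R where "R = mat N n (\<lambda>(k, j). u j $ k)"
  have R: "R \<in> carrier_mat N n" by (simp add: R_def)
  have AR: "A * R = 1\<^sub>m n"
  proof (rule eq_matI)
    fix i j assume ij: "i < dim_row (1\<^sub>m n :: 'a mat)" "j < dim_col (1\<^sub>m n :: 'a mat)"
    have "(A * R) $$ (i, j) = (A *\<^sub>v u j) $ i"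
      using ij A u(1)[of j] by (auto simp: R_def scalar_prod_def intro!: sum.cong)
    then show "(A * R) $$ (i, j) = 1\<^sub>m n $$ (i, j)" using ij by (simp add: u(2) unit_vec_def)
  qed (use A R in auto)
  obtain z where z: "z \<in> carrier_vec (n + n)" "z \<noteq> 0\<^sub>v (n + n)" "hcat B R *\<^sub>v z = 0\<^sub>v N"
    by (rule ex_kernel_vec[OF hcat_carrier[OF B R] less])
  define v w where "v = vec_first z n" and "w = vec_last z n"
  have vw: "v \<in> carrier_vec n" "w \<in> carrier_vec n" "z = v @\<^sub>v w"
    using z(1) by (auto simp: v_def w_def vec_first_last_append)
  have eq: "B *\<^sub>v v + R *\<^sub>v w = 0\<^sub>v N" using z(3) unfolding vw(3) hcat_mult_vec[OF B R vw(1,2)] .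
  have "A *\<^sub>v (B *\<^sub>v v + R *\<^sub>v w) = A *\<^sub>v (B *\<^sub>v v) + A *\<^sub>v (R *\<^sub>v w)"
    using A B R vw by (intro mult_add_distrib_mat_vec) auto
  also have "\<dots> = (A * B) *\<^sub>v v + (A * R) *\<^sub>v w"
    using A B R vw by (simp add: assoc_mult_mat_vec)
  also have "\<dots> = w" unfolding AB AR using vw by auto
  finally have w0: "w = 0\<^sub>v n" using eq A by auto
  have "R *\<^sub>v w = 0\<^sub>v N" unfolding w0 using R by auto
  then have "B *\<^sub>v v = 0\<^sub>v N" using eq B vw(1) by auto
  then have "v = 0\<^sub>v n" using inj vw(1) by simp
  then have "z = 0\<^sub>v (n + n)" using w0 vw(3) by (auto intro!: eq_vecI)
  with z(2) show False by simp
qed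

section \<open>Representation spaces, subrepresentations and simplicity\<close>

lemma rep_spaceD:
  assumes "M \<in> rep_space l (framed k \<alpha>)"
  shows "i < l \<Longrightarrow> qX M i \<in> carrier_mat (\<alpha> i) (\<alpha> (succ_mod l i))"
    and "i < l \<Longrightarrow> qY M i \<in> carrier_mat (\<alpha> (succ_mod l i)) (\<alpha> i)"
    and "qx M \<in> carrier_mat (\<alpha> 0) k" and "qy M \<in> carrier_mat k (\<alpha> 0)"
  using assms by (auto simp: rep_space_def framed_def dest: PiE_mem)

lemma rep_spaceI:
  assumes "\<And>i. i < l \<Longrightarrow> qX M i \<in> carrier_mat (\<alpha> i) (\<alpha> (succ_mod l i))"
    and "\<And>i. i < l \<Longrightarrow> qY M i \<in> carrier_mat (\<alpha> (succ_mod l i)) (\<alpha> i)"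
    and "qX M \<in> extensional {..<l}" "qY M \<in> extensional {..<l}"
    and "qx M \<in> carrier_mat (\<alpha> 0) k" and "qy M \<in> carrier_mat k (\<alpha> 0)"
  shows "M \<in> rep_space l (framed k \<alpha>)"
  using assms by (auto simp: rep_space_def framed_def PiE_iff)

lemma rep_space_extensional:
  assumes "M \<in> rep_space l d"
  shows "qX M \<in> extensional {..<l}" "qY M \<in> extensional {..<l}"
  using assms by (auto simp: rep_space_def PiE_iff)

lemma verts_all: "(\<forall>v\<in>verts l. P v) \<longleftrightarrow> P None \<and> (\<forall>i<l. P (Some i))"
  by (auto simp: verts_def)

abbreviation subsp :: "complex vec set \<Rightarrow> nat \<Rightarrow> bool" where
  "subsp U n \<equiv> VectorSpace.subspace class_ring U (module_vec TYPE(complex) n)"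

lemma subspD:
  assumes "subsp U n"
  shows "u \<in> U \<Longrightarrow> u \<in> carrier_vec n" "0\<^sub>v n \<in> U" "u \<in> U \<Longrightarrow> v \<in> U \<Longrightarrow> u + v \<in> U"
    "u \<in> U \<Longrightarrow> a \<cdot>\<^sub>v u \<in> U"
  using assms by (auto simp: subspace_vec_iff)

lemma subspI:
  assumes "\<And>u. u \<in> U \<Longrightarrow> u \<in> carrier_vec n" "0\<^sub>v n \<in> U" "\<And>u v. u \<in> U \<Longrightarrow> v \<in> U \<Longrightarrow> u + v \<in> U"
    "\<And>a u. u \<in> U \<Longrightarrow> a \<cdot>\<^sub>v u \<in> U"
  shows "subsp U n"
  using assms by (auto simp: subspace_vec_iff)

lemma subsp_zero: "subsp {0\<^sub>v n} n" and subsp_full: "subsp (carrier_vec n) n"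
  by (auto intro!: subspI)

lemma subrep_framed_iff:
  "subrep l (framed k \<alpha>) M U \<longleftrightarrow>
    subsp (U None) k \<and> (\<forall>i<l. subsp (U (Some i)) (\<alpha> i)) \<and>
    (\<forall>i<l. (\<forall>u\<in>U (Some (succ_mod l i)). qX M i *\<^sub>v u \<in> U (Some i)) \<and>
           (\<forall>u\<in>U (Some i). qY M i *\<^sub>v u \<in> U (Some (succ_mod l i)))) \<and>
    (\<forall>u\<in>U None. qx M *\<^sub>v u \<in> U (Some 0)) \<and>
    (\<forall>u\<in>U (Some 0). qy M *\<^sub>v u \<in> U None)"
  unfolding subrep_def verts_all by (auto simp: framed_def)

lemma simple_framed_iff:
  "simple_rep l (framed 1 \<alpha>) M \<longleftrightarrow> (\<forall>U. subrep l (framed 1 \<alpha>) M U \<longrightarrow>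
     (U None = {0\<^sub>v 1} \<and> (\<forall>i<l. U (Some i) = {0\<^sub>v (\<alpha> i)})) \<or>
     (U None = carrier_vec 1 \<and> (\<forall>i<l. U (Some i) = carrier_vec (\<alpha> i))))"
  unfolding simple_rep_def verts_all by (auto simp: framed_def verts_def)

lemma carrier_vec_1_neq: "carrier_vec 1 \<noteq> {0\<^sub>v 1 :: complex vec}"
proof
  assume *: "carrier_vec 1 = {0\<^sub>v 1 :: complex vec}"
  have "unit_vec 1 0 \<in> {0\<^sub>v 1 :: complex vec}" unfolding *[symmetric] by (rule unit_vec_carrier)
  then have "unit_vec 1 0 $ 0 = (0\<^sub>v 1 :: complex vec) $ 0" by (simp only: singleton_iff)
  then show False by simp
qed

text \<open>The arrows into and out of the vertex \<open>i\<close>: from and to \<open>succ_mod l i\<close>, \<open>pred_mod l i\<close> and, if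
  \<open>i = 0\<close>, the framing vertex; the sign makes the moment map at \<open>i\<close> the composite of the two.\<close>

definition fdim :: "nat \<Rightarrow> nat" where "fdim i = of_bool (i = 0)"

definition frin :: "nat \<Rightarrow> nat \<Rightarrow> quiver_rep \<Rightarrow> complex mat" where
  "frin i n M = (if i = 0 then qx M else 0\<^sub>m n 0)"

definition frout :: "nat \<Rightarrow> nat \<Rightarrow> quiver_rep \<Rightarrow> complex mat" where
  "frout i n M = (if i = 0 then qy M else 0\<^sub>m 0 n)"

definition frsp :: "nat \<Rightarrow> complex vec set \<Rightarrow> complex vec set" where
  "frsp i U = (if i = 0 then U else carrier_vec 0)"

lemma frin_carrier: "M \<in> rep_space l (framed 1 \<alpha>) \<Longrightarrow> frin i (\<alpha> i) M \<in> carrier_mat (\<alpha> i) (fdim i)"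
  by (auto simp: frin_def fdim_def dest: rep_spaceD)

lemma frout_carrier: "M \<in> rep_space l (framed 1 \<alpha>) \<Longrightarrow> frout i (\<alpha> i) M \<in> carrier_mat (fdim i) (\<alpha> i)"
  by (auto simp: frout_def fdim_def dest: rep_spaceD)

lemma frin_frout:
  "(if i = 0 then qx M * qy M else 0\<^sub>m n n) = frin i n M * frout i n M"
  by (auto simp: frin_def frout_def scalar_prod_def intro!: eq_matI)

lemma uminus_mult_mat:
  assumes "(A :: complex mat) \<in> carrier_mat n p" "B \<in> carrier_mat p m"
  shows "(- A) * B = - (A * B)" "B' \<in> carrier_mat q n \<Longrightarrow> B' * (- A) = - (B' * A)"
  using assms by (auto intro!: eq_matI simp: scalar_prod_def sum_negf[symmetric])

lemma moment_at:
  assumes "M \<in> moment_fiber l c \<alpha>" "i < l"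
  shows "qX M i * qY M i + (- qY M (pred_mod l i)) * qX M (pred_mod l i) + frin i (\<alpha> i) M * frout i (\<alpha> i) M
    = c i \<cdot>\<^sub>m 1\<^sub>m (\<alpha> i)"
proof -
  have M: "M \<in> rep_space l (framed 1 \<alpha>)" using assms by (simp add: moment_fiber_def)
  have r: "pred_mod l i < l" "succ_mod l (pred_mod l i) = i"
    using assms(2) by (auto simp: pred_mod_less succ_pred_mod)
  note X = rep_spaceD(1)[OF M r(1), unfolded r(2)] and Y = rep_spaceD(2)[OF M r(1), unfolded r(2)]
  have XY: "qX M i * qY M i \<in> carrier_mat (\<alpha> i) (\<alpha> i)"
    using rep_spaceD(1,2)[OF M assms(2)] by auto
  have YX: "qY M (pred_mod l i) * qX M (pred_mod l i) \<in> carrier_mat (\<alpha> i) (\<alpha> i)" using X Y by auto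
  show ?thesis
    unfolding uminus_mult_mat(1)[OF Y X] frin_frout[symmetric]
    using assms add_uminus_minus_mat[OF XY YX] by (simp add: moment_fiber_def)
qed

section \<open>Reflection functors\<close>

lemma mult_mat_vec_smult:
  "A \<in> carrier_mat n p \<Longrightarrow> u \<in> carrier_vec p \<Longrightarrow> A *\<^sub>v (a \<cdot>\<^sub>v u) = a \<cdot>\<^sub>v (A *\<^sub>v u)"
  for A :: "complex mat"
  by (rule mult_mat_vec)

lemma uminus_mat_vec:
  "A \<in> carrier_mat n p \<Longrightarrow> u \<in> carrier_vec p \<Longrightarrow> (- A) *\<^sub>v u = (- 1) \<cdot>\<^sub>v (A *\<^sub>v u)"
  for A :: "complex mat"
  by (auto intro!: eq_vecI simp: scalar_prod_def sum_negf[symmetric])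

lemma zero_mult_vec: "0\<^sub>m n p *\<^sub>v u = 0\<^sub>v n" if "u \<in> carrier_vec p" for u :: "complex vec"
  using that by (auto intro!: eq_vecI simp: scalar_prod_def)

lemma mult_zero_vec: "(A :: complex mat) \<in> carrier_mat n p \<Longrightarrow> A *\<^sub>v 0\<^sub>v p = 0\<^sub>v n"
  by (auto intro!: eq_vecI simp: scalar_prod_def)

lemma carrier_vec_0: "u \<in> carrier_vec 0 \<longleftrightarrow> u = 0\<^sub>v 0" for u :: "complex vec"
  by (auto intro!: eq_vecI)

lemma frsp_subsp: "subsp U 1 \<Longrightarrow> subsp (frsp i U) (fdim i)"
  using subsp_full[of 0] by (simp add: frsp_def fdim_def)

definition sum3 :: "complex mat \<Rightarrow> complex mat \<Rightarrow> complex mat \<Rightarrow> complex vec set \<Rightarrow> complex vec set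
    \<Rightarrow> complex vec set \<Rightarrow> complex vec set" where
  "sum3 A1 A2 A3 U1 U2 U3 = {A1 *\<^sub>v u1 + A2 *\<^sub>v u2 + A3 *\<^sub>v u3 | u1 u2 u3. u1 \<in> U1 \<and> u2 \<in> U2 \<and> u3 \<in> U3}"

lemma sum3_facts:
  assumes A: "A1 \<in> carrier_mat n p1" "A2 \<in> carrier_mat n p2" "A3 \<in> carrier_mat n p3"
    and U: "subsp U1 p1" "subsp U2 p2" "subsp U3 p3"
  shows "subsp (sum3 A1 A2 A3 U1 U2 U3) n"
    and "u \<in> U1 \<Longrightarrow> A1 *\<^sub>v u \<in> sum3 A1 A2 A3 U1 U2 U3"
    and "u \<in> U2 \<Longrightarrow> A2 *\<^sub>v u \<in> sum3 A1 A2 A3 U1 U2 U3"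
    and "u \<in> U3 \<Longrightarrow> A3 *\<^sub>v u \<in> sum3 A1 A2 A3 U1 U2 U3"
proof -
  let ?S = "sum3 A1 A2 A3 U1 U2 U3"
  have I: "A1 *\<^sub>v u1 + A2 *\<^sub>v u2 + A3 *\<^sub>v u3 \<in> ?S" if "u1 \<in> U1" "u2 \<in> U2" "u3 \<in> U3" for u1 u2 u3
    using that unfolding sum3_def by blast
  note c1 = subspD(1)[OF U(1)] and c2 = subspD(1)[OF U(2)] and c3 = subspD(1)[OF U(3)]
  note z = subspD(2)[OF U(1)] subspD(2)[OF U(2)] subspD(2)[OF U(3)]
  note Az = mult_zero_vec[OF A(1)] mult_zero_vec[OF A(2)] mult_zero_vec[OF A(3)]
  have 1: "A1 *\<^sub>v w \<in> ?S" if "w \<in> U1" for w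
    using I[OF that z(2,3)] A(1) c1[OF that] by (simp add: Az)
  then show "A1 *\<^sub>v u \<in> ?S" if "u \<in> U1" using that by blast
  show "A2 *\<^sub>v u \<in> ?S" if "u \<in> U2"
    using I[OF z(1) that z(3)] A(2) c2[OF that] by (simp add: Az)
  show "A3 *\<^sub>v u \<in> ?S" if "u \<in> U3"
    using I[OF z(1,2) that] A(3) c3[OF that] by (simp add: Az)
  show "subsp ?S n"
  proof (rule subspI)
    show "u \<in> carrier_vec n" if "u \<in> ?S" for u
      using that A c1 c2 c3 unfolding sum3_def by auto
    show "0\<^sub>v n \<in> ?S" using 1[OF z(1)] by (simp add: Az)
    fix u assume "u \<in> ?S"
    then obtain u1 u2 u3 where u: "u1 \<in> U1" "u2 \<in> U2" "u3 \<in> U3" "u = A1 *\<^sub>v u1 + A2 *\<^sub>v u2 + A3 *\<^sub>v u3"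
      unfolding sum3_def by blast
    show "a \<cdot>\<^sub>v u \<in> ?S" for a
    proof -
      have "a \<cdot>\<^sub>v u = A1 *\<^sub>v (a \<cdot>\<^sub>v u1) + A2 *\<^sub>v (a \<cdot>\<^sub>v u2) + A3 *\<^sub>v (a \<cdot>\<^sub>v u3)"
        using A c1[OF u(1)] c2[OF u(2)] c3[OF u(3)] unfolding u(4)
        by (simp add: mult_mat_vec_smult smult_add_distrib_vec[of _ n])
      then show ?thesis using I subspD(4)[OF U(1) u(1)] subspD(4)[OF U(2) u(2)] subspD(4)[OF U(3) u(3)] by simp
    qed
    fix v assume "v \<in> ?S"
    then obtain v1 v2 v3 where v: "v1 \<in> U1" "v2 \<in> U2" "v3 \<in> U3" "v = A1 *\<^sub>v v1 + A2 *\<^sub>v v2 + A3 *\<^sub>v v3"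
      unfolding sum3_def by blast
    have "u + v = A1 *\<^sub>v (u1 + v1) + A2 *\<^sub>v (u2 + v2) + A3 *\<^sub>v (u3 + v3)"
    proof -
      have "A1 *\<^sub>v (u1 + v1) = A1 *\<^sub>v u1 + A1 *\<^sub>v v1" "A2 *\<^sub>v (u2 + v2) = A2 *\<^sub>v u2 + A2 *\<^sub>v v2"
        "A3 *\<^sub>v (u3 + v3) = A3 *\<^sub>v u3 + A3 *\<^sub>v v3"
        using A c1[OF u(1)] c2[OF u(2)] c3[OF u(3)] c1[OF v(1)] c2[OF v(2)] c3[OF v(3)]
        by (auto intro!: mult_add_distrib_mat_vec)
      moreover have "A1 *\<^sub>v u1 \<in> carrier_vec n" "A2 *\<^sub>v u2 \<in> carrier_vec n" "A3 *\<^sub>v u3 \<in> carrier_vec n"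
        "A1 *\<^sub>v v1 \<in> carrier_vec n" "A2 *\<^sub>v v2 \<in> carrier_vec n" "A3 *\<^sub>v v3 \<in> carrier_vec n"
        using A c1[OF u(1)] c2[OF u(2)] c3[OF u(3)] c1[OF v(1)] c2[OF v(2)] c3[OF v(3)] by auto
      ultimately show ?thesis unfolding u(4) v(4) by (auto intro!: eq_vecI)
    qed
    then show "u + v \<in> ?S"
      using I subspD(3)[OF U(1) u(1) v(1)] subspD(3)[OF U(2) u(2) v(2)] subspD(3)[OF U(3) u(3) v(3)] by simp
  qed
qed

lemma cartan_cases:
  assumes "2 \<le> l" "i < l"
  shows "cartan l i i = 2" "j \<noteq> i \<Longrightarrow> cartan l i j = - of_bool (j = succ_mod l i) - of_bool (j = pred_mod l i)"
  using succ_mod_neq[OF assms] pred_mod_neq[OF assms] by (auto simp: cartan_def)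

lemma smult_one_mult_vec:
  fixes u :: "complex vec"
  assumes "u \<in> carrier_vec p"
  shows "(k \<cdot>\<^sub>m 1\<^sub>m p) *\<^sub>v u = k \<cdot>\<^sub>v u"
proof (rule eq_vecI)
  fix i assume i: "i < dim_vec (k \<cdot>\<^sub>v u)"
  then have ip: "i < p" using assms by simp
  have "((k \<cdot>\<^sub>m 1\<^sub>m p) *\<^sub>v u) $ i = (\<Sum>j\<in>{0..<p}. (k \<cdot>\<^sub>m 1\<^sub>m p) $$ (i, j) * u $ j)"
    using ip assms by (simp add: scalar_prod_def) (rule sum.cong, auto)
  also have "\<dots> = (\<Sum>j\<in>{0..<p}. if j = i then k * u $ i else 0)"
    using ip by (intro sum.cong) auto
  also have "\<dots> = k * u $ i" using ip by simp
  finally show "((k \<cdot>\<^sub>m 1\<^sub>m p) *\<^sub>v u) $ i = (k \<cdot>\<^sub>v u) $ i" using i by simp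
qed (use assms in simp)

lemma shift_scalars:
  fixes X Y V :: "complex mat"
  assumes "X \<in> carrier_mat n n" "Y \<in> carrier_mat n n" "V \<in> carrier_mat n n"
  shows "X + a \<cdot>\<^sub>m 1\<^sub>m n - (Y - b \<cdot>\<^sub>m 1\<^sub>m n) + V = (X - Y + V) + (a + b) \<cdot>\<^sub>m 1\<^sub>m n"
  using assms by (intro eq_matI) (auto simp: algebra_simps)

text \<open>The reflection functor at a vertex \<open>i\<close> with \<open>c i \<noteq> 0\<close>: replace the space at \<open>i\<close> by the kernel of the
  map into it from its neighbours, which is a complement of its image under the map to the neighbours.\<close>

lemma reflection_functor:
  assumes l: "2 \<le> l" and i: "i < l" and M: "M \<in> moment_fiber l c \<alpha>"
    and simple: "simple_rep l (framed 1 \<alpha>) M" and ci: "c i \<noteq> 0"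
  obtains M' m where "M' \<in> moment_fiber l (weyl_refl l i c) (\<alpha>(i := m))"
    "simple_rep l (framed 1 (\<alpha>(i := m))) M'"
    "int m = int (\<alpha> i) + defect l (\<lambda>j. int (\<alpha> j)) i"
proof -
  define s r where "s = succ_mod l i" and "r = pred_mod l i"
  have l0: "l > 0" using l by simp
  have sr: "s < l" "r < l" "s \<noteq> i" "r \<noteq> i" "succ_mod l r = i" "pred_mod l s = i"
    using l i l0 by (auto simp: s_def r_def succ_mod_less pred_mod_less succ_mod_neq pred_mod_neq
      succ_pred_mod pred_succ_mod)
  have succ_i: "succ_mod l j = i \<longleftrightarrow> j = r" if "j < l" for j
    using that sr(5) pred_succ_mod[OF that] r_def by auto
  have pred_i: "pred_mod l j = i \<longleftrightarrow> j = s" if "j < l" for j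
    using that sr(6) succ_pred_mod[OF that] s_def by auto
  have Mr: "M \<in> rep_space l (framed 1 \<alpha>)" using M by (simp add: moment_fiber_def)
  let ?n = "\<alpha> i" and ?f = "fdim i"
  define A1 A2 A3 where "A1 = qX M i" and "A2 = - qY M r" and "A3 = frin i ?n M"
  define B1 B2 B3 where "B1 = qY M i" and "B2 = qX M r" and "B3 = frout i ?n M"
  have A: "A1 \<in> carrier_mat ?n (\<alpha> s)" "A2 \<in> carrier_mat ?n (\<alpha> r)" "A3 \<in> carrier_mat ?n ?f"
    using rep_spaceD(1)[OF Mr i] rep_spaceD(2)[OF Mr sr(2)] frin_carrier[OF Mr, of i] sr(5)
    by (auto simp: A1_def A2_def A3_def s_def)
  have B: "B1 \<in> carrier_mat (\<alpha> s) ?n" "B2 \<in> carrier_mat (\<alpha> r) ?n" "B3 \<in> carrier_mat ?f ?n"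
    using rep_spaceD(2)[OF Mr i] rep_spaceD(1)[OF Mr sr(2)] frout_carrier[OF Mr, of i] sr(5)
    by (auto simp: B1_def B2_def B3_def s_def)
  have Yr: "qY M r \<in> carrier_mat ?n (\<alpha> r)" using rep_spaceD(2)[OF Mr sr(2)] sr(5) by simp
  have AB: "A1 * B1 + A2 * B2 + A3 * B3 = c i \<cdot>\<^sub>m 1\<^sub>m ?n"
    unfolding A1_def A2_def A3_def B1_def B2_def B3_def r_def by (rule moment_at[OF M i])
  \<comment> \<open>The \<open>P\<close> maps lead out of the new space and the \<open>Q\<close>
    maps into it. Paths between neighbours through the new vertex agree with the old ones, except
    that a path back to the same block changes by \<open>c i\<close>; this is the required shift of
    the parameter at the neighbours.\<close>
  obtain m P1 P2 P3 Q1 Q2 Q3 where m: "?n + m = \<alpha> s + \<alpha> r + ?f"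
    and P: "P1 \<in> carrier_mat (\<alpha> s) m" "P2 \<in> carrier_mat (\<alpha> r) m" "P3 \<in> carrier_mat ?f m"
    and Q: "Q1 \<in> carrier_mat m (\<alpha> s)" "Q2 \<in> carrier_mat m (\<alpha> r)" "Q3 \<in> carrier_mat m ?f"
    and QP: "Q1 * P1 + Q2 * P2 + Q3 * P3 = (- c i) \<cdot>\<^sub>m 1\<^sub>m m"
    and PQ: "P1 * Q1 = B1 * A1 - c i \<cdot>\<^sub>m 1\<^sub>m (\<alpha> s)" "P1 * Q2 = B1 * A2" "P1 * Q3 = B1 * A3"
    "P2 * Q1 = B2 * A1" "P2 * Q2 = B2 * A2 - c i \<cdot>\<^sub>m 1\<^sub>m (\<alpha> r)" "P2 * Q3 = B2 * A3"
    "P3 * Q1 = B3 * A1" "P3 * Q2 = B3 * A2" "P3 * Q3 = B3 * A3 - c i \<cdot>\<^sub>m 1\<^sub>m ?f"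
    by (rule dual_blocks3[OF A B AB ci])
  define \<alpha>' where "\<alpha>' = \<alpha>(i := m)"
  \<comment> \<open>The sign that \<open>A2\<close> carries is returned to the arrow from the
    predecessor, hence \<open>- Q2\<close>.\<close>
  define M' where "M' = \<lparr>qX = (qX M)(i := Q1, r := P2), qY = (qY M)(i := P1, r := - Q2),
    qx = (if i = 0 then Q3 else qx M), qy = (if i = 0 then P3 else qy M)\<rparr>"
  have X': "qX M' i = Q1" "qX M' r = P2" "\<And>j. j \<noteq> i \<Longrightarrow> j \<noteq> r \<Longrightarrow> qX M' j = qX M j"
    and Y': "qY M' i = P1" "qY M' r = - Q2" "\<And>j. j \<noteq> i \<Longrightarrow> j \<noteq> r \<Longrightarrow> qY M' j = qY M j"
    using sr(4) by (auto simp: M'_def)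
  have M'r: "M' \<in> rep_space l (framed 1 \<alpha>')"
  proof (rule rep_spaceI)
    fix j assume j: "j < l"
    consider "j = i" | "j = r" "j \<noteq> i" | "j \<noteq> i" "j \<noteq> r" by blast
    then have "qX M' j \<in> carrier_mat (\<alpha>' j) (\<alpha>' (succ_mod l j)) \<and> qY M' j \<in> carrier_mat (\<alpha>' (succ_mod l j)) (\<alpha>' j)"
    proof cases
      case 1
      then show ?thesis using P Q sr by (auto simp: X' Y' \<alpha>'_def s_def)
    next
      case 2
      then show ?thesis using P Q sr by (auto simp: X' Y' \<alpha>'_def)
    next
      case 3
      then show ?thesis using rep_spaceD(1,2)[OF Mr j] succ_i[OF j] by (auto simp: X' Y' \<alpha>'_def)
    qed
    then show "qX M' j \<in> carrier_mat (\<alpha>' j) (\<alpha>' (succ_mod l j))"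
      "qY M' j \<in> carrier_mat (\<alpha>' (succ_mod l j)) (\<alpha>' j)" by auto
  next
    show "qX M' \<in> extensional {..<l}" "qY M' \<in> extensional {..<l}"
      using rep_space_extensional[OF Mr] i sr(2) by (auto simp: M'_def extensional_def)
    show "qx M' \<in> carrier_mat (\<alpha>' 0) 1" "qy M' \<in> carrier_mat 1 (\<alpha>' 0)"
      using rep_spaceD(3,4)[OF Mr] P Q by (auto simp: M'_def \<alpha>'_def fdim_def)
  qed
  have frM': "frin i m M' = Q3" "frout i m M' = P3"
    using P(3) Q(3) by (auto simp: frin_def frout_def M'_def fdim_def intro!: eq_matI)
  have moment: "qX M' j * qY M' j - qY M' (pred_mod l j) * qX M' (pred_mod l j)
      + (if j = 0 then qx M' * qy M' else 0\<^sub>m (\<alpha>' j) (\<alpha>' j)) = weyl_refl l i c j \<cdot>\<^sub>m 1\<^sub>m (\<alpha>' j)"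
    if j: "j < l" for j
  proof (cases "j = i")
    case True
    have d: "\<alpha>' j = m" using True by (simp add: \<alpha>'_def)
    have w: "weyl_refl l i c j = - c i" using i cartan_cases(1)[OF l i] by (simp add: weyl_refl_def True)
    have "Q1 * P1 \<in> carrier_mat m m" "Q2 * P2 \<in> carrier_mat m m" "Q3 * P3 \<in> carrier_mat m m" using P Q by auto
    then have "Q1 * P1 - (- Q2) * P2 + Q3 * P3 = Q1 * P1 + Q2 * P2 + Q3 * P3"
      unfolding uminus_mult_mat(1)[OF Q(2) P(2)] using P Q by (intro eq_matI) auto
    then show ?thesis
      unfolding d w frin_frout unfolding True r_def[symmetric] X' Y' frM' QP[symmetric] by simp
  next
    case False
    then have d: "\<alpha>' j = \<alpha> j" by (simp add: \<alpha>'_def)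
    let ?XY = "qX M j * qY M j" and ?YX = "qY M (pred_mod l j) * qX M (pred_mod l j)"
    have p: "pred_mod l j < l" "succ_mod l (pred_mod l j) = j" using j l0 by (auto simp: pred_mod_less succ_pred_mod)
    have cXY: "?XY \<in> carrier_mat (\<alpha> j) (\<alpha> j)" using rep_spaceD(1,2)[OF Mr j] by auto
    have cYX: "?YX \<in> carrier_mat (\<alpha> j) (\<alpha> j)"
      using rep_spaceD(1,2)[OF Mr p(1), unfolded p(2)] by auto
    define V where "V = (if j = 0 then qx M * qy M else 0\<^sub>m (\<alpha> j) (\<alpha> j))"
    have cV: "V \<in> carrier_mat (\<alpha> j) (\<alpha> j)" using rep_spaceD(3,4)[OF Mr] by (auto simp: V_def)
    have V': "(if j = 0 then qx M' * qy M' else 0\<^sub>m (\<alpha>' j) (\<alpha>' j)) = V"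
      using False by (auto simp: V_def M'_def d)
    have mom: "?XY - ?YX + V = c j \<cdot>\<^sub>m 1\<^sub>m (\<alpha> j)"
      using M j by (simp add: moment_fiber_def V_def)
    have XY: "qX M' j * qY M' j = ?XY + (of_bool (j = r) * c i) \<cdot>\<^sub>m 1\<^sub>m (\<alpha> j)"
    proof (cases "j = r")
      case True
      have "P2 * (- Q2) = - (B2 * A2 - c i \<cdot>\<^sub>m 1\<^sub>m (\<alpha> r))"
        unfolding PQ(5)[symmetric] by (rule uminus_mult_mat(2)[OF Q(2) P(2) P(2)])
      also have "B2 * A2 = - (B2 * qY M r)"
        unfolding A2_def by (rule uminus_mult_mat(2)[OF Yr B(2) B(2)])
      also have "- (- (B2 * qY M r) - c i \<cdot>\<^sub>m 1\<^sub>m (\<alpha> r)) = B2 * qY M r + c i \<cdot>\<^sub>m 1\<^sub>m (\<alpha> r)"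
        using B(2) Yr by (intro eq_matI) auto
      finally show ?thesis using True by (simp add: X' Y' B2_def)
    next
      case neq: False
      then show ?thesis using False cXY by (simp add: X' Y') (auto intro!: eq_matI)
    qed
    have YX: "qY M' (pred_mod l j) * qX M' (pred_mod l j) = ?YX - (of_bool (j = s) * c i) \<cdot>\<^sub>m 1\<^sub>m (\<alpha> j)"
    proof (cases "j = s")
      case True
      then show ?thesis using PQ(1) by (simp add: X' Y' sr A1_def B1_def)
    next
      case neq: False
      have "pred_mod l j \<noteq> i" using neq pred_i[OF j] by simp
      moreover have "pred_mod l j \<noteq> r" using False p(2) sr(5) by auto
      ultimately show ?thesis using neq cYX by (simp add: X' Y') (auto intro!: eq_matI)
    qed
    \<comment> \<open>For \<open>l = 2\<close> both neighbours coincide and both terms occur, in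
      accordance with the Cartan entry -2.\<close>
    have w: "weyl_refl l i c j = c j + (of_bool (j = r) * c i + of_bool (j = s) * c i)"
      using j by (simp add: weyl_refl_def cartan_cases(2)[OF l i False] s_def r_def)
    have "qX M' j * qY M' j - qY M' (pred_mod l j) * qX M' (pred_mod l j) + V
      = (?XY - ?YX + V) + (of_bool (j = r) * c i + of_bool (j = s) * c i) \<cdot>\<^sub>m 1\<^sub>m (\<alpha> j)"
      unfolding XY YX by (rule shift_scalars[OF cXY cYX cV])
    also have "\<dots> = weyl_refl l i c j \<cdot>\<^sub>m 1\<^sub>m (\<alpha> j)"
      unfolding mom w by (auto intro!: eq_matI simp: algebra_simps)
    finally show ?thesis using V' unfolding d by simp
  qed
  have M'mom: "M' \<in> moment_fiber l (weyl_refl l i c) \<alpha>'"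
    unfolding moment_fiber_def using M'r moment by blast
  have simple': "simple_rep l (framed 1 \<alpha>') M'"
    unfolding simple_framed_iff
  proof (intro allI impI)
    fix U' assume U': "subrep l (framed 1 \<alpha>') M' U'"
    have sub': "subsp (U' None) 1" "\<And>j. j < l \<Longrightarrow> subsp (U' (Some j)) (\<alpha>' j)"
      and aX: "\<And>j u. j < l \<Longrightarrow> u \<in> U' (Some (succ_mod l j)) \<Longrightarrow> qX M' j *\<^sub>v u \<in> U' (Some j)"
      and aY: "\<And>j u. j < l \<Longrightarrow> u \<in> U' (Some j) \<Longrightarrow> qY M' j *\<^sub>v u \<in> U' (Some (succ_mod l j))"
      and ax: "\<And>u. u \<in> U' None \<Longrightarrow> qx M' *\<^sub>v u \<in> U' (Some 0)"
      and ay: "\<And>u. u \<in> U' (Some 0) \<Longrightarrow> qy M' *\<^sub>v u \<in> U' None"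
      using U' unfolding subrep_framed_iff by blast+
    define W1 W2 W3 where "W1 = U' (Some s)" and "W2 = U' (Some r)" and "W3 = frsp i (U' None)"
    have W: "subsp W1 (\<alpha> s)" "subsp W2 (\<alpha> r)" "subsp W3 ?f"
      using sub'(2)[OF sr(1)] sub'(2)[OF sr(2)] frsp_subsp[OF sub'(1)] sr(3,4)
      by (auto simp: W1_def W2_def W3_def \<alpha>'_def)
    have Ui: "subsp (U' (Some i)) m" using sub'(2)[OF i] by (simp add: \<alpha>'_def)
    note cW1 = subspD(1)[OF W(1)] and cW2 = subspD(1)[OF W(2)] and cW3 = subspD(1)[OF W(3)]
    note cUi = subspD(1)[OF Ui]
    have Qmap: "Q1 *\<^sub>v u \<in> U' (Some i)" if "u \<in> W1" for u
      using aX[OF i, of u] that by (simp add: W1_def s_def X'(1))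
    have Qmap2: "Q2 *\<^sub>v u \<in> U' (Some i)" if "u \<in> W2" for u
    proof -
      have "(- Q2) *\<^sub>v u \<in> U' (Some i)" using aY[OF sr(2), of u] that by (simp add: W2_def Y'(2) sr(5))
      then have "(- 1) \<cdot>\<^sub>v ((- 1) \<cdot>\<^sub>v (Q2 *\<^sub>v u)) \<in> U' (Some i)"
        unfolding uminus_mat_vec[OF Q(2) cW2[OF that]] by (rule subspD(4)[OF Ui])
      then show ?thesis by (simp add: smult_smult_assoc)
    qed
    have Qmap3: "Q3 *\<^sub>v u \<in> U' (Some i)" if "u \<in> W3" for u
    proof (cases "i = 0")
      case True
      then show ?thesis using ax[of u] that by (simp add: W3_def frsp_def M'_def)
    next
      case False
      then have "u = 0\<^sub>v ?f" using cW3[OF that] by (simp add: fdim_def carrier_vec_0)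
      then show ?thesis using mult_zero_vec[OF Q(3)] subspD(2)[OF Ui] by simp
    qed
    have Pmap: "P1 *\<^sub>v u \<in> W1" "P2 *\<^sub>v u \<in> W2" "P3 *\<^sub>v u \<in> W3" if "u \<in> U' (Some i)" for u
    proof -
      show "P1 *\<^sub>v u \<in> W1" using aY[OF i that] by (simp add: W1_def s_def Y'(1))
      show "P2 *\<^sub>v u \<in> W2" using aX[OF sr(2), of u] that by (simp add: W2_def X'(2) sr(5))
      show "P3 *\<^sub>v u \<in> W3"
        using ay[of u] that P(3) cUi[OF that] by (auto simp: W3_def frsp_def M'_def fdim_def)
    qed
    have BA_off: "B *\<^sub>v (A *\<^sub>v u) = P *\<^sub>v (Q *\<^sub>v u)"
      if "P * Q = B * A" "A \<in> carrier_mat ?n p" "B \<in> carrier_mat q ?n" "P \<in> carrier_mat q m" "Q \<in> carrier_mat m p"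
        "u \<in> carrier_vec p" for A B P Q :: "complex mat" and p q u
      using that by (metis assoc_mult_mat_vec)
    have BA_diag: "B *\<^sub>v (A *\<^sub>v u) = P *\<^sub>v (Q *\<^sub>v u) + c i \<cdot>\<^sub>v u"
      if "P * Q = B * A - c i \<cdot>\<^sub>m 1\<^sub>m p" "A \<in> carrier_mat ?n p" "B \<in> carrier_mat p ?n" "P \<in> carrier_mat p m"
        "Q \<in> carrier_mat m p" "u \<in> carrier_vec p" for A B P Q :: "complex mat" and p u
    proof -
      have cBA: "B * A \<in> carrier_mat p p" using that by auto
      have "P *\<^sub>v (Q *\<^sub>v u) = (B * A - c i \<cdot>\<^sub>m 1\<^sub>m p) *\<^sub>v u"
        unfolding that(1)[symmetric] by (rule assoc_mult_mat_vec[symmetric, OF that(4,5,6)])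
      also have "\<dots> = (B * A) *\<^sub>v u - (c i \<cdot>\<^sub>m 1\<^sub>m p) *\<^sub>v u"
        using cBA that(6) by (intro minus_mult_distrib_mat_vec) auto
      also have "(c i \<cdot>\<^sub>m 1\<^sub>m p) *\<^sub>v u = c i \<cdot>\<^sub>v u"
        by (rule smult_one_mult_vec[OF that(6)])
      also have "(B * A) *\<^sub>v u = B *\<^sub>v (A *\<^sub>v u)" by (rule assoc_mult_mat_vec[OF that(3,2,6)])
      finally show ?thesis using that by (auto intro!: eq_vecI)
    qed
    \<comment> \<open>A subrepresentation of \<open>M'\<close> is carried to \<open>M\<close> by
      taking at \<open>i\<close> the image of the subspaces at the neighbours. It is stable because
      \<open>B * A\<close> and \<open>P * Q\<close> differ by scalars only.\<close>
    define Ui' where "Ui' = sum3 A1 A2 A3 W1 W2 W3"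
    note s3 = sum3_facts[OF A W, folded Ui'_def]
    have Bmap: "B1 *\<^sub>v v \<in> W1 \<and> B2 *\<^sub>v v \<in> W2 \<and> B3 *\<^sub>v v \<in> W3" if "v \<in> Ui'" for v
    proof -
      obtain u1 u2 u3 where u: "u1 \<in> W1" "u2 \<in> W2" "u3 \<in> W3" "v = A1 *\<^sub>v u1 + A2 *\<^sub>v u2 + A3 *\<^sub>v u3"
        using \<open>v \<in> Ui'\<close> unfolding Ui'_def sum3_def by blast
      note cu = cW1[OF u(1)] cW2[OF u(2)] cW3[OF u(3)]
      have cA: "A1 *\<^sub>v u1 \<in> carrier_vec ?n" "A2 *\<^sub>v u2 \<in> carrier_vec ?n" "A3 *\<^sub>v u3 \<in> carrier_vec ?n"
        using A cu by auto
      have dist: "B *\<^sub>v v = B *\<^sub>v (A1 *\<^sub>v u1) + B *\<^sub>v (A2 *\<^sub>v u2) + B *\<^sub>v (A3 *\<^sub>v u3)"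
        if "B \<in> carrier_mat q ?n" for B :: "complex mat" and q
        unfolding u(4) mult_add_distrib_mat_vec[OF that add_carrier_vec[OF cA(1,2)] cA(3)]
          mult_add_distrib_mat_vec[OF that cA(1,2)] ..
      note q = Qmap[OF u(1)] Qmap2[OF u(2)] Qmap3[OF u(3)]
      have "B1 *\<^sub>v v \<in> W1"
        unfolding dist[OF B(1)] BA_diag[OF PQ(1) A(1) B(1) P(1) Q(1) cu(1)]
          BA_off[OF PQ(2) A(2) B(1) P(1) Q(2) cu(2)] BA_off[OF PQ(3) A(3) B(1) P(1) Q(3) cu(3)]
        by (intro subspD(3,4)[OF W(1)] Pmap q u(1))
      moreover have "B2 *\<^sub>v v \<in> W2"
        unfolding dist[OF B(2)] BA_diag[OF PQ(5) A(2) B(2) P(2) Q(2) cu(2)]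
          BA_off[OF PQ(4) A(1) B(2) P(2) Q(1) cu(1)] BA_off[OF PQ(6) A(3) B(2) P(2) Q(3) cu(3)]
        by (intro subspD(3,4)[OF W(2)] Pmap q u(2))
      moreover have "B3 *\<^sub>v v \<in> W3"
        unfolding dist[OF B(3)] BA_diag[OF PQ(9) A(3) B(3) P(3) Q(3) cu(3)]
          BA_off[OF PQ(7) A(1) B(3) P(3) Q(1) cu(1)] BA_off[OF PQ(8) A(2) B(3) P(3) Q(2) cu(2)]
        by (intro subspD(3,4)[OF W(3)] Pmap q u(3))
      ultimately show ?thesis by blast
    qed
    define U where "U = U'(Some i := Ui')"
    have UN: "U None = U' None" "U (Some i) = Ui'" "\<And>j. j \<noteq> i \<Longrightarrow> U (Some j) = U' (Some j)"
      by (auto simp: U_def)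
    have "subrep l (framed 1 \<alpha>) M U"
      unfolding subrep_framed_iff
    proof (intro conjI allI impI ballI)
      show "subsp (U None) 1" using sub'(1) by (simp add: UN)
      fix j assume j: "j < l"
      show "subsp (U (Some j)) (\<alpha> j)"
        using s3(1) sub'(2)[OF j] by (cases "j = i") (auto simp: UN \<alpha>'_def)
      show "qX M j *\<^sub>v u \<in> U (Some j)" if u: "u \<in> U (Some (succ_mod l j))" for u
      proof -
        consider "j = i" | "j = r" | "j \<noteq> i" "j \<noteq> r" by blast
        then show ?thesis
        proof cases
          case 1
          then show ?thesis using u s3(2)[of u] sr(3) by (simp add: UN s_def[symmetric] W1_def A1_def)
        next
          case 2
          then show ?thesis using u Bmap[of u] sr(4,5) by (simp add: UN W2_def B2_def)
        next
          case 3
          then show ?thesis using u aX[OF j, of u] succ_i[OF j] by (simp add: UN X')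
        qed
      qed
      show "qY M j *\<^sub>v u \<in> U (Some (succ_mod l j))" if u: "u \<in> U (Some j)" for u
      proof -
        consider "j = i" | "j = r" | "j \<noteq> i" "j \<noteq> r" by blast
        then show ?thesis
        proof cases
          case 1
          then show ?thesis using u Bmap[of u] sr(3) by (simp add: UN s_def[symmetric] W1_def B1_def)
        next
          case 2
          then have uW: "u \<in> W2" using u sr(4) by (simp add: UN W2_def)
          have "(- 1) \<cdot>\<^sub>v (A2 *\<^sub>v u) \<in> Ui'" using s3(3)[OF uW] by (rule subspD(4)[OF s3(1)])
          moreover have "(- 1) \<cdot>\<^sub>v (A2 *\<^sub>v u) = qY M r *\<^sub>v u"
            unfolding A2_def uminus_mat_vec[OF Yr cW2[OF uW]] by (simp add: smult_smult_assoc)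
          ultimately show ?thesis using 2 sr(5) by (simp add: UN)
        next
          case 3
          then show ?thesis using u aY[OF j, of u] succ_i[OF j] by (simp add: UN Y')
        qed
      qed
    next
      fix u assume u: "u \<in> U None"
      show "qx M *\<^sub>v u \<in> U (Some 0)"
      proof (cases "i = 0")
        case True
        then have "u \<in> W3" using u by (simp add: UN W3_def frsp_def)
        from s3(4)[OF this] show ?thesis using True UN(2) by (simp add: A3_def frin_def)
      next
        case False
        then show ?thesis using u ax[of u] by (simp add: UN M'_def)
      qed
    next
      fix u assume u: "u \<in> U (Some 0)"
      show "qy M *\<^sub>v u \<in> U None"
      proof (cases "i = 0")
        case True
        then have "B3 *\<^sub>v u \<in> W3" using Bmap[of u] u UN(2) by simp
        then show ?thesis using True by (simp add: UN W3_def frsp_def B3_def frout_def)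
      next
        case False
        then show ?thesis using u ay[of u] by (simp add: UN M'_def)
      qed
    qed
    with simple have dich: "(U None = {0\<^sub>v 1} \<and> (\<forall>j<l. U (Some j) = {0\<^sub>v (\<alpha> j)})) \<or>
      (U None = carrier_vec 1 \<and> (\<forall>j<l. U (Some j) = carrier_vec (\<alpha> j)))"
      unfolding simple_framed_iff by blast
    \<comment> \<open>A vector at the new vertex is recovered from its images at the neighbours, as
      \<open>c i \<noteq> 0\<close>. Hence the part of \<open>U'\<close> at \<open>i\<close> is zero
      or everything as soon as the neighbouring parts are.\<close>
    have scal: "(- c i) \<cdot>\<^sub>v u = Q1 *\<^sub>v (P1 *\<^sub>v u) + Q2 *\<^sub>v (P2 *\<^sub>v u) + Q3 *\<^sub>v (P3 *\<^sub>v u)"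
      if u: "u \<in> carrier_vec m" for u
    proof -
      have cc: "Q1 * P1 \<in> carrier_mat m m" "Q2 * P2 \<in> carrier_mat m m" "Q3 * P3 \<in> carrier_mat m m"
        using P Q by auto
      have "(- c i) \<cdot>\<^sub>v u = ((- c i) \<cdot>\<^sub>m 1\<^sub>m m) *\<^sub>v u"
        by (rule smult_one_mult_vec[OF u, symmetric])
      also have "\<dots> = (Q1 * P1) *\<^sub>v u + (Q2 * P2) *\<^sub>v u + (Q3 * P3) *\<^sub>v u"
        unfolding QP[symmetric] add_mult_distrib_mat_vec[OF add_carrier_mat[OF cc(2)] cc(3) u]
          add_mult_distrib_mat_vec[OF cc(1,2) u] ..
      finally show ?thesis using P Q u by (simp add: assoc_mult_mat_vec)
    qed
    from dich show "(U' None = {0\<^sub>v 1} \<and> (\<forall>j<l. U' (Some j) = {0\<^sub>v (\<alpha>' j)})) \<or>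
      (U' None = carrier_vec 1 \<and> (\<forall>j<l. U' (Some j) = carrier_vec (\<alpha>' j)))"
    proof
      assume z: "U None = {0\<^sub>v 1} \<and> (\<forall>j<l. U (Some j) = {0\<^sub>v (\<alpha> j)})"
      then have z': "U' None = {0\<^sub>v 1}" "\<And>j. j < l \<Longrightarrow> j \<noteq> i \<Longrightarrow> U' (Some j) = {0\<^sub>v (\<alpha> j)}"
        using UN by auto
      have Wz: "W1 = {0\<^sub>v (\<alpha> s)}" "W2 = {0\<^sub>v (\<alpha> r)}" "W3 = {0\<^sub>v ?f}"
        using z' sr by (auto simp: W1_def W2_def W3_def frsp_def fdim_def carrier_vec_0)
      have "u = 0\<^sub>v m" if u: "u \<in> U' (Some i)" for u
      proof -
        have "P1 *\<^sub>v u = 0\<^sub>v (\<alpha> s)" "P2 *\<^sub>v u = 0\<^sub>v (\<alpha> r)" "P3 *\<^sub>v u = 0\<^sub>v ?f"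
          using Pmap[OF u] Wz by auto
        then have *: "(- c i) \<cdot>\<^sub>v u = 0\<^sub>v m"
          using scal[OF cUi[OF u]] mult_zero_vec[OF Q(1)] mult_zero_vec[OF Q(2)] mult_zero_vec[OF Q(3)] by simp
        have "u = inverse (- c i) \<cdot>\<^sub>v ((- c i) \<cdot>\<^sub>v u)" using ci by (simp add: smult_smult_assoc)
        moreover have "inverse (- c i) \<cdot>\<^sub>v 0\<^sub>v m = 0\<^sub>v m" by (intro eq_vecI) auto
        ultimately show ?thesis unfolding * by (rule trans)
      qed
      then have "U' (Some i) = {0\<^sub>v m}" using subspD(2)[OF Ui] by blast
      then have "U' (Some j) = {0\<^sub>v (\<alpha>' j)}" if "j < l" for j
        using z'(2)[OF that] by (cases "j = i") (auto simp: \<alpha>'_def)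
      with z'(1) show ?thesis by blast
    next
      assume z: "U None = carrier_vec 1 \<and> (\<forall>j<l. U (Some j) = carrier_vec (\<alpha> j))"
      then have z': "U' None = carrier_vec 1" "\<And>j. j < l \<Longrightarrow> j \<noteq> i \<Longrightarrow> U' (Some j) = carrier_vec (\<alpha> j)"
        using UN by auto
      have Wz: "W1 = carrier_vec (\<alpha> s)" "W2 = carrier_vec (\<alpha> r)" "W3 = carrier_vec ?f"
        using z' sr by (auto simp: W1_def W2_def W3_def frsp_def fdim_def)
      have "u \<in> U' (Some i)" if u: "u \<in> carrier_vec m" for u
      proof -
        have "(- c i) \<cdot>\<^sub>v u \<in> U' (Some i)"
          unfolding scal[OF u]
          by (intro subspD(3)[OF Ui] Qmap Qmap2 Qmap3) (use P u Wz in auto)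
        then have "inverse (- c i) \<cdot>\<^sub>v ((- c i) \<cdot>\<^sub>v u) \<in> U' (Some i)" by (rule subspD(4)[OF Ui])
        then show ?thesis using ci by (simp add: smult_smult_assoc)
      qed
      then have "U' (Some i) = carrier_vec m" using cUi by blast
      then have "U' (Some j) = carrier_vec (\<alpha>' j)" if "j < l" for j
        using z'(2)[OF that] by (cases "j = i") (auto simp: \<alpha>'_def)
      with z'(1) show ?thesis by blast
    qed
  qed
  have "int m = int (\<alpha> i) + defect l (\<lambda>j. int (\<alpha> j)) i"
    using m by (cases "i = 0") (simp_all add: defect_def s_def r_def fdim_def)
  then show thesis using that[of M' m] M'mom simple' by (simp add: \<alpha>'_def)
qed

text \<open>At a vertex with \<open>c i = 0\<close> the composite of the maps out of and into \<open>i\<close> vanishes, while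
  simplicity makes the first one injective and the second one surjective.\<close>

lemma simple_defect_nonneg:
  assumes l: "2 \<le> l" and i: "i < l" and M: "M \<in> moment_fiber l c \<alpha>"
    and simple: "simple_rep l (framed 1 \<alpha>) M" and ci: "c i = 0"
  shows "0 \<le> defect l (\<lambda>j. int (\<alpha> j)) i"
proof -
  define s r where "s = succ_mod l i" and "r = pred_mod l i"
  have l0: "l > 0" using l by simp
  have sr: "s < l" "r < l" "s \<noteq> i" "r \<noteq> i" "succ_mod l r = i" "pred_mod l s = i"
    using l i l0 by (auto simp: s_def r_def succ_mod_less pred_mod_less succ_mod_neq pred_mod_neq
      succ_pred_mod pred_succ_mod)
  have succ_i: "succ_mod l j = i \<longleftrightarrow> j = r" if "j < l" for j
    using that sr(5) pred_succ_mod[OF that] r_def by auto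
  have Mr: "M \<in> rep_space l (framed 1 \<alpha>)" using M by (simp add: moment_fiber_def)
  let ?n = "\<alpha> i" and ?f = "fdim i"
  define A1 A2 A3 where "A1 = qX M i" and "A2 = - qY M r" and "A3 = frin i ?n M"
  define B1 B2 B3 where "B1 = qY M i" and "B2 = qX M r" and "B3 = frout i ?n M"
  have Yr: "qY M r \<in> carrier_mat ?n (\<alpha> r)" using rep_spaceD(2)[OF Mr sr(2)] sr(5) by simp
  have A: "A1 \<in> carrier_mat ?n (\<alpha> s)" "A2 \<in> carrier_mat ?n (\<alpha> r)" "A3 \<in> carrier_mat ?n ?f"
    using rep_spaceD(1)[OF Mr i] Yr frin_carrier[OF Mr, of i] sr(5)
    by (auto simp: A1_def A2_def A3_def s_def)
  have B: "B1 \<in> carrier_mat (\<alpha> s) ?n" "B2 \<in> carrier_mat (\<alpha> r) ?n" "B3 \<in> carrier_mat ?f ?n"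
    using rep_spaceD(2)[OF Mr i] rep_spaceD(1)[OF Mr sr(2)] frout_carrier[OF Mr, of i] sr(5)
    by (auto simp: B1_def B2_def B3_def s_def)
  have AB: "A1 * B1 + A2 * B2 + A3 * B3 = 0\<^sub>m ?n ?n"
    using moment_at[OF M i] ci unfolding A1_def A2_def A3_def B1_def B2_def B3_def r_def
    by (auto intro!: eq_matI)
  have A23: "hcat A2 A3 \<in> carrier_mat ?n (\<alpha> r + ?f)" and B23: "vcat B2 B3 \<in> carrier_mat (\<alpha> r + ?f) ?n"
    using A B by auto
  let ?A = "hcat A1 (hcat A2 A3)" and ?B = "vcat B1 (vcat B2 B3)"
  have "2 * ?n \<le> \<alpha> s + (\<alpha> r + ?f)"
  proof (rule exact_dim_le)
    show "?A \<in> carrier_mat ?n (\<alpha> s + (\<alpha> r + ?f))" using A(1) A23 by auto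
    show "?B \<in> carrier_mat (\<alpha> s + (\<alpha> r + ?f)) ?n" using B(1) B23 by auto
    have "A1 * B1 \<in> carrier_mat ?n ?n" "A2 * B2 \<in> carrier_mat ?n ?n" "A3 * B3 \<in> carrier_mat ?n ?n"
      using A B by auto
    then show "?A * ?B = 0\<^sub>m ?n ?n"
      unfolding hcat_mult_vcat[OF A(1) A23 B(1) B23] hcat_mult_vcat[OF A(2,3) B(2,3)] AB[symmetric]
      by (simp add: assoc_add_mat[of _ ?n ?n])
  next
    fix v assume v: "v \<in> carrier_vec ?n" and Bv: "?B *\<^sub>v v = 0\<^sub>v (\<alpha> s + (\<alpha> r + ?f))"
    define K where "K = {v \<in> carrier_vec ?n. B1 *\<^sub>v v = 0\<^sub>v (\<alpha> s) \<and> B2 *\<^sub>v v = 0\<^sub>v (\<alpha> r) \<and> B3 *\<^sub>v v = 0\<^sub>v ?f}"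
    have zz: "0\<^sub>v (\<alpha> s + (\<alpha> r + ?f)) = 0\<^sub>v (\<alpha> s) @\<^sub>v (0\<^sub>v (\<alpha> r) @\<^sub>v (0\<^sub>v ?f :: complex vec))"
      by (auto intro!: eq_vecI)
    have "(B1 *\<^sub>v v) @\<^sub>v ((B2 *\<^sub>v v) @\<^sub>v (B3 *\<^sub>v v)) = 0\<^sub>v (\<alpha> s) @\<^sub>v (0\<^sub>v (\<alpha> r) @\<^sub>v 0\<^sub>v ?f)"
      using Bv unfolding zz vcat_mult_vec[OF B(1) B23 v] vcat_mult_vec[OF B(2,3) v] .
    then have vK: "v \<in> K"
      using B v append_vec_eq[of "B1 *\<^sub>v v" "\<alpha> s" "0\<^sub>v (\<alpha> s)"] append_vec_eq[of "B2 *\<^sub>v v" "\<alpha> r" "0\<^sub>v (\<alpha> r)"]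
      by (auto simp: K_def)
    have subK: "subsp K ?n"
    proof (rule subspI)
      show "0\<^sub>v ?n \<in> K"
        using mult_zero_vec[OF B(1)] mult_zero_vec[OF B(2)] mult_zero_vec[OF B(3)] by (simp add: K_def)
      show "u + w \<in> K" if "u \<in> K" "w \<in> K" for u w
        using that B by (auto simp: K_def mult_add_distrib_mat_vec[of _ _ ?n])
      show "a \<cdot>\<^sub>v u \<in> K" if "u \<in> K" for a u
        using that B by (auto simp: K_def mult_mat_vec_smult[of _ _ ?n])
    qed (simp add: K_def)
    \<comment> \<open>The common kernel at \<open>i\<close> with zero elsewhere is a
      subrepresentation that does not contain the space at infinity.\<close>
    define U where "U = (\<lambda>v. case v of None \<Rightarrow> {0\<^sub>v 1} | Some j \<Rightarrow> if j = i then K else {0\<^sub>v (\<alpha> j)})"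
    have z: "0\<^sub>v ?n \<in> K" using subspD(2)[OF subK] .
    have "subrep l (framed 1 \<alpha>) M U"
      unfolding subrep_framed_iff
    proof (intro conjI allI impI ballI)
      show "subsp (U None) 1" by (simp add: U_def subsp_zero)
      fix j assume j: "j < l"
      show "subsp (U (Some j)) (\<alpha> j)" using subK by (simp add: U_def subsp_zero)
      show "qX M j *\<^sub>v u \<in> U (Some j)" if u: "u \<in> U (Some (succ_mod l j))" for u
      proof (cases "j = r")
        case True
        then show ?thesis using u sr(4,5) by (simp add: U_def K_def B2_def)
      next
        case False
        then have "u = 0\<^sub>v (\<alpha> (succ_mod l j))" using u succ_i[OF j] by (simp add: U_def)
        then have "qX M j *\<^sub>v u = 0\<^sub>v (\<alpha> j)" using mult_zero_vec[OF rep_spaceD(1)[OF Mr j]] by simp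
        then show ?thesis using z by (simp add: U_def)
      qed
      show "qY M j *\<^sub>v u \<in> U (Some (succ_mod l j))" if u: "u \<in> U (Some j)" for u
      proof (cases "j = i")
        case True
        then show ?thesis using u sr(3) by (simp add: U_def K_def B1_def s_def)
      next
        case False
        then have "u = 0\<^sub>v (\<alpha> j)" using u by (simp add: U_def)
        then have "qY M j *\<^sub>v u = 0\<^sub>v (\<alpha> (succ_mod l j))" using mult_zero_vec[OF rep_spaceD(2)[OF Mr j]] by simp
        then show ?thesis using z by (simp add: U_def)
      qed
    next
      fix u assume "u \<in> U None"
      then have "qx M *\<^sub>v u = 0\<^sub>v (\<alpha> 0)" using mult_zero_vec[OF rep_spaceD(3)[OF Mr]] by (simp add: U_def)
      then show "qx M *\<^sub>v u \<in> U (Some 0)" using z by (auto simp: U_def)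
    next
      fix u assume u: "u \<in> U (Some 0)"
      show "qy M *\<^sub>v u \<in> U None"
      proof (cases "i = 0")
        case True
        then show ?thesis using u by (simp add: U_def K_def B3_def frout_def fdim_def)
      next
        case False
        then show ?thesis using u mult_zero_vec[OF rep_spaceD(4)[OF Mr]] by (simp add: U_def)
      qed
    qed
    then have "U (Some i) = {0\<^sub>v ?n}"
      using simple i carrier_vec_1_neq unfolding simple_framed_iff by (fastforce simp: U_def)
    then show "v = 0\<^sub>v ?n" using vK by (simp add: U_def)
  next
    fix w :: "complex vec" assume w: "w \<in> carrier_vec ?n"
    let ?S = "sum3 A1 A2 A3 (carrier_vec (\<alpha> s)) (carrier_vec (\<alpha> r)) (carrier_vec ?f)"
    note s3 = sum3_facts[OF A subsp_full subsp_full subsp_full]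
    \<comment> \<open>The image at \<open>i\<close> with the full spaces elsewhere is a
      subrepresentation that contains the space at infinity.\<close>
    define U where "U = (\<lambda>v. case v of None \<Rightarrow> carrier_vec 1 | Some j \<Rightarrow> if j = i then ?S else carrier_vec (\<alpha> j))"
    have Scar: "v \<in> carrier_vec ?n" if "v \<in> ?S" for v using subspD(1)[OF s3(1) that] .
    have "subrep l (framed 1 \<alpha>) M U"
      unfolding subrep_framed_iff
    proof (intro conjI allI impI ballI)
      show "subsp (U None) 1" by (simp add: U_def subsp_full)
      fix j assume j: "j < l"
      show "subsp (U (Some j)) (\<alpha> j)" using s3(1) by (simp add: U_def subsp_full)
      have Ucar: "U (Some k) \<subseteq> carrier_vec (\<alpha> k)" for k using Scar by (auto simp: U_def)
      show "qX M j *\<^sub>v u \<in> U (Some j)" if u: "u \<in> U (Some (succ_mod l j))" for u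
      proof (cases "j = i")
        case True
        then have "u \<in> carrier_vec (\<alpha> s)" using u sr(3) by (simp add: U_def s_def)
        from s3(2)[OF this] show ?thesis using True by (simp add: U_def A1_def)
      next
        case False
        have "u \<in> carrier_vec (\<alpha> (succ_mod l j))" using u Ucar by blast
        then show ?thesis using False rep_spaceD(1)[OF Mr j] by (auto simp: U_def)
      qed
      show "qY M j *\<^sub>v u \<in> U (Some (succ_mod l j))" if u: "u \<in> U (Some j)" for u
      proof (cases "j = r")
        case True
        then have uc: "u \<in> carrier_vec (\<alpha> r)" using u sr(4) by (simp add: U_def)
        have "(- 1) \<cdot>\<^sub>v (A2 *\<^sub>v u) \<in> ?S" using s3(3)[OF uc] by (rule subspD(4)[OF s3(1)])
        moreover have "(- 1) \<cdot>\<^sub>v (A2 *\<^sub>v u) = qY M r *\<^sub>v u"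
          unfolding A2_def uminus_mat_vec[OF Yr uc] by (simp add: smult_smult_assoc)
        ultimately show ?thesis using True sr(5) by (simp add: U_def)
      next
        case False
        have "u \<in> carrier_vec (\<alpha> j)" using u Ucar by blast
        then show ?thesis using False rep_spaceD(2)[OF Mr j] succ_i[OF j] by (auto simp: U_def)
      qed
    next
      fix u assume u: "u \<in> U None"
      then have uc: "u \<in> carrier_vec 1" by (simp add: U_def)
      show "qx M *\<^sub>v u \<in> U (Some 0)"
      proof (cases "i = 0")
        case True
        then have "u \<in> carrier_vec ?f" using uc by (simp add: fdim_def)
        from s3(4)[OF this] show ?thesis using True by (simp add: U_def A3_def frin_def)
      next
        case False
        then show ?thesis using uc rep_spaceD(3)[OF Mr] by (auto simp: U_def)
      qed
    next
      fix u assume "u \<in> U (Some 0)"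
      then have "u \<in> carrier_vec (\<alpha> 0)" using Scar by (auto simp: U_def split: if_splits)
      then show "qy M *\<^sub>v u \<in> U None" using rep_spaceD(4)[OF Mr] by (auto simp: U_def)
    qed
    then have "U (Some i) = carrier_vec ?n"
      using simple i carrier_vec_1_neq unfolding simple_framed_iff by (fastforce simp: U_def)
    then have "w \<in> ?S" using w by (simp add: U_def)
    then obtain u1 u2 u3 where u: "u1 \<in> carrier_vec (\<alpha> s)" "u2 \<in> carrier_vec (\<alpha> r)" "u3 \<in> carrier_vec ?f"
      "w = A1 *\<^sub>v u1 + A2 *\<^sub>v u2 + A3 *\<^sub>v u3" unfolding sum3_def by blast
    have u23: "u2 @\<^sub>v u3 \<in> carrier_vec (\<alpha> r + ?f)" using u by auto
    have "?A *\<^sub>v (u1 @\<^sub>v (u2 @\<^sub>v u3)) = A1 *\<^sub>v u1 + (A2 *\<^sub>v u2 + A3 *\<^sub>v u3)"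
      unfolding hcat_mult_vec[OF A(1) A23 u(1) u23] hcat_mult_vec[OF A(2,3) u(2,3)] ..
    also have "\<dots> = w" unfolding u(4) using A u by (subst assoc_add_vec[of _ ?n]) auto
    finally show "\<exists>u\<in>carrier_vec (\<alpha> s + (\<alpha> r + ?f)). ?A *\<^sub>v u = w"
      using u u23 by (intro bexI[of _ "u1 @\<^sub>v (u2 @\<^sub>v u3)"]) auto
  qed
  then show ?thesis by (cases "i = 0") (simp_all add: defect_def s_def r_def fdim_def)
qed

section \<open>Unframed representations\<close>

text \<open>A primitive \<open>potential c\<close> of the parameter, viewed as an \<open>l\<close>-periodic function on the integers.\<close>

definition potential :: "nat \<Rightarrow> (nat \<Rightarrow> complex) \<Rightarrow> int \<Rightarrow> complex" where
  "potential l c p = (\<Sum>k\<in>{0<..p}. c (cls l k)) - (\<Sum>k\<in>{p<..0}. c (cls l k))"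

lemma potential_step: "potential l c p = potential l c (p - 1) + c (cls l p)"
proof (cases "0 < p")
  case True
  have "{0<..p} = insert p {0<..p - 1}" using True by auto
  then show ?thesis using True by (simp add: potential_def)
next
  case False
  have "{p - 1<..0} = insert p {p<..0}" using False by auto
  then show ?thesis using False by (simp add: potential_def)
qed

lemma int_constantI:
  fixes D :: "int \<Rightarrow> 'a"
  assumes "\<And>p. D p = D (p - 1)"
  shows "D p = D q"
proof -
  have "D p = D 0" for p
  proof (induction p rule: int_induct[where k = 0])
    case (step1 i)
    then show ?case using assms[of "i + 1"] by simp
  next
    case (step2 i)
    then show ?case using assms[of i] by simp
  qed simp
  then show ?thesis by metis
qed

lemma sum_over_period:
  assumes "l > 0"
  shows "(\<Sum>j<l. c (cls l (p + int j))) = (\<Sum>i<l. c i)"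
proof (rule sum.reindex_bij_betw)
  have inj: "inj_on (\<lambda>j. cls l (p + int j)) {..<l}"
  proof (rule inj_onI)
    fix x y assume *: "x \<in> {..<l}" "y \<in> {..<l}" "cls l (p + int x) = cls l (p + int y)"
    have "p + int x = p + int y" by (rule cls_inj_window[OF assms *(3)]) (use * in auto)
    then show "x = y" by simp
  qed
  moreover have "(\<lambda>j. cls l (p + int j)) ` {..<l} = {..<l}"
    by (rule card_subset_eq) (use assms inj in \<open>auto simp: card_image cls_less\<close>)
  ultimately show "bij_betw (\<lambda>j. cls l (p + int j)) {..<l} {..<l}" by (simp add: bij_betw_def)
qed

lemma potential_period1:
  assumes "l > 0"
  shows "potential l c (p + int l) = potential l c p + (\<Sum>i<l. c i)"
proof -
  have "potential l c (p + int m) = potential l c p + (\<Sum>j<m. c (cls l (p + 1 + int j)))" for m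
  proof (induction m)
    case (Suc m)
    have "potential l c (p + int (Suc m)) = potential l c (p + int m) + c (cls l (p + 1 + int m))"
      using potential_step[of l c "p + int (Suc m)"] by (simp add: algebra_simps)
    then show ?case using Suc by simp
  qed simp
  then show ?thesis using sum_over_period[OF assms, of c "p + 1"] by simp
qed

lemma potential_period:
  assumes "l > 0"
  shows "potential l c (p + int l * m) = potential l c p + of_int m * (\<Sum>i<l. c i)"
proof -
  define D where "D = (\<lambda>m. potential l c (p + int l * m) - of_int m * (\<Sum>i<l. c i))"
  have "D m = D 0"
  proof (rule int_constantI)
    fix k
    have "potential l c (p + int l * (k - 1) + int l) = potential l c (p + int l * (k - 1)) + (\<Sum>i<l. c i)"
      by (rule potential_period1[OF assms])
    then show "D k = D (k - 1)" by (simp add: D_def algebra_simps)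
  qed
  then show ?thesis by (simp add: D_def algebra_simps)
qed

lemma potential_window_sum:
  "p \<le> q \<Longrightarrow> potential l c q - potential l c p = (\<Sum>k\<in>{p<..q}. c (cls l k))"
proof (induction q rule: int_ge_induct)
  case (step q)
  have "{p<..q + 1} = insert (q + 1) {p<..q}" using step by auto
  then show ?case using step potential_step[of l c "q + 1"] by simp
qed simp

text \<open>The reflection permutes the potential by \<open>sig l i\<close> up to an additive
  constant. Differences are compared because the normalization at 0 is not preserved:
  \<open>sig l i\<close> may move 0.\<close>

lemma potential_reflect:
  assumes "2 \<le> l" "i < l"
  shows "potential l (weyl_refl l i c) p - potential l (weyl_refl l i c) q =
    potential l c (sig l i p) - potential l c (sig l i q)"
proof -
  let ?t = "potential l c" and ?t' = "potential l (weyl_refl l i c)"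
  define D where "D = (\<lambda>p. ?t' p - ?t (sig l i p))"
  have l: "l > 0" using assms by simp
  have "D p = D q"
  proof (rule int_constantI)
    fix p
    have n: "cls l (j + 1) \<noteq> cls l j" for j
      using assms succ_mod_neq[of l "cls l j"] by (simp add: cls_succ cls_less)
    have w: "weyl_refl l i c (cls l p) =
      (if cls l p = i then - c i else
         c (cls l p) + (of_bool (cls l (p - 1) = i) + of_bool (cls l (p + 1) = i)) * c i)"
    proof (cases "cls l p = i")
      case True
      then show ?thesis using assms cartan_cases(1)[OF assms] by (simp add: weyl_refl_def)
    next
      case False
      have "cls l p = succ_mod l i \<longleftrightarrow> cls l (p - 1) = i" "cls l p = pred_mod l i \<longleftrightarrow> cls l (p + 1) = i"
        using cls_pred_eq_iff[OF assms(2), of p] cls_succ_eq_iff[OF assms(2), of p] by auto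
      then show ?thesis
        using False l cartan_cases(2)[OF assms False] by (simp add: weyl_refl_def cls_less)
    qed
    have s: "?t' p = ?t' (p - 1) + weyl_refl l i c (cls l p)" by (rule potential_step)
    have t0: "?t p = ?t (p - 1) + c (cls l p)" by (rule potential_step)
    have tm: "?t (p - 1) = ?t (p - 2) + c (cls l (p - 1))"
      using potential_step[of l c "p - 1"] by simp
    have tp: "?t (p + 1) = ?t p + c (cls l (p + 1))"
      using potential_step[of l c "p + 1"] by simp
    consider "cls l p = i" | "cls l p \<noteq> i" by blast
    then show "D p = D (p - 1)"
    proof cases
      case 1
      then have "sig l i p = p - 1" "sig l i (p - 1) = p"
        using n[of "p - 1"] by (auto simp: sig_def)
      then show ?thesis using 1 s w t0 by (simp add: D_def)
    next
      case 2
      have "sig l i p = (if cls l (p + 1) = i then p + 1 else p)"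
        "sig l i (p - 1) = (if cls l (p - 1) = i then p - 2 else p - 1)"
        using 2 by (auto simp: sig_def)
      then show ?thesis using 2 s w t0 tm tp by (auto simp: D_def algebra_simps)
    qed
  qed
  then show ?thesis by (simp add: D_def algebra_simps)
qed

text \<open>The sum is the increment of the potential over one period, and \<open>sig l i\<close>
  commutes with translation by a period.\<close>

lemma sum_weyl_refl:
  assumes "2 \<le> l" "i < l"
  shows "(\<Sum>j<l. weyl_refl l i c j) = (\<Sum>j<l. c j)"
proof -
  have l: "l > 0" using assms by simp
  have "(\<Sum>j<l. weyl_refl l i c j) = potential l (weyl_refl l i c) (0 + int l) - potential l (weyl_refl l i c) 0"
    using potential_period1[OF l, of "weyl_refl l i c" 0] by simp
  also have "\<dots> = potential l c (sig l i (0 + int l * 1)) - potential l c (sig l i 0)"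
    unfolding potential_reflect[OF assms] by simp
  also have "\<dots> = (\<Sum>j<l. c j)"
    unfolding sig_shift[OF l] using potential_period1[OF l, of c "sig l i 0"] by simp
  finally show ?thesis .
qed

lemma minus_eq_smultD:
  fixes x v :: "complex vec"
  assumes "x \<in> carrier_vec n" "v \<in> carrier_vec n"
  shows "z \<cdot>\<^sub>v v - x = k \<cdot>\<^sub>v v \<Longrightarrow> x = (z - k) \<cdot>\<^sub>v v"
    and "x - z \<cdot>\<^sub>v v = k \<cdot>\<^sub>v v \<Longrightarrow> x = (z + k) \<cdot>\<^sub>v v"
proof -
  assume eq: "z \<cdot>\<^sub>v v - x = k \<cdot>\<^sub>v v"
  have *: "(z \<cdot>\<^sub>v v - x) $ a = (k \<cdot>\<^sub>v v) $ a" for a using eq by simp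
  have "z * v $ a - x $ a = k * v $ a" if "a < n" for a using *[of a] that assms by simp
  then show "x = (z - k) \<cdot>\<^sub>v v" using assms by (intro eq_vecI) (auto simp: algebra_simps)
next
  assume eq: "x - z \<cdot>\<^sub>v v = k \<cdot>\<^sub>v v"
  have *: "(x - z \<cdot>\<^sub>v v) $ a = (k \<cdot>\<^sub>v v) $ a" for a using eq by simp
  have "x $ a - z * v $ a = k * v $ a" if "a < n" for a using *[of a] that assms by simp
  then show "x = (z + k) \<cdot>\<^sub>v v" using assms by (intro eq_vecI) (auto simp: algebra_simps)
qed

text \<open>Eigenvectors of \<open>X * Y\<close> can be pushed along the cycle as long as the eigenvalue does not vanish.
  There are only finitely many eigenvalues and a full turn shifts them by \<open>\<Sum>i<l. c i\<close>, so the chain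
  stops on both sides.\<close>

lemma unframed_chain:
  assumes l: "l > 0" and cd: "(\<Sum>i<l. c i) \<noteq> 0"
    and X: "\<And>i. i < l \<Longrightarrow> X i \<in> carrier_mat (\<beta> i) (\<beta> (succ_mod l i))"
    and Y: "\<And>i. i < l \<Longrightarrow> Y i \<in> carrier_mat (\<beta> (succ_mod l i)) (\<beta> i)"
    and rel: "\<And>i. i < l \<Longrightarrow> X i * Y i - Y (pred_mod l i) * X (pred_mod l i) = c i \<cdot>\<^sub>m 1\<^sub>m (\<beta> i)"
    and i: "i < l" "\<beta> i \<noteq> 0"
  obtains p q where "p < int i" "int i \<le> q" "potential l c p = potential l c q"
proof -
  \<comment> \<open>\<open>E k z\<close> says that \<open>z\<close> is an eigenvalue of
    \<open>X * Y\<close> at the vertex below the integer \<open>k\<close>; the chain runs on the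
    universal cover of the cycle.\<close>
  define E where "E = (\<lambda>k z. \<exists>v\<in>carrier_vec (\<beta> (cls l k)). v \<noteq> 0\<^sub>v (\<beta> (cls l k)) \<and>
    (X (cls l k) * Y (cls l k)) *\<^sub>v v = z \<cdot>\<^sub>v v)"
  have XY: "X j * Y j \<in> carrier_mat (\<beta> j) (\<beta> j)" if "j < l" for j using X[OF that] Y[OF that] by auto
  have smult_neq: "z \<cdot>\<^sub>v v \<noteq> 0\<^sub>v m" if "z \<noteq> 0" "v \<in> carrier_vec m" "v \<noteq> 0\<^sub>v m" for z :: complex and v m
  proof
    assume "z \<cdot>\<^sub>v v = 0\<^sub>v m"
    then have "inverse z \<cdot>\<^sub>v (z \<cdot>\<^sub>v v) = 0\<^sub>v m" by (auto intro!: eq_vecI)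
    then show False using that by (simp add: smult_smult_assoc)
  qed
  have YX: "Y j *\<^sub>v (X j *\<^sub>v v) = (z - c (succ_mod l j)) \<cdot>\<^sub>v v"
    if j: "j < l" and v: "v \<in> carrier_vec (\<beta> (succ_mod l j))"
      and ev: "(X (succ_mod l j) * Y (succ_mod l j)) *\<^sub>v v = z \<cdot>\<^sub>v v" for j z v
  proof -
    let ?k = "succ_mod l j"
    have k: "?k < l" by (rule succ_mod_less[OF l])
    have pk: "pred_mod l ?k = j" by (rule pred_succ_mod[OF j])
    have cYX: "Y j * X j \<in> carrier_mat (\<beta> ?k) (\<beta> ?k)" using X[OF j] Y[OF j] by auto
    have "X ?k * Y ?k - Y j * X j = c ?k \<cdot>\<^sub>m 1\<^sub>m (\<beta> ?k)" using rel[OF k] unfolding pk .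
    then have "(X ?k * Y ?k - Y j * X j) *\<^sub>v v = c ?k \<cdot>\<^sub>v v" using smult_one_mult_vec[OF v] by simp
    then have "z \<cdot>\<^sub>v v - (Y j * X j) *\<^sub>v v = c ?k \<cdot>\<^sub>v v"
      unfolding minus_mult_distrib_mat_vec[OF XY[OF k] cYX v] ev .
    moreover have "(Y j * X j) *\<^sub>v v = Y j *\<^sub>v (X j *\<^sub>v v)"
      by (rule assoc_mult_mat_vec[OF Y[OF j] X[OF j] v])
    moreover have "Y j *\<^sub>v (X j *\<^sub>v v) \<in> carrier_vec (\<beta> ?k)" using X[OF j] Y[OF j] v by auto
    ultimately have eq: "z \<cdot>\<^sub>v v - Y j *\<^sub>v (X j *\<^sub>v v) = c ?k \<cdot>\<^sub>v v"
      and cv: "Y j *\<^sub>v (X j *\<^sub>v v) \<in> carrier_vec (\<beta> ?k)" by auto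
    show ?thesis by (rule minus_eq_smultD(1)[OF cv v eq])
  qed
  have up: "E (k + 1) (z + c (cls l (k + 1)))" if Ek: "E k z" and z: "z \<noteq> 0" for k z
  proof -
    let ?j = "cls l k"
    have j: "?j < l" by (rule cls_less[OF l])
    have sj: "cls l (k + 1) = succ_mod l ?j" by (rule cls_succ[OF l])
    obtain v where v: "v \<in> carrier_vec (\<beta> ?j)" "v \<noteq> 0\<^sub>v (\<beta> ?j)" "(X ?j * Y ?j) *\<^sub>v v = z \<cdot>\<^sub>v v"
      using Ek unfolding E_def by blast
    let ?w = "Y ?j *\<^sub>v v"
    have w: "?w \<in> carrier_vec (\<beta> (succ_mod l ?j))" using Y[OF j] v(1) by auto
    have XYv: "X ?j *\<^sub>v ?w = z \<cdot>\<^sub>v v" using assoc_mult_mat_vec[OF X[OF j] Y[OF j] v(1)] v(3) by simp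
    have nz: "?w \<noteq> 0\<^sub>v (\<beta> (succ_mod l ?j))"
    proof
      assume "?w = 0\<^sub>v (\<beta> (succ_mod l ?j))"
      then have "z \<cdot>\<^sub>v v = 0\<^sub>v (\<beta> ?j)" using XYv mult_zero_vec[OF X[OF j]] by simp
      with smult_neq[OF z v(1,2)] show False by simp
    qed
    let ?s = "succ_mod l ?j"
    have s: "?s < l" by (rule succ_mod_less[OF l])
    have cYX: "Y ?j * X ?j \<in> carrier_mat (\<beta> ?s) (\<beta> ?s)" using X[OF j] Y[OF j] by auto
    have r: "X ?s * Y ?s - Y ?j * X ?j = c ?s \<cdot>\<^sub>m 1\<^sub>m (\<beta> ?s)"
      using rel[OF s] unfolding pred_succ_mod[OF j] .
    have "(X ?s * Y ?s) *\<^sub>v ?w - (Y ?j * X ?j) *\<^sub>v ?w = c ?s \<cdot>\<^sub>v ?w"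
      unfolding minus_mult_distrib_mat_vec[OF XY[OF s] cYX w, symmetric] r by (rule smult_one_mult_vec[OF w])
    moreover have "(Y ?j * X ?j) *\<^sub>v ?w = z \<cdot>\<^sub>v ?w"
      unfolding assoc_mult_mat_vec[OF Y[OF j] X[OF j] w] XYv by (rule mult_mat_vec_smult[OF Y[OF j] v(1)])
    ultimately have eq: "(X ?s * Y ?s) *\<^sub>v ?w - z \<cdot>\<^sub>v ?w = c ?s \<cdot>\<^sub>v ?w" by simp
    have cw: "(X ?s * Y ?s) *\<^sub>v ?w \<in> carrier_vec (\<beta> ?s)" using XY[OF s] w by auto
    have "(X ?s * Y ?s) *\<^sub>v ?w = (z + c ?s) \<cdot>\<^sub>v ?w"
      by (rule minus_eq_smultD(2)[OF cw w eq])
    then show ?thesis unfolding E_def sj using w nz by blast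
  qed
  have down: "E (k - 1) (z - c (cls l k))" if Ek: "E k z" and z: "z \<noteq> c (cls l k)" for k z
  proof -
    let ?j = "cls l (k - 1)"
    have j: "?j < l" by (rule cls_less[OF l])
    have sj: "cls l k = succ_mod l ?j" using cls_succ[OF l, of "k - 1"] by simp
    obtain v where v: "v \<in> carrier_vec (\<beta> (succ_mod l ?j))" "v \<noteq> 0\<^sub>v (\<beta> (succ_mod l ?j))"
      "(X (succ_mod l ?j) * Y (succ_mod l ?j)) *\<^sub>v v = z \<cdot>\<^sub>v v"
      using Ek unfolding E_def sj by blast
    let ?y = "z - c (succ_mod l ?j)"
    have y: "?y \<noteq> 0" using z unfolding sj by simp
    note YXv = YX[OF j v(1,3)]
    let ?w = "X ?j *\<^sub>v v"
    have w: "?w \<in> carrier_vec (\<beta> ?j)" using X[OF j] v(1) by auto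
    have nz: "?w \<noteq> 0\<^sub>v (\<beta> ?j)"
    proof
      assume "?w = 0\<^sub>v (\<beta> ?j)"
      then have "?y \<cdot>\<^sub>v v = 0\<^sub>v (\<beta> (succ_mod l ?j))" using YXv mult_zero_vec[OF Y[OF j]] by simp
      with smult_neq[OF y v(1,2)] show False by simp
    qed
    have "(X ?j * Y ?j) *\<^sub>v ?w = ?y \<cdot>\<^sub>v ?w"
      unfolding assoc_mult_mat_vec[OF X[OF j] Y[OF j] w] YXv by (rule mult_mat_vec_smult[OF X[OF j] v(1)])
    then show ?thesis unfolding E_def using w nz by (simp only: sj) blast
  qed
  define F where "F = {z. eigenvalue (X i * Y i) z}"
  have finF: "finite F" unfolding F_def using card_finite_spectrum(1)[OF XY[OF i(1)]] by (simp add: spectrum_def)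
  have d: "dim_row (X i * Y i) = \<beta> i" using XY[OF i(1)] by (rule carrier_matD(1))
  have EF: "z \<in> F" if "E k z" "cls l k = i" for k z
    using that(1) unfolding E_def that(2) F_def eigenvalue_def eigenvector_def mem_Collect_eq d by blast
  have "spectrum (X i * Y i) \<noteq> {}" by (rule spectrum_non_empty[OF XY[OF i(1)]]) (use i(2) in simp)
  then obtain z0 where "eigenvalue (X i * Y i) z0" by (auto simp: spectrum_def)
  then have E0: "E (int i) z0"
    unfolding E_def eigenvalue_def eigenvector_def cls_of_nat[OF i(1)] d by blast
  let ?t = "potential l c"
  \<comment> \<open>The eigenvalue at position \<open>k\<close> of the chain is
    \<open>s + potential l c k\<close>. Upwards the chain can stop only where this value is zero at
    the current position, downwards only where it is zero at the next lower one. Both ends are thus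
    zeros of the same function, the lower one strictly below \<open>i\<close>.\<close>
  define s where "s = z0 - ?t (int i)"
  \<comment> \<open>A chain without end would return to the vertex \<open>i\<close> with infinitely
    many eigenvalues, each full turn shifting them by the non-zero sum of \<open>c\<close>.\<close>
  have inf: "\<not> (\<forall>m. s + ?t (int i + int l * f m) \<in> F)" if f: "inj f" for f :: "nat \<Rightarrow> int"
  proof
    assume *: "\<forall>m. s + ?t (int i + int l * f m) \<in> F"
    have "inj (\<lambda>m. s + ?t (int i + int l * f m))"
      using f cd unfolding potential_period[OF l] inj_def by simp
    then have "infinite (range (\<lambda>m. s + ?t (int i + int l * f m)))" by (rule range_inj_infinite)
    moreover have "range (\<lambda>m. s + ?t (int i + int l * f m)) \<subseteq> F" using * by blast
    ultimately show False using finF finite_subset by blast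
  qed
  have cls_i: "cls l (int i + int l * m) = i" for m using i(1) by (simp add: cls_def)
  have "\<exists>q. int i \<le> q \<and> s + ?t q = 0"
  proof (rule ccontr)
    assume neg: "\<not> ?thesis"
    then have nz: "s + ?t k \<noteq> 0" if "int i \<le> k" for k using that by blast
    have chain: "E (int i + int m) (s + ?t (int i + int m))" for m
    proof (induction m)
      case (Suc m)
      have "E (int i + int m + 1) (s + ?t (int i + int m) + c (cls l (int i + int m + 1)))"
        by (rule up[OF Suc]) (rule nz, simp)
      then show ?case using potential_step[of l c "int i + int m + 1"] by (simp add: add.assoc add.commute[of 1])
    qed (use E0 in \<open>simp add: s_def\<close>)
    have "s + ?t (int i + int l * int m) \<in> F" for m
      using EF[OF chain[of "l * m"]] cls_i[of "int m"] by simp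
    moreover have "inj int" by simp
    ultimately show False using inf by blast
  qed
  then obtain q where q: "int i \<le> q" "s + ?t q = 0" by blast
  have "\<exists>p. p < int i \<and> s + ?t p = 0"
  proof (rule ccontr)
    assume neg: "\<not> ?thesis"
    then have nz: "s + ?t k \<noteq> 0" if "k < int i" for k using that by blast
    have chain: "E (int i - int m) (s + ?t (int i - int m))" for m
    proof (induction m)
      case (Suc m)
      let ?k = "int i - int m"
      have st: "?t ?k = ?t (?k - 1) + c (cls l ?k)" by (rule potential_step)
      have ne: "s + ?t ?k \<noteq> c (cls l ?k)" using nz[of "?k - 1"] st by auto
      have "E (?k - 1) (s + ?t ?k - c (cls l ?k))" by (rule down[OF Suc ne])
      moreover have "?k - 1 = int i - int (Suc m)" by simp
      ultimately show ?case using st by simp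
    qed (use E0 in \<open>simp add: s_def\<close>)
    have "s + ?t (int i + int l * (- int m)) \<in> F" for m
      using EF[OF chain[of "l * m"]] cls_i[of "- int m"] by simp
    moreover have "inj (\<lambda>m. - int m)" by (simp add: inj_def)
    ultimately show False using inf[of "\<lambda>m. - int m"] by simp
  qed
  then obtain p where p: "p < int i" "s + ?t p = 0" by blast
  show thesis using that[OF p(1) q(1)] p(2) q(2) by (metis add_left_cancel)
qed

section \<open>Standard parameters and a simple representation\<close>

lemma weyl_refl_involution:
  assumes "2 \<le> l" "i < l"
  shows "weyl_refl l i (weyl_refl l i c) = c"
  using assms cartan_cases(1)[OF assms] by (auto simp: weyl_refl_def fun_eq_iff)

lemma weyl_refl_fixed_iff:
  assumes "2 \<le> l" "i < l"
  shows "weyl_refl l i c = c \<longleftrightarrow> c i = 0"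
proof
  assume "weyl_refl l i c = c"
  then have "weyl_refl l i c i = c i" by simp
  then show "c i = 0" using assms cartan_cases(1)[OF assms] by (simp add: weyl_refl_def)
next
  assume "c i = 0"
  then show "weyl_refl l i c = c" by (auto simp: weyl_refl_def)
qed

lemma weyl_refl_Bij:
  assumes "2 \<le> l" "i < l"
  shows "weyl_refl l i \<in> Bij UNIV"
proof -
  have "bij (weyl_refl l i)"
    by (rule o_bij[where g = "weyl_refl l i"]) (auto simp: weyl_refl_involution[OF assms] fun_eq_iff)
  then show ?thesis by (simp add: Bij_def)
qed

lemma mult_BijGroup_UNIV:
  "g \<in> Bij UNIV \<Longrightarrow> f \<in> Bij UNIV \<Longrightarrow> g \<otimes>\<^bsub>BijGroup UNIV\<^esub> f = (\<lambda>x. g (f x))"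
  by (simp add: BijGroup_def compose_def restrict_def)

lemma W_parabolic_Bij:
  assumes "2 \<le> l" "J \<subseteq> {..<l}" "w \<in> W_parabolic l J"
  shows "w \<in> Bij UNIV"
proof -
  have "weyl_refl l ` J \<subseteq> carrier (BijGroup UNIV)"
  proof (rule image_subsetI)
    fix i assume "i \<in> J"
    then have "i < l" using assms(2) by blast
    then show "weyl_refl l i \<in> carrier (BijGroup UNIV)"
      using weyl_refl_Bij[OF assms(1)] by (simp add: BijGroup_def)
  qed
  from group.generate_in_carrier[OF group_BijGroup this assms(3)[unfolded W_parabolic_def]]
  show ?thesis by (simp add: BijGroup_def)
qed

lemma W_parabolic_mult:
  assumes "2 \<le> l" "J \<subseteq> {..<l}" "v \<in> W_parabolic l J" "w \<in> W_parabolic l J"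
  shows "(\<lambda>x. v (w x)) \<in> W_parabolic l J"
proof -
  have "v \<otimes>\<^bsub>BijGroup UNIV\<^esub> w \<in> W_parabolic l J"
    using assms(3,4) unfolding W_parabolic_def by (rule generate.eng)
  then show ?thesis
    unfolding mult_BijGroup_UNIV[OF W_parabolic_Bij[OF assms(1-3)] W_parabolic_Bij[OF assms(1,2,4)]] .
qed

lemma W_parabolic_fixes:
  assumes "2 \<le> l" "J \<subseteq> {..<l}" and fix0: "\<And>i. i \<in> J \<Longrightarrow> c i = 0" and "w \<in> W_parabolic l J"
  shows "w c = c"
proof -
  have H: "h \<in> Bij UNIV \<and> h c = c" if hJ: "h \<in> weyl_refl l ` J" for h
  proof -
    obtain i where i: "i \<in> J" "h = weyl_refl l i" using hJ by blast
    then have il: "i < l" using assms(2) by blast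
    show ?thesis
      using weyl_refl_Bij[OF assms(1) il] weyl_refl_fixed_iff[OF assms(1) il] fix0[OF i(1)] i(2) by blast
  qed
  show ?thesis
    using assms(4) unfolding W_parabolic_def
  proof (induction rule: generate.induct)
    case one
    show ?case by (simp add: BijGroup_def)
  next
    case (incl h)
    then show ?case using H by blast
  next
    case (inv h)
    then have h: "h \<in> Bij UNIV" "h c = c" using H by blast+
    then have "inj h" by (auto simp: Bij_def bij_betw_def)
    have "inv_into UNIV h c = c" by (rule inv_into_f_eq[OF \<open>inj h\<close>]) (use h in auto)
    then show ?case by (simp add: inv_BijGroup[OF h(1)])
  next
    case (eng v w)
    have "v \<in> Bij UNIV" "w \<in> Bij UNIV"
      by (rule W_parabolic_Bij[OF assms(1,2)], unfold W_parabolic_def, rule eng)+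
    from mult_BijGroup_UNIV[OF this] show ?case using eng.IH by simp
  qed
qed

text \<open>The reflection in the real root given by a window of the cycle, built by conjugation with
  simple reflections that shrink the window.\<close>

lemma ex_root_reflection:
  assumes l: "2 \<le> l" and "p < q" "\<not> int l dvd q - p"
  shows "\<exists>w\<in>W_parabolic l {..<l}. \<forall>c. w c = c \<longleftrightarrow> potential l c p = potential l c q"
  using assms(2,3)
proof (induction "nat (q - p)" arbitrary: p q rule: less_induct)
  case less
  have l0: "l > 0" using l by simp
  have n: "cls l (j + 1) \<noteq> cls l j" for j
    using l l0 succ_mod_neq[of l "cls l j"] by (simp add: cls_succ cls_less)
  have gen: "weyl_refl l i \<in> W_parabolic l {..<l}" if "i < l" for i
    unfolding W_parabolic_def using that by (intro generate.incl) simp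
  show ?case
  proof (cases "q = p + 1")
    case True
    have "weyl_refl l (cls l q) c = c \<longleftrightarrow> potential l c p = potential l c q" for c
      using weyl_refl_fixed_iff[OF l cls_less[OF l0], of q c] potential_step[of l c q] True by auto
    then show ?thesis using gen[OF cls_less[OF l0]] by blast
  next
    case False
    \<comment> \<open>The reflection at this class moves the left end inwards, from \<open>p\<close>
      to \<open>p + 1\<close>. The right end moves inwards or stays, because \<open>q + 1\<close>
      would have class \<open>i\<close> only if \<open>l\<close> divided
      \<open>q - p\<close>.\<close>
    define i where "i = cls l (p + 1)"
    have i: "i < l" unfolding i_def by (rule cls_less[OF l0])
    have sp: "sig l i p = p + 1" using n[of p] by (simp add: sig_def i_def)
    have dvd: "cls l j = cls l k \<longleftrightarrow> int l dvd j - k" for j k by (rule cls_eq_iff[OF l0])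
    have q1: "cls l (q + 1) \<noteq> i" using less.prems(2) by (simp add: i_def dvd)
    have sq: "sig l i q = (if cls l q = i then q - 1 else q)" using q1 by (simp add: sig_def)
    \<comment> \<open>If both ends move, then \<open>q - (p + 1)\<close> is a positive multiple of
      \<open>l\<close> and so at least 2. The window stays non-empty, and its new length leaves
      remainder \<open>l - 1\<close> modulo \<open>l\<close>.\<close>
    have key: "sig l i p < sig l i q \<and> \<not> int l dvd sig l i q - sig l i p"
    proof (cases "cls l q = i")
      case True
      then have d: "int l dvd q - (p + 1)" by (simp add: i_def dvd)
      have "int l \<le> q - (p + 1)" by (rule zdvd_imp_le[OF d]) (use False less.prems(1) in simp)
      then have "p + 1 < q - 1" using l by simp
      moreover have "\<not> int l dvd (q - 1) - (p + 1)"
      proof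
        assume "int l dvd (q - 1) - (p + 1)"
        from dvd_diff[OF d this] have "int l dvd 1" by simp
        then show False using l by simp
      qed
      ultimately show ?thesis using True sp sq by simp
    next
      case neq: False
      then have "\<not> int l dvd q - (p + 1)" by (simp add: i_def dvd)
      then show ?thesis using neq sp sq False less.prems(1) by simp
    qed
    moreover have "nat (sig l i q - sig l i p) < nat (q - p)"
      using sp sq less.prems(1) by simp
    ultimately obtain w where w: "w \<in> W_parabolic l {..<l}"
      "\<And>c. w c = c \<longleftrightarrow> potential l c (sig l i p) = potential l c (sig l i q)"
      using less.hyps[of "sig l i q" "sig l i p"] by blast
    define w' where "w' = (\<lambda>c. weyl_refl l i (w (weyl_refl l i c)))"
    have "w' \<in> W_parabolic l {..<l}"
      unfolding w'_def by (rule W_parabolic_mult[OF l order_refl gen[OF i] W_parabolic_mult[OF l order_refl w(1) gen[OF i]]])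
    moreover have "w' c = c \<longleftrightarrow> potential l c p = potential l c q" for c
    proof -
      have "w' c = c \<longleftrightarrow> w (weyl_refl l i c) = weyl_refl l i c"
        unfolding w'_def by (metis weyl_refl_involution[OF l i])
      also have "\<dots> \<longleftrightarrow> potential l (weyl_refl l i c) (sig l i p) = potential l (weyl_refl l i c) (sig l i q)"
        by (rule w(2))
      also have "\<dots> \<longleftrightarrow> potential l c p = potential l c q"
        using potential_reflect[OF l i, of c "sig l i p" "sig l i q"]
        unfolding sig_sig[OF l i] by (metis eq_iff_diff_eq_0)
      finally show ?thesis .
    qed
    ultimately show ?thesis by blast
  qed
qed

lemma J_standard_zero:
  assumes "2 \<le> l" "J \<subseteq> {..<l}" "J_standard l J c" "i \<in> J"
  shows "c i = 0"
proof -
  have "weyl_refl l i \<in> W_parabolic l J"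
    unfolding W_parabolic_def using assms(4) by (intro generate.incl) simp
  then have "weyl_refl l i c = c"
    using assms(3) unfolding J_standard_def stabilizer_def by blast
  then show ?thesis using weyl_refl_fixed_iff[OF assms(1)] assms(2,4) by blast
qed

text \<open>The reflection attached to the window fixes \<open>c\<close>, so standardness puts it
  into the parabolic subgroup of \<open>J\<close>. It then also fixes every parameter vanishing on
  \<open>J\<close>, in particular the indicator of a class outside \<open>J\<close>; but the window
  sum of that indicator counts how often the class occurs in the window.\<close>

lemma J_standard_window:
  assumes l: "2 \<le> l" and J: "J \<subseteq> {..<l}" "J_standard l J c" and cd: "(\<Sum>i<l. c i) \<noteq> 0"
    and pq: "potential l c p = potential l c q" "p < k" "k \<le> q"
  shows "cls l k \<in> J"
proof (rule ccontr)
  assume neg: "cls l k \<notin> J"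
  have l0: "l > 0" using l by simp
  \<comment> \<open>A window of full turns, an imaginary root, has a non-zero multiple of the sum of
    \<open>c\<close> as its increment.\<close>
  have nd: "\<not> int l dvd q - p"
  proof
    assume "int l dvd q - p"
    then obtain m where m: "q - p = int l * m" by (rule dvdE)
    then have "q = p + int l * m" by simp
    then have "of_int m * (\<Sum>i<l. c i) = 0" using pq(1) potential_period[OF l0, of c p m] by simp
    then show False using cd m pq(2,3) by simp
  qed
  have "p < q" using pq by simp
  from ex_root_reflection[OF l this nd] obtain w where w: "w \<in> W_parabolic l {..<l}"
    "\<And>c. w c = c \<longleftrightarrow> potential l c p = potential l c q" by blast
  have "w \<in> stabilizer (W_aff l) (\<lambda>w. w) c"
    using w pq(1) by (simp add: stabilizer_def W_aff_def)
  then have wJ: "w \<in> W_parabolic l J" using J(2) by (simp add: J_standard_def)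
  \<comment> \<open>The test parameter that separates the reflection from the parabolic subgroup if
    the class of \<open>k\<close> is not in \<open>J\<close>.\<close>
  define c0 :: "nat \<Rightarrow> complex" where "c0 = (\<lambda>j. of_bool (j = cls l k))"
  have "w c0 = c0" by (rule W_parabolic_fixes[OF l J(1) _ wJ]) (use neg in \<open>auto simp: c0_def\<close>)
  then have "potential l c0 p = potential l c0 q" using w(2) by blast
  then have "(\<Sum>j\<in>{p<..q}. c0 (cls l j)) = 0"
    using potential_window_sum[of p q l c0] \<open>p < q\<close> by simp
  moreover have "(\<Sum>j\<in>{p<..q}. c0 (cls l j)) = of_nat (card {j \<in> {p<..q}. cls l j = cls l k})"
    unfolding c0_def by (simp add: sum.If_cases of_bool_def Int_def)
  ultimately have "card {j \<in> {p<..q}. cls l j = cls l k} = 0" by (simp only: of_nat_eq_0_iff)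
  moreover have "finite {j \<in> {p<..q}. cls l j = cls l k}"
    by (rule finite_subset[of _ "{p<..q}"]) auto
  ultimately have "{j \<in> {p<..q}. cls l j = cls l k} = {}" using card_0_eq by blast
  then show False using pq(2,3) by auto
qed

section \<open>Coordinate subspaces and a diagonal matrix\<close>

lemma subsp_full_of_units:
  assumes "subsp U n" "\<And>a. a < n \<Longrightarrow> unit_vec n a \<in> U"
  shows "U = carrier_vec n"
proof
  show "U \<subseteq> carrier_vec n" using subspD(1)[OF assms(1)] by blast
  show "carrier_vec n \<subseteq> U"
  proof
    fix v :: "complex vec" assume v: "v \<in> carrier_vec n"
    have "k \<le> n \<Longrightarrow> vec n (\<lambda>j. if j < k then v $ j else 0) \<in> U" for k
    proof (induction k)
      case 0
      have "vec n (\<lambda>j. if j < 0 then v $ j else 0) = 0\<^sub>v n" by (auto intro!: eq_vecI)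
      then show ?case using subspD(2)[OF assms(1)] by simp
    next
      case (Suc k)
      have "vec n (\<lambda>j. if j < Suc k then v $ j else 0) =
        vec n (\<lambda>j. if j < k then v $ j else 0) + v $ k \<cdot>\<^sub>v unit_vec n k"
        using Suc.prems by (intro eq_vecI) (auto simp: less_Suc_eq)
      then show ?case using Suc subspD(3,4)[OF assms(1)] assms(2)[of k] by simp
    qed
    from this[of n] have "vec n (\<lambda>j. if j < n then v $ j else 0) \<in> U" by simp
    moreover have "vec n (\<lambda>j. if j < n then v $ j else 0) = v" using v by (auto intro!: eq_vecI)
    ultimately show "v \<in> U" by simp
  qed
qed

lemma subsp_1_cases:
  assumes "subsp U 1"
  shows "U = {0\<^sub>v 1} \<or> U = carrier_vec 1"
proof (cases "U = {0\<^sub>v 1}")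
  case False
  then obtain v where v: "v \<in> U" "v \<noteq> 0\<^sub>v 1" using subspD(2)[OF assms] by blast
  have vc: "v \<in> carrier_vec 1" by (rule subspD(1)[OF assms v(1)])
  have "v $ 0 \<noteq> 0"
  proof
    assume *: "v $ 0 = 0"
    have "v = 0\<^sub>v 1" using vc * by (intro eq_vecI) auto
    with v(2) show False by simp
  qed
  moreover from this have "inverse (v $ 0) \<cdot>\<^sub>v v = unit_vec 1 0" using vc by (intro eq_vecI) auto
  ultimately have "unit_vec 1 0 \<in> U" using subspD(4)[OF assms v(1), of "inverse (v $ 0)"] by simp
  then have "U = carrier_vec 1" using assms by (intro subsp_full_of_units) auto
  then show ?thesis by simp
qed simp

text \<open>The entries \<open>a + 1\<close> are distinct, so that invariant subspaces are spanned
  by unit vectors, and non-zero, so that the matrix is invertible.\<close>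

definition dmat :: "nat \<Rightarrow> complex mat" where
  "dmat r = mat r r (\<lambda>(a, b). if a = b then of_nat (a + 1) else 0)"

lemma dmat_carrier: "dmat r \<in> carrier_mat r r"
  by (simp add: dmat_def)

lemma dmat_vec: "v \<in> carrier_vec r \<Longrightarrow> a < r \<Longrightarrow> (dmat r *\<^sub>v v) $ a = of_nat (a + 1) * v $ a"
proof -
  assume v: "v \<in> carrier_vec r" and a: "a < r"
  have "(dmat r *\<^sub>v v) $ a = (\<Sum>j\<in>{0..<r}. dmat r $$ (a, j) * v $ j)"
    using v a by (simp add: dmat_def scalar_prod_def)
  also have "\<dots> = (\<Sum>j\<in>{0..<r}. if j = a then of_nat (a + 1) * v $ a else 0)"
    using a by (intro sum.cong) (auto simp: dmat_def)
  also have "\<dots> = of_nat (a + 1) * v $ a" using a by simp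
  finally show ?thesis .
qed

lemma dmat_mult:
  assumes "Z \<in> carrier_mat r r" "a < r" "b < r"
  shows "(dmat r * Z) $$ (a, b) = of_nat (a + 1) * Z $$ (a, b)"
    and "(Z * dmat r) $$ (a, b) = of_nat (b + 1) * Z $$ (a, b)"
proof -
  have "(dmat r * Z) $$ (a, b) = (\<Sum>j\<in>{0..<r}. dmat r $$ (a, j) * Z $$ (j, b))"
    using assms by (simp add: dmat_def scalar_prod_def)
  also have "\<dots> = (\<Sum>j\<in>{0..<r}. if j = a then of_nat (a + 1) * Z $$ (a, b) else 0)"
    using assms by (intro sum.cong) (auto simp: dmat_def)
  finally show "(dmat r * Z) $$ (a, b) = of_nat (a + 1) * Z $$ (a, b)" using assms by simp
  have "(Z * dmat r) $$ (a, b) = (\<Sum>j\<in>{0..<r}. Z $$ (a, j) * dmat r $$ (j, b))"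
    using assms by (simp add: dmat_def scalar_prod_def)
  also have "\<dots> = (\<Sum>j\<in>{0..<r}. if j = b then of_nat (b + 1) * Z $$ (a, b) else 0)"
    using assms by (intro sum.cong) (auto simp: dmat_def)
  finally show "(Z * dmat r) $$ (a, b) = of_nat (b + 1) * Z $$ (a, b)" using assms by simp
qed

text \<open>Applying the product of the factors \<open>dmat r - (b + 1)\<close> over all
  \<open>b \<noteq> a\<close> kills every coordinate except the one at \<open>a\<close>.\<close>

lemma dmat_invariant_unit:
  assumes U: "subsp U r" and inv: "\<And>u. u \<in> U \<Longrightarrow> dmat r *\<^sub>v u \<in> U"
    and v: "v \<in> U" "a < r" "v $ a \<noteq> 0"
  shows "unit_vec r a \<in> U"
proof -
  have "\<exists>w\<in>U. \<forall>j<r. w $ j = v $ j * (\<Prod>b\<in>S. of_nat (j + 1) - of_nat (b + 1))" if "finite S" for S :: "nat set"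
    using that
  proof (induction S rule: finite_induct)
    case empty
    then show ?case using v(1) by auto
  next
    case (insert b S)
    then obtain w where w: "w \<in> U" "\<forall>j<r. w $ j = v $ j * (\<Prod>b\<in>S. of_nat (j + 1) - of_nat (b + 1))" by blast
    have wc: "w \<in> carrier_vec r" by (rule subspD(1)[OF U w(1)])
    let ?w = "dmat r *\<^sub>v w + (- of_nat (b + 1)) \<cdot>\<^sub>v w"
    have "?w \<in> U" by (intro subspD(3)[OF U] inv w(1) subspD(4)[OF U])
    moreover have "?w $ j = v $ j * (\<Prod>b\<in>insert b S. of_nat (j + 1) - of_nat (b + 1))" if j: "j < r" for j
    proof -
      have "?w $ j = (dmat r *\<^sub>v w) $ j + (- of_nat (b + 1)) * w $ j"
        using wc j by (simp add: dmat_def)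
      also have "\<dots> = (of_nat (j + 1) - of_nat (b + 1)) * w $ j"
        unfolding dmat_vec[OF wc j] by (simp add: algebra_simps)
      finally show ?thesis using w(2) j insert.hyps by simp
    qed
    ultimately show ?case by blast
  qed
  from this[of "{..<r} - {a}"] obtain w where w: "w \<in> U"
    "\<forall>j<r. w $ j = v $ j * (\<Prod>b\<in>{..<r} - {a}. of_nat (j + 1) - of_nat (b + 1))" by auto
  have wc: "w \<in> carrier_vec r" by (rule subspD(1)[OF U w(1)])
  have wj: "w $ j = 0" if "j < r" "j \<noteq> a" for j
    using w(2) that by (auto simp: prod_zero_iff)
  have wa: "w $ a \<noteq> 0" using w(2) v(2,3) by auto
  have "inverse (w $ a) \<cdot>\<^sub>v w = unit_vec r a"
    using wc wj wa v(2) by (intro eq_vecI) auto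
  then show ?thesis using subspD(4)[OF U w(1), of "inverse (w $ a)"] by simp
qed

text \<open>A Calogero--Moser point: all \<open>X i\<close> are identities except for one diagonal matrix with distinct
  non-zero entries.\<close>

lemma ex_simple_multiple_delta:
  assumes l: "l > 0" and cd: "(\<Sum>i<l. c i) \<noteq> 0"
  obtains M where "M \<in> moment_fiber l c (\<lambda>_. r)" "simple_rep l (framed 1 (\<lambda>_. r)) M"
proof -
  let ?s = "\<Sum>i<l. c i"
  \<comment> \<open>The off-diagonal entries are forced by requiring the commutator of
    \<open>dmat r\<close> and \<open>Z\<close> plus \<open>x * y\<close> to be the scalar
    \<open>?s\<close>. On the diagonal the commutator vanishes and \<open>x * y\<close> already has
    the entry \<open>?s\<close>.\<close>
  define Z where "Z = mat r r (\<lambda>(a, b). if a = b then 0 else - ?s / (of_nat (a + 1) - of_nat (b + 1)))"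
  define x :: "complex mat" where "x = mat r 1 (\<lambda>_. 1)"
  define y :: "complex mat" where "y = mat 1 r (\<lambda>_. ?s)"
  \<comment> \<open>With identities for \<open>X\<close>, the moment equations at the vertices 0 up
    to \<open>i\<close> determine \<open>P i\<close> recursively from \<open>Z * dmat r\<close>. The
    equation at the last vertex is then the commutator relation.\<close>
  define P where "P = (\<lambda>i. Z * dmat r - x * y + (\<Sum>j\<le>i. c j) \<cdot>\<^sub>m 1\<^sub>m r)"
  define M where "M = \<lparr>qX = (\<lambda>i\<in>{..<l}. if Suc i = l then dmat r else 1\<^sub>m r),
    qY = (\<lambda>i\<in>{..<l}. if Suc i = l then Z else P i), qx = x, qy = y\<rparr>"
  have car: "Z \<in> carrier_mat r r" "x \<in> carrier_mat r 1" "y \<in> carrier_mat 1 r" "\<And>i. P i \<in> carrier_mat r r"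
    by (auto simp: Z_def x_def y_def P_def)
  have Mr: "M \<in> rep_space l (framed 1 (\<lambda>_. r))"
    by (rule rep_spaceI) (use car in \<open>auto simp: M_def dmat_carrier\<close>)
  have xy: "(x * y) $$ (a, b) = ?s" if "a < r" "b < r" for a b
    using that by (simp add: x_def y_def scalar_prod_def)
  have cxy: "x * y \<in> carrier_mat r r" using car by auto
  have cDZ: "dmat r * Z \<in> carrier_mat r r" "Z * dmat r \<in> carrier_mat r r"
    by (rule mult_carrier_mat[OF dmat_carrier car(1)], rule mult_carrier_mat[OF car(1) dmat_carrier])
  have CM: "(dmat r * Z) $$ (a, b) - (Z * dmat r) $$ (a, b) + ?s = (if a = b then ?s else 0)"
    if "a < r" "b < r" for a b
  proof -
    have "(dmat r * Z) $$ (a, b) - (Z * dmat r) $$ (a, b) =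
      (of_nat (a + 1) - of_nat (b + 1)) * Z $$ (a, b)"
      unfolding dmat_mult[OF car(1) that] by (simp add: algebra_simps)
    also have "\<dots> = (if a = b then 0 else - ?s)"
      using that by (simp add: Z_def)
    finally show ?thesis by simp
  qed
  have Pidx: "P i $$ (a, b) = (Z * dmat r) $$ (a, b) - ?s + (if a = b then (\<Sum>j\<le>i. c j) else 0)"
    if "a < r" "b < r" for i a b
    using that xy[OF that] carrier_matD[OF car(2)] carrier_matD[OF car(3)] carrier_matD[OF car(1)]
      carrier_matD[OF dmat_carrier[of r]] by (simp add: P_def)
  have moment: "qX M i * qY M i - qY M (pred_mod l i) * qX M (pred_mod l i)
      + (if i = 0 then qx M * qy M else 0\<^sub>m r r) = c i \<cdot>\<^sub>m 1\<^sub>m r" if i: "i < l" for i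
  proof -
    define X1 where "X1 = (if Suc i = l then dmat r * Z else P i)"
    have X1: "qX M i * qY M i = X1" using i left_mult_one_mat[OF car(4)] by (simp add: M_def X1_def)
    define X2 where "X2 = (if i = 0 then Z * dmat r else P (i - 1))"
    have X2: "qY M (pred_mod l i) * qX M (pred_mod l i) = X2"
    proof (cases "i = 0")
      case True
      then have "pred_mod l i = l - 1" using l by (simp add: pred_mod_def)
      then show ?thesis using True l by (simp add: M_def X2_def)
    next
      case False
      have "(i + l - 1) mod l = (i - 1 + l) mod l" using False by simp
      then have "pred_mod l i = i - 1" using i by (simp add: pred_mod_def)
      moreover have "i - 1 < l" "Suc (i - 1) \<noteq> l" using False i by auto
      ultimately show ?thesis using False i right_mult_one_mat[OF car(4)] by (simp add: M_def X2_def)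
    qed
    define V where "V = (if i = 0 then x * y else 0\<^sub>m r r)"
    have cs: "X1 \<in> carrier_mat r r" "X2 \<in> carrier_mat r r" "V \<in> carrier_mat r r"
      using car cDZ cxy by (auto simp: X1_def X2_def V_def)
    have sum_lt: "(\<Sum>j<l. c j) = (\<Sum>j\<le>i. c j)" if "Suc i = l"
      unfolding that[symmetric] lessThan_Suc_atMost ..
    have sum_i: "(\<Sum>j\<le>i. c j) = (\<Sum>j\<le>i - 1. c j) + c i" if "i \<noteq> 0"
      using that by (cases i) auto
    have "X1 - X2 + V = c i \<cdot>\<^sub>m 1\<^sub>m r"
    proof (rule eq_matI)
      fix a b assume "a < dim_row (c i \<cdot>\<^sub>m 1\<^sub>m r)" "b < dim_col (c i \<cdot>\<^sub>m 1\<^sub>m r)"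
      then have ab: "a < r" "b < r" by auto
      have "(X1 - X2 + V) $$ (a, b) = X1 $$ (a, b) - X2 $$ (a, b) + V $$ (a, b)"
        using cs ab by simp
      also have "\<dots> = (if a = b then c i else 0)"
      proof (cases "i = 0")
        case True
        then have V: "V $$ (a, b) = ?s" and x2: "X2 $$ (a, b) = (Z * dmat r) $$ (a, b)"
          using xy[OF ab] by (auto simp: V_def X2_def)
        show ?thesis
        proof (cases "Suc i = l")
          case s: True
          then have "?s = c i" using sum_lt True by simp
          then show ?thesis using CM[OF ab] s unfolding V x2 by (simp add: X1_def)
        next
          case False
          then show ?thesis using Pidx[OF ab, of i] True unfolding V x2 by (simp add: X1_def)
        qed
      next
        case False
        then have V: "V $$ (a, b) = 0" and x2: "X2 $$ (a, b) = P (i - 1) $$ (a, b)"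
          using ab by (auto simp: V_def X2_def)
        show ?thesis
        proof (cases "Suc i = l")
          case s: True
          have "?s = (\<Sum>j\<le>i - 1. c j) + c i" using sum_lt[OF s] sum_i[OF False] by simp
          then show ?thesis using CM[OF ab] s unfolding V x2 Pidx[OF ab] by (auto simp: X1_def algebra_simps split: if_splits)
        next
          case ns: False
          then show ?thesis using sum_i[OF False] unfolding V x2 Pidx[OF ab] by (simp add: X1_def Pidx[OF ab])
        qed
      qed
      finally show "(X1 - X2 + V) $$ (a, b) = (c i \<cdot>\<^sub>m 1\<^sub>m r) $$ (a, b)" using ab by simp
    qed (use cs in auto)
    then show ?thesis unfolding X1 X2 by (cases "i = 0") (simp_all add: V_def M_def)
  qed
  have mem: "M \<in> moment_fiber l c (\<lambda>_. r)" unfolding moment_fiber_def using Mr moment by blast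
  have "simple_rep l (framed 1 (\<lambda>_. r)) M"
    unfolding simple_framed_iff
  proof (intro allI impI)
    fix U assume U: "subrep l (framed 1 (\<lambda>_. r)) M U"
    have sub: "subsp (U None) 1" "\<And>j. j < l \<Longrightarrow> subsp (U (Some j)) r"
      and aX: "\<And>j u. j < l \<Longrightarrow> u \<in> U (Some (succ_mod l j)) \<Longrightarrow> qX M j *\<^sub>v u \<in> U (Some j)"
      and ax: "\<And>u. u \<in> U None \<Longrightarrow> qx M *\<^sub>v u \<in> U (Some 0)"
      and ay: "\<And>u. u \<in> U (Some 0) \<Longrightarrow> qy M *\<^sub>v u \<in> U None"
      using U unfolding subrep_framed_iff by blast+
    let ?L = "l - 1"
    have L: "?L < l" "Suc ?L = l" "succ_mod l ?L = 0" using l by (auto simp: succ_mod_def)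
    have DU: "dmat r *\<^sub>v u \<in> U (Some ?L)" if "u \<in> U (Some 0)" for u
      using aX[OF L(1), of u] that L by (simp add: M_def)
    have chain1: "U (Some (Suc j)) \<subseteq> U (Some j)" if "Suc j < l" for j
    proof
      fix u assume u: "u \<in> U (Some (Suc j))"
      have "succ_mod l j = Suc j" using that by (simp add: succ_mod_def)
      then show "u \<in> U (Some j)"
        using aX[of j u] u that subspD(1)[OF sub(2)[OF that] u] by (simp add: M_def)
    qed
    have chain: "U (Some (j + m)) \<subseteq> U (Some j)" if "j + m < l" for j m
      using that
    proof (induction m)
      case (Suc m)
      then show ?case using chain1[of "j + m"] by auto
    qed simp
    have toL: "U (Some ?L) \<subseteq> U (Some j)" and to0: "U (Some j) \<subseteq> U (Some 0)" if "j < l" for j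
      using chain[of j "?L - j"] chain[of 0 j] that by auto
    note U0 = sub(2)[OF l]
    have inv: "dmat r *\<^sub>v u \<in> U (Some 0)" if "u \<in> U (Some 0)" for u
      using DU[OF that] toL[OF l] by blast
    \<comment> \<open>The space at infinity decides. If it is zero, a non-zero vector at 0 would
      yield a unit vector there, on which \<open>y\<close> does not vanish. If it is full, the
      vector \<open>x\<close> has no zero coordinate and yields all unit vectors.\<close>
    from subsp_1_cases[OF sub(1)] show "(U None = {0\<^sub>v 1} \<and> (\<forall>i<l. U (Some i) = {0\<^sub>v r})) \<or>
      (U None = carrier_vec 1 \<and> (\<forall>i<l. U (Some i) = carrier_vec r))"
    proof
      assume N: "U None = {0\<^sub>v 1}"
      have z: "v = 0\<^sub>v r" if v: "v \<in> U (Some 0)" for v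
      proof (rule ccontr)
        assume "v \<noteq> 0\<^sub>v r"
        then obtain a where a: "a < r" "v $ a \<noteq> 0"
          using subspD(1)[OF U0 v] by (metis carrier_vecD eq_vecI index_zero_vec)
        have "unit_vec r a \<in> U (Some 0)" by (rule dmat_invariant_unit[OF U0 inv v a])
        then have "y *\<^sub>v unit_vec r a \<in> U None" using ay by (simp add: M_def)
        then have "(y *\<^sub>v unit_vec r a) $ 0 = 0" unfolding N by simp
        moreover have "(y *\<^sub>v unit_vec r a) $ 0 = (\<Sum>j\<in>{0..<r}. y $$ (0, j) * unit_vec r a $ j)"
          by (simp add: y_def scalar_prod_def)
        moreover have "\<dots> = (\<Sum>j\<in>{0..<r}. if j = a then ?s else 0)"
          by (rule sum.cong) (auto simp: y_def unit_vec_def)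
        moreover have "(\<Sum>j\<in>{0..<r}. if j = a then ?s else 0) = ?s" using a(1) by simp
        ultimately show False using cd by simp
      qed
      have "U (Some i) = {0\<^sub>v r}" if "i < l" for i
        using z to0[OF that] subspD(2)[OF sub(2)[OF that]] by blast
      with N show ?thesis by blast
    next
      assume N: "U None = carrier_vec 1"
      have "x *\<^sub>v unit_vec 1 0 \<in> U (Some 0)" using ax N by (simp add: M_def)
      moreover have "(x *\<^sub>v unit_vec 1 0) $ a = 1" if "a < r" for a
        using that by (simp add: x_def scalar_prod_def)
      ultimately have "unit_vec r a \<in> U (Some 0)" if "a < r" for a
        using dmat_invariant_unit[OF U0 inv _ that] that by (metis one_neq_zero)
      then have full0: "U (Some 0) = carrier_vec r" by (rule subsp_full_of_units[OF U0])
      \<comment> \<open>The arrow from the vertex 0 to the last vertex is \<open>dmat r\<close>,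
        which is onto.\<close>
      have "carrier_vec r \<subseteq> U (Some ?L)"
      proof
        fix v :: "complex vec" assume v: "v \<in> carrier_vec r"
        define u where "u = vec r (\<lambda>a. v $ a / of_nat (a + 1))"
        have u: "u \<in> carrier_vec r" by (simp add: u_def)
        have "dmat r *\<^sub>v u = v"
        proof (rule eq_vecI)
          fix a assume "a < dim_vec v"
          then have a: "a < r" using v by simp
          have "of_nat (a + 1) \<noteq> (0 :: complex)" by (simp only: of_nat_eq_0_iff)
          then show "(dmat r *\<^sub>v u) $ a = v $ a" unfolding dmat_vec[OF u a] using a by (simp add: u_def)
        qed (use v in \<open>simp add: dmat_def\<close>)
        then show "v \<in> U (Some ?L)" using DU[of u] u full0 by simp
      qed
      then have "U (Some i) = carrier_vec r" if "i < l" for i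
        using toL[OF that] subspD(1)[OF sub(2)[OF that]] by blast
      with N show ?thesis by blast
    qed
  qed
  with mem show thesis by (rule that)
qed

section \<open>Invariant functions\<close>

text \<open>Words in \<open>X\<close> (True) and \<open>Y\<close> (False), read from left to right along a path of the cycle.\<close>

fun act :: "nat \<Rightarrow> quiver_rep \<Rightarrow> nat \<Rightarrow> bool list \<Rightarrow> complex vec \<Rightarrow> complex vec" where
  "act l M i [] v = v"
| "act l M i (True # w) v = act l M (pred_mod l i) w (qX M (pred_mod l i) *\<^sub>v v)"
| "act l M i (False # w) v = act l M (succ_mod l i) w (qY M i *\<^sub>v v)"

fun wend :: "nat \<Rightarrow> nat \<Rightarrow> bool list \<Rightarrow> nat" where
  "wend l i [] = i"
| "wend l i (True # w) = wend l (pred_mod l i) w"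
| "wend l i (False # w) = wend l (succ_mod l i) w"

definition frame_vec :: "quiver_rep \<Rightarrow> complex vec" where
  "frame_vec M = qx M *\<^sub>v unit_vec 1 0"

text \<open>The trace of the closed path that enters the cycle from infinity, follows
  \<open>w\<close> and returns; the space at infinity is one-dimensional, so the single entry is the
  trace.\<close>

definition chi :: "nat \<Rightarrow> quiver_rep \<Rightarrow> bool list \<Rightarrow> complex" where
  "chi l M w = (qy M *\<^sub>v act l M 0 w (frame_vec M)) $ 0"

lemma qX_pred_carrier:
  assumes "M \<in> rep_space l (framed k \<alpha>)" "i < l"
  shows "qX M (pred_mod l i) \<in> carrier_mat (\<alpha> (pred_mod l i)) (\<alpha> i)"
  using rep_spaceD(1)[OF assms(1) pred_mod_less] assms(2) by (metis gr_implies_not0 neq0_conv succ_pred_mod)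

lemma act_carrier:
  assumes "M \<in> rep_space l (framed k \<alpha>)"
  shows "i < l \<Longrightarrow> v \<in> carrier_vec (\<alpha> i) \<Longrightarrow> act l M i w v \<in> carrier_vec (\<alpha> (wend l i w))"
proof (induction w arbitrary: i v)
  case (Cons b w)
  then have l: "l > 0" by simp
  show ?case
  proof (cases b)
    case True
    have "qX M (pred_mod l i) *\<^sub>v v \<in> carrier_vec (\<alpha> (pred_mod l i))"
      by (rule mult_mat_vec_carrier[OF qX_pred_carrier[OF assms Cons.prems(1)] Cons.prems(2)])
    from Cons.IH[OF pred_mod_less[OF l] this] show ?thesis using True by simp
  next
    case False
    have "qY M i *\<^sub>v v \<in> carrier_vec (\<alpha> (succ_mod l i))"
      by (rule mult_mat_vec_carrier[OF rep_spaceD(2)[OF assms Cons.prems(1)] Cons.prems(2)])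
    from Cons.IH[OF succ_mod_less[OF l] this] show ?thesis using False by simp
  qed
qed simp

lemma act_linear:
  assumes M: "M \<in> rep_space l (framed k \<alpha>)"
  shows "i < l \<Longrightarrow> u \<in> carrier_vec (\<alpha> i) \<Longrightarrow> v \<in> carrier_vec (\<alpha> i) \<Longrightarrow>
      act l M i w (u + v) = act l M i w u + act l M i w v"
    and "i < l \<Longrightarrow> u \<in> carrier_vec (\<alpha> i) \<Longrightarrow> act l M i w (a \<cdot>\<^sub>v u) = a \<cdot>\<^sub>v act l M i w u"
proof -
  show "i < l \<Longrightarrow> u \<in> carrier_vec (\<alpha> i) \<Longrightarrow> v \<in> carrier_vec (\<alpha> i) \<Longrightarrow>
      act l M i w (u + v) = act l M i w u + act l M i w v"
  proof (induction w arbitrary: i u v)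
    case (Cons b w)
    then have l: "l > 0" by simp
    note cX = qX_pred_carrier[OF M Cons.prems(1)] and cY = rep_spaceD(2)[OF M Cons.prems(1)]
    show ?case
    proof (cases b)
      case True
      show ?thesis
        using Cons.IH[OF pred_mod_less[OF l] mult_mat_vec_carrier[OF cX Cons.prems(2)]
          mult_mat_vec_carrier[OF cX Cons.prems(3)]] True
        by (simp add: mult_add_distrib_mat_vec[OF cX Cons.prems(2,3)])
    next
      case False
      show ?thesis
        using Cons.IH[OF succ_mod_less[OF l] mult_mat_vec_carrier[OF cY Cons.prems(2)]
          mult_mat_vec_carrier[OF cY Cons.prems(3)]] False
        by (simp add: mult_add_distrib_mat_vec[OF cY Cons.prems(2,3)])
    qed
  qed simp
  show "i < l \<Longrightarrow> u \<in> carrier_vec (\<alpha> i) \<Longrightarrow> act l M i w (a \<cdot>\<^sub>v u) = a \<cdot>\<^sub>v act l M i w u"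
  proof (induction w arbitrary: i u)
    case (Cons b w)
    then have l: "l > 0" by simp
    note cX = qX_pred_carrier[OF M Cons.prems(1)] and cY = rep_spaceD(2)[OF M Cons.prems(1)]
    show ?case
    proof (cases b)
      case True
      show ?thesis
        using Cons.IH[OF pred_mod_less[OF l] mult_mat_vec_carrier[OF cX Cons.prems(2)]] True
        by (simp add: mult_mat_vec_smult[OF cX Cons.prems(2)])
    next
      case False
      show ?thesis
        using Cons.IH[OF succ_mod_less[OF l] mult_mat_vec_carrier[OF cY Cons.prems(2)]] False
        by (simp add: mult_mat_vec_smult[OF cY Cons.prems(2)])
    qed
  qed simp
qed

lemma act_zero:
  assumes M: "M \<in> rep_space l (framed k \<alpha>)"
  shows "i < l \<Longrightarrow> act l M i w (0\<^sub>v (\<alpha> i)) = 0\<^sub>v (\<alpha> (wend l i w))"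
proof (induction w arbitrary: i)
  case (Cons b w)
  then have l: "l > 0" by simp
  show ?case
    using Cons.IH[OF pred_mod_less[OF l]] Cons.IH[OF succ_mod_less[OF l]]
      mult_zero_vec[OF qX_pred_carrier[OF M Cons.prems]] mult_zero_vec[OF rep_spaceD(2)[OF M Cons.prems]]
    by (cases b) simp_all
qed simp

lemma vec_1_eq_zero: "u \<in> carrier_vec 1 \<Longrightarrow> u $ 0 = 0 \<Longrightarrow> u = 0\<^sub>v 1" for u :: "complex vec"
  by (intro eq_vecI) auto

text \<open>The matrices \<open>T i\<close> may be rectangular, so that this covers isomorphisms as
  well as the inclusion of a direct summand.\<close>

lemma act_transforms:
  assumes M: "M \<in> rep_space l (framed k \<alpha>)" and N: "N \<in> rep_space l (framed k' \<beta>)"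
    and T: "transforms l T M N" "\<And>i. i < l \<Longrightarrow> T i \<in> carrier_mat (\<beta> i) (\<alpha> i)"
  shows "i < l \<Longrightarrow> v \<in> carrier_vec (\<alpha> i) \<Longrightarrow> act l N i w (T i *\<^sub>v v) = T (wend l i w) *\<^sub>v act l M i w v"
proof (induction w arbitrary: i v)
  case (Cons b w)
  then have l: "l > 0" by simp
  note i = Cons.prems(1) and v = Cons.prems(2)
  show ?case
  proof (cases b)
    case True
    let ?p = "pred_mod l i"
    have p: "?p < l" "succ_mod l ?p = i" using l i by (auto simp: pred_mod_less succ_pred_mod)
    note cX = qX_pred_carrier[OF M i] and cX' = qX_pred_carrier[OF N i]
    have "qX N ?p * T i = T ?p * qX M ?p" using T(1) p unfolding transforms_def by metis
    then have "qX N ?p *\<^sub>v (T i *\<^sub>v v) = T ?p *\<^sub>v (qX M ?p *\<^sub>v v)"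
      using assoc_mult_mat_vec[OF cX' T(2)[OF i] v] assoc_mult_mat_vec[OF T(2)[OF p(1)] cX v] by simp
    then show ?thesis using Cons.IH[OF p(1) mult_mat_vec_carrier[OF cX v]] True by simp
  next
    case False
    have s: "succ_mod l i < l" by (rule succ_mod_less[OF l])
    note cY = rep_spaceD(2)[OF M i] and cY' = rep_spaceD(2)[OF N i]
    have "qY N i * T i = T (succ_mod l i) * qY M i" using T(1) i unfolding transforms_def by metis
    then have "qY N i *\<^sub>v (T i *\<^sub>v v) = T (succ_mod l i) *\<^sub>v (qY M i *\<^sub>v v)"
      using assoc_mult_mat_vec[OF cY' T(2)[OF i] v] assoc_mult_mat_vec[OF T(2)[OF s] cY v] by simp
    then show ?thesis using Cons.IH[OF s mult_mat_vec_carrier[OF cY v]] False by simp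
  qed
qed simp

lemma frame_vec_carrier: "M \<in> rep_space l (framed 1 \<alpha>) \<Longrightarrow> frame_vec M \<in> carrier_vec (\<alpha> 0)"
  unfolding frame_vec_def by (rule mult_mat_vec_carrier[OF rep_spaceD(3)]) auto

lemma chi_transforms:
  assumes M: "M \<in> rep_space l (framed 1 \<alpha>)" and N: "N \<in> rep_space l (framed 1 \<beta>)" and l: "l > 0"
    and T: "transforms l T M N" "\<And>i. i < l \<Longrightarrow> T i \<in> carrier_mat (\<beta> i) (\<alpha> i)"
    and w: "wend l 0 w = 0"
  shows "chi l N w = chi l M w"
proof -
  note fv = frame_vec_carrier[OF M]
  have "qx N = T 0 * qx M" using T(1) by (simp add: transforms_def)
  then have "frame_vec N = T 0 *\<^sub>v frame_vec M"
    unfolding frame_vec_def using assoc_mult_mat_vec[OF T(2)[OF l] rep_spaceD(3)[OF M], of "unit_vec 1 0"] by simp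
  then have "act l N 0 w (frame_vec N) = T 0 *\<^sub>v act l M 0 w (frame_vec M)"
    using act_transforms[OF M N T l fv, of w] w by simp
  moreover have "act l M 0 w (frame_vec M) \<in> carrier_vec (\<alpha> 0)"
    using act_carrier[OF M l fv, of w] w by simp
  moreover have "qy N * T 0 = qy M" using T(1) by (simp add: transforms_def)
  ultimately show ?thesis
    unfolding chi_def using assoc_mult_mat_vec[OF rep_spaceD(4)[OF N] T(2)[OF l]] by simp
qed

section \<open>Path scalars as invariant polynomial functions\<close>

lemma poly_funs_sum:
  "(\<And>b. b < n \<Longrightarrow> f b \<in> poly_funs l \<alpha>) \<Longrightarrow> (\<lambda>M. \<Sum>b<n. f b M) \<in> poly_funs l \<alpha>" for n :: nat
proof (induction n)
  case 0
  show ?case using poly_funs.const[of 0] by simp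
next
  case (Suc n)
  have "(\<lambda>M. \<Sum>b<n. f b M) \<in> poly_funs l \<alpha>" using Suc by simp
  from poly_funs.add[OF this Suc.prems[of n]] show ?case by simp
qed

text \<open>The recursion of \<open>act\<close> carried out on coordinate functions instead of
  vectors, so that polynomiality can be read off it.\<close>

fun pact :: "nat \<Rightarrow> (nat \<Rightarrow> nat) \<Rightarrow> nat \<Rightarrow> bool list \<Rightarrow> (nat \<Rightarrow> quiver_rep \<Rightarrow> complex) \<Rightarrow> nat \<Rightarrow> quiver_rep \<Rightarrow> complex" where
  "pact l \<alpha> i [] f = f"
| "pact l \<alpha> i (True # w) f =
    pact l \<alpha> (pred_mod l i) w (\<lambda>a M. \<Sum>b<\<alpha> i. qX M (pred_mod l i) $$ (a, b) * f b M)"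
| "pact l \<alpha> i (False # w) f =
    pact l \<alpha> (succ_mod l i) w (\<lambda>a M. \<Sum>b<\<alpha> i. qY M i $$ (a, b) * f b M)"

lemma pact_poly_funs:
  "i < l \<Longrightarrow> (\<And>b. b < \<alpha> i \<Longrightarrow> f b \<in> poly_funs l \<alpha>) \<Longrightarrow> a < \<alpha> (wend l i w) \<Longrightarrow> pact l \<alpha> i w f a \<in> poly_funs l \<alpha>"
proof (induction w arbitrary: i f)
  case (Cons b w)
  then have l: "l > 0" by simp
  note i = Cons.prems(1)
  show ?case
  proof (cases b)
    case True
    have p: "pred_mod l i < l" "succ_mod l (pred_mod l i) = i" using l i by (auto simp: pred_mod_less succ_pred_mod)
    have "(\<lambda>M. \<Sum>b<\<alpha> i. qX M (pred_mod l i) $$ (a', b) * f b M) \<in> poly_funs l \<alpha>"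
      if "a' < \<alpha> (pred_mod l i)" for a'
      using that Cons.prems(2) p
      by (intro poly_funs_sum poly_funs.mult poly_funs.coord_X) auto
    from Cons.IH[OF p(1) this] show ?thesis using True Cons.prems(3) by simp
  next
    case False
    have "(\<lambda>M. \<Sum>b<\<alpha> i. qY M i $$ (a', b) * f b M) \<in> poly_funs l \<alpha>"
      if "a' < \<alpha> (succ_mod l i)" for a'
      using that Cons.prems(2) i
      by (intro poly_funs_sum poly_funs.mult poly_funs.coord_Y) auto
    from Cons.IH[OF succ_mod_less[OF l] this] show ?thesis using False Cons.prems(3) by simp
  qed
qed simp

lemma pact_eval:
  assumes M: "M \<in> rep_space l (framed k \<alpha>)"
  shows "i < l \<Longrightarrow> v \<in> carrier_vec (\<alpha> i) \<Longrightarrow> (\<And>b. b < \<alpha> i \<Longrightarrow> f b M = v $ b) \<Longrightarrow> a < \<alpha> (wend l i w) \<Longrightarrow>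
    pact l \<alpha> i w f a M = act l M i w v $ a"
proof (induction w arbitrary: i v f)
  case (Cons b w)
  then have l: "l > 0" by simp
  note i = Cons.prems(1) and v = Cons.prems(2)
  have idx: "(A *\<^sub>v v) $ a' = (\<Sum>b<\<alpha> i. A $$ (a', b) * f b M)"
    if "A \<in> carrier_mat n (\<alpha> i)" "a' < n" for A :: "complex mat" and n a'
    using that v Cons.prems(3) by (auto simp: scalar_prod_def atLeast0LessThan intro!: sum.cong)
  show ?case
  proof (cases b)
    case True
    note cX = qX_pred_carrier[OF M i]
    have e: "(\<lambda>a M. \<Sum>b<\<alpha> i. qX M (pred_mod l i) $$ (a, b) * f b M) a' M = (qX M (pred_mod l i) *\<^sub>v v) $ a'"
      if "a' < \<alpha> (pred_mod l i)" for a' using idx[OF cX that] by simp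
    show ?thesis
      using Cons.IH[where f = "\<lambda>a M. \<Sum>b<\<alpha> i. qX M (pred_mod l i) $$ (a, b) * f b M",
        OF pred_mod_less[OF l] mult_mat_vec_carrier[OF cX v] e] True Cons.prems(4) by simp
  next
    case False
    note cY = rep_spaceD(2)[OF M i]
    have e: "(\<lambda>a M. \<Sum>b<\<alpha> i. qY M i $$ (a, b) * f b M) a' M = (qY M i *\<^sub>v v) $ a'"
      if "a' < \<alpha> (succ_mod l i)" for a' using idx[OF cY that] by simp
    show ?thesis
      using Cons.IH[where f = "\<lambda>a M. \<Sum>b<\<alpha> i. qY M i $$ (a, b) * f b M",
        OF succ_mod_less[OF l] mult_mat_vec_carrier[OF cY v] e] False Cons.prems(4) by simp
  qed
qed simp

text \<open>A path scalar is polynomial in the matrix entries and unchanged by a change of basis, so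
  it is one of the functions by which \<open>git_rel\<close> tests points.\<close>

lemma chi_git_rel:
  assumes l: "l > 0" and MN: "(M, N) \<in> git_rel l c \<alpha>" and w: "wend l 0 w = 0"
  shows "chi l M w = chi l N w"
proof -
  define f where "f = (\<lambda>M. \<Sum>a<\<alpha> 0. qy M $$ (0, a) * pact l \<alpha> 0 w (\<lambda>a M. qx M $$ (a, 0)) a M)"
  have poly: "f \<in> poly_funs l \<alpha>"
    unfolding f_def
    by (intro poly_funs_sum poly_funs.mult poly_funs.coord_y pact_poly_funs poly_funs.coord_x)
      (use l w in auto)
  have eval: "f M = chi l M w" if M: "M \<in> rep_space l (framed 1 \<alpha>)" for M
  proof -
    note fv = frame_vec_carrier[OF M]
    have "qx M $$ (b, 0) = frame_vec M $ b" if "b < \<alpha> 0" for b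
      using rep_spaceD(3)[OF M] that by (simp add: frame_vec_def scalar_prod_def)
    then have "pact l \<alpha> 0 w (\<lambda>a M. qx M $$ (a, 0)) a M = act l M 0 w (frame_vec M) $ a" if "a < \<alpha> 0" for a
      using that w by (intro pact_eval[OF M l fv]) auto
    then have "f M = (\<Sum>a<\<alpha> 0. qy M $$ (0, a) * act l M 0 w (frame_vec M) $ a)"
      unfolding f_def by (intro sum.cong) auto
    also have "\<dots> = chi l M w"
      using act_carrier[OF M l fv, of w] w rep_spaceD(4)[OF M]
      by (simp add: chi_def scalar_prod_def atLeast0LessThan)
    finally show ?thesis .
  qed
  have rs: "M \<in> rep_space l (framed 1 \<alpha>)" if "M \<in> moment_fiber l c \<alpha>" for M
    using that by (simp add: moment_fiber_def)
  have "f \<in> invariant_funs l c \<alpha>"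
    unfolding invariant_funs_def
  proof (intro CollectI conjI ballI impI)
    show "f \<in> poly_funs l \<alpha>" by (rule poly)
    fix M N assume MN: "M \<in> moment_fiber l c \<alpha>" "N \<in> moment_fiber l c \<alpha>" "isomorphic_reps l \<alpha> M N"
    obtain g where g: "g \<in> GL l \<alpha>" "transforms l g M N" using MN(3) unfolding isomorphic_reps_def by blast
    have "g i \<in> carrier_mat (\<alpha> i) (\<alpha> i)" if "i < l" for i using g(1) that unfolding GL_def by (auto dest: PiE_mem)
    then have "chi l N w = chi l M w" by (rule chi_transforms[OF rs[OF MN(1)] rs[OF MN(2)] l g(2) _ w])
    then show "f M = f N" using eval rs MN by simp
  qed
  moreover have "M \<in> moment_fiber l c \<alpha>" "N \<in> moment_fiber l c \<alpha>"
    using MN unfolding git_rel_def by blast+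
  moreover have "\<forall>f\<in>invariant_funs l c \<alpha>. f M = f N" using MN unfolding git_rel_def by blast
  ultimately show ?thesis using eval rs by metis
qed

text \<open>The correspondence between two framed representations generated by the framing. If the scalars
  attached to closed words agree and the first representation is simple, it is the graph of an
  injective map.\<close>

inductive gen :: "nat \<Rightarrow> (nat \<Rightarrow> nat) \<Rightarrow> (nat \<Rightarrow> nat) \<Rightarrow> quiver_rep \<Rightarrow> quiver_rep \<Rightarrow> nat \<Rightarrow> complex vec \<Rightarrow> complex vec \<Rightarrow> bool"
  for l \<alpha> \<beta> M N where
  gen_frame: "gen l \<alpha> \<beta> M N 0 (frame_vec M) (frame_vec N)"
| gen_zero: "i < l \<Longrightarrow> gen l \<alpha> \<beta> M N i (0\<^sub>v (\<alpha> i)) (0\<^sub>v (\<beta> i))"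
| gen_add: "gen l \<alpha> \<beta> M N i u u' \<Longrightarrow> gen l \<alpha> \<beta> M N i v v' \<Longrightarrow> gen l \<alpha> \<beta> M N i (u + v) (u' + v')"
| gen_smult: "gen l \<alpha> \<beta> M N i u u' \<Longrightarrow> gen l \<alpha> \<beta> M N i (a \<cdot>\<^sub>v u) (a \<cdot>\<^sub>v u')"
| gen_X: "i < l \<Longrightarrow> gen l \<alpha> \<beta> M N (succ_mod l i) u u' \<Longrightarrow> gen l \<alpha> \<beta> M N i (qX M i *\<^sub>v u) (qX N i *\<^sub>v u')"
| gen_Y: "i < l \<Longrightarrow> gen l \<alpha> \<beta> M N i u u' \<Longrightarrow> gen l \<alpha> \<beta> M N (succ_mod l i) (qY M i *\<^sub>v u) (qY N i *\<^sub>v u')"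

lemma gen_carrier:
  assumes M: "M \<in> rep_space l (framed 1 \<alpha>)" and N: "N \<in> rep_space l (framed 1 \<beta>)" and l: "l > 0"
  shows "gen l \<alpha> \<beta> M N i u u' \<Longrightarrow> i < l \<and> u \<in> carrier_vec (\<alpha> i) \<and> u' \<in> carrier_vec (\<beta> i)"
proof (induction rule: gen.induct)
  case gen_frame
  then show ?case using l frame_vec_carrier[OF M] frame_vec_carrier[OF N] by simp
next
  case (gen_X i u u')
  then show ?case
    using mult_mat_vec_carrier[OF rep_spaceD(1)[OF M gen_X(1)]] mult_mat_vec_carrier[OF rep_spaceD(1)[OF N gen_X(1)]]
    by blast
next
  case (gen_Y i u u')
  then show ?case
    using mult_mat_vec_carrier[OF rep_spaceD(2)[OF M gen_Y(1)]] mult_mat_vec_carrier[OF rep_spaceD(2)[OF N gen_Y(1)]]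
      succ_mod_less[OF l] by blast
qed auto

text \<open>A path from \<open>i\<close> back to infinity cannot distinguish the two members of a
  generated pair: an arrow applied to the pair can be prefixed to the word, and at the framing
  vectors only closed words remain.\<close>

lemma gen_pairing:
  assumes M: "M \<in> rep_space l (framed 1 \<alpha>)" and N: "N \<in> rep_space l (framed 1 \<beta>)" and l: "l > 0"
    and chi: "\<And>w. wend l 0 w = 0 \<Longrightarrow> chi l M w = chi l N w"
  shows "gen l \<alpha> \<beta> M N i u u' \<Longrightarrow> wend l i w = 0 \<Longrightarrow>
    (qy M *\<^sub>v act l M i w u) $ 0 = (qy N *\<^sub>v act l N i w u') $ 0"
proof (induction arbitrary: w rule: gen.induct)
  case gen_frame
  then show ?case using chi[of w] by (simp add: chi_def)
next
  case (gen_zero i)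
  note yM = rep_spaceD(4)[OF M] and yN = rep_spaceD(4)[OF N]
  have a: "act l M i w (0\<^sub>v (\<alpha> i)) = 0\<^sub>v (\<alpha> 0)" and b: "act l N i w (0\<^sub>v (\<beta> i)) = 0\<^sub>v (\<beta> 0)"
    using act_zero[OF M gen_zero(1), of w] act_zero[OF N gen_zero(1), of w] gen_zero(2) by simp_all
  show ?case unfolding a b mult_zero_vec[OF yM] mult_zero_vec[OF yN] by simp
next
  case (gen_add i u u' v v')
  note cu = gen_carrier[OF M N l gen_add(1)] and cv = gen_carrier[OF M N l gen_add(2)]
  note yM = rep_spaceD(4)[OF M] and yN = rep_spaceD(4)[OF N]
  have c: "act l M i w u \<in> carrier_vec (\<alpha> 0)" "act l M i w v \<in> carrier_vec (\<alpha> 0)"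
    "act l N i w u' \<in> carrier_vec (\<beta> 0)" "act l N i w v' \<in> carrier_vec (\<beta> 0)"
    using act_carrier[OF M, of i _ w] act_carrier[OF N, of i _ w] cu cv gen_add.prems by auto
  have "act l M i w (u + v) = act l M i w u + act l M i w v" using cu cv act_linear(1)[OF M] by blast
  moreover have "act l N i w (u' + v') = act l N i w u' + act l N i w v'" using cu cv act_linear(1)[OF N] by blast
  ultimately show ?case
    using gen_add.IH(1)[OF gen_add.prems] gen_add.IH(2)[OF gen_add.prems] yM yN
    by (simp add: mult_add_distrib_mat_vec[OF yM c(1,2)] mult_add_distrib_mat_vec[OF yN c(3,4)]
      del: index_mult_mat_vec)
next
  case (gen_smult i u u' a)
  note cu = gen_carrier[OF M N l gen_smult(1)]
  note yM = rep_spaceD(4)[OF M] and yN = rep_spaceD(4)[OF N]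
  have c: "act l M i w u \<in> carrier_vec (\<alpha> 0)" "act l N i w u' \<in> carrier_vec (\<beta> 0)"
    using act_carrier[OF M, of i _ w] act_carrier[OF N, of i _ w] cu gen_smult.prems by auto
  have "act l M i w (a \<cdot>\<^sub>v u) = a \<cdot>\<^sub>v act l M i w u" using cu act_linear(2)[OF M] by blast
  moreover have "act l N i w (a \<cdot>\<^sub>v u') = a \<cdot>\<^sub>v act l N i w u'" using cu act_linear(2)[OF N] by blast
  ultimately show ?case
    using gen_smult.IH[OF gen_smult.prems] yM yN
    by (simp add: mult_mat_vec_smult[OF yM c(1)] mult_mat_vec_smult[OF yN c(2)] del: index_mult_mat_vec)
next
  case (gen_X i u u')
  show ?case using gen_X.IH[of "True # w"] gen_X.prems pred_succ_mod[OF gen_X(1)] by simp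
next
  case (gen_Y i u u')
  show ?case using gen_Y.IH[of "False # w"] gen_Y.prems by simp
qed

text \<open>Simplicity of \<open>M\<close> has two consequences: every vector of \<open>M\<close> is
  the first member of a generated pair, and only zero is killed by all paths to infinity. If the
  dimension of \<open>N\<close> at \<open>i\<close> were smaller, a non-zero vector would be paired
  with zero, hence be killed by all those paths.\<close>

lemma simple_dim_le:
  assumes M: "M \<in> rep_space l (framed 1 \<alpha>)" and N: "N \<in> rep_space l (framed 1 \<beta>)" and l: "l > 0"
    and chi: "\<And>w. wend l 0 w = 0 \<Longrightarrow> chi l M w = chi l N w"
    and simple: "simple_rep l (framed 1 \<alpha>) M" and i: "i < l"
  shows "\<alpha> i \<le> \<beta> i"
proof (rule ccontr)
  assume "\<not> ?thesis"
  then have less: "\<beta> i < \<alpha> i" by simp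
  note yM = rep_spaceD(4)[OF M]
  let ?G = "gen l \<alpha> \<beta> M N"
  note carr = gen_carrier[OF M N l]
  \<comment> \<open>The first members of generated pairs form a subrepresentation that contains the
    space at infinity.\<close>
  define U where "U = (\<lambda>v. case v of None \<Rightarrow> carrier_vec 1 | Some j \<Rightarrow> {u. \<exists>u'. ?G j u u'})"
  have "subrep l (framed 1 \<alpha>) M U"
    unfolding subrep_framed_iff
  proof (intro conjI allI impI ballI)
    show "subsp (U None) 1" by (simp add: U_def subsp_full)
    fix j assume j: "j < l"
    show "subsp (U (Some j)) (\<alpha> j)"
    proof (rule subspI)
      show "u \<in> carrier_vec (\<alpha> j)" if "u \<in> U (Some j)" for u using that carr by (auto simp: U_def)
      show "0\<^sub>v (\<alpha> j) \<in> U (Some j)" by (simp add: U_def) (rule exI, rule gen_zero[OF j])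
      show "u + v \<in> U (Some j)" if "u \<in> U (Some j)" "v \<in> U (Some j)" for u v
        using that by (auto simp: U_def intro: gen_add)
      show "a \<cdot>\<^sub>v u \<in> U (Some j)" if "u \<in> U (Some j)" for a u
        using that by (auto simp: U_def intro: gen_smult)
    qed
    show "qX M j *\<^sub>v u \<in> U (Some j)" if "u \<in> U (Some (succ_mod l j))" for u
      using that j by (auto simp: U_def intro: gen_X)
    show "qY M j *\<^sub>v u \<in> U (Some (succ_mod l j))" if "u \<in> U (Some j)" for u
      using that j by (auto simp: U_def intro: gen_Y)
  next
    fix u assume "u \<in> U None"
    then have u: "u \<in> carrier_vec 1" by (simp add: U_def)
    have "u = u $ 0 \<cdot>\<^sub>v unit_vec 1 0" using u by (intro eq_vecI) auto
    then have "qx M *\<^sub>v u = u $ 0 \<cdot>\<^sub>v frame_vec M"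
      unfolding frame_vec_def using mult_mat_vec_smult[OF rep_spaceD(3)[OF M], of "unit_vec 1 0" "u $ 0"] by simp
    then show "qx M *\<^sub>v u \<in> U (Some 0)" using gen_smult[OF gen_frame, of l \<alpha> \<beta> M N "u $ 0"] by (auto simp: U_def)
  next
    fix u assume "u \<in> U (Some 0)"
    then have "u \<in> carrier_vec (\<alpha> 0)" using carr by (auto simp: U_def)
    then show "qy M *\<^sub>v u \<in> U None" using mult_mat_vec_carrier[OF yM] by (simp add: U_def)
  qed
  moreover have "U None \<noteq> {0\<^sub>v 1}" using carrier_vec_1_neq by (simp add: U_def)
  ultimately have full: "U (Some i) = carrier_vec (\<alpha> i)"
    using simple i unfolding simple_framed_iff by blast
  \<comment> \<open>The vectors killed by all paths to infinity form a subrepresentation that is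
    zero at infinity.\<close>
  define K where "K = (\<lambda>j. {u \<in> carrier_vec (\<alpha> j). \<forall>w. wend l j w = 0 \<longrightarrow> (qy M *\<^sub>v act l M j w u) $ 0 = 0})"
  define V where "V = (\<lambda>v. case v of None \<Rightarrow> {0\<^sub>v 1} | Some j \<Rightarrow> K j)"
  have act0: "act l M j w u \<in> carrier_vec (\<alpha> 0)" if "j < l" "u \<in> carrier_vec (\<alpha> j)" "wend l j w = 0" for j w u
    using act_carrier[OF M that(1,2), of w] that(3) by simp
  have "subrep l (framed 1 \<alpha>) M V"
    unfolding subrep_framed_iff
  proof (intro conjI allI impI ballI)
    show "subsp (V None) 1" by (simp add: V_def subsp_zero)
    fix j assume j: "j < l"
    have add: "u + v \<in> K j" if uv: "u \<in> K j" "v \<in> K j" for u v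
    proof -
      have c: "u \<in> carrier_vec (\<alpha> j)" "v \<in> carrier_vec (\<alpha> j)" using uv by (auto simp: K_def)
      have "(qy M *\<^sub>v act l M j w (u + v)) $ 0 = 0" if w: "wend l j w = 0" for w
      proof -
        have "qy M *\<^sub>v act l M j w (u + v) = qy M *\<^sub>v act l M j w u + qy M *\<^sub>v act l M j w v"
          unfolding act_linear(1)[OF M j c] by (rule mult_add_distrib_mat_vec[OF yM act0[OF j c(1) w] act0[OF j c(2) w]])
        moreover have "(qy M *\<^sub>v act l M j w u) $ 0 = 0" "(qy M *\<^sub>v act l M j w v) $ 0 = 0"
          using uv w by (auto simp: K_def)
        ultimately show ?thesis using yM by (simp del: index_mult_mat_vec)
      qed
      then show ?thesis using c by (simp add: K_def)
    qed
    have smult: "a \<cdot>\<^sub>v u \<in> K j" if u: "u \<in> K j" for a u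
    proof -
      have c: "u \<in> carrier_vec (\<alpha> j)" using u by (auto simp: K_def)
      have "(qy M *\<^sub>v act l M j w (a \<cdot>\<^sub>v u)) $ 0 = 0" if w: "wend l j w = 0" for w
      proof -
        have "qy M *\<^sub>v act l M j w (a \<cdot>\<^sub>v u) = a \<cdot>\<^sub>v (qy M *\<^sub>v act l M j w u)"
          unfolding act_linear(2)[OF M j c] by (rule mult_mat_vec_smult[OF yM act0[OF j c w]])
        moreover have "(qy M *\<^sub>v act l M j w u) $ 0 = 0" using u w by (auto simp: K_def)
        ultimately show ?thesis using yM by (simp del: index_mult_mat_vec)
      qed
      then show ?thesis using c by (simp add: K_def)
    qed
    have "0\<^sub>v (\<alpha> j) \<in> K j"
    proof -
      have "(qy M *\<^sub>v act l M j w (0\<^sub>v (\<alpha> j))) $ 0 = 0" if w: "wend l j w = 0" for w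
        using act_zero[OF M j, of w] w mult_zero_vec[OF yM] by simp
      then show ?thesis by (simp add: K_def)
    qed
    then show "subsp (V (Some j)) (\<alpha> j)"
      unfolding V_def by (auto intro!: subspI add smult) (simp add: K_def)
    show "qX M j *\<^sub>v u \<in> V (Some j)" if u: "u \<in> V (Some (succ_mod l j))" for u
    proof -
      have "u \<in> K (succ_mod l j)" using u by (simp add: V_def)
      then have uc: "u \<in> carrier_vec (\<alpha> (succ_mod l j))"
        and *: "\<And>w. wend l (succ_mod l j) w = 0 \<Longrightarrow> (qy M *\<^sub>v act l M (succ_mod l j) w u) $ 0 = 0"
        by (auto simp: K_def)
      have "(qy M *\<^sub>v act l M j w (qX M j *\<^sub>v u)) $ 0 = 0" if "wend l j w = 0" for w
        using *[of "True # w"] that pred_succ_mod[OF j] by simp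
      then show ?thesis
        using mult_mat_vec_carrier[OF rep_spaceD(1)[OF M j] uc] by (simp add: V_def K_def)
    qed
    show "qY M j *\<^sub>v u \<in> V (Some (succ_mod l j))" if u: "u \<in> V (Some j)" for u
    proof -
      have "u \<in> K j" using u by (simp add: V_def)
      then have uc: "u \<in> carrier_vec (\<alpha> j)"
        and *: "\<And>w. wend l j w = 0 \<Longrightarrow> (qy M *\<^sub>v act l M j w u) $ 0 = 0"
        by (auto simp: K_def)
      have "(qy M *\<^sub>v act l M (succ_mod l j) w (qY M j *\<^sub>v u)) $ 0 = 0" if "wend l (succ_mod l j) w = 0" for w
        using *[of "False # w"] that by simp
      then show ?thesis
        using mult_mat_vec_carrier[OF rep_spaceD(2)[OF M j] uc] by (simp add: V_def K_def)
    qed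
  next
    fix u assume "u \<in> V None"
    then have "u = 0\<^sub>v 1" by (simp add: V_def)
    then have x: "qx M *\<^sub>v u = 0\<^sub>v (\<alpha> 0)" using mult_zero_vec[OF rep_spaceD(3)[OF M]] by simp
    have "act l M 0 w (0\<^sub>v (\<alpha> 0)) = 0\<^sub>v (\<alpha> 0)" if "wend l 0 w = 0" for w
      using act_zero[OF M l, of w] that by simp
    then show "qx M *\<^sub>v u \<in> V (Some 0)"
      unfolding x V_def K_def using mult_zero_vec[OF yM] by simp
  next
    fix u assume "u \<in> V (Some 0)"
    then have uc: "u \<in> carrier_vec (\<alpha> 0)" and *: "(qy M *\<^sub>v act l M 0 [] u) $ 0 = 0"
      unfolding V_def K_def by (auto simp del: act.simps)
    have "qy M *\<^sub>v u \<in> carrier_vec 1" by (rule mult_mat_vec_carrier[OF yM uc])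
    then have "qy M *\<^sub>v u = 0\<^sub>v 1" using * by (intro vec_1_eq_zero) simp_all
    then show "qy M *\<^sub>v u \<in> V None" by (simp add: V_def)
  qed
  moreover have "V None \<noteq> carrier_vec 1" using carrier_vec_1_neq by (simp add: V_def)
  ultimately have "V (Some i) = {0\<^sub>v (\<alpha> i)}"
    using simple i unfolding simple_framed_iff by blast
  then have Kz: "K i = {0\<^sub>v (\<alpha> i)}" by (simp add: V_def)
  have "\<exists>u'. ?G i (unit_vec (\<alpha> i) j) u'" for j
  proof -
    have "unit_vec (\<alpha> i) j \<in> U (Some i)" unfolding full by simp
    then show ?thesis by (simp add: U_def)
  qed
  then obtain f where f: "\<And>j. ?G i (unit_vec (\<alpha> i) j) (f j)" by metis
  have fc: "f j \<in> carrier_vec (\<beta> i)" for j using carr[OF f] by blast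
  define F where "F = mat (\<beta> i) (\<alpha> i) (\<lambda>(a, j). f j $ a)"
  have F: "F \<in> carrier_mat (\<beta> i) (\<alpha> i)" by (simp add: F_def)
  obtain v where v: "v \<in> carrier_vec (\<alpha> i)" "v \<noteq> 0\<^sub>v (\<alpha> i)" "F *\<^sub>v v = 0\<^sub>v (\<beta> i)"
    by (rule ex_kernel_vec[OF F less])
  \<comment> \<open>The columns of \<open>F\<close> are chosen partners of the unit vectors. As
    generated pairs are closed under linear combinations, \<open>v\<close> is paired with
    \<open>F *\<^sub>v v\<close>, which is zero.\<close>
  have "k \<le> \<alpha> i \<Longrightarrow> ?G i (vec (\<alpha> i) (\<lambda>j. if j < k then v $ j else 0)) (vec (\<beta> i) (\<lambda>a. \<Sum>j<k. v $ j * f j $ a))" for k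
  proof (induction k)
    case 0
    have "vec (\<alpha> i) (\<lambda>j. if j < 0 then v $ j else 0) = 0\<^sub>v (\<alpha> i)" by (intro eq_vecI) auto
    moreover have "vec (\<beta> i) (\<lambda>a. \<Sum>j<0. v $ j * f j $ a) = 0\<^sub>v (\<beta> i)" by (intro eq_vecI) auto
    ultimately show ?case using gen_zero[OF i] by simp
  next
    case (Suc k)
    have "vec (\<alpha> i) (\<lambda>j. if j < Suc k then v $ j else 0) =
      vec (\<alpha> i) (\<lambda>j. if j < k then v $ j else 0) + v $ k \<cdot>\<^sub>v unit_vec (\<alpha> i) k"
      using Suc.prems by (intro eq_vecI) (auto simp: less_Suc_eq)
    moreover have "vec (\<beta> i) (\<lambda>a. \<Sum>j<Suc k. v $ j * f j $ a) =
      vec (\<beta> i) (\<lambda>a. \<Sum>j<k. v $ j * f j $ a) + v $ k \<cdot>\<^sub>v f k"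
      using fc[of k] by (intro eq_vecI) auto
    ultimately show ?case using gen_add[OF Suc.IH gen_smult[OF f]] Suc.prems by simp
  qed
  from this[OF order_refl] have "?G i (vec (\<alpha> i) (\<lambda>j. if j < \<alpha> i then v $ j else 0))
    (vec (\<beta> i) (\<lambda>a. \<Sum>j<\<alpha> i. v $ j * f j $ a))" .
  moreover have "vec (\<alpha> i) (\<lambda>j. if j < \<alpha> i then v $ j else 0) = v" using v(1) by (intro eq_vecI) auto
  moreover have "vec (\<beta> i) (\<lambda>a. \<Sum>j<\<alpha> i. v $ j * f j $ a) = F *\<^sub>v v"
    using v(1) by (intro eq_vecI) (auto simp: F_def scalar_prod_def atLeast0LessThan mult.commute)
  ultimately have G: "?G i v (0\<^sub>v (\<beta> i))" using v(3) by simp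
  have G0: "?G i (0\<^sub>v (\<alpha> i)) (0\<^sub>v (\<beta> i))" by (rule gen_zero[OF i])
  have "(qy M *\<^sub>v act l M i w v) $ 0 = 0" if w: "wend l i w = 0" for w
  proof -
    have "(qy M *\<^sub>v act l M i w v) $ 0 = (qy M *\<^sub>v act l M i w (0\<^sub>v (\<alpha> i))) $ 0"
      using gen_pairing[OF M N l chi G w] gen_pairing[OF M N l chi G0 w] by simp
    moreover have "0\<^sub>v (\<alpha> i) \<in> K i" unfolding Kz by simp
    ultimately show ?thesis using w by (simp add: K_def)
  qed
  then have "v \<in> K i" using v(1) by (simp add: K_def)
  then show False using Kz v(2) by simp
qed

section \<open>Leaves\<close>

definition dsum :: "complex mat \<Rightarrow> complex mat \<Rightarrow> complex mat" where
  "dsum A B = diag_block_mat [A, B]"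

lemma dsum_four_block:
  "A \<in> carrier_mat p r \<Longrightarrow> B \<in> carrier_mat q s \<Longrightarrow> dsum A B = four_block_mat A (0\<^sub>m p s) (0\<^sub>m q r) B"
proof -
  assume "A \<in> carrier_mat p r" "B \<in> carrier_mat q s"
  moreover have "diag_block_mat [A, B] = four_block_mat A (0\<^sub>m (dim_row A) (dim_col (diag_block_mat [B])))
    (0\<^sub>m (dim_row (diag_block_mat [B])) (dim_col A)) (diag_block_mat [B])"
    by (simp only: diag_block_mat.simps Let_def)
  ultimately show ?thesis unfolding dsum_def by (simp only: diag_block_mat_singleton) auto
qed

lemma dsum_carrier:
  "A \<in> carrier_mat p r \<Longrightarrow> B \<in> carrier_mat q s \<Longrightarrow> dsum A B \<in> carrier_mat (p + q) (r + s)"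
  by (simp add: dsum_four_block)

lemma dsum_mult:
  assumes "A \<in> carrier_mat p r" "B \<in> carrier_mat q s" "C \<in> carrier_mat r t" "D \<in> carrier_mat s u"
  shows "dsum A B * dsum C D = dsum (A * C) (B * D)"
proof -
  have AC: "A * C \<in> carrier_mat p t" and BD: "B * D \<in> carrier_mat q u" using assms by auto
  have "dsum A B * dsum C D = four_block_mat (A * C + 0\<^sub>m p s * 0\<^sub>m s t) (A * 0\<^sub>m r u + 0\<^sub>m p s * D)
    (0\<^sub>m q r * C + B * 0\<^sub>m s t) (0\<^sub>m q r * 0\<^sub>m r u + B * D)"
    unfolding dsum_four_block[OF assms(1,2)] dsum_four_block[OF assms(3,4)]
    by (rule mult_four_block_mat) (use assms in auto)
  also have "\<dots> = dsum (A * C) (B * D)"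
    unfolding dsum_four_block[OF AC BD] using assms by simp
  finally show ?thesis .
qed

lemma dsum_add_minus:
  assumes "A \<in> carrier_mat p r" "B \<in> carrier_mat q s" "C \<in> carrier_mat p r" "D \<in> carrier_mat q s"
  shows "dsum A B - dsum C D = dsum (A - C) (B - D)" "dsum A B + dsum C D = dsum (A + C) (B + D)"
proof -
  have m: "A - C \<in> carrier_mat p r" "B - D \<in> carrier_mat q s"
    by (rule minus_carrier_mat[OF assms(3)], rule minus_carrier_mat[OF assms(4)])
  have a: "A + C \<in> carrier_mat p r" "B + D \<in> carrier_mat q s" using assms by auto
  show "dsum A B - dsum C D = dsum (A - C) (B - D)"
    unfolding dsum_four_block[OF assms(1,2)] dsum_four_block[OF assms(3,4)] dsum_four_block[OF m]
    using assms by (intro eq_matI) auto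
  show "dsum A B + dsum C D = dsum (A + C) (B + D)"
    unfolding dsum_four_block[OF assms(1,2)] dsum_four_block[OF assms(3,4)] dsum_four_block[OF a]
    using assms by (intro eq_matI) auto
qed

lemma dsum_eq_scalar:
  assumes "A \<in> carrier_mat p p" "B \<in> carrier_mat q q"
  shows "dsum A B = k \<cdot>\<^sub>m 1\<^sub>m (p + q) \<longleftrightarrow> A = k \<cdot>\<^sub>m 1\<^sub>m p \<and> B = k \<cdot>\<^sub>m 1\<^sub>m q"
proof -
  have s: "k \<cdot>\<^sub>m 1\<^sub>m (p + q) = four_block_mat (k \<cdot>\<^sub>m 1\<^sub>m p) (0\<^sub>m p q) (0\<^sub>m q p) (k \<cdot>\<^sub>m 1\<^sub>m q)"
    by (intro eq_matI) auto
  show ?thesis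
  proof
    assume "dsum A B = k \<cdot>\<^sub>m 1\<^sub>m (p + q)"
    then have "four_block_mat A (0\<^sub>m p q) (0\<^sub>m q p) B =
      four_block_mat (k \<cdot>\<^sub>m 1\<^sub>m p) (0\<^sub>m p q) (0\<^sub>m q p) (k \<cdot>\<^sub>m 1\<^sub>m q)"
      unfolding s dsum_four_block[OF assms] .
    from four_block_inject(1,4)[OF this, of p p q q] show "A = k \<cdot>\<^sub>m 1\<^sub>m p \<and> B = k \<cdot>\<^sub>m 1\<^sub>m q"
      using assms by auto
  next
    assume "A = k \<cdot>\<^sub>m 1\<^sub>m p \<and> B = k \<cdot>\<^sub>m 1\<^sub>m q"
    then show "dsum A B = k \<cdot>\<^sub>m 1\<^sub>m (p + q)" unfolding s dsum_four_block[OF assms] by simp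
  qed
qed

lemma dsum_mult_vec:
  assumes "A \<in> carrier_mat p r" "B \<in> carrier_mat q s" "u \<in> carrier_vec r" "v \<in> carrier_vec s"
  shows "dsum A B *\<^sub>v (u @\<^sub>v v) = (A *\<^sub>v u) @\<^sub>v (B *\<^sub>v v)"
proof -
  have "dsum A B *\<^sub>v (u @\<^sub>v v) = (A *\<^sub>v u + 0\<^sub>m p s *\<^sub>v v) @\<^sub>v (0\<^sub>m q r *\<^sub>v u + B *\<^sub>v v)"
    unfolding dsum_four_block[OF assms(1,2)]
    by (rule four_block_mat_mult_vec[OF assms(1) zero_carrier_mat zero_carrier_mat assms(2-4)])
  also have "\<dots> = (A *\<^sub>v u) @\<^sub>v (B *\<^sub>v v)"
    using assms mult_mat_vec_carrier[OF assms(1,3)] mult_mat_vec_carrier[OF assms(2,4)]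
    by (simp add: zero_mult_vec)
  finally show ?thesis .
qed

section \<open>The moment map on direct sums and under change of basis\<close>

text \<open>Also applied to unframed representations, where \<open>qx M * qy M\<close> factors
  through a space of dimension zero and so vanishes.\<close>

definition mu :: "nat \<Rightarrow> nat \<Rightarrow> quiver_rep \<Rightarrow> nat \<Rightarrow> complex mat" where
  "mu l n M i = qX M i * qY M i - qY M (pred_mod l i) * qX M (pred_mod l i)
    + (if i = 0 then qx M * qy M else 0\<^sub>m n n)"

lemma moment_fiber_iff:
  "M \<in> moment_fiber l c \<alpha> \<longleftrightarrow> M \<in> rep_space l (framed 1 \<alpha>) \<and> (\<forall>i<l. mu l (\<alpha> i) M i = c i \<cdot>\<^sub>m 1\<^sub>m (\<alpha> i))"
  by (simp add: moment_fiber_def mu_def)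

lemma mu_parts:
  assumes "M \<in> rep_space l (framed k \<alpha>)" "i < l"
  shows "qX M i * qY M i \<in> carrier_mat (\<alpha> i) (\<alpha> i)"
    and "qY M (pred_mod l i) * qX M (pred_mod l i) \<in> carrier_mat (\<alpha> i) (\<alpha> i)"
    and "(if i = 0 then qx M * qy M else 0\<^sub>m (\<alpha> i) (\<alpha> i)) \<in> carrier_mat (\<alpha> i) (\<alpha> i)"
    and "mu l (\<alpha> i) M i \<in> carrier_mat (\<alpha> i) (\<alpha> i)"
proof -
  have p: "pred_mod l i < l" "succ_mod l (pred_mod l i) = i"
    using assms(2) by (auto simp: pred_mod_less succ_pred_mod)
  show 1: "qX M i * qY M i \<in> carrier_mat (\<alpha> i) (\<alpha> i)"
    by (rule mult_carrier_mat[OF rep_spaceD(1,2)[OF assms]])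
  show 2: "qY M (pred_mod l i) * qX M (pred_mod l i) \<in> carrier_mat (\<alpha> i) (\<alpha> i)"
    by (rule mult_carrier_mat[OF rep_spaceD(2,1)[OF assms(1) p(1), unfolded p(2)]])
  show 3: "(if i = 0 then qx M * qy M else 0\<^sub>m (\<alpha> i) (\<alpha> i)) \<in> carrier_mat (\<alpha> i) (\<alpha> i)"
    using mult_carrier_mat[OF rep_spaceD(3,4)[OF assms(1)]] by simp
  show "mu l (\<alpha> i) M i \<in> carrier_mat (\<alpha> i) (\<alpha> i)"
    unfolding mu_def by (rule add_carrier_mat[OF 3])
qed

context
  fixes l :: nat and \<alpha> \<alpha>' \<alpha>'' :: "nat \<Rightarrow> nat" and M0 M1 :: quiver_rep
  assumes l: "l > 0" and split: "\<And>i. i < l \<Longrightarrow> \<alpha> i = \<alpha>' i + \<alpha>'' i"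
    and M0: "M0 \<in> rep_space l (framed 1 \<alpha>')" and M1: "M1 \<in> rep_space l (framed 0 \<alpha>'')"
begin

lemma dsum_rep_sel:
  "i < l \<Longrightarrow> qX (direct_sum_rep l M0 M1) i = dsum (qX M0 i) (qX M1 i)" "i < l \<Longrightarrow> qY (direct_sum_rep l M0 M1) i = dsum (qY M0 i) (qY M1 i)"
  "qx (direct_sum_rep l M0 M1) = dsum (qx M0) (qx M1)" "qy (direct_sum_rep l M0 M1) = dsum (qy M0) (qy M1)"
  by (simp_all add: direct_sum_rep_def dsum_def)

lemma dsum_rep_space: "(direct_sum_rep l M0 M1) \<in> rep_space l (framed 1 \<alpha>)"
proof (rule rep_spaceI)
  fix i assume i: "i < l"
  show "qX (direct_sum_rep l M0 M1) i \<in> carrier_mat (\<alpha> i) (\<alpha> (succ_mod l i))"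
    unfolding dsum_rep_sel(1)[OF i] split[OF i] split[OF succ_mod_less[OF l]]
    by (rule dsum_carrier[OF rep_spaceD(1)[OF M0 i] rep_spaceD(1)[OF M1 i]])
  show "qY (direct_sum_rep l M0 M1) i \<in> carrier_mat (\<alpha> (succ_mod l i)) (\<alpha> i)"
    unfolding dsum_rep_sel(2)[OF i] split[OF i] split[OF succ_mod_less[OF l]]
    by (rule dsum_carrier[OF rep_spaceD(2)[OF M0 i] rep_spaceD(2)[OF M1 i]])
next
  show "qX (direct_sum_rep l M0 M1) \<in> extensional {..<l}" "qY (direct_sum_rep l M0 M1) \<in> extensional {..<l}" by (simp_all add: direct_sum_rep_def)
  show "qx (direct_sum_rep l M0 M1) \<in> carrier_mat (\<alpha> 0) 1" "qy (direct_sum_rep l M0 M1) \<in> carrier_mat 1 (\<alpha> 0)"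
    unfolding dsum_rep_sel split[OF l]
    using dsum_carrier[OF rep_spaceD(3)[OF M0] rep_spaceD(3)[OF M1]]
      dsum_carrier[OF rep_spaceD(4)[OF M0] rep_spaceD(4)[OF M1]] by simp_all
qed

lemma mu_dsum:
  assumes i: "i < l"
  shows "mu l (\<alpha> i) (direct_sum_rep l M0 M1) i = dsum (mu l (\<alpha>' i) M0 i) (mu l (\<alpha>'' i) M1 i)"
proof -
  let ?p = "pred_mod l i"
  have p: "?p < l" "succ_mod l ?p = i" using i l by (auto simp: pred_mod_less succ_pred_mod)
  note a = mu_parts[OF M0 i] and b = mu_parts[OF M1 i]
  have XY: "qX (direct_sum_rep l M0 M1) i * qY (direct_sum_rep l M0 M1) i = dsum (qX M0 i * qY M0 i) (qX M1 i * qY M1 i)"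
    unfolding dsum_rep_sel(1,2)[OF i]
    by (rule dsum_mult[OF rep_spaceD(1)[OF M0 i] rep_spaceD(1)[OF M1 i] rep_spaceD(2)[OF M0 i] rep_spaceD(2)[OF M1 i]])
  have YX: "qY (direct_sum_rep l M0 M1) ?p * qX (direct_sum_rep l M0 M1) ?p = dsum (qY M0 ?p * qX M0 ?p) (qY M1 ?p * qX M1 ?p)"
    unfolding dsum_rep_sel(1,2)[OF p(1)]
    by (rule dsum_mult[OF rep_spaceD(2)[OF M0 p(1)] rep_spaceD(2)[OF M1 p(1)]
      rep_spaceD(1)[OF M0 p(1)] rep_spaceD(1)[OF M1 p(1)]])
  have xy: "(if i = 0 then qx (direct_sum_rep l M0 M1) * qy (direct_sum_rep l M0 M1) else 0\<^sub>m (\<alpha> i) (\<alpha> i)) =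
    dsum (if i = 0 then qx M0 * qy M0 else 0\<^sub>m (\<alpha>' i) (\<alpha>' i)) (if i = 0 then qx M1 * qy M1 else 0\<^sub>m (\<alpha>'' i) (\<alpha>'' i))"
  proof (cases "i = 0")
    case True
    then show ?thesis
      unfolding dsum_rep_sel(3,4)
      using dsum_mult[OF rep_spaceD(3)[OF M0] rep_spaceD(3)[OF M1] rep_spaceD(4)[OF M0] rep_spaceD(4)[OF M1]] by simp
  next
    case False
    have "dsum (0\<^sub>m (\<alpha>' i) (\<alpha>' i)) (0\<^sub>m (\<alpha>'' i) (\<alpha>'' i)) = 0\<^sub>m (\<alpha> i) (\<alpha> i)"
      unfolding split[OF i] dsum_four_block[OF zero_carrier_mat zero_carrier_mat] by (intro eq_matI) auto
    then show ?thesis using False by simp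
  qed
  show ?thesis
    unfolding mu_def XY YX xy dsum_add_minus(1)[OF a(1) b(1) a(2) b(2)]
    by (rule dsum_add_minus(2)[OF minus_carrier_mat[OF a(2)] minus_carrier_mat[OF b(2)] a(3) b(3)])
qed

lemma dsum_moment_iff:
  "(\<forall>i<l. mu l (\<alpha> i) (direct_sum_rep l M0 M1) i = c i \<cdot>\<^sub>m 1\<^sub>m (\<alpha> i)) \<longleftrightarrow>
    (\<forall>i<l. mu l (\<alpha>' i) M0 i = c i \<cdot>\<^sub>m 1\<^sub>m (\<alpha>' i) \<and> mu l (\<alpha>'' i) M1 i = c i \<cdot>\<^sub>m 1\<^sub>m (\<alpha>'' i))"
  using mu_dsum split dsum_eq_scalar[OF mu_parts(4)[OF M0] mu_parts(4)[OF M1]] by simp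

lemma dsum_inclusion:
  "transforms l (\<lambda>i. vcat (1\<^sub>m (\<alpha>' i)) (0\<^sub>m (\<alpha>'' i) (\<alpha>' i))) M0 (direct_sum_rep l M0 M1)"
proof -
  let ?i = "\<lambda>i. vcat (1\<^sub>m (\<alpha>' i)) (0\<^sub>m (\<alpha>'' i) (\<alpha>' i)) :: complex mat"
  have key: "dsum A B * vcat (1\<^sub>m r) (0\<^sub>m s r) = vcat (1\<^sub>m p) (0\<^sub>m q p) * A"
    if A: "A \<in> carrier_mat p r" and B: "B \<in> carrier_mat q s" for A B :: "complex mat" and p q r s
  proof -
    have "dsum A B = vcat (hcat A (0\<^sub>m p s)) (hcat (0\<^sub>m q r) B)"
      unfolding dsum_four_block[OF A B] using A B by (intro eq_matI) (auto simp: hcat_def vcat_def)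
    then have "dsum A B * vcat (1\<^sub>m r) (0\<^sub>m s r) =
      vcat (hcat A (0\<^sub>m p s) * vcat (1\<^sub>m r) (0\<^sub>m s r)) (hcat (0\<^sub>m q r) B * vcat (1\<^sub>m r) (0\<^sub>m s r))"
      using vcat_mult[OF hcat_carrier[OF A zero_carrier_mat] hcat_carrier[OF zero_carrier_mat B]
        vcat_carrier[OF one_carrier_mat zero_carrier_mat]] by simp
    also have "hcat A (0\<^sub>m p s) * vcat (1\<^sub>m r) (0\<^sub>m s r) = A"
      unfolding hcat_mult_vcat[OF A zero_carrier_mat one_carrier_mat zero_carrier_mat] using A by simp
    also have "hcat (0\<^sub>m q r) B * vcat (1\<^sub>m r) (0\<^sub>m s r) = 0\<^sub>m q r"
      unfolding hcat_mult_vcat[OF zero_carrier_mat B one_carrier_mat zero_carrier_mat] using B by simp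
    also have "vcat A (0\<^sub>m q r) = vcat (1\<^sub>m p) (0\<^sub>m q p) * A"
      unfolding vcat_mult[OF one_carrier_mat zero_carrier_mat A] using A by simp
    finally show ?thesis .
  qed
  \<comment> \<open>The second summand has dimension zero at infinity, so the inclusion is the
    identity there, as \<open>transforms\<close> demands.\<close>
  have e1: "vcat (1\<^sub>m 1) (0\<^sub>m 0 1) = (1\<^sub>m 1 :: complex mat)" by (intro eq_matI) (auto simp: vcat_def)
  show ?thesis
    unfolding transforms_def
  proof (intro conjI allI impI)
    fix i assume i: "i < l"
    show "qX (direct_sum_rep l M0 M1) i * ?i (succ_mod l i) = ?i i * qX M0 i"
      unfolding dsum_rep_sel(1)[OF i] by (rule key[OF rep_spaceD(1)[OF M0 i] rep_spaceD(1)[OF M1 i]])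
    show "qY (direct_sum_rep l M0 M1) i * ?i i = ?i (succ_mod l i) * qY M0 i"
      unfolding dsum_rep_sel(2)[OF i] by (rule key[OF rep_spaceD(2)[OF M0 i] rep_spaceD(2)[OF M1 i]])
  next
    have "dsum (qx M0) (qx M1) * 1\<^sub>m 1 = ?i 0 * qx M0"
      using key[OF rep_spaceD(3)[OF M0] rep_spaceD(3)[OF M1]] unfolding e1 .
    moreover have "dsum (qx M0) (qx M1) \<in> carrier_mat (\<alpha>' 0 + \<alpha>'' 0) 1"
      using dsum_carrier[OF rep_spaceD(3)[OF M0] rep_spaceD(3)[OF M1]] by simp
    ultimately show "qx (direct_sum_rep l M0 M1) = ?i 0 * qx M0" unfolding dsum_rep_sel(3) by (metis right_mult_one_mat)
    have "dsum (qy M0) (qy M1) * ?i 0 = 1\<^sub>m 1 * qy M0"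
      using key[OF rep_spaceD(4)[OF M0] rep_spaceD(4)[OF M1]] unfolding e1 .
    then show "qy (direct_sum_rep l M0 M1) * ?i 0 = qy M0" unfolding dsum_rep_sel(4) left_mult_one_mat[OF rep_spaceD(4)[OF M0]] .
  qed
qed

lemma chi_dsum: "wend l 0 w = 0 \<Longrightarrow> chi l (direct_sum_rep l M0 M1) w = chi l M0 w"
proof (rule chi_transforms[OF M0 dsum_rep_space l dsum_inclusion])
  fix i assume i: "i < l"
  show "vcat (1\<^sub>m (\<alpha>' i)) (0\<^sub>m (\<alpha>'' i) (\<alpha>' i)) \<in> carrier_mat (\<alpha> i) (\<alpha>' i)"
    unfolding split[OF i] by (rule vcat_carrier[OF one_carrier_mat zero_carrier_mat])
qed

end

lemma GL_inverse:
  assumes "g \<in> GL l \<alpha>" "i < l"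
  obtains h where "g i \<in> carrier_mat (\<alpha> i) (\<alpha> i)" "h \<in> carrier_mat (\<alpha> i) (\<alpha> i)" "h * g i = 1\<^sub>m (\<alpha> i)"
proof -
  have "g i \<in> {g \<in> carrier_mat (\<alpha> i) (\<alpha> i). invertible_mat g}"
    using assms unfolding GL_def by (rule PiE_mem[OF _ lessThan_iff[THEN iffD2]])
  then have g: "g i \<in> carrier_mat (\<alpha> i) (\<alpha> i)" "invertible_mat (g i)" by auto
  obtain h where h: "g i * h = 1\<^sub>m (dim_row (g i))" "h * g i = 1\<^sub>m (dim_row h)"
    using g(2) unfolding invertible_mat_def inverts_mat_def by blast
  have "dim_row h = dim_col (h * g i)" unfolding h(2) by simp
  then have r: "dim_row h = \<alpha> i" using g(1) by simp
  have "dim_col h = dim_col (g i * h)" by simp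
  then have "dim_col h = \<alpha> i" unfolding h(1) using g(1) by simp
  then show thesis using that[of h] g(1) h(2) r by (metis carrier_matI)
qed

text \<open>The moment map is equivariant, and a scalar matrix is unchanged by conjugation.\<close>

lemma mu_transforms:
  assumes M: "M \<in> rep_space l (framed 1 \<alpha>)" and N: "N \<in> rep_space l (framed 1 \<alpha>)"
    and g: "g \<in> GL l \<alpha>" "transforms l g M N" and i: "i < l"
    and muN: "mu l (\<alpha> i) N i = k \<cdot>\<^sub>m 1\<^sub>m (\<alpha> i)"
  shows "mu l (\<alpha> i) M i = k \<cdot>\<^sub>m 1\<^sub>m (\<alpha> i)"
proof -
  have l: "l > 0" using i by simp
  have gc: "g j \<in> carrier_mat (\<alpha> j) (\<alpha> j)" if "j < l" for j by (rule GL_inverse[OF g(1) that])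
  let ?p = "pred_mod l i" and ?s = "succ_mod l i"
  have p: "?p < l" "succ_mod l ?p = i" and s: "?s < l" using i l by (auto simp: pred_mod_less succ_pred_mod succ_mod_less)
  note X = rep_spaceD(1)[OF M] and Y = rep_spaceD(2)[OF M] and X' = rep_spaceD(1)[OF N] and Y' = rep_spaceD(2)[OF N]
  have t: "qX N j * g (succ_mod l j) = g j * qX M j" "qY N j * g j = g (succ_mod l j) * qY M j" if "j < l" for j
    using g(2) that unfolding transforms_def by blast+
  have XY: "qX N i * qY N i * g i = g i * (qX M i * qY M i)"
  proof -
    have "qX N i * qY N i * g i = qX N i * (g ?s * qY M i)"
      unfolding assoc_mult_mat[OF X'[OF i] Y'[OF i] gc[OF i]] t(2)[OF i] ..
    also have "\<dots> = g i * (qX M i * qY M i)"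
      unfolding assoc_mult_mat[OF X'[OF i] gc[OF s] Y[OF i], symmetric] t(1)[OF i]
      by (rule assoc_mult_mat[OF gc[OF i] X[OF i] Y[OF i]])
    finally show ?thesis .
  qed
  note pp = p(1)
  have YX: "qY N ?p * qX N ?p * g i = g i * (qY M ?p * qX M ?p)"
  proof -
    have "qY N ?p * qX N ?p * g i = qY N ?p * (g ?p * qX M ?p)"
      using assoc_mult_mat[OF Y'[OF pp] X'[OF pp] gc[OF succ_mod_less[OF l]]] t(1)[OF pp] unfolding p(2) by simp
    also have "\<dots> = g i * (qY M ?p * qX M ?p)"
      using assoc_mult_mat[OF Y'[OF pp] gc[OF pp] X[OF pp]] t(2)[OF pp]
        assoc_mult_mat[OF gc[OF succ_mod_less[OF l]] Y[OF pp] X[OF pp]] unfolding p(2) by simp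
    finally show ?thesis .
  qed
  have xy: "(if i = 0 then qx N * qy N else 0\<^sub>m (\<alpha> i) (\<alpha> i)) * g i =
    g i * (if i = 0 then qx M * qy M else 0\<^sub>m (\<alpha> i) (\<alpha> i))"
  proof (cases "i = 0")
    case True
    have "qx N = g 0 * qx M" "qy N * g 0 = qy M" using g(2) unfolding transforms_def by blast+
    then show ?thesis
      using True assoc_mult_mat[OF rep_spaceD(3)[OF N] rep_spaceD(4)[OF N] gc[OF l]]
        assoc_mult_mat[OF gc[OF l] rep_spaceD(3)[OF M] rep_spaceD(4)[OF M]] by simp
  next
    case False
    then show ?thesis using gc[OF i] by simp
  qed
  note a = mu_parts[OF M i] and b = mu_parts[OF N i]
  have "mu l (\<alpha> i) N i * g i = g i * mu l (\<alpha> i) M i"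
  proof -
    have "mu l (\<alpha> i) N i * g i = (qX N i * qY N i - qY N ?p * qX N ?p) * g i +
      (if i = 0 then qx N * qy N else 0\<^sub>m (\<alpha> i) (\<alpha> i)) * g i"
      unfolding mu_def by (rule add_mult_distrib_mat[OF minus_carrier_mat[OF b(2)] b(3) gc[OF i]])
    also have "(qX N i * qY N i - qY N ?p * qX N ?p) * g i = g i * (qX M i * qY M i) - g i * (qY M ?p * qX M ?p)"
      unfolding minus_mult_distrib_mat[OF b(1,2) gc[OF i]] XY YX ..
    also have "\<dots> = g i * (qX M i * qY M i - qY M ?p * qX M ?p)"
      by (rule mult_minus_distrib_mat[OF gc[OF i] a(1,2), symmetric])
    also have "g i * (qX M i * qY M i - qY M ?p * qX M ?p) + (if i = 0 then qx N * qy N else 0\<^sub>m (\<alpha> i) (\<alpha> i)) * g i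
      = g i * mu l (\<alpha> i) M i"
      unfolding xy mu_def by (rule mult_add_distrib_mat[OF gc[OF i] minus_carrier_mat[OF a(2)] a(3), symmetric])
    finally show ?thesis .
  qed
  then have eq: "g i * mu l (\<alpha> i) M i = k \<cdot>\<^sub>m g i"
    unfolding muN using gc[OF i] by (simp add: mult_smult_assoc_mat[of _ "\<alpha> i" "\<alpha> i"])
  obtain h where h: "h \<in> carrier_mat (\<alpha> i) (\<alpha> i)" "h * g i = 1\<^sub>m (\<alpha> i)" by (rule GL_inverse[OF g(1) i])
  have "mu l (\<alpha> i) M i = (h * g i) * mu l (\<alpha> i) M i" unfolding h(2) by (rule left_mult_one_mat[OF a(4), symmetric])
  also have "\<dots> = h * (k \<cdot>\<^sub>m g i)" unfolding assoc_mult_mat[OF h(1) gc[OF i] a(4)] eq ..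
  also have "\<dots> = k \<cdot>\<^sub>m 1\<^sub>m (\<alpha> i)" unfolding mult_smult_distrib[OF h(1) gc[OF i]] h(2) ..
  finally show ?thesis .
qed

text \<open>The definition of \<open>leaf\<close> states no moment equations for \<open>M0\<close>
  and \<open>M1\<close>. They are inherited from \<open>M\<close> by equivariance and the block form
  of the moment map.\<close>

lemma leaf_memD:
  assumes l: "l > 0" and p: "p \<in> leaf l c \<alpha> \<alpha>'"
  obtains M \<alpha>'' M0 M1 where "M \<in> p" "\<And>N. N \<in> p \<Longrightarrow> (M, N) \<in> git_rel l c \<alpha>"
    "\<And>i. i < l \<Longrightarrow> \<alpha> i = \<alpha>' i + \<alpha>'' i" "M0 \<in> moment_fiber l c \<alpha>'" "simple_rep l (framed 1 \<alpha>') M0"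
    "M1 \<in> rep_space l (framed 0 \<alpha>'')" "\<And>i. i < l \<Longrightarrow> mu l (\<alpha>'' i) M1 i = c i \<cdot>\<^sub>m 1\<^sub>m (\<alpha>'' i)"
    "\<And>w. wend l 0 w = 0 \<Longrightarrow> chi l M w = chi l M0 w"
proof -
  obtain M \<alpha>'' M0 M1 where M: "M \<in> p" and split: "\<forall>i<l. \<alpha> i = \<alpha>' i + \<alpha>'' i"
    and M0: "M0 \<in> rep_space l (framed 1 \<alpha>')" and M1: "M1 \<in> rep_space l (framed 0 \<alpha>'')"
    and simple: "simple_rep l (framed 1 \<alpha>') M0" and iso: "isomorphic_reps l \<alpha> (direct_sum_rep l M0 M1) M"
    using p unfolding leaf_def by blast
  have "p \<in> quiver_variety l c \<alpha>" using p by (simp add: leaf_def)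
  then obtain M' where M': "p = git_rel l c \<alpha> `` {M'}" unfolding quiver_variety_def by (rule quotientE)
  have rel: "(M, N) \<in> git_rel l c \<alpha>" if "N \<in> p" for N
  proof -
    have "(M', M) \<in> git_rel l c \<alpha>" "(M', N) \<in> git_rel l c \<alpha>" using M that unfolding M' by auto
    then show ?thesis unfolding git_rel_def by (simp add: Ball_def) metis
  qed
  have MM: "M \<in> moment_fiber l c \<alpha>" using M unfolding M' git_rel_def by auto
  have split': "\<And>i. i < l \<Longrightarrow> \<alpha> i = \<alpha>' i + \<alpha>'' i" using split by blast
  let ?S = "direct_sum_rep l M0 M1"
  have S: "?S \<in> rep_space l (framed 1 \<alpha>)" by (rule dsum_rep_space[OF l split' M0 M1])
  have Mr: "M \<in> rep_space l (framed 1 \<alpha>)" using MM by (simp add: moment_fiber_iff)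
  obtain g where g: "g \<in> GL l \<alpha>" "transforms l g ?S M" using iso unfolding isomorphic_reps_def by blast
  have "mu l (\<alpha> i) ?S i = c i \<cdot>\<^sub>m 1\<^sub>m (\<alpha> i)" if "i < l" for i
    by (rule mu_transforms[OF S Mr g that]) (use MM that in \<open>simp add: moment_fiber_iff\<close>)
  then have mus: "\<forall>i<l. mu l (\<alpha>' i) M0 i = c i \<cdot>\<^sub>m 1\<^sub>m (\<alpha>' i) \<and> mu l (\<alpha>'' i) M1 i = c i \<cdot>\<^sub>m 1\<^sub>m (\<alpha>'' i)"
    using dsum_moment_iff[OF l split' M0 M1] by blast
  have chi: "chi l M w = chi l M0 w" if w: "wend l 0 w = 0" for w
  proof -
    have "chi l M w = chi l ?S w"
      by (rule chi_transforms[OF S Mr l g(2) _ w]) (rule GL_inverse[OF g(1)])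
    also have "\<dots> = chi l M0 w" by (rule chi_dsum[OF l split' M0 M1 w])
    finally show ?thesis .
  qed
  have "M0 \<in> moment_fiber l c \<alpha>'" using M0 mus by (simp add: moment_fiber_iff)
  then show thesis using that[OF M rel split' _ simple M1 _ chi] mus by blast
qed

text \<open>The two descriptions of \<open>p\<close> may use different representatives, but path
  scalars are constant on \<open>p\<close> and see only the summand with the framing. So the two
  simple summands have equal path scalars.\<close>

lemma leaf_dim_unique:
  assumes l: "l > 0" and p: "p \<in> leaf l c \<alpha> \<alpha>1" "p \<in> leaf l c \<alpha> \<alpha>2" and i: "i < l"
  shows "\<alpha>1 i \<le> \<alpha>2 i"
proof -
  obtain M \<alpha>'' M0 M1 where M: "M \<in> p" "\<And>N. N \<in> p \<Longrightarrow> (M, N) \<in> git_rel l c \<alpha>"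
    "M0 \<in> moment_fiber l c \<alpha>1" "simple_rep l (framed 1 \<alpha>1) M0"
    "\<And>w. wend l 0 w = 0 \<Longrightarrow> chi l M w = chi l M0 w"
    by (rule leaf_memD[OF l p(1)]) (rule that)
  obtain N \<beta>'' N0 N1 where N: "N \<in> p" "N0 \<in> moment_fiber l c \<alpha>2"
    "\<And>w. wend l 0 w = 0 \<Longrightarrow> chi l N w = chi l N0 w"
    by (rule leaf_memD[OF l p(2)]) (rule that)
  have "chi l M0 w = chi l N0 w" if w: "wend l 0 w = 0" for w
    using M(5)[OF w] N(3)[OF w] chi_git_rel[OF l M(2)[OF N(1)] w] by simp
  from simple_dim_le[OF _ _ l this M(4) i] show ?thesis
    using M(3) N(2) by (simp add: moment_fiber_iff)
qed

section \<open>Complements of subspaces and semisimplicity\<close>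

text \<open>The complement is built greedily: a unit vector is adjoined to \<open>T\<close> whenever
  it is not yet in the sum of \<open>U\<close> and \<open>T\<close>.\<close>

lemma ex_complement:
  assumes U: "subsp U n"
  obtains T where "subsp T n" "U \<inter> T = {0\<^sub>v n}" "{u + t | u t. u \<in> U \<and> t \<in> T} = carrier_vec n"
proof -
  have "k \<le> n \<Longrightarrow> \<exists>T. subsp T n \<and> U \<inter> T = {0\<^sub>v n} \<and> (\<forall>j<k. \<exists>u\<in>U. \<exists>t\<in>T. unit_vec n j = u + t)" for k
  proof (induction k)
    case 0
    have "U \<inter> {0\<^sub>v n} = {0\<^sub>v n}" using subspD(2)[OF U] by blast
    then show ?case using subsp_zero[of n] by (intro exI[of _ "{0\<^sub>v n}"]) auto
  next
    case (Suc k)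
    then obtain T where T: "subsp T n" "U \<inter> T = {0\<^sub>v n}" "\<forall>j<k. \<exists>u\<in>U. \<exists>t\<in>T. unit_vec n j = u + t" by auto
    show ?case
    proof (cases "\<exists>u\<in>U. \<exists>t\<in>T. unit_vec n k = u + t")
      case True
      then show ?thesis using T by (intro exI[of _ T]) (auto simp: less_Suc_eq)
    next
      case False
      let ?e = "unit_vec n k :: complex vec"
      define T' where "T' = {t + a \<cdot>\<^sub>v ?e | t a. t \<in> T}"
      note cT = subspD(1)[OF T(1)] and cU = subspD(1)[OF U]
      have TT': "t \<in> T'" if "t \<in> T" for t
      proof -
        have "t = t + 0 \<cdot>\<^sub>v ?e" using cT[OF that] by (intro eq_vecI) auto
        then show ?thesis using that unfolding T'_def by blast
      qed
      have eT': "?e \<in> T'"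
      proof -
        have "?e = 0\<^sub>v n + 1 \<cdot>\<^sub>v ?e" by (intro eq_vecI) auto
        then show ?thesis using subspD(2)[OF T(1)] unfolding T'_def by blast
      qed
      have sub: "subsp T' n"
      proof (rule subspI)
        show "u \<in> carrier_vec n" if "u \<in> T'" for u using that cT unfolding T'_def by auto
        show "0\<^sub>v n \<in> T'" by (rule TT'[OF subspD(2)[OF T(1)]])
        show "u + v \<in> T'" if uv: "u \<in> T'" "v \<in> T'" for u v
        proof -
          obtain t a t' a' where t: "t \<in> T" "u = t + a \<cdot>\<^sub>v ?e" "t' \<in> T" "v = t' + a' \<cdot>\<^sub>v ?e"
            using uv unfolding T'_def by blast
          have "u + v = (t + t') + (a + a') \<cdot>\<^sub>v ?e"
            unfolding t(2,4) using cT[OF t(1)] cT[OF t(3)] by (intro eq_vecI) (auto simp: algebra_simps)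
          then show ?thesis using subspD(3)[OF T(1) t(1,3)] unfolding T'_def by blast
        qed
        show "b \<cdot>\<^sub>v u \<in> T'" if u: "u \<in> T'" for b u
        proof -
          obtain t a where t: "t \<in> T" "u = t + a \<cdot>\<^sub>v ?e" using u unfolding T'_def by blast
          have "b \<cdot>\<^sub>v u = b \<cdot>\<^sub>v t + (b * a) \<cdot>\<^sub>v ?e"
            unfolding t(2) using cT[OF t(1)] by (intro eq_vecI) (auto simp: algebra_simps)
          then show ?thesis using subspD(4)[OF T(1) t(1)] unfolding T'_def by blast
        qed
      qed
      have int: "U \<inter> T' = {0\<^sub>v n}"
      proof (intro equalityI subsetI)
        fix u assume u: "u \<in> U \<inter> T'"
        then obtain t a where t: "t \<in> T" "u = t + a \<cdot>\<^sub>v ?e" unfolding T'_def by blast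
        note ct = cT[OF t(1)]
        have uU: "u \<in> U" and cu: "u \<in> carrier_vec n" using u cU by auto
        have "a = 0"
        proof (rule ccontr)
          assume a: "a \<noteq> 0"
          have "?e = inverse a \<cdot>\<^sub>v u + (- inverse a) \<cdot>\<^sub>v t"
          proof (rule eq_vecI)
            fix j assume "j < dim_vec (inverse a \<cdot>\<^sub>v u + (- inverse a) \<cdot>\<^sub>v t)"
            then have j: "j < n" using ct by simp
            have uj: "u $ j = t $ j + a * ?e $ j" unfolding t(2) using j ct by simp
            have "(inverse a \<cdot>\<^sub>v u + (- inverse a) \<cdot>\<^sub>v t) $ j = inverse a * u $ j - inverse a * t $ j"
              using j ct cu by simp
            also have "\<dots> = ?e $ j" unfolding uj using a by (simp add: algebra_simps)
            finally show "?e $ j = (inverse a \<cdot>\<^sub>v u + (- inverse a) \<cdot>\<^sub>v t) $ j" by simp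
          qed (use ct in simp)
          then show False using False subspD(4)[OF U uU] subspD(4)[OF T(1) t(1)] by blast
        qed
        then have "u = t" unfolding t(2) using ct by (intro eq_vecI) auto
        then show "u \<in> {0\<^sub>v n}" using T(2) t(1) uU by blast
      next
        fix u assume "u \<in> {0\<^sub>v n :: complex vec}"
        then show "u \<in> U \<inter> T'" using subspD(2)[OF U] subspD(2)[OF sub] by simp
      qed
      have "\<exists>u\<in>U. \<exists>t\<in>T'. unit_vec n j = u + t" if "j < Suc k" for j
      proof (cases "j = k")
        case True
        have "?e = 0\<^sub>v n + ?e" by (intro eq_vecI) auto
        then show ?thesis using True eT' subspD(2)[OF U] by blast
      next
        case False
        then show ?thesis using that T(3) TT' by (metis less_SucE)
      qed
      with sub int show ?thesis by blast
    qed
  qed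
  from this[OF order_refl] obtain T where T: "subsp T n" "U \<inter> T = {0\<^sub>v n}"
    "\<forall>j<n. \<exists>u\<in>U. \<exists>t\<in>T. unit_vec n j = u + t" by blast
  note cT = subspD(1)[OF T(1)] and cU = subspD(1)[OF U]
  let ?W = "{u + t | u t. u \<in> U \<and> t \<in> T}"
  have "subsp ?W n"
  proof (rule subspI)
    show "w \<in> carrier_vec n" if "w \<in> ?W" for w using that cT cU by auto
    have "0\<^sub>v n = 0\<^sub>v n + (0\<^sub>v n :: complex vec)" by (intro eq_vecI) auto
    then show "0\<^sub>v n \<in> ?W" using subspD(2)[OF U] subspD(2)[OF T(1)] by blast
    show "v + w \<in> ?W" if vw: "v \<in> ?W" "w \<in> ?W" for v w
    proof -
      obtain u t u' t' where *: "u \<in> U" "t \<in> T" "v = u + t" "u' \<in> U" "t' \<in> T" "w = u' + t'"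
        using vw by blast
      have "v + w = (u + u') + (t + t')"
        unfolding *(3,6) using cU[OF *(1)] cU[OF *(4)] cT[OF *(2)] cT[OF *(5)] by (intro eq_vecI) auto
      then show ?thesis using subspD(3)[OF U *(1,4)] subspD(3)[OF T(1) *(2,5)] by blast
    qed
    show "a \<cdot>\<^sub>v v \<in> ?W" if v: "v \<in> ?W" for a v
    proof -
      obtain u t where *: "u \<in> U" "t \<in> T" "v = u + t" using v by blast
      have "a \<cdot>\<^sub>v v = a \<cdot>\<^sub>v u + a \<cdot>\<^sub>v t"
        unfolding *(3) using cU[OF *(1)] cT[OF *(2)] by (intro eq_vecI) (auto simp: algebra_simps)
      then show ?thesis using subspD(4)[OF U *(1)] subspD(4)[OF T(1) *(2)] by blast
    qed
  qed
  then have "?W = carrier_vec n"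
    by (rule subsp_full_of_units) (use T(3) in blast)
  with T(1,2) show thesis by (rule that)
qed

definition zero_rep :: "nat \<Rightarrow> (nat \<Rightarrow> nat) \<Rightarrow> quiver_rep" where
  "zero_rep l \<beta> = \<lparr>qX = (\<lambda>i\<in>{..<l}. 0\<^sub>m (\<beta> i) (\<beta> (succ_mod l i))),
    qY = (\<lambda>i\<in>{..<l}. 0\<^sub>m (\<beta> (succ_mod l i)) (\<beta> i)), qx = 0\<^sub>m (\<beta> 0) 0, qy = 0\<^sub>m 0 (\<beta> 0)\<rparr>"

lemma zero_rep_space: "zero_rep l \<beta> \<in> rep_space l (framed 0 \<beta>)"
  by (rule rep_spaceI) (auto simp: zero_rep_def)

lemma mu_zero_rep:
  assumes "i < l"
  shows "mu l (\<beta> i) (zero_rep l \<beta>) i = 0\<^sub>m (\<beta> i) (\<beta> i)"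
proof -
  let ?p = "pred_mod l i"
  have p: "?p < l" "succ_mod l ?p = i" using assms by (auto simp: pred_mod_less succ_pred_mod)
  have "qX (zero_rep l \<beta>) i * qY (zero_rep l \<beta>) i = 0\<^sub>m (\<beta> i) (\<beta> i)"
    using assms by (simp add: zero_rep_def)
  moreover have "qY (zero_rep l \<beta>) ?p * qX (zero_rep l \<beta>) ?p = 0\<^sub>m (\<beta> i) (\<beta> i)"
    using p by (simp add: zero_rep_def)
  moreover have "(if i = 0 then qx (zero_rep l \<beta>) * qy (zero_rep l \<beta>) else 0\<^sub>m (\<beta> i) (\<beta> i)) = 0\<^sub>m (\<beta> i) (\<beta> i)"
    by (simp add: zero_rep_def)
  ultimately show ?thesis unfolding mu_def by (simp only:) (intro eq_matI, auto)
qed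

lemma append_zero_eq_zero: "0\<^sub>v n @\<^sub>v 0\<^sub>v m = (0\<^sub>v (n + m) :: complex vec)"
  by (intro eq_vecI) auto

lemma append_vec_linear:
  fixes u u' v v' :: "complex vec"
  assumes "u \<in> carrier_vec n" "u' \<in> carrier_vec n" "v \<in> carrier_vec m" "v' \<in> carrier_vec m"
  shows "(u @\<^sub>v v) + (u' @\<^sub>v v') = (u + u') @\<^sub>v (v + v')" "a \<cdot>\<^sub>v (u @\<^sub>v v) = (a \<cdot>\<^sub>v u) @\<^sub>v (a \<cdot>\<^sub>v v)"
  using assms by (auto intro!: eq_vecI)

lemma append_vec_cases:
  assumes "z \<in> carrier_vec (n + m)"
  obtains u v where "u \<in> carrier_vec n" "v \<in> carrier_vec m" "z = u @\<^sub>v v"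
  by (rule that[of "vec_first z n" "vec_last z m"])
    (use assms in \<open>auto simp: vec_first_last_append\<close>)

text \<open>Intersection with the first block, projection to the first block, and intersection with
  the second block.\<close>

lemma subsp_split:
  assumes U: "subsp U (n + m)"
  shows "subsp {u \<in> carrier_vec n. u @\<^sub>v 0\<^sub>v m \<in> U} n"
    and "subsp {u \<in> carrier_vec n. \<exists>v\<in>carrier_vec m. u @\<^sub>v v \<in> U} n"
    and "subsp {v \<in> carrier_vec m. 0\<^sub>v n @\<^sub>v v \<in> U} m"
proof -
  have z: "0\<^sub>v n @\<^sub>v 0\<^sub>v m \<in> U" using subspD(2)[OF U] by (simp add: append_zero_eq_zero)
  show "subsp {u \<in> carrier_vec n. u @\<^sub>v 0\<^sub>v m \<in> U} n"
  proof (rule subspI)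
    show "u + v \<in> {u \<in> carrier_vec n. u @\<^sub>v 0\<^sub>v m \<in> U}"
      if "u \<in> {u \<in> carrier_vec n. u @\<^sub>v 0\<^sub>v m \<in> U}" "v \<in> {u \<in> carrier_vec n. u @\<^sub>v 0\<^sub>v m \<in> U}" for u v
      using that subspD(3)[OF U, of "u @\<^sub>v 0\<^sub>v m" "v @\<^sub>v 0\<^sub>v m"]
        append_vec_linear(1)[of u n v "0\<^sub>v m" m "0\<^sub>v m"] by simp
    show "a \<cdot>\<^sub>v u \<in> {u \<in> carrier_vec n. u @\<^sub>v 0\<^sub>v m \<in> U}" if "u \<in> {u \<in> carrier_vec n. u @\<^sub>v 0\<^sub>v m \<in> U}" for a u
    proof -
      have "a \<cdot>\<^sub>v 0\<^sub>v m = (0\<^sub>v m :: complex vec)" by (intro eq_vecI) auto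
      then show ?thesis
        using that subspD(4)[OF U, of "u @\<^sub>v 0\<^sub>v m" a]
          append_vec_linear(2)[of u n u "0\<^sub>v m" m "0\<^sub>v m" a] by simp
    qed
  qed (use z in auto)
  show "subsp {u \<in> carrier_vec n. \<exists>v\<in>carrier_vec m. u @\<^sub>v v \<in> U} n"
  proof (rule subspI)
    show "0\<^sub>v n \<in> {u \<in> carrier_vec n. \<exists>v\<in>carrier_vec m. u @\<^sub>v v \<in> U}"
      using z by (intro CollectI conjI bexI[of _ "0\<^sub>v m"]) auto
    show "u + v \<in> {u \<in> carrier_vec n. \<exists>v\<in>carrier_vec m. u @\<^sub>v v \<in> U}"
      if uv: "u \<in> {u \<in> carrier_vec n. \<exists>v\<in>carrier_vec m. u @\<^sub>v v \<in> U}"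
        "v \<in> {u \<in> carrier_vec n. \<exists>v\<in>carrier_vec m. u @\<^sub>v v \<in> U}" for u v
    proof -
      obtain u' v' where *: "u' \<in> carrier_vec m" "u @\<^sub>v u' \<in> U" "v' \<in> carrier_vec m" "v @\<^sub>v v' \<in> U"
        "u \<in> carrier_vec n" "v \<in> carrier_vec n" using uv by blast
      have "(u + v) @\<^sub>v (u' + v') \<in> U"
        using subspD(3)[OF U *(2,4)] append_vec_linear(1)[OF *(5,6,1,3)] by simp
      moreover have "u' + v' \<in> carrier_vec m" "u + v \<in> carrier_vec n" using * by simp_all
      ultimately show ?thesis by blast
    qed
    show "a \<cdot>\<^sub>v u \<in> {u \<in> carrier_vec n. \<exists>v\<in>carrier_vec m. u @\<^sub>v v \<in> U}"
      if u: "u \<in> {u \<in> carrier_vec n. \<exists>v\<in>carrier_vec m. u @\<^sub>v v \<in> U}" for a u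
    proof -
      obtain u' where *: "u' \<in> carrier_vec m" "u @\<^sub>v u' \<in> U" "u \<in> carrier_vec n" using u by blast
      have "(a \<cdot>\<^sub>v u) @\<^sub>v (a \<cdot>\<^sub>v u') \<in> U"
        using subspD(4)[OF U *(2), of a] append_vec_linear(2)[OF *(3,3,1,1), of a] by simp
      moreover have "a \<cdot>\<^sub>v u' \<in> carrier_vec m" "a \<cdot>\<^sub>v u \<in> carrier_vec n" using * by auto
      ultimately show ?thesis by blast
    qed
  qed auto
  show "subsp {v \<in> carrier_vec m. 0\<^sub>v n @\<^sub>v v \<in> U} m"
  proof (rule subspI)
    show "u + v \<in> {v \<in> carrier_vec m. 0\<^sub>v n @\<^sub>v v \<in> U}"
      if "u \<in> {v \<in> carrier_vec m. 0\<^sub>v n @\<^sub>v v \<in> U}" "v \<in> {v \<in> carrier_vec m. 0\<^sub>v n @\<^sub>v v \<in> U}" for u v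
      using that subspD(3)[OF U, of "0\<^sub>v n @\<^sub>v u" "0\<^sub>v n @\<^sub>v v"]
        append_vec_linear(1)[of "0\<^sub>v n" n "0\<^sub>v n" u m v] by simp
    show "a \<cdot>\<^sub>v u \<in> {v \<in> carrier_vec m. 0\<^sub>v n @\<^sub>v v \<in> U}" if "u \<in> {v \<in> carrier_vec m. 0\<^sub>v n @\<^sub>v v \<in> U}" for a u
    proof -
      have "a \<cdot>\<^sub>v 0\<^sub>v n = (0\<^sub>v n :: complex vec)" by (intro eq_vecI) auto
      then show ?thesis
        using that subspD(4)[OF U, of "0\<^sub>v n @\<^sub>v u" a]
          append_vec_linear(2)[of "0\<^sub>v n" n "0\<^sub>v n" u m u a] by simp
    qed
  qed (use z in auto)
qed

definition in_image :: "complex vec set \<Rightarrow> complex vec set \<Rightarrow> complex vec set" where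
  "in_image A T = {u @\<^sub>v t | u t. u \<in> A \<and> t \<in> T}"

lemma in_image_subsp:
  assumes A: "subsp A n" and T: "subsp T m"
  shows "subsp (in_image A T) (n + m)"
proof (rule subspI)
  show "z \<in> carrier_vec (n + m)" if "z \<in> in_image A T" for z
    using that subspD(1)[OF A] subspD(1)[OF T] unfolding in_image_def by auto
  show "0\<^sub>v (n + m) \<in> in_image A T"
    using subspD(2)[OF A] subspD(2)[OF T] unfolding in_image_def append_zero_eq_zero[symmetric] by blast
  show "y + z \<in> in_image A T" if yz: "y \<in> in_image A T" "z \<in> in_image A T" for y z
  proof -
    obtain u t u' t' where *: "u \<in> A" "t \<in> T" "y = u @\<^sub>v t" "u' \<in> A" "t' \<in> T" "z = u' @\<^sub>v t'"
      using yz unfolding in_image_def by blast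
    have "y + z = (u + u') @\<^sub>v (t + t')" unfolding *(3,6)
      by (rule append_vec_linear(1)[OF subspD(1)[OF A *(1)] subspD(1)[OF A *(4)] subspD(1)[OF T *(2)] subspD(1)[OF T *(5)]])
    then show ?thesis using subspD(3)[OF A *(1,4)] subspD(3)[OF T *(2,5)] unfolding in_image_def by blast
  qed
  show "a \<cdot>\<^sub>v y \<in> in_image A T" if y: "y \<in> in_image A T" for a y
  proof -
    obtain u t where *: "u \<in> A" "t \<in> T" "y = u @\<^sub>v t" using y unfolding in_image_def by blast
    note cu = subspD(1)[OF A *(1)] and ct = subspD(1)[OF T *(2)]
    have "a \<cdot>\<^sub>v y = (a \<cdot>\<^sub>v u) @\<^sub>v (a \<cdot>\<^sub>v t)" unfolding *(3)
      by (rule append_vec_linear(2)[OF cu cu ct ct])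
    then show ?thesis using subspD(4)[OF A *(1)] subspD(4)[OF T *(2)] unfolding in_image_def by blast
  qed
qed

lemma semisimple_framed_iff:
  "semisimple_rep l (framed 1 \<alpha>) M \<longleftrightarrow> (\<forall>U. subrep l (framed 1 \<alpha>) M U \<longrightarrow>
    (\<exists>U'. subrep l (framed 1 \<alpha>) M U' \<and>
      U None \<inter> U' None = {0\<^sub>v 1} \<and> {u + u' | u u'. u \<in> U None \<and> u' \<in> U' None} = carrier_vec 1 \<and>
      (\<forall>i<l. U (Some i) \<inter> U' (Some i) = {0\<^sub>v (\<alpha> i)} \<and>
        {u + u' | u u'. u \<in> U (Some i) \<and> u' \<in> U' (Some i)} = carrier_vec (\<alpha> i))))"
  unfolding semisimple_rep_def verts_all by (simp add: framed_def)

lemma dsum_zero_rep_action: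
  fixes \<beta> :: "nat \<Rightarrow> nat"
  assumes M0: "M0 \<in> rep_space l (framed 1 \<alpha>')"
  defines "S \<equiv> direct_sum_rep l M0 (zero_rep l \<beta>)"
  shows "i < l \<Longrightarrow> u \<in> carrier_vec (\<alpha>' (succ_mod l i)) \<Longrightarrow> v \<in> carrier_vec (\<beta> (succ_mod l i)) \<Longrightarrow>
      qX S i *\<^sub>v (u @\<^sub>v v) = (qX M0 i *\<^sub>v u) @\<^sub>v 0\<^sub>v (\<beta> i)"
    and "i < l \<Longrightarrow> u \<in> carrier_vec (\<alpha>' i) \<Longrightarrow> v \<in> carrier_vec (\<beta> i) \<Longrightarrow>
      qY S i *\<^sub>v (u @\<^sub>v v) = (qY M0 i *\<^sub>v u) @\<^sub>v 0\<^sub>v (\<beta> (succ_mod l i))"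
    and "u \<in> carrier_vec 1 \<Longrightarrow> qx S *\<^sub>v u = (qx M0 *\<^sub>v u) @\<^sub>v 0\<^sub>v (\<beta> 0)"
    and "u \<in> carrier_vec (\<alpha>' 0) \<Longrightarrow> v \<in> carrier_vec (\<beta> 0) \<Longrightarrow> qy S *\<^sub>v (u @\<^sub>v v) = qy M0 *\<^sub>v u"
proof -
  let ?Z = "zero_rep l \<beta>"
  have Z: "?Z \<in> rep_space l (framed 0 \<beta>)" by (rule zero_rep_space)
  have sel': "qx S = dsum (qx M0) (qx ?Z)" "qy S = dsum (qy M0) (qy ?Z)"
    by (simp_all add: S_def direct_sum_rep_def dsum_def)
  show "qX S i *\<^sub>v (u @\<^sub>v v) = (qX M0 i *\<^sub>v u) @\<^sub>v 0\<^sub>v (\<beta> i)"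
    if i: "i < l" and uv: "u \<in> carrier_vec (\<alpha>' (succ_mod l i))" "v \<in> carrier_vec (\<beta> (succ_mod l i))"
  proof -
    have "qX S i = dsum (qX M0 i) (qX ?Z i)" using i by (simp add: S_def direct_sum_rep_def dsum_def)
    moreover have "qX ?Z i *\<^sub>v v = 0\<^sub>v (\<beta> i)" using i uv by (simp add: zero_rep_def zero_mult_vec)
    ultimately show ?thesis
      using dsum_mult_vec[OF rep_spaceD(1)[OF M0 i] rep_spaceD(1)[OF Z i] uv] by simp
  qed
  show "qY S i *\<^sub>v (u @\<^sub>v v) = (qY M0 i *\<^sub>v u) @\<^sub>v 0\<^sub>v (\<beta> (succ_mod l i))"
    if i: "i < l" and uv: "u \<in> carrier_vec (\<alpha>' i)" "v \<in> carrier_vec (\<beta> i)"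
  proof -
    have "qY S i = dsum (qY M0 i) (qY ?Z i)" using i by (simp add: S_def direct_sum_rep_def dsum_def)
    moreover have "qY ?Z i *\<^sub>v v = 0\<^sub>v (\<beta> (succ_mod l i))" using i uv by (simp add: zero_rep_def zero_mult_vec)
    ultimately show ?thesis
      using dsum_mult_vec[OF rep_spaceD(2)[OF M0 i] rep_spaceD(2)[OF Z i] uv] by simp
  qed
  have e: "w @\<^sub>v 0\<^sub>v 0 = w" for w :: "complex vec" by (intro eq_vecI) auto
  show "qx S *\<^sub>v u = (qx M0 *\<^sub>v u) @\<^sub>v 0\<^sub>v (\<beta> 0)" if u: "u \<in> carrier_vec 1"
  proof -
    have "qx ?Z *\<^sub>v 0\<^sub>v 0 = 0\<^sub>v (\<beta> 0)" by (simp add: zero_rep_def zero_mult_vec)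
    then show ?thesis
      using dsum_mult_vec[OF rep_spaceD(3)[OF M0] rep_spaceD(3)[OF Z] u zero_carrier_vec]
      unfolding sel'(1) e by simp
  qed
  show "qy S *\<^sub>v (u @\<^sub>v v) = qy M0 *\<^sub>v u" if uv: "u \<in> carrier_vec (\<alpha>' 0)" "v \<in> carrier_vec (\<beta> 0)"
  proof -
    have "qy ?Z *\<^sub>v v = 0\<^sub>v 0" using uv by (simp add: zero_rep_def zero_mult_vec)
    then show ?thesis
      using dsum_mult_vec[OF rep_spaceD(4)[OF M0] rep_spaceD(4)[OF Z] uv]
      by (simp only: sel'(2) e)
  qed
qed

text \<open>The intersection \<open>R\<close> of \<open>U\<close> with \<open>M0\<close> and its
  projection \<open>P\<close> to \<open>M0\<close> are subrepresentations of the simple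
  \<open>M0\<close> with the same space at infinity, hence equal. So \<open>U\<close> is the sum of
  \<open>R\<close> and its part \<open>K\<close> in the zero representation, and a complement is
  found blockwise; any family of linear complements serves in the second block.\<close>

lemma semisimple_dsum_zero:
  assumes l: "l > 0" and split: "\<And>i. i < l \<Longrightarrow> \<alpha> i = \<alpha>' i + \<beta> i"
    and M0: "M0 \<in> rep_space l (framed 1 \<alpha>')" and simple: "simple_rep l (framed 1 \<alpha>') M0"
  shows "semisimple_rep l (framed 1 \<alpha>) (direct_sum_rep l M0 (zero_rep l \<beta>))"
  unfolding semisimple_framed_iff
proof (intro allI impI)
  let ?S = "direct_sum_rep l M0 (zero_rep l \<beta>)"
  note S = dsum_zero_rep_action[OF M0, where \<beta> = \<beta>]
  fix U assume U: "subrep l (framed 1 \<alpha>) ?S U"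
  have subN: "subsp (U None) 1" and sub0: "\<And>j. j < l \<Longrightarrow> subsp (U (Some j)) (\<alpha> j)"
    and aX: "\<And>j u. j < l \<Longrightarrow> u \<in> U (Some (succ_mod l j)) \<Longrightarrow> qX ?S j *\<^sub>v u \<in> U (Some j)"
    and aY: "\<And>j u. j < l \<Longrightarrow> u \<in> U (Some j) \<Longrightarrow> qY ?S j *\<^sub>v u \<in> U (Some (succ_mod l j))"
    and ax: "\<And>u. u \<in> U None \<Longrightarrow> qx ?S *\<^sub>v u \<in> U (Some 0)"
    and ay: "\<And>u. u \<in> U (Some 0) \<Longrightarrow> qy ?S *\<^sub>v u \<in> U None"
    using U unfolding subrep_framed_iff by blast+
  have sub: "subsp (U (Some j)) (\<alpha>' j + \<beta> j)" if "j < l" for j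
    using sub0[OF that] split[OF that] by simp
  note sp = subsp_split[OF sub]
  have sl: "succ_mod l j < l" for j by (rule succ_mod_less[OF l])
  note cN = subspD(1)[OF subN]
  define K where "K = (\<lambda>j. {v \<in> carrier_vec (\<beta> j). 0\<^sub>v (\<alpha>' j) @\<^sub>v v \<in> U (Some j)})"
  have KD: "0\<^sub>v (\<alpha>' j) @\<^sub>v v \<in> U (Some j)" "v \<in> carrier_vec (\<beta> j)" if "v \<in> K j" for j v
    using that by (simp_all add: K_def)
  have "\<forall>j. \<exists>T. j < l \<longrightarrow> subsp T (\<beta> j) \<and> K j \<inter> T = {0\<^sub>v (\<beta> j)} \<and>
    {u + t | u t. u \<in> K j \<and> t \<in> T} = carrier_vec (\<beta> j)"
  proof
    fix j
    show "\<exists>T. j < l \<longrightarrow> subsp T (\<beta> j) \<and> K j \<inter> T = {0\<^sub>v (\<beta> j)} \<and>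
      {u + t | u t. u \<in> K j \<and> t \<in> T} = carrier_vec (\<beta> j)"
    proof (cases "j < l")
      case True
      obtain T where T: "subsp T (\<beta> j)" "K j \<inter> T = {0\<^sub>v (\<beta> j)}" "{u + t | u t. u \<in> K j \<and> t \<in> T} = carrier_vec (\<beta> j)"
        unfolding K_def by (rule ex_complement[OF sp(3)[OF True]])
      show ?thesis by (rule exI[of _ T]) (rule impI conjI T)+
    qed simp
  qed
  from choice[OF this] obtain T where T0: "\<forall>j. j < l \<longrightarrow> subsp (T j) (\<beta> j) \<and> K j \<inter> T j = {0\<^sub>v (\<beta> j)} \<and>
    {u + t | u t. u \<in> K j \<and> t \<in> T j} = carrier_vec (\<beta> j)" ..
  have T: "subsp (T j) (\<beta> j)" "K j \<inter> T j = {0\<^sub>v (\<beta> j)}"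
    "{u + t | u t. u \<in> K j \<and> t \<in> T j} = carrier_vec (\<beta> j)" if "j < l" for j
    using mp[OF spec[OF T0] that] by (rule conjunct1, simp_all only: simp_thms)
  have Tsum: "\<exists>v\<in>carrier_vec (\<beta> j). \<exists>t\<in>T j. 0\<^sub>v (\<alpha>' j) @\<^sub>v v \<in> U (Some j) \<and> z = v + t"
    if j: "j < l" and z: "z \<in> carrier_vec (\<beta> j)" for j z
  proof -
    obtain u t where "u \<in> K j" "t \<in> T j" "z = u + t" using z unfolding T(3)[OF j, symmetric] mem_Collect_eq by (elim exE conjE)
    then show ?thesis using KD by blast
  qed
  note cT = subspD(1)[OF T(1)]
  define R where "R = (\<lambda>v. case v of None \<Rightarrow> U None | Some j \<Rightarrow> {u \<in> carrier_vec (\<alpha>' j). u @\<^sub>v 0\<^sub>v (\<beta> j) \<in> U (Some j)})"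
  define P where "P = (\<lambda>v. case v of None \<Rightarrow> U None | Some j \<Rightarrow> {u \<in> carrier_vec (\<alpha>' j). \<exists>v\<in>carrier_vec (\<beta> j). u @\<^sub>v v \<in> U (Some j)})"
  have PI: "u \<in> P (Some j)" if "u \<in> carrier_vec (\<alpha>' j)" "v \<in> carrier_vec (\<beta> j)" "u @\<^sub>v v \<in> U (Some j)" for u v j
    unfolding P_def option.case by (intro CollectI conjI bexI[of _ v] that)
  have PE: "\<exists>v. v \<in> carrier_vec (\<beta> j) \<and> u @\<^sub>v v \<in> U (Some j) \<and> u \<in> carrier_vec (\<alpha>' j)" if "u \<in> P (Some j)" for u j
    using that[unfolded P_def option.case mem_Collect_eq] by (elim conjE bexE, intro exI conjI)
  have subR: "subrep l (framed 1 \<alpha>') M0 R"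
    unfolding subrep_framed_iff
  proof (intro conjI allI impI ballI)
    show "subsp (R None) 1" using subN by (simp add: R_def)
    fix j assume j: "j < l"
    show "subsp (R (Some j)) (\<alpha>' j)" using sp(1)[OF j] by (simp add: R_def)
    show "qX M0 j *\<^sub>v u \<in> R (Some j)" if "u \<in> R (Some (succ_mod l j))" for u
      using that aX[OF j, of "u @\<^sub>v 0\<^sub>v (\<beta> (succ_mod l j))"] S(1)[OF j, of u "0\<^sub>v (\<beta> (succ_mod l j))"]
        mult_mat_vec_carrier[OF rep_spaceD(1)[OF M0 j], of u] by (simp add: R_def)
    show "qY M0 j *\<^sub>v u \<in> R (Some (succ_mod l j))" if "u \<in> R (Some j)" for u
      using that aY[OF j, of "u @\<^sub>v 0\<^sub>v (\<beta> j)"] S(2)[OF j, of u "0\<^sub>v (\<beta> j)"]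
        mult_mat_vec_carrier[OF rep_spaceD(2)[OF M0 j], of u] by (simp add: R_def)
  next
    fix u assume "u \<in> R None"
    then have u: "u \<in> U None" by (simp add: R_def)
    show "qx M0 *\<^sub>v u \<in> R (Some 0)"
      using ax[OF u] S(3)[OF cN[OF u]] mult_mat_vec_carrier[OF rep_spaceD(3)[OF M0] cN[OF u]] by (simp add: R_def)
  next
    fix u assume "u \<in> R (Some 0)"
    then show "qy M0 *\<^sub>v u \<in> R None"
      using ay[of "u @\<^sub>v 0\<^sub>v (\<beta> 0)"] S(4)[of u "0\<^sub>v (\<beta> 0)"] by (simp add: R_def)
  qed
  have subP: "subrep l (framed 1 \<alpha>') M0 P"
    unfolding subrep_framed_iff
  proof (intro conjI allI impI ballI)
    show "subsp (P None) 1" using subN by (simp add: P_def)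
    fix j assume j: "j < l"
    show "subsp (P (Some j)) (\<alpha>' j)" using sp(2)[OF j] by (simp add: P_def)
    show "qX M0 j *\<^sub>v u \<in> P (Some j)" if u: "u \<in> P (Some (succ_mod l j))" for u
    proof -
      obtain v where v: "v \<in> carrier_vec (\<beta> (succ_mod l j))" "u @\<^sub>v v \<in> U (Some (succ_mod l j))"
        "u \<in> carrier_vec (\<alpha>' (succ_mod l j))" using PE[OF u] by (elim exE conjE)
      have w: "(qX M0 j *\<^sub>v u) @\<^sub>v 0\<^sub>v (\<beta> j) \<in> U (Some j)" using aX[OF j v(2)] unfolding S(1)[OF j v(3,1)] .
      have "qX M0 j *\<^sub>v u \<in> carrier_vec (\<alpha>' j)" by (rule mult_mat_vec_carrier[OF rep_spaceD(1)[OF M0 j] v(3)])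
      from PI[OF this zero_carrier_vec w] show ?thesis .
    qed
    show "qY M0 j *\<^sub>v u \<in> P (Some (succ_mod l j))" if u: "u \<in> P (Some j)" for u
    proof -
      obtain v where v: "v \<in> carrier_vec (\<beta> j)" "u @\<^sub>v v \<in> U (Some j)" "u \<in> carrier_vec (\<alpha>' j)"
        using PE[OF u] by (elim exE conjE)
      have w: "(qY M0 j *\<^sub>v u) @\<^sub>v 0\<^sub>v (\<beta> (succ_mod l j)) \<in> U (Some (succ_mod l j))"
        using aY[OF j v(2)] unfolding S(2)[OF j v(3,1)] .
      have "qY M0 j *\<^sub>v u \<in> carrier_vec (\<alpha>' (succ_mod l j))"
        by (rule mult_mat_vec_carrier[OF rep_spaceD(2)[OF M0 j] v(3)])
      from PI[OF this zero_carrier_vec w] show ?thesis .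
    qed
  next
    fix u assume "u \<in> P None"
    then have u: "u \<in> U None" by (simp add: P_def)
    have w: "(qx M0 *\<^sub>v u) @\<^sub>v 0\<^sub>v (\<beta> 0) \<in> U (Some 0)" using ax[OF u] unfolding S(3)[OF cN[OF u]] .
    have "qx M0 *\<^sub>v u \<in> carrier_vec (\<alpha>' 0)" by (rule mult_mat_vec_carrier[OF rep_spaceD(3)[OF M0] cN[OF u]])
    from PI[OF this zero_carrier_vec w] show "qx M0 *\<^sub>v u \<in> P (Some 0)" .
  next
    fix u assume u: "u \<in> P (Some 0)"
    obtain v where v: "v \<in> carrier_vec (\<beta> 0)" "u @\<^sub>v v \<in> U (Some 0)" "u \<in> carrier_vec (\<alpha>' 0)"
      using PE[OF u] by (elim exE conjE)
    show "qy M0 *\<^sub>v u \<in> P None" using ay[OF v(2)] unfolding S(4)[OF v(3,1)] by (simp add: P_def)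
  qed
  have dR: "(R None = {0\<^sub>v 1} \<and> (\<forall>i<l. R (Some i) = {0\<^sub>v (\<alpha>' i)})) \<or>
    (R None = carrier_vec 1 \<and> (\<forall>i<l. R (Some i) = carrier_vec (\<alpha>' i)))"
    and dP: "(P None = {0\<^sub>v 1} \<and> (\<forall>i<l. P (Some i) = {0\<^sub>v (\<alpha>' i)})) \<or>
    (P None = carrier_vec 1 \<and> (\<forall>i<l. P (Some i) = carrier_vec (\<alpha>' i)))"
    using simple subR subP unfolding simple_framed_iff by blast+
  have RP: "R None = U None" "P None = U None" by (simp_all add: R_def P_def)
  \<comment> \<open>\<open>B\<close> is the common value of \<open>R\<close> and \<open>P\<close> in
    the block \<open>M0\<close>, zero or everything according to the space at infinity, and
    \<open>A\<close> is the opposite choice.\<close>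
  define A where "A = (\<lambda>j. if U None = {0\<^sub>v 1} then carrier_vec (\<alpha>' j) else {0\<^sub>v (\<alpha>' j) :: complex vec})"
  define B where "B = (\<lambda>j. if U None = {0\<^sub>v 1} then {0\<^sub>v (\<alpha>' j) :: complex vec} else carrier_vec (\<alpha>' j))"
  have subA: "subsp (A j) (\<alpha>' j)" for j by (simp add: A_def subsp_zero subsp_full)
  have PB: "P (Some j) = B j" "R (Some j) = B j" if "j < l" for j
    using dP dR RP carrier_vec_1_neq that by (auto simp: B_def)
  define U' where "U' = (\<lambda>v. case v of None \<Rightarrow> if U None = {0\<^sub>v 1} then carrier_vec 1 else {0\<^sub>v 1}
    | Some j \<Rightarrow> in_image (A j) (T j))"
  have UI: "a @\<^sub>v t \<in> U' (Some j)" if "a \<in> A j" "t \<in> T j" for a t j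
    unfolding U'_def option.case in_image_def by (intro CollectI exI[of _ a] exI[of _ t] conjI refl that)
  have UE: "\<exists>a t. a \<in> A j \<and> t \<in> T j \<and> u = a @\<^sub>v t" if "u \<in> U' (Some j)" for u j
    using that[unfolded U'_def option.case in_image_def mem_Collect_eq] by (elim exE conjE, intro exI conjI)
  have subU': "subrep l (framed 1 \<alpha>) ?S U'"
    unfolding subrep_framed_iff
  proof (intro conjI allI impI ballI)
    show "subsp (U' None) 1" by (simp add: U'_def subsp_zero subsp_full)
    fix j assume j: "j < l"
    show "subsp (U' (Some j)) (\<alpha> j)"
      using in_image_subsp[OF subA T(1)[OF j]] split[OF j] by (simp add: U'_def)
    have tz: "0\<^sub>v (\<beta> k) \<in> T k" if "k < l" for k by (rule subspD(2)[OF T(1)[OF that]])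
    show "qX ?S j *\<^sub>v u \<in> U' (Some j)" if u: "u \<in> U' (Some (succ_mod l j))" for u
    proof -
      obtain a t where at: "a \<in> A (succ_mod l j)" "t \<in> T (succ_mod l j)" "u = a @\<^sub>v t"
        using UE[OF u] by (elim exE conjE)
      have ca: "a \<in> carrier_vec (\<alpha>' (succ_mod l j))" by (rule subspD(1)[OF subA at(1)])
      have w: "qX M0 j *\<^sub>v a \<in> A j"
        using at(1) mult_mat_vec_carrier[OF rep_spaceD(1)[OF M0 j] ca] mult_zero_vec[OF rep_spaceD(1)[OF M0 j]]
        by (auto simp: A_def split: if_splits)
      show ?thesis
        unfolding at(3) S(1)[OF j ca cT[OF sl at(2)]] by (rule UI[OF w tz[OF j]])
    qed
    show "qY ?S j *\<^sub>v u \<in> U' (Some (succ_mod l j))" if u: "u \<in> U' (Some j)" for u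
    proof -
      obtain a t where at: "a \<in> A j" "t \<in> T j" "u = a @\<^sub>v t"
        using UE[OF u] by (elim exE conjE)
      have ca: "a \<in> carrier_vec (\<alpha>' j)" by (rule subspD(1)[OF subA at(1)])
      have w: "qY M0 j *\<^sub>v a \<in> A (succ_mod l j)"
        using at(1) mult_mat_vec_carrier[OF rep_spaceD(2)[OF M0 j] ca] mult_zero_vec[OF rep_spaceD(2)[OF M0 j]]
        by (auto simp: A_def split: if_splits)
      show ?thesis
        unfolding at(3) S(2)[OF j ca cT[OF j at(2)]] by (rule UI[OF w tz[OF sl]])
    qed
  next
    fix u assume u: "u \<in> U' None"
    then have cu: "u \<in> carrier_vec 1" by (auto simp: U'_def split: if_splits)
    have w: "qx M0 *\<^sub>v u \<in> A 0"
      using u mult_mat_vec_carrier[OF rep_spaceD(3)[OF M0] cu] mult_zero_vec[OF rep_spaceD(3)[OF M0]]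
      by (auto simp: A_def U'_def split: if_splits)
    show "qx ?S *\<^sub>v u \<in> U' (Some 0)"
      unfolding S(3)[OF cu] by (rule UI[OF w subspD(2)[OF T(1)[OF l]]])
  next
    fix u assume u: "u \<in> U' (Some 0)"
    obtain a t where at: "a \<in> A 0" "t \<in> T 0" "u = a @\<^sub>v t" using UE[OF u] by (elim exE conjE)
    have ca: "a \<in> carrier_vec (\<alpha>' 0)" by (rule subspD(1)[OF subA at(1)])
    show "qy ?S *\<^sub>v u \<in> U' None"
      unfolding at(3) S(4)[OF ca cT[OF l at(2)]]
      using at(1) mult_mat_vec_carrier[OF rep_spaceD(4)[OF M0] ca] mult_zero_vec[OF rep_spaceD(4)[OF M0]]
      by (auto simp: A_def U'_def split: if_splits)
  qed
  have addz: "0\<^sub>v k + w = w" "w + 0\<^sub>v k = w" if "w \<in> carrier_vec k" for k and w :: "complex vec"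
    using that by simp_all
  have None_part: "U None \<inter> U' None = {0\<^sub>v 1}" "{u + u' | u u'. u \<in> U None \<and> u' \<in> U' None} = carrier_vec 1"
  proof -
    have "U None = {0\<^sub>v 1} \<or> U None = carrier_vec 1" by (rule subsp_1_cases[OF subN])
    then have "(U None = {0\<^sub>v 1} \<and> U' None = carrier_vec 1) \<or> (U None = carrier_vec 1 \<and> U' None = {0\<^sub>v 1})"
      using carrier_vec_1_neq by (auto simp: U'_def)
    then show "U None \<inter> U' None = {0\<^sub>v 1}" "{u + u' | u u'. u \<in> U None \<and> u' \<in> U' None} = carrier_vec 1"
    proof (atomize (full), elim disjE)
      assume "U None = {0\<^sub>v 1} \<and> U' None = carrier_vec 1"
      then have e: "U None = {0\<^sub>v 1}" "U' None = carrier_vec 1" by simp_all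
      have "{0\<^sub>v 1 + u' | u'. u' \<in> carrier_vec 1} = (carrier_vec 1 :: complex vec set)"
        using addz(1)[of _ 1] by (auto intro!: exI)
      then show "U None \<inter> U' None = {0\<^sub>v 1} \<and> {u + u' | u u'. u \<in> U None \<and> u' \<in> U' None} = carrier_vec 1"
        unfolding e by simp
    next
      assume "U None = carrier_vec 1 \<and> U' None = {0\<^sub>v 1}"
      then have e: "U None = carrier_vec 1" "U' None = {0\<^sub>v 1}" by simp_all
      have "{u + 0\<^sub>v 1 | u. u \<in> carrier_vec 1} = (carrier_vec 1 :: complex vec set)"
        using addz(2)[of _ 1] by (auto intro!: exI)
      then show "U None \<inter> U' None = {0\<^sub>v 1} \<and> {u + u' | u u'. u \<in> U None \<and> u' \<in> U' None} = carrier_vec 1"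
        unfolding e by simp
    qed
  qed
  have Some_part: "U (Some i) \<inter> U' (Some i) = {0\<^sub>v (\<alpha> i)} \<and>
    {u + u' | u u'. u \<in> U (Some i) \<and> u' \<in> U' (Some i)} = carrier_vec (\<alpha> i)" if i: "i < l" for i
  proof (intro conjI equalityI subsetI)
    fix z assume z: "z \<in> U (Some i) \<inter> U' (Some i)"
    obtain a t where at: "a \<in> A i" "t \<in> T i" "z = a @\<^sub>v t" using UE[OF IntD2[OF z]] by (elim exE conjE)
    have ca: "a \<in> carrier_vec (\<alpha>' i)" by (rule subspD(1)[OF subA at(1)])
    have ct: "t \<in> carrier_vec (\<beta> i)" by (rule cT[OF i at(2)])
    have "a \<in> P (Some i)" by (rule PI[OF ca ct IntD1[OF z, unfolded at(3)]])
    then have a0: "a = 0\<^sub>v (\<alpha>' i)" using PB[OF i] at(1) by (auto simp: A_def B_def split: if_splits)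
    have "t = 0\<^sub>v (\<beta> i)" using T(2)[OF i] z at(2) ct unfolding at(3) a0 K_def by blast
    then show "z \<in> {0\<^sub>v (\<alpha> i)}" unfolding at(3) a0 split[OF i] by (simp add: append_zero_eq_zero)
  next
    fix z assume "z \<in> {0\<^sub>v (\<alpha> i) :: complex vec}"
    then show "z \<in> U (Some i) \<inter> U' (Some i)"
      using subspD(2)[OF sub0[OF i]] subspD(2)[of "U' (Some i)" "\<alpha> i"] subU' i
      unfolding subrep_framed_iff by blast
  next
    fix z assume "z \<in> {u + u' | u u'. u \<in> U (Some i) \<and> u' \<in> U' (Some i)}"
    then obtain u u' where "u \<in> U (Some i)" "u' \<in> U' (Some i)" "z = u + u'" by blast
    moreover have "subsp (U' (Some i)) (\<alpha> i)" using subU' i unfolding subrep_framed_iff by blast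
    ultimately show "z \<in> carrier_vec (\<alpha> i)" using subspD(1)[OF sub0[OF i]] subspD(1) by fastforce
  next
    fix z :: "complex vec" assume "z \<in> carrier_vec (\<alpha> i)"
    then have "z \<in> carrier_vec (\<alpha>' i + \<beta> i)" unfolding split[OF i] .
    then obtain x y where xy: "x \<in> carrier_vec (\<alpha>' i)" "y \<in> carrier_vec (\<beta> i)" "z = x @\<^sub>v y"
      by (rule append_vec_cases)
    obtain v t where vt: "v \<in> carrier_vec (\<beta> i)" "t \<in> T i" "0\<^sub>v (\<alpha>' i) @\<^sub>v v \<in> U (Some i)" "y = v + t"
      using Tsum[OF i xy(2)] by blast
    have ct: "t \<in> carrier_vec (\<beta> i)" by (rule cT[OF i vt(2)])
    show "z \<in> {u + u' | u u'. u \<in> U (Some i) \<and> u' \<in> U' (Some i)}"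
    proof (cases "U None = {0\<^sub>v 1}")
      case True
      have "z = (0\<^sub>v (\<alpha>' i) @\<^sub>v v) + (x @\<^sub>v t)"
        unfolding xy(3) vt(4) append_vec_linear(1)[OF zero_carrier_vec xy(1) vt(1) ct] addz(1)[OF xy(1)] ..
      moreover have "x @\<^sub>v t \<in> U' (Some i)"
        using True xy(1) by (intro UI[OF _ vt(2)]) (simp add: A_def)
      ultimately show ?thesis using vt(3) by blast
    next
      case False
      have "x \<in> R (Some i)" unfolding PB(2)[OF i] using False xy(1) by (simp add: B_def)
      then have "x @\<^sub>v 0\<^sub>v (\<beta> i) \<in> U (Some i)" by (simp add: R_def)
      from subspD(3)[OF sub[OF i] this vt(3)] have "x @\<^sub>v v \<in> U (Some i)"
        unfolding append_vec_linear(1)[OF xy(1) zero_carrier_vec zero_carrier_vec vt(1)]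
          addz(2)[OF xy(1)] addz(1)[OF vt(1)] .
      moreover have "z = (x @\<^sub>v v) + (0\<^sub>v (\<alpha>' i) @\<^sub>v t)"
        unfolding xy(3) vt(4) append_vec_linear(1)[OF xy(1) zero_carrier_vec vt(1) ct] addz(2)[OF xy(1)] ..
      moreover have "0\<^sub>v (\<alpha>' i) @\<^sub>v t \<in> U' (Some i)"
        using False by (intro UI[OF _ vt(2)]) (simp add: A_def)
      ultimately show ?thesis by blast
    qed
  qed
  show "\<exists>U'. subrep l (framed 1 \<alpha>) ?S U' \<and>
      U None \<inter> U' None = {0\<^sub>v 1} \<and> {u + u' | u u'. u \<in> U None \<and> u' \<in> U' None} = carrier_vec 1 \<and>
      (\<forall>i<l. U (Some i) \<inter> U' (Some i) = {0\<^sub>v (\<alpha> i)} \<and>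
        {u + u' | u u'. u \<in> U (Some i) \<and> u' \<in> U' (Some i)} = carrier_vec (\<alpha> i))"
    using subU' None_part Some_part by blast
qed

lemma isomorphic_refl:
  assumes M: "M \<in> rep_space l (framed 1 \<alpha>)" and l: "l > 0"
  shows "isomorphic_reps l \<alpha> M M"
proof -
  define g where "g = (\<lambda>i\<in>{..<l}. 1\<^sub>m (\<alpha> i) :: complex mat)"
  have "invertible_mat (1\<^sub>m n :: complex mat)" for n
    by (auto simp: invertible_mat_def inverts_mat_def intro!: exI[of _ "1\<^sub>m n"])
  then have "g \<in> GL l \<alpha>" by (auto simp: GL_def g_def)
  moreover have "transforms l g M M"
    unfolding transforms_def
  proof (intro conjI allI impI)
    fix i assume i: "i < l"
    have s: "succ_mod l i < l" by (rule succ_mod_less[OF l])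
    show "qX M i * g (succ_mod l i) = g i * qX M i"
      using i s left_mult_one_mat[OF rep_spaceD(1)[OF M i]] right_mult_one_mat[OF rep_spaceD(1)[OF M i]]
      by (simp add: g_def)
    show "qY M i * g i = g (succ_mod l i) * qY M i"
      using i s left_mult_one_mat[OF rep_spaceD(2)[OF M i]] right_mult_one_mat[OF rep_spaceD(2)[OF M i]]
      by (simp add: g_def)
  next
    show "qx M = g 0 * qx M" "qy M * g 0 = qy M"
      using l left_mult_one_mat[OF rep_spaceD(3)[OF M]] right_mult_one_mat[OF rep_spaceD(4)[OF M]]
      by (simp_all add: g_def)
  qed
  ultimately show ?thesis unfolding isomorphic_reps_def by blast
qed

text \<open>The zero representation is taken as second summand; its moment equations hold because
  \<open>c\<close> vanishes wherever it has positive dimension.\<close>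

lemma leaf_nonempty:
  assumes l: "l > 0" and M0: "M0 \<in> moment_fiber l c \<alpha>'" and simple: "simple_rep l (framed 1 \<alpha>') M0"
    and le: "\<And>i. i < l \<Longrightarrow> \<alpha>' i \<le> \<alpha> i" and c0: "\<And>i. i < l \<Longrightarrow> \<alpha>' i \<noteq> \<alpha> i \<Longrightarrow> c i = 0"
  shows "leaf l c \<alpha> \<alpha>' \<noteq> {}"
proof -
  define \<beta> where "\<beta> = (\<lambda>i. \<alpha> i - \<alpha>' i)"
  have split: "\<alpha> i = \<alpha>' i + \<beta> i" if "i < l" for i using le[OF that] by (simp add: \<beta>_def)
  have M0r: "M0 \<in> rep_space l (framed 1 \<alpha>')" using M0 by (simp add: moment_fiber_iff)
  let ?Z = "zero_rep l \<beta>"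
  let ?S = "direct_sum_rep l M0 ?Z"
  have Z: "?Z \<in> rep_space l (framed 0 \<beta>)" by (rule zero_rep_space)
  have S: "?S \<in> rep_space l (framed 1 \<alpha>)" by (rule dsum_rep_space[OF l split M0r Z])
  have "mu l (\<beta> i) ?Z i = c i \<cdot>\<^sub>m 1\<^sub>m (\<beta> i)" if i: "i < l" for i
  proof (cases "\<alpha>' i = \<alpha> i")
    case True
    then have "\<beta> i = 0" by (simp add: \<beta>_def)
    then show ?thesis unfolding mu_zero_rep[OF i] by (intro eq_matI) auto
  next
    case False
    then show ?thesis unfolding mu_zero_rep[OF i] c0[OF i False] by (intro eq_matI) auto
  qed
  then have "\<forall>i<l. mu l (\<alpha> i) ?S i = c i \<cdot>\<^sub>m 1\<^sub>m (\<alpha> i)"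
    using M0 dsum_moment_iff[OF l split M0r Z] by (simp add: moment_fiber_iff)
  then have Sm: "?S \<in> moment_fiber l c \<alpha>" using S by (simp add: moment_fiber_iff)
  define p where "p = git_rel l c \<alpha> `` {?S}"
  have "p \<in> quiver_variety l c \<alpha>" unfolding p_def quiver_variety_def by (rule quotientI[OF Sm])
  moreover have "?S \<in> p" unfolding p_def git_rel_def using Sm by blast
  moreover have "semisimple_rep l (framed 1 \<alpha>) ?S" by (rule semisimple_dsum_zero[OF l split M0r simple])
  moreover have "isomorphic_reps l \<alpha> ?S ?S" by (rule isomorphic_refl[OF S l])
  moreover have "\<forall>i<l. \<alpha> i = \<alpha>' i + \<beta> i" using split by blast
  ultimately have "p \<in> leaf l c \<alpha> \<alpha>'"
    unfolding leaf_def using M0r Z simple by blast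
  then show ?thesis by blast
qed

section \<open>The parametrization\<close>

text \<open>A maximum principle: away from 0 a non-negative defect means that \<open>2 * a i\<close>
  is at most the sum over the two neighbours, so a maximum attained there spreads to both sides
  until it reaches 0.\<close>

lemma defect_nonneg_constant:
  fixes a :: "nat \<Rightarrow> int"
  assumes nonneg: "\<And>i. i < l \<Longrightarrow> 0 \<le> defect l a i" and i: "i < l"
  shows "a i = a 0"
proof -
  have l: "l > 0" using i by simp
  define m where "m = Max (a ` {..<l})"
  have le: "a j \<le> m" if "j < l" for j using that by (simp add: m_def)
  have "m \<in> a ` {..<l}" unfolding m_def using l by (intro Max_in) auto
  then obtain j0 where j0: "j0 < l" "a j0 = m" by auto
  have nb: "a (succ_mod l j) = m" "a (pred_mod l j) = m" if "j < l" "a j = m" "0 < j" for j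
    using nonneg[OF that(1)] le[OF succ_mod_less[OF l], of j] le[OF pred_mod_less[OF l], of j] that
    by (simp_all add: defect_def)
  \<comment> \<open>At 0 the framing leaves a slack of one only, so at a maximum the two neighbours
    cannot both be smaller; for \<open>l = 2\<close> they coincide and a drop counts twice. Hence
    the maximum also occurs away from 0.\<close>
  have "\<exists>i0<l. 0 < i0 \<and> a i0 = m" if "l \<noteq> 1"
  proof (rule ccontr)
    assume no: "\<not> (\<exists>i0<l. 0 < i0 \<and> a i0 = m)"
    have l2: "2 \<le> l" using l that by simp
    have a0: "a 0 = m" using no j0 by (metis gr0I)
    have "a (succ_mod l 0) \<noteq> m" "a (pred_mod l 0) \<noteq> m"
      using no succ_mod_less[OF l, of 0] pred_mod_less[OF l, of 0] succ_mod_neq[OF l2 l] pred_mod_neq[OF l2 l]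
      by (metis gr0I)+
    then show False
      using nonneg[OF l] le[OF succ_mod_less[OF l], of 0] le[OF pred_mod_less[OF l], of 0] a0
      by (simp add: defect_def)
  qed
  moreover have ?thesis if "l = 1" using i that by simp
  moreover have ?thesis if i0: "i0 < l" "0 < i0" "a i0 = m" for i0
  proof -
    have up: "i0 + k < l \<longrightarrow> a (i0 + k) = m" for k
    proof (induction k)
      case (Suc k)
      show ?case
      proof
        assume k: "i0 + Suc k < l"
        then have "succ_mod l (i0 + k) = i0 + Suc k" by (simp add: succ_mod_def)
        then show "a (i0 + Suc k) = m" using nb(1)[of "i0 + k"] Suc k i0 by simp
      qed
    qed (simp add: i0)
    have down: "k \<le> i0 \<longrightarrow> a (i0 - k) = m" for k
    proof (induction k)
      case (Suc k)
      show ?case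
      proof
        assume k: "Suc k \<le> i0"
        then have "pred_mod l (i0 - k) = i0 - Suc k" using i0(1) by (simp add: pred_mod_def mod_if)
        then show "a (i0 - Suc k) = m" using nb(2)[of "i0 - k"] Suc k i0 by simp
      qed
    qed (simp add: i0)
    have "a j = m" if "j < l" for j
      using up[of "j - i0"] down[of "i0 - j"] that by (cases "i0 \<le> j") simp_all
    then show ?thesis using i l by simp
  qed
  ultimately show ?thesis by blast
qed

lemma defect_reflect:
  assumes "2 \<le> l" "i < l" "\<And>j. j < l \<Longrightarrow> b j = a j + of_bool (j = i) * defect l a i"
  shows "defect l b i = - defect l a i"
proof -
  have l: "l > 0" using assms(1) by simp
  have "b i = a i + defect l a i" "b (succ_mod l i) = a (succ_mod l i)" "b (pred_mod l i) = a (pred_mod l i)"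
    using assms(3)[OF assms(2)] assms(3)[OF succ_mod_less[OF l], of i] assms(3)[OF pred_mod_less[OF l], of i]
      succ_mod_neq[OF assms(1,2)] pred_mod_neq[OF assms(1,2)] by simp_all
  then show ?thesis by (simp add: defect_def)
qed

lemma defect_one: "defect 1 a 0 = 1"
  by (simp add: defect_def succ_mod_def pred_mod_def)

lemma empty_ell_core: "l > 0 \<Longrightarrow> {} \<in> ell_cores l"
  by (simp add: ell_cores_def empty_partition ell_step_def)

lemma sum_update_less:
  fixes l :: nat
  assumes "i < l" "m < \<alpha> i"
  shows "(\<Sum>j<l. (\<alpha>(i := m)) j) < (\<Sum>j<l. \<alpha> j :: nat)"
  using assms by (intro sum_strict_mono_ex1) auto

text \<open>If a coordinate of the defect is negative, reflecting there makes the dimension vector smaller;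
  if none is, the dimension vector is a multiple of \<open>\<delta>\<close>.\<close>

lemma simple_dim_core:
  assumes l: "l > 0" and "(\<Sum>i<l. c i) \<noteq> 0" "M \<in> moment_fiber l c \<alpha>" "simple_rep l (framed 1 \<alpha>) M"
  shows "\<exists>\<nu>\<in>ell_cores l. \<exists>r. \<forall>i<l. \<alpha> i = Res l \<nu> i + r"
  using assms(2-4)
proof (induction "\<Sum>i<l. \<alpha> i" arbitrary: c \<alpha> M rule: less_induct)
  case less
  let ?d = "defect l (\<lambda>j. int (\<alpha> j))"
  show ?case
  proof (cases "\<exists>i<l. ?d i < 0")
    case True
    then obtain i where i: "i < l" "?d i < 0" by blast
    have l2: "2 \<le> l"
    proof (rule ccontr)
      assume "\<not> 2 \<le> l"
      then have "l = 1" "i = 0" using i(1) by simp_all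
      then show False using i(2) defect_one by simp
    qed
    have ci: "c i \<noteq> 0"
    proof
      assume "c i = 0"
      from simple_defect_nonneg[OF l2 i(1) less.prems(2,3) this] show False using i(2) by simp
    qed
    obtain M' m where M': "M' \<in> moment_fiber l (weyl_refl l i c) (\<alpha>(i := m))"
      "simple_rep l (framed 1 (\<alpha>(i := m))) M'" and m: "int m = int (\<alpha> i) + ?d i"
      by (rule reflection_functor[OF l2 i(1) less.prems(2,3) ci])
    have "m < \<alpha> i" using m i(2) by simp
    from sum_update_less[where \<alpha> = \<alpha>, OF i(1) this]
    have lt: "(\<Sum>j<l. (\<alpha>(i := m)) j) < (\<Sum>j<l. \<alpha> j)" .
    have "(\<Sum>j<l. weyl_refl l i c j) \<noteq> 0" using sum_weyl_refl[OF l2 i(1)] less.prems(1) by metis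
    from less.hyps[OF lt this M'] obtain \<kappa> r where \<kappa>: "\<kappa> \<in> ell_cores l"
      "\<And>j. j < l \<Longrightarrow> (\<alpha>(i := m)) j = Res l \<kappa> j + r" by blast
    \<comment> \<open>Reflecting the core of the smaller vector back gives the core of \<alpha>. The
      multiplicity \<open>r\<close> of \<delta> is unchanged, since the defect does not see
      it.\<close>
    obtain \<kappa>' where \<kappa>': "\<kappa>' \<in> ell_cores l"
      and R: "\<And>j. int (Res l \<kappa>' j) = int (Res l \<kappa> j) + of_bool (j = i) * defect l (\<lambda>j. int (Res l \<kappa> j)) i"
      using reflect_ell_core[OF \<kappa>(1) l2 i(1)] by metis
    have "defect l (\<lambda>j. int (Res l \<kappa> j)) i = defect l (\<lambda>j. int ((\<alpha>(i := m)) j)) i"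
      by (rule defect_cong[OF i(1), of _ _ "- int r"]) (simp add: \<kappa>(2) del: fun_upd_apply)
    also have "\<dots> = - ?d i"
      by (rule defect_reflect[OF l2 i(1)]) (simp add: m)
    finally have d: "defect l (\<lambda>j. int (Res l \<kappa> j)) i = - ?d i" .
    have "\<alpha> j = Res l \<kappa>' j + r" if "j < l" for j
      using R[of j] \<kappa>(2)[OF that] m unfolding d by (cases "j = i") simp_all
    then show ?thesis using \<kappa>'(1) by blast
  next
    case False
    have nonneg: "0 \<le> ?d i" if i: "i < l" for i
    proof (rule ccontr)
      assume "\<not> 0 \<le> ?d i"
      then have "?d i < 0" by (rule not_le_imp_less)
      with i False show False by blast
    qed
    have const: "int (\<alpha> i) = int (\<alpha> 0)" if "i < l" for i
      by (rule defect_nonneg_constant[where a = "\<lambda>j. int (\<alpha> j)", OF nonneg that])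
    have "\<alpha> i = Res l {} i + \<alpha> 0" if "i < l" for i
      using const[OF that] by (simp add: Res_def)
    then show ?thesis using empty_ell_core[OF l] by blast
  qed
qed

text \<open>Removing the boxes of one residue \<open>i\<close> from the core is a reflection; the condition on the edges
  makes \<open>c i\<close> nonzero and is inherited by the reflected data.\<close>

lemma core_simple_exists:
  assumes l: "l > 0" and "\<nu> \<in> ell_cores l" "(\<Sum>i<l. c i) \<noteq> 0"
    and "\<And>p q. p < q \<Longrightarrow> potential l c p = potential l c q \<Longrightarrow> edge \<nu> q \<le> edge \<nu> p"
  shows "\<exists>\<alpha>. (\<forall>i<l. \<alpha> i = Res l \<nu> i + r) \<and> (\<exists>M\<in>moment_fiber l c \<alpha>. simple_rep l (framed 1 \<alpha>) M)"
  using assms(2-4)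
proof (induction "card \<nu>" arbitrary: c \<nu> rule: less_induct)
  case less
  have \<nu>: "\<nu> \<in> partitions" "flush l \<nu>" using less.prems(1) ell_cores_iff[OF l] by blast+
  show ?case
  proof (cases "\<nu> = {}")
    case True
    obtain M where "M \<in> moment_fiber l c (\<lambda>_. r)" "simple_rep l (framed 1 (\<lambda>_. r)) M"
      by (rule ex_simple_multiple_delta[OF l less.prems(2)])
    then show ?thesis by (intro exI[of _ "\<lambda>_. r"]) (auto simp: True Res_def)
  next
    case False
    obtain k where k: "edge \<nu> (k - 1) = 0" "edge \<nu> k = 1" by (rule ex_removable_edge[OF \<nu>(1) False])
    define i where "i = cls l k"
    have i: "i < l" unfolding i_def by (rule cls_less[OF l])
    have ci: "c i \<noteq> 0"
    proof
      assume "c i = 0"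
      then have "potential l c (k - 1) = potential l c k" using potential_step[of l c k] by (simp add: i_def)
      from less.prems(3)[OF _ this] show False using k by simp
    qed
    have l2: "2 \<le> l"
    proof (rule ccontr)
      assume "\<not> 2 \<le> l"
      then have "l = 1" using l by simp
      then show False using \<nu>(2) k unfolding flush_def by (metis of_nat_1 zero_neq_one)
    qed
    let ?d = "defect l (\<lambda>j. int (Res l \<nu> j)) i"
    have d: "?d < 0" by (rule core_defect_removable[OF less.prems(1) i i_def[symmetric] k])
    obtain \<kappa> where \<kappa>: "\<kappa> \<in> ell_cores l" and E: "\<And>k. edge \<kappa> k = edge \<nu> (sig l i k)"
      and R: "\<And>j. int (Res l \<kappa> j) = int (Res l \<nu> j) + of_bool (j = i) * ?d"
      using reflect_ell_core[OF less.prems(1) l2 i] by metis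
    let ?c = "weyl_refl l i c"
    have \<kappa>p: "\<kappa> \<in> partitions" using \<kappa> ell_cores_iff[OF l] by blast
    have Rle: "Res l \<kappa> j \<le> Res l \<nu> j" for j using R[of j] d by (cases "j = i") simp_all
    have "Res l \<kappa> i < Res l \<nu> i" using R[of i] d by simp
    then have "(\<Sum>j<l. Res l \<kappa> j) < (\<Sum>j<l. Res l \<nu> j)"
      using i Rle by (intro sum_strict_mono_ex1) auto
    then have lt: "card \<kappa> < card \<nu>" using card_eq_sum_Res[OF \<kappa>p l] card_eq_sum_Res[OF \<nu>(1) l] by simp
    have sc: "(\<Sum>j<l. ?c j) \<noteq> 0" using sum_weyl_refl[OF l2 i] less.prems(2) by metis
    have c'i: "?c i = - c i" using i cartan_cases(1)[OF l2 i] by (simp add: weyl_refl_def)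
    have sl: "sig l i p \<le> p + 1" "p - 1 \<le> sig l i p" for p by (simp_all add: sig_def)
    have cond: "edge \<kappa> q \<le> edge \<kappa> p" if pq: "p < q" "potential l ?c p = potential l ?c q" for p q
    proof -
      have "potential l c (sig l i p) = potential l c (sig l i q)"
        using potential_reflect[OF l2 i, of c p q] pq(2) by simp
      \<comment> \<open>\<open>sig l i\<close> can reverse two positions only if it exchanges them,
        that is if \<open>q = p + 1\<close> has class \<open>i\<close>. Then the potentials would
        differ by \<open>?c i\<close>, which is not zero.\<close>
      moreover have "sig l i p < sig l i q"
      proof (cases "q = p + 1")
        case True
        have "cls l q \<noteq> i"
        proof
          assume "cls l q = i"
          then show False using potential_step[of l ?c q] pq(2) True c'i ci by simp
        qed
        then have "sig l i p \<le> p" "q \<le> sig l i q" using True by (auto simp: sig_def)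
        then show ?thesis using True by simp
      next
        case False
        have "sig l i p \<noteq> sig l i q" using sig_sig[OF l2 i] pq(1) by (metis less_irrefl)
        then show ?thesis using sl(1)[of p] sl(2)[of q] pq(1) False by linarith
      qed
      ultimately show ?thesis unfolding E using less.prems(3) by blast
    qed
    obtain \<alpha> M where \<alpha>: "\<And>j. j < l \<Longrightarrow> \<alpha> j = Res l \<kappa> j + r"
      and M: "M \<in> moment_fiber l ?c \<alpha>" "simple_rep l (framed 1 \<alpha>) M"
      using less.hyps[OF lt \<kappa> sc cond] by blast
    have "?c i \<noteq> 0" using c'i ci by simp
    \<comment> \<open>The same reflection leads from the smaller core and the reflected parameter
      back to \<nu> and \<open>c\<close>.\<close>
    from reflection_functor[OF l2 i M this] obtain M' m where
      M': "M' \<in> moment_fiber l c (\<alpha>(i := m))" "simple_rep l (framed 1 (\<alpha>(i := m))) M'"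
      and m: "int m = int (\<alpha> i) + defect l (\<lambda>j. int (\<alpha> j)) i"
      unfolding weyl_refl_involution[OF l2 i] by metis
    have "defect l (\<lambda>j. int (\<alpha> j)) i = defect l (\<lambda>j. int (Res l \<kappa> j)) i"
      by (rule defect_cong[OF i, of _ _ "int r"]) (simp add: \<alpha>)
    also have "\<dots> = - ?d" by (rule defect_reflect[OF l2 i]) (rule R)
    finally have d': "defect l (\<lambda>j. int (\<alpha> j)) i = - ?d" .
    have "(\<alpha>(i := m)) j = Res l \<nu> j + r" if "j < l" for j
      using R[of j] \<alpha>[OF that] m unfolding d' by (cases "j = i") simp_all
    then show ?thesis using M' by blast
  qed
qed

section \<open>Independence of values outside the cycle\<close>

lemma rep_space_framed_cong:
  assumes "l > 0" "\<And>i. i < l \<Longrightarrow> \<alpha> i = \<beta> i"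
  shows "rep_space l (framed k \<alpha>) = rep_space l (framed k \<beta>)"
proof -
  have "(\<Pi>\<^sub>E i\<in>{..<l}. carrier_mat (\<alpha> i) (\<alpha> (succ_mod l i))) =
      (\<Pi>\<^sub>E i\<in>{..<l}. carrier_mat (\<beta> i) (\<beta> (succ_mod l i)) :: complex mat set)"
    "(\<Pi>\<^sub>E i\<in>{..<l}. carrier_mat (\<alpha> (succ_mod l i)) (\<alpha> i) :: complex mat set) =
      (\<Pi>\<^sub>E i\<in>{..<l}. carrier_mat (\<beta> (succ_mod l i)) (\<beta> i))"
    using assms by (auto intro!: PiE_cong simp: succ_mod_less)
  then show ?thesis using assms by (simp add: rep_space_def framed_def)
qed

lemma simple_framed_cong:
  assumes "\<And>i. i < l \<Longrightarrow> \<alpha> i = \<beta> i"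
  shows "simple_rep l (framed 1 \<alpha>) M \<longleftrightarrow> simple_rep l (framed 1 \<beta>) M"
  unfolding simple_framed_iff subrep_framed_iff using assms by simp

lemma leaf_cong:
  assumes "l > 0" "\<And>i. i < l \<Longrightarrow> \<beta> i = \<gamma> i"
  shows "leaf l c \<alpha> \<beta> = leaf l c \<alpha> \<gamma>"
proof -
  have "(\<forall>i<l. \<alpha> i = \<beta> i + \<alpha>'' i) \<longleftrightarrow> (\<forall>i<l. \<alpha> i = \<gamma> i + \<alpha>'' i)" for \<alpha>'' using assms(2) by simp
  moreover have "rep_space l (framed 1 \<beta>) = rep_space l (framed 1 \<gamma>)"
    using assms by (rule rep_space_framed_cong)
  moreover have "simple_rep l (framed 1 \<beta>) M \<longleftrightarrow> simple_rep l (framed 1 \<gamma>) M" for M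
    using assms(2) by (rule simple_framed_cong)
  ultimately show ?thesis by (simp only: leaf_def)
qed

text \<open>At a position whose class is in \<open>J\<close>, a \<open>J\<close>-core has no edge 0
  followed by an edge 1, so along the window the edges can only fall.\<close>

lemma edge_antimono_window:
  assumes \<nu>: "\<nu> \<in> J_cores l J" and J: "\<And>k. p < k \<Longrightarrow> k \<le> q \<Longrightarrow> cls l k \<in> J" and "p \<le> q"
  shows "edge \<nu> q \<le> edge \<nu> p"
proof -
  have p: "\<nu> \<in> partitions" using \<nu> by (simp add: J_cores_def)
  have step: "edge \<nu> k \<le> edge \<nu> (k - 1)" if "p < k" "k \<le> q" for k
    using \<nu> J[OF that] edge_01[OF p, of k] edge_01[OF p, of "k - 1"] unfolding J_cores_iff by force
  have "edge \<nu> (p + int d) \<le> edge \<nu> p" if "p + int d \<le> q" for d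
    using that
  proof (induction d)
    case (Suc d)
    then have "edge \<nu> (p + int d) \<le> edge \<nu> p" by simp
    moreover have "edge \<nu> (p + int (Suc d)) \<le> edge \<nu> (p + int (Suc d) - 1)" by (rule step) (use Suc.prems in simp_all)
    ultimately show ?case by simp
  qed simp
  from this[of "nat (q - p)"] show ?thesis using assms(3) by simp
qed

text \<open>The hypotheses on \<open>J\<close> are those that \<open>J\<close>-standardness provides. For \<open>l = 1\<close> they may fail
  for the given \<open>J\<close>, because there \<open>W_parabolic 1 J\<close> does not depend on \<open>J\<close>, but they hold for \<open>{}\<close>.\<close>

locale window_condition =
  fixes l n :: nat and J :: "nat set" and c :: "nat \<Rightarrow> complex" and \<nu> :: diagram and \<alpha> :: "nat \<Rightarrow> nat"
  assumes l: "l > 0" and J: "J \<subseteq> {..<l}" and proper: "J \<noteq> {..<l}"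
    and c0: "i \<in> J \<Longrightarrow> c i = 0"
    and window: "potential l c p = potential l c q \<Longrightarrow> p < k \<Longrightarrow> k \<le> q \<Longrightarrow> cls l k \<in> J"
    and cd: "(\<Sum>i<l. c i) \<noteq> 0"
    and \<nu>: "\<nu> \<in> ell_cores l" "\<nu> \<in> J_cores l J"
    and \<alpha>: "i < l \<Longrightarrow> \<alpha> i = Res l \<nu> i + n"
begin

abbreviation core_image :: "diagram set" where
  "core_image \<equiv> (Core_ell l \<circ> Core_J l J) ` (\<Union>n'\<in>{0..n}. partitions_with_core l \<nu> (n' * l + card \<nu>))"

lemma core_image_cores: "core_image \<subseteq> ell_cores l \<inter> J_cores l J"
proof
  fix \<kappa> assume "\<kappa> \<in> core_image"
  then obtain \<mu> where "\<mu> \<in> partitions" "\<kappa> = Core_ell l (Core_J l J \<mu>)"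
    by (auto simp: partitions_with_core_def)
  then show "\<kappa> \<in> ell_cores l \<inter> J_cores l J"
    using Core_ell_J_core[OF Core_J_facts(2)[of \<mu>] J l] by simp
qed

text \<open>The agreement of \<alpha>' and \<alpha> outside \<open>J\<close> is kept in the
  conclusion because it fixes the multiple of \<delta> in \<open>leaf_determined\<close>.\<close>

lemma leaf_imp_core:
  assumes "leaf l c \<alpha> \<alpha>' \<noteq> {}"
  shows "(\<exists>\<nu>'\<in>core_image. \<exists>r::nat. \<forall>i<l. \<alpha>' i = Res l \<nu>' i + r) \<and> (\<forall>i<l. i \<notin> J \<longrightarrow> \<alpha>' i = \<alpha> i)"
proof -
  obtain x where x: "x \<in> leaf l c \<alpha> \<alpha>'" using assms by blast
  obtain \<alpha>'' M0 M1 where s: "\<And>i. i < l \<Longrightarrow> \<alpha> i = \<alpha>' i + \<alpha>'' i"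
    and M0: "M0 \<in> moment_fiber l c \<alpha>'" "simple_rep l (framed 1 \<alpha>') M0"
    and M1: "M1 \<in> rep_space l (framed 0 \<alpha>'')" "\<And>i. i < l \<Longrightarrow> mu l (\<alpha>'' i) M1 i = c i \<cdot>\<^sub>m 1\<^sub>m (\<alpha>'' i)"
    by (rule leaf_memD[OF l x]) (rule that)
  note X = rep_spaceD(1)[OF M1(1)] and Y = rep_spaceD(2)[OF M1(1)]
  have rel: "qX M1 i * qY M1 i - qY M1 (pred_mod l i) * qX M1 (pred_mod l i) = c i \<cdot>\<^sub>m 1\<^sub>m (\<alpha>'' i)"
    if i: "i < l" for i
  proof -
    have p: "pred_mod l i < l" by (rule pred_mod_less[OF l])
    let ?A = "qX M1 i * qY M1 i - qY M1 (pred_mod l i) * qX M1 (pred_mod l i)"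
    have "qY M1 (pred_mod l i) * qX M1 (pred_mod l i) \<in> carrier_mat (\<alpha>'' i) (\<alpha>'' i)"
      using X[OF p] Y[OF p] unfolding succ_pred_mod[OF i] by (rule mult_carrier_mat[rotated])
    from minus_carrier_mat[OF this] have A: "?A \<in> carrier_mat (\<alpha>'' i) (\<alpha>'' i)" .
    have "i = 0 \<Longrightarrow> qx M1 * qy M1 = 0\<^sub>m (\<alpha>'' i) (\<alpha>'' i)"
      using rep_spaceD(3,4)[OF M1(1)] by (intro eq_matI) (auto simp: scalar_prod_def)
    then have "mu l (\<alpha>'' i) M1 i = ?A + 0\<^sub>m (\<alpha>'' i) (\<alpha>'' i)" by (simp add: mu_def)
    then show ?thesis using M1(2)[OF i] right_add_zero_mat[OF A] by simp
  qed
  have off: "\<alpha>' i = \<alpha> i" if i: "i < l" "i \<notin> J" for i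
  proof (rule ccontr)
    assume "\<alpha>' i \<noteq> \<alpha> i"
    then have ne: "\<alpha>'' i \<noteq> 0" using s[OF i(1)] by simp
    obtain p q where pq: "p < int i" "int i \<le> q" "potential l c p = potential l c q"
      by (rule unframed_chain[where X = "qX M1" and Y = "qY M1" and \<beta> = \<alpha>'', OF l cd X Y rel i(1) ne])
    from window[OF pq(3,1,2)] show False using i cls_of_nat[OF i(1)] by simp
  qed
  obtain \<nu>' r where \<nu>': "\<nu>' \<in> ell_cores l" and r: "\<And>i. i < l \<Longrightarrow> \<alpha>' i = Res l \<nu>' i + r"
    using simple_dim_core[OF l cd M0] by blast
  have l2: "2 \<le> l" if "i \<in> J" for i
  proof (rule ccontr)
    assume "\<not> 2 \<le> l"
    then have "l = 1" using l by simp
    then show False using J proper that by force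
  qed
  have "0 \<le> defect l (\<lambda>j. int (Res l \<nu>' j)) i" if i: "i \<in> J" for i
  proof -
    have il: "i < l" using i J by blast
    have "defect l (\<lambda>j. int (\<alpha>' j)) i = defect l (\<lambda>j. int (Res l \<nu>' j)) i"
      by (rule defect_cong[OF il, of _ _ "int r"]) (simp add: r)
    then show ?thesis using simple_defect_nonneg[OF l2[OF i] il M0 c0[OF i]] by simp
  qed
  then have \<nu>'J: "\<nu>' \<in> J_cores l J" by (rule ell_core_J_core[OF \<nu>'(1) J])
  \<comment> \<open>\<alpha>' exceeds the residue vector of \<nu>' by \<open>r\<close> copies of
    \<delta>; after subtracting them from \<alpha> as well, the remaining difference is supported in
    \<open>J\<close>. The defect of \<open>a\<close> on \<open>J\<close> is that of the
    \<open>J\<close>-core \<nu>, hence non-negative.\<close>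
  define a where "a = (\<lambda>i. int (\<alpha> i) - int r)"
  have "\<exists>\<mu>\<in>partitions. (J_step l J)\<^sup>*\<^sup>* \<mu> \<nu>' \<and> (\<forall>i<l. int (Res l \<mu> i) = a i)"
  proof (rule add_J_boxes[OF _ J proper])
    show "\<nu>' \<in> partitions" using \<nu>' by (simp add: ell_cores_def)
    show "int (Res l \<nu>' i) \<le> a i" if "i < l" for i using r[OF that] s[OF that] by (simp add: a_def)
    show "int (Res l \<nu>' i) = a i" if "i < l" "i \<notin> J" for i using r[OF that(1)] off[OF that] by (simp add: a_def)
    show "0 \<le> defect l a i" if i: "i \<in> J" for i
    proof -
      have il: "i < l" using i J by blast
      have "defect l a i = defect l (\<lambda>j. int (Res l \<nu> j)) i"
        by (rule defect_cong[OF il, of _ _ "int n - int r"]) (simp add: a_def \<alpha>)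
      then show ?thesis using J_core_defect[OF \<nu>(2) il i] by simp
    qed
  qed
  then obtain \<mu> where \<mu>: "\<mu> \<in> partitions" "(J_step l J)\<^sup>*\<^sup>* \<mu> \<nu>'" "\<And>i. i < l \<Longrightarrow> int (Res l \<mu> i) = a i" by blast
  have core: "Core_ell l \<mu> = \<nu>"
    by (rule Core_ell_unique[OF \<mu>(1) l \<nu>(1), of "int n - int r"]) (simp add: \<mu>(3) a_def \<alpha>)
  obtain m where m: "card \<mu> = card \<nu> + m * l" "\<And>i. i < l \<Longrightarrow> Res l \<mu> i = Res l \<nu> i + m"
    using Core_ell_facts[OF \<mu>(1) l] unfolding core by metis
  \<comment> \<open>The partition \<mu> has residue vector
    \<open>Res l \<nu> + (n - r) \<delta>\<close>, so \<open>m = n - r\<close>, and \<open>r\<close>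
    is a natural number.\<close>
  have "m \<le> n" using m(2)[OF l] \<mu>(3)[OF l] \<alpha>[OF l] by (simp add: a_def)
  moreover have "\<mu> \<in> partitions_with_core l \<nu> (m * l + card \<nu>)"
    using \<mu>(1) core m(1) by (simp add: partitions_with_core_def)
  moreover have "\<nu>' = (Core_ell l \<circ> Core_J l J) \<mu>"
    using Core_J_eqI[OF \<mu>(1,2) \<nu>'J] Core_ell_core[OF \<nu>' l] by simp
  ultimately have "\<nu>' \<in> core_image" by (intro image_eqI UN_I) auto
  then show ?thesis using r off by blast
qed

text \<open>The boxes removed in passing from a partition to its \<open>J\<close>-core have residues
  in \<open>J\<close>. They give the dimension vector of the second summand, on whose support
  \<open>c\<close> vanishes.\<close>

lemma core_imp_leaf:
  assumes "\<nu>' \<in> core_image"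
  shows "\<exists>\<alpha>'. leaf l c \<alpha> \<alpha>' \<noteq> {} \<and> (\<exists>r::nat. \<forall>i<l. \<alpha>' i = Res l \<nu>' i + r)"
proof -
  obtain n' \<tau> where n': "n' \<le> n" and \<tau>: "\<tau> \<in> partitions" "card \<tau> = n' * l + card \<nu>" "Core_ell l \<tau> = \<nu>"
    and \<nu>': "\<nu>' = Core_ell l (Core_J l J \<tau>)"
    using assms by (auto simp: partitions_with_core_def)
  obtain m where m: "card \<tau> = card \<nu> + m * l" "\<And>i. i < l \<Longrightarrow> Res l \<tau> i = Res l \<nu> i + m"
    using Core_ell_facts[OF \<tau>(1) l] unfolding \<tau>(3) by metis
  have mn: "m = n'" using m(1) \<tau>(2) l by simp
  note \<mu> = J_steps_facts[OF Core_J_facts(1)[OF \<tau>(1), of l J] \<tau>(1)]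
  have \<mu>p: "Core_J l J \<tau> \<in> partitions" using \<mu> by blast
  obtain r where r: "\<And>i. i < l \<Longrightarrow> Res l (Core_J l J \<tau>) i = Res l \<nu>' i + r"
    using Core_ell_facts[OF \<mu>p l] unfolding \<nu>' by metis
  have \<nu>'c: "\<nu>' \<in> ell_cores l" "\<nu>' \<in> J_cores l J" using assms core_image_cores by blast+
  have "edge \<nu>' q \<le> edge \<nu>' p" if "p < q" "potential l c p = potential l c q" for p q
    by (rule edge_antimono_window[OF \<nu>'c(2)]) (use that window[OF that(2)] in auto)
  \<comment> \<open>Adding \<open>n - n'\<close> copies of \<delta> turns the residue vector of
    \<tau> into \<alpha>; the same shift of its \<open>J\<close>-core gives \<alpha>'.\<close>
  from core_simple_exists[OF l \<nu>'c(1) cd this, of "r + (n - n')"] obtain \<alpha>' M where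
    \<alpha>': "\<And>i. i < l \<Longrightarrow> \<alpha>' i = Res l \<nu>' i + (r + (n - n'))"
    and M: "M \<in> moment_fiber l c \<alpha>'" "simple_rep l (framed 1 \<alpha>') M" by blast
  have e: "\<alpha>' i = Res l (Core_J l J \<tau>) i + (n - n')" "\<alpha> i = Res l \<tau> i + (n - n')" if "i < l" for i
    using \<alpha>'[OF that] r[OF that] m(2)[OF that] \<alpha>[OF that] n' mn by simp_all
  have "leaf l c \<alpha> \<alpha>' \<noteq> {}"
  proof (rule leaf_nonempty[OF l M])
    show "\<alpha>' i \<le> \<alpha> i" if "i < l" for i using \<mu> by (simp add: e[OF that])
    show "c i = 0" if "i < l" "\<alpha>' i \<noteq> \<alpha> i" for i
    proof -
      have "Res l (Core_J l J \<tau>) i \<noteq> Res l \<tau> i" using that(2) by (simp add: e[OF that(1)])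
      then have "i \<in> J" using \<mu> by blast
      then show ?thesis by (rule c0)
    qed
  qed
  then show ?thesis using \<alpha>' by blast
qed

definition has_core :: "(nat \<Rightarrow> nat) \<Rightarrow> diagram \<Rightarrow> bool" where
  "has_core \<beta> \<kappa> \<longleftrightarrow> (\<exists>r::int. \<forall>i<l. int (\<beta> i) = int (Res l \<kappa> i) + r)"

lemma has_core_unique:
  assumes "has_core \<beta> \<kappa>1" "has_core \<beta> \<kappa>2" "\<kappa>1 \<in> ell_cores l" "\<kappa>2 \<in> ell_cores l"
  shows "\<kappa>1 = \<kappa>2"
proof -
  obtain r1 r2 where "\<And>i. i < l \<Longrightarrow> int (\<beta> i) = int (Res l \<kappa>1 i) + r1"
    "\<And>i. i < l \<Longrightarrow> int (\<beta> i) = int (Res l \<kappa>2 i) + r2"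
    using assms(1,2) unfolding has_core_def by blast
  then have "int (Res l \<kappa>1 i) = int (Res l \<kappa>2 i) + (r2 - r1)" if "i < l" for i using that by fastforce
  from ell_core_unique[OF l assms(3,4) this] show ?thesis .
qed

lemma leaf_eq_iff:
  assumes "leaf l c \<alpha> \<beta> \<noteq> {}" "leaf l c \<alpha> \<gamma> \<noteq> {}"
  shows "leaf l c \<alpha> \<beta> = leaf l c \<alpha> \<gamma> \<longleftrightarrow> (\<forall>i<l. \<beta> i = \<gamma> i)"
proof
  assume eq: "leaf l c \<alpha> \<beta> = leaf l c \<alpha> \<gamma>"
  obtain x where x: "x \<in> leaf l c \<alpha> \<beta>" using assms(1) by blast
  then have x': "x \<in> leaf l c \<alpha> \<gamma>" unfolding eq .
  show "\<forall>i<l. \<beta> i = \<gamma> i"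
    using leaf_dim_unique[OF l x x'] leaf_dim_unique[OF l x' x] by (simp add: le_antisym)
next
  assume "\<forall>i<l. \<beta> i = \<gamma> i"
  then show "leaf l c \<alpha> \<beta> = leaf l c \<alpha> \<gamma>" using leaf_cong[OF l] by blast
qed

text \<open>Vectors with the same core differ by a multiple of \<delta>, and both agree with
  \<alpha> at a vertex outside the proper subset \<open>J\<close>, so the multiple is zero.\<close>

lemma leaf_determined:
  assumes "leaf l c \<alpha> \<beta> \<noteq> {}" "leaf l c \<alpha> \<gamma> \<noteq> {}" "has_core \<beta> \<kappa>" "has_core \<gamma> \<kappa>"
  shows "leaf l c \<alpha> \<beta> = leaf l c \<alpha> \<gamma>"
proof -
  obtain r1 r2 where r: "\<And>i. i < l \<Longrightarrow> int (\<beta> i) = int (Res l \<kappa> i) + r1"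
    "\<And>i. i < l \<Longrightarrow> int (\<gamma> i) = int (Res l \<kappa> i) + r2"
    using assms(3,4) unfolding has_core_def by blast
  obtain j where j: "j < l" "j \<notin> J" using J proper by blast
  then have "\<beta> j = \<gamma> j" using leaf_imp_core[OF assms(1)] leaf_imp_core[OF assms(2)] by simp
  then have "r1 = r2" using r(1)[OF j(1)] r(2)[OF j(1)] by simp
  then have "\<forall>i<l. \<beta> i = \<gamma> i" using r by (metis of_nat_eq_iff)
  then show ?thesis using leaf_eq_iff[OF assms(1,2)] by blast
qed

lemma leaves_parametrized:
  "\<exists>\<Phi>. bij_betw \<Phi> (symplectic_leaves l c \<alpha>) core_image
    \<and> (\<forall>\<alpha>'. leaf l c \<alpha> \<alpha>' \<noteq> {} \<longrightarrow> (\<forall>\<nu>'\<in>ell_cores l. \<Phi> (leaf l c \<alpha> \<alpha>') = \<nu>' \<longleftrightarrow> has_core \<alpha>' \<nu>'))"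
proof -
  \<comment> \<open>A leaf is only a set of points, so its core is selected by description;
    \<open>leaf_eq_iff\<close> makes it independent of the vector that presents the leaf.\<close>
  define \<Phi> where "\<Phi> = (\<lambda>L. THE \<kappa>. \<kappa> \<in> ell_cores l \<and> (\<exists>\<beta>. L = leaf l c \<alpha> \<beta> \<and> has_core \<beta> \<kappa>))"
  have \<Phi>: "\<Phi> (leaf l c \<alpha> \<beta>) = \<kappa>" if ne: "leaf l c \<alpha> \<beta> \<noteq> {}" and \<kappa>: "\<kappa> \<in> ell_cores l" "has_core \<beta> \<kappa>" for \<beta> \<kappa>
    unfolding \<Phi>_def
  proof (rule the_equality)
    show "\<kappa> \<in> ell_cores l \<and> (\<exists>\<gamma>. leaf l c \<alpha> \<beta> = leaf l c \<alpha> \<gamma> \<and> has_core \<gamma> \<kappa>)" using \<kappa> by blast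
    fix \<kappa>' assume "\<kappa>' \<in> ell_cores l \<and> (\<exists>\<gamma>. leaf l c \<alpha> \<beta> = leaf l c \<alpha> \<gamma> \<and> has_core \<gamma> \<kappa>')"
    then obtain \<gamma> where \<gamma>: "\<kappa>' \<in> ell_cores l" "leaf l c \<alpha> \<beta> = leaf l c \<alpha> \<gamma>" "has_core \<gamma> \<kappa>'" by blast
    have "\<forall>i<l. \<beta> i = \<gamma> i" using leaf_eq_iff[OF ne] ne \<gamma>(2) by metis
    then have "has_core \<beta> \<kappa>'" using \<gamma>(3) by (simp add: has_core_def)
    then show "\<kappa>' = \<kappa>" using \<kappa> \<gamma>(1) has_core_unique by blast
  qed
  have ex: "\<exists>\<kappa>\<in>core_image. \<kappa> \<in> ell_cores l \<and> has_core \<beta> \<kappa>" if ne: "leaf l c \<alpha> \<beta> \<noteq> {}" for \<beta>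
  proof -
    obtain \<kappa> r where \<kappa>: "\<kappa> \<in> core_image" "\<forall>i<l. \<beta> i = Res l \<kappa> i + r" using leaf_imp_core[OF ne] by blast
    then have "has_core \<beta> \<kappa>" unfolding has_core_def by (intro exI[of _ "int r"]) simp
    then show ?thesis using \<kappa>(1) core_image_cores by blast
  qed
  have "bij_betw \<Phi> (symplectic_leaves l c \<alpha>) core_image"
    unfolding bij_betw_def
  proof
    show "inj_on \<Phi> (symplectic_leaves l c \<alpha>)"
    proof (rule inj_onI)
      fix L1 L2 assume L: "L1 \<in> symplectic_leaves l c \<alpha>" "L2 \<in> symplectic_leaves l c \<alpha>" and eq: "\<Phi> L1 = \<Phi> L2"
      obtain \<beta> \<gamma> where \<beta>: "L1 = leaf l c \<alpha> \<beta>" "leaf l c \<alpha> \<beta> \<noteq> {}" and \<gamma>: "L2 = leaf l c \<alpha> \<gamma>" "leaf l c \<alpha> \<gamma> \<noteq> {}"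
        using L unfolding symplectic_leaves_def by blast
      obtain \<kappa>1 \<kappa>2 where "\<kappa>1 \<in> ell_cores l" "has_core \<beta> \<kappa>1" "\<kappa>2 \<in> ell_cores l" "has_core \<gamma> \<kappa>2"
        using ex[OF \<beta>(2)] ex[OF \<gamma>(2)] by blast
      moreover from this have "\<kappa>1 = \<kappa>2" using \<Phi>[OF \<beta>(2)] \<Phi>[OF \<gamma>(2)] eq \<beta>(1) \<gamma>(1) by metis
      ultimately show "L1 = L2" unfolding \<beta>(1) \<gamma>(1) using leaf_determined[OF \<beta>(2) \<gamma>(2)] by blast
    qed
    show "\<Phi> ` symplectic_leaves l c \<alpha> = core_image"
    proof (intro equalityI subsetI)
      fix \<kappa> assume "\<kappa> \<in> \<Phi> ` symplectic_leaves l c \<alpha>"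
      then obtain \<beta> where \<beta>: "\<kappa> = \<Phi> (leaf l c \<alpha> \<beta>)" "leaf l c \<alpha> \<beta> \<noteq> {}"
        unfolding symplectic_leaves_def by blast
      then show "\<kappa> \<in> core_image" using ex[OF \<beta>(2)] \<Phi>[OF \<beta>(2)] by metis
    next
      fix \<kappa> assume \<kappa>: "\<kappa> \<in> core_image"
      then obtain \<beta> r where \<beta>: "leaf l c \<alpha> \<beta> \<noteq> {}" "\<forall>i<l. \<beta> i = Res l \<kappa> i + r" using core_imp_leaf by blast
      then have "has_core \<beta> \<kappa>" unfolding has_core_def by (intro exI[of _ "int r"]) simp
      moreover have "\<kappa> \<in> ell_cores l" using \<kappa> core_image_cores by blast
      ultimately have "\<kappa> = \<Phi> (leaf l c \<alpha> \<beta>)" using \<Phi>[OF \<beta>(1)] by simp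
      moreover have "leaf l c \<alpha> \<beta> \<in> symplectic_leaves l c \<alpha>" unfolding symplectic_leaves_def using \<beta>(1) by blast
      ultimately show "\<kappa> \<in> \<Phi> ` symplectic_leaves l c \<alpha>" by blast
    qed
  qed
  moreover have "\<Phi> (leaf l c \<alpha> \<beta>) = \<kappa> \<longleftrightarrow> has_core \<beta> \<kappa>" if "leaf l c \<alpha> \<beta> \<noteq> {}" "\<kappa> \<in> ell_cores l" for \<beta> \<kappa>
    using ex[OF that(1)] \<Phi>[OF that(1)] that(2) by metis
  ultimately show ?thesis by blast
qed

end

text \<open>For \<open>l = 1\<close> flushness makes the whole edge sequence decreasing, so a core
  has no removable box and is empty.\<close>

lemma J_cores_one: "J_cores 1 J \<inter> ell_cores 1 = {{}}"
proof -
  have "\<mu> = {}" if \<mu>: "\<mu> \<in> ell_cores 1" for \<mu>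
  proof (rule ccontr)
    assume ne: "\<mu> \<noteq> {}"
    have p: "\<mu> \<in> partitions" "flush 1 \<mu>" using \<mu> ell_cores_iff[of 1 \<mu>] by auto
    obtain k where "edge \<mu> (k - 1) = 0" "edge \<mu> k = 1" by (rule ex_removable_edge[OF p(1) ne])
    then show False using p(2) unfolding flush_def by (metis of_nat_1 zero_neq_one)
  qed
  moreover have "{} \<in> ell_cores 1" by (rule empty_ell_core) simp
  moreover have "{} \<in> J_cores 1 J" by (auto simp: J_cores_def empty_partition removable_def)
  ultimately show ?thesis by blast
qed

lemma Core_one:
  assumes "\<mu> \<in> partitions" "J \<subseteq> {..<1}"
  shows "Core_ell 1 (Core_J 1 J \<mu>) = {}"
  using Core_ell_J_core[OF Core_J_facts(2)[OF assms(1)] assms(2)] J_cores_one[of J] by auto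

theorem proposition7p31:
  fixes l n :: nat
    and J :: "nat set"
    and c :: "nat \<Rightarrow> complex"
    and \<nu> :: diagram
    and \<alpha> :: "nat \<Rightarrow> nat"
  assumes "l > 0"
    and "J \<subseteq> {..<l}"
    and "J_standard l J c"
    and "(\<Sum>i<l. c i) \<noteq> 0"
    and "\<nu> \<in> ell_cores l \<inter> J_cores l J"
    and "\<forall>i<l. \<alpha> i = Res l \<nu> i + n"
  shows "(Core_ell l \<circ> Core_J l J) ` (\<Union>n'\<in>{0..n}. partitions_with_core l \<nu> (n' * l + card \<nu>))
           \<subseteq> ell_cores l \<inter> J_cores l J
    \<and> (\<exists>\<Phi>. bij_betw \<Phi> (symplectic_leaves l c \<alpha>)
              ((Core_ell l \<circ> Core_J l J) `
                 (\<Union>n'\<in>{0..n}. partitions_with_core l \<nu> (n' * l + card \<nu>)))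
          \<and> (\<forall>\<alpha>'. leaf l c \<alpha> \<alpha>' \<noteq> {} \<longrightarrow>
               (\<forall>\<nu>'\<in>ell_cores l. \<Phi> (leaf l c \<alpha> \<alpha>') = \<nu>' \<longleftrightarrow>
                  (\<exists>r'::int. \<forall>i<l. int (\<alpha>' i) = int (Res l \<nu>' i) + r'))))"
proof -
  \<comment> \<open>For \<open>l = 1\<close> the reflection group is trivial, so
    \<open>J = {0}\<close> counts as standard although \<open>c 0 \<noteq> 0\<close>. Replacing
    \<open>J\<close> by the empty set leaves the image unchanged, because every composite core is
    then empty.\<close>
  define J0 where "J0 = (if l = 1 then {} else J)"
  have l2: "2 \<le> l" if "l \<noteq> 1" using that assms(1) by simp
  have \<nu>: "\<nu> \<in> ell_cores l" "\<nu> \<in> J_cores l J" using assms(5) by simp_all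
  have wc: "window_condition l n J0 c \<nu> \<alpha>"
  proof
    show "J0 \<subseteq> {..<l}" using assms(2) by (simp add: J0_def)
    have z: "c i = 0" if "i \<in> J0" for i
      using that J_standard_zero[OF l2 assms(2,3), of i] by (auto simp: J0_def split: if_splits)
    then show "c i = 0" if "i \<in> J0" for i using that .
    show "J0 \<noteq> {..<l}"
    proof
      assume "J0 = {..<l}"
      then have "(\<Sum>i<l. c i) = 0" using z by (intro sum.neutral) simp
      then show False using assms(4) by simp
    qed
    show "cls l k \<in> J0" if pq: "potential l c p = potential l c q" "p < k" "k \<le> q" for p q k
    proof (cases "l = 1")
      case True
      have "potential l c q = potential l c p + of_int (q - p) * (\<Sum>i<l. c i)"
        using potential_period[OF assms(1), of c p "q - p"] True by simp
      then show ?thesis using pq assms(4) by simp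
    next
      case False
      then show ?thesis using J_standard_window[OF l2[OF False] assms(2,3,4) pq] by (simp add: J0_def)
    qed
    show "\<nu> \<in> J_cores l J0" using \<nu>(2) by (auto simp: J0_def J_cores_def)
  qed (use assms \<nu> in auto)
  interpret window_condition l n J0 c \<nu> \<alpha> by (rule wc)
  have "(Core_ell l \<circ> Core_J l J) \<mu> = (Core_ell l \<circ> Core_J l J0) \<mu>" if "\<mu> \<in> partitions" for \<mu>
    using Core_one[OF that, of J] Core_one[OF that, of "{}"] assms(2) by (auto simp: J0_def)
  then have image: "(Core_ell l \<circ> Core_J l J) ` (\<Union>n'\<in>{0..n}. partitions_with_core l \<nu> (n' * l + card \<nu>)) = core_image"
    by (intro image_cong refl) (auto simp: partitions_with_core_def)
  have "(Core_ell l \<circ> Core_J l J) ` (\<Union>n'\<in>{0..n}. partitions_with_core l \<nu> (n' * l + card \<nu>))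
    \<subseteq> ell_cores l \<inter> J_cores l J"
    using Core_ell_J_core[OF Core_J_facts(2) assms(2,1)] by (auto simp: partitions_with_core_def)
  then show ?thesis using leaves_parametrized unfolding image has_core_def by (rule conjI)
qed

end
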